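(* Assume $N,L\ge2$ and let $M\in\mathbb Z$. (i) The operators $E_i,F_i,K_i^{\pm1},D$ ($0\le i<N$) on $\mathcal F_M$ defined below satisfy the defining relations of $U_q(\widehat{\mathfrak{sl}}_N)$ and make $\mathcal F_M$ an integrable $U_q(\widehat{\mathfrak{sl}}_N)$-module; likewise the operators $\dot E_a,\dot F_a,\dot K_a^{\pm1},\dot D$ ($0\le a<L$) make $\mathcal F_M$ an integrable $U_q(\widehat{\mathfrak{sl}}_L)$-module. (ii) The resulting actions of $U'_q(\widehat{\mathfrak{sl}}_N)$ and $U'_q(\widehat{\mathfrak{sl}}_L)$ on $\mathcal F_M$ commute with each other.
   Context: Let $N,L\ge 2$ be integers, $q$ an indeterminate and $\mathbb K=\mathbb Q(q^{1/(2N)})$. Let $\mathbb K^L$ have basis $\mathfrak e_1,\dots,\mathfrak e_L$, $\mathbb K^N$ have basis $\mathfrak v_1,\dots,\mathfrak v_N$, and $V_{\mathrm{aff}}=\mathbb K[z^{\pm1}]\otimes\mathbb K^L\otimes\mathbb K^N$, with basis $z^m\mathfrak e_a\mathfrak v_\epsilon$. Identify $V_{\mathrm{aff}}^{\otimes n}=(\mathbb K[z^{\pm1}]\otimes\mathbb K^L)^{\otimes n}\otimes(\mathbb K^N)^{\otimes n}$, and $(\mathbb K[z^{\pm1}]\otimes\mathbb K^L)^{\otimes n}=\mathbb K[z_1^{\pm1},\dots,z_n^{\pm1}]\otimes(\mathbb K^L)^{\otimes n}$ via $z^{m_1}\mathfrak e_{a_1}\otimes\cdots\otimes z^{m_n}\mathfrak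 e_{a_n}\mapsto z_1^{m_1}\cdots z_n^{m_n}\otimes\mathfrak e_{a_1}\otimes\cdots\otimes\mathfrak e_{a_n}$. With $E_{a,b}$ the matrix units of $\mathbb K^L$ put $R(z_1,z_2)=(q^2z_1-z_2)\sum_{a}E_{a,a}\otimes E_{a,a}+q(z_1-z_2)\sum_{a\neq b}E_{a,a}\otimes E_{b,b}+z_1(q^2-1)\sum_{a<b}E_{a,b}\otimes E_{b,a}+z_2(q^2-1)\sum_{a>b}E_{a,b}\otimes E_{b,a}$, let $s$ be the operator exchanging the two tensor factors of $(\mathbb K[z^{\pm1}]\otimes\mathbb K^L)^{\otimes 2}$, and $\overset{c}{T}=\frac{z_1-q^2z_2}{z_1-z_2}\bigl(1-s\cdot\frac{R(z_1,z_2)}{q^2z_1-z_2}\bigr)-1$. Let $\overset{s}{T}$ on $(\mathbb K^N)^{\otimes 2}$ send $\mathfrak v_{\epsilon_1}\otimes\mathfrak v_{\epsilon_2}$ to $q^2\mathfrak v_{\epsilon_1}\otimes\mathfrak v_{\epsilon_2}$ if $\epsilon_1=\epsilon_2$, to $q\,\mathfrak v_{\epsilon_2}\otimes\mathfrak v_{\epsilon_1}$ if $\epsilon_1<\epsilon_2$, and to $q\,\mathfrak v_{\epsilon_2}\otimes\mathfrak v_{\epsilon_1}+(q^2-1)\mathfrak v_{\epsilon_1}\otimes\mathfrak v_{\epsilon_2}$ if $\epsilon_1>\epsilon_2$. For $1\le i<n$ let $\overset{c}{T}_i$, $\overset{s}{T}_i$ act in the $i$th and $(i+1)$st factors. The wedge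 product is $\wedge^nV_{\mathrm{aff}}=V_{\mathrm{aff}}^{\otimes n}/\sum_{i=1}^{n-1}\mathrm{Im}(\overset{c}{T}_i-\overset{s}{T}_i)$. Every $k\in\mathbb Z$ is written uniquely as $k=\bar k-N(\dot k+L\underline k)$ with $\bar k\in\{1,\dots,N\}$, $\dot k\in\{1,\dots,L\}$, $\underline k\in\mathbb Z$; $u_k=z^{\underline k}\mathfrak e_{\dot k}\mathfrak v_{\bar k}$; $u_{k_1}\wedge\cdots\wedge u_{k_n}$ is the image of $u_{k_1}\otimes\cdots\otimes u_{k_n}$; $v\wedge w$ denotes the image of the tensor product of lifts. Fock space: $\mathcal F_M$ is the inductive limit of $\wedge^nV_{\mathrm{aff}}$ along $v\mapsto v\wedge u_{M-n}$; the image of $v\in\wedge^nV_{\mathrm{aff}}$ is written $v\wedge u_{M-n}\wedge u_{M-n-1}\wedge\cdots$; the vacuum is $|M\rangle=u_M\wedge u_{M-1}\wedge\cdots$; for $v\in\wedge^nV_{\mathrm{aff}}$ and $u=w\wedge u_{M-n-r}\wedge\cdots\in\mathcal F_{M-n}$ ($w\in\wedge^rV_{\mathrm{aff}}$) put $v\wedge u=(v\wedge w)\wedge u_{M-n-r}\wedge\cdots\in\mathcal F_M$. Quantum affine algebras: for $M'\ge2$, $U_q(\widehat{\mathfrak{sl}}_{M'})$ is the $\mathbb K$-algebra with generators $E_i,F_i,K_i^{\pm1}$ ($0\le i<M'$) and $D$, and relations: the $K_i^{\pm1}$ and $D$ commute pairwise, $K_iK_i^{-1}=K_i^{-1}K_i=1$,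 $K_iE_j=q^{a_{ij}}E_jK_i$, $K_iF_j=q^{-a_{ij}}F_jK_i$, $[D,E_i]=\delta_{i,0}E_i$, $[D,F_i]=-\delta_{i,0}F_i$, $[E_i,F_j]=\delta_{ij}\frac{K_i-K_i^{-1}}{q-q^{-1}}$, and for $i\ne j$, $\sum_{k=0}^{1-a_{ij}}(-1)^k\begin{bmatrix}1-a_{ij}\\k\end{bmatrix}_qX_i^{1-a_{ij}-k}X_jX_i^k=0$ for $X=E,F$; here $a_{ij}=2\delta(i\equiv j)-\delta(i\equiv j+1)-\delta(i\equiv j-1)$ (congruences mod $M'$) and $[k]_q=\frac{q^k-q^{-k}}{q-q^{-1}}$, $q$-binomials as usual. $U'_q(\widehat{\mathfrak{sl}}_{M'})$ is the subalgebra generated by $E_i,F_i,K_i^{\pm1}$. The generators of $U_q(\widehat{\mathfrak{sl}}_L)$ are written with dots: $\dot E_a,\dot F_a,\dot K_a,\dot D$. $U_q(\widehat{\mathfrak{sl}}_N)$ acts on $V_{\mathrm{aff}}$ by $K_i(z^m\mathfrak e_a\mathfrak v_\epsilon)=q^{\delta_{\epsilon,i}-\delta_{\epsilon,i+1}}z^m\mathfrak e_a\mathfrak v_\epsilon$, $E_i(z^m\mathfrak e_a\mathfrak v_\epsilon)=\delta_{\epsilon,i+1}z^{m+\delta_{i,0}}\mathfrak e_a\mathfrak v_{\epsilon-1}$, $F_i(z^m\mathfrak e_a\mathfrak v_\epsilon)=\delta_{\epsilon,i}z^{m-\delta_{i,0}}\mathfrak e_a\mathfrak v_{\epsilon+1}$,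 $D(z^m\mathfrak e_a\mathfrak v_\epsilon)=mz^m\mathfrak e_a\mathfrak v_\epsilon$ (indices of $\mathfrak v$ and Kronecker deltas mod $N$); $U_q(\widehat{\mathfrak{sl}}_L)$ acts by $\dot K_a(z^m\mathfrak e_b\mathfrak v_\epsilon)=q^{\delta_{b,L-a+1}-\delta_{b,L-a}}z^m\mathfrak e_b\mathfrak v_\epsilon$, $\dot E_a(z^m\mathfrak e_b\mathfrak v_\epsilon)=\delta_{b,L-a}z^{m+\delta_{a,0}}\mathfrak e_{b+1}\mathfrak v_\epsilon$, $\dot F_a(z^m\mathfrak e_b\mathfrak v_\epsilon)=\delta_{b,L-a+1}z^{m-\delta_{a,0}}\mathfrak e_{b-1}\mathfrak v_\epsilon$, $\dot D(z^m\mathfrak e_b\mathfrak v_\epsilon)=mz^m\mathfrak e_b\mathfrak v_\epsilon$ (indices of $\mathfrak e$ and deltas mod $L$). $U_q(\widehat{\mathfrak{sl}}_N)$ acts on $V_{\mathrm{aff}}^{\otimes n}$ via the iterated coproduct $\Delta^+$: $\Delta^+(K_i)=K_i\otimes K_i$, $\Delta^+(E_i)=E_i\otimes K_i+1\otimes E_i$, $\Delta^+(F_i)=F_i\otimes1+K_i^{-1}\otimes F_i$, $\Delta^+(D)=D\otimes1+1\otimes D$; $U_q(\widehat{\mathfrak{sl}}_L)$ acts via the iterated coproduct $\Delta^-$: $\Delta^-(\dot K_a)=\dot K_a\otimes\dot K_a$, $\Delta^-(\dot E_a)=\dot E_a\otimes1+\dot K_a\otimes\dot E_a$, $\Delta^-(\dot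 F_a)=\dot F_a\otimes\dot K_a^{-1}+1\otimes\dot F_a$, $\Delta^-(\dot D)=\dot D\otimes1+1\otimes\dot D$. Both actions descend to $\wedge^nV_{\mathrm{aff}}$ (known). Operators on $\mathcal F_M$: every $w\in\mathcal F_M$ can be written $w=v\wedge|-NLm\rangle$ with $m$ large and $v\in\wedge^{M+NLm}V_{\mathrm{aff}}$. Let $\bar v_m=u_{-NLm}\wedge u_{-NLm-1}\wedge\cdots\wedge u_{-NL(m+1)+1}$ and write $|m\rangle\!\rangle:=|-NLm\rangle$. Set $D|m\rangle\!\rangle=\dot D|m\rangle\!\rangle=NL\frac{m(1-m)}2|m\rangle\!\rangle$, $K_i|m\rangle\!\rangle=q^{L\delta_{i,0}}|m\rangle\!\rangle$, $E_i|m\rangle\!\rangle=0$, $F_i|m\rangle\!\rangle=\delta_{i,0}F_0(\bar v_m)\wedge|-NL(m+1)\rangle$, $\dot K_a|m\rangle\!\rangle=q^{N\delta_{a,0}}|m\rangle\!\rangle$, $\dot E_a|m\rangle\!\rangle=0$, $\dot F_a|m\rangle\!\rangle=\delta_{a,0}q^{-N}\dot F_0(\bar v_m)\wedge|-NL(m+1)\rangle$; and for $w=v\wedge|m\rangle\!\rangle$: $D(w)=D(v)\wedge|m\rangle\!\rangle+v\wedge D|m\rangle\!\rangle$, $K_i(w)=K_i(v)\wedge K_i|m\rangle\!\rangle$, $E_i(w)=E_i(v)\wedge K_i|m\rangle\!\rangle$, $F_i(w)=F_i(v)\wedge|m\rangle\!\rangle+K_i^{-1}(v)\wedge F_i|m\rangle\!\rangle$,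 $\dot D(w)=\dot D(v)\wedge|m\rangle\!\rangle+v\wedge\dot D|m\rangle\!\rangle$, $\dot K_a(w)=\dot K_a(v)\wedge\dot K_a|m\rangle\!\rangle$, $\dot E_a(w)=\dot E_a(v)\wedge|m\rangle\!\rangle$, $\dot F_a(w)=\dot F_a(v)\wedge\dot K_a^{-1}|m\rangle\!\rangle+v\wedge\dot F_a|m\rangle\!\rangle$. These operators are well defined (independent of the presentation). A module is integrable if the $E_i,F_i$ act locally nilpotently and it is a direct sum of weight spaces. *)

theory Defs
  imports Main "HOL-Computational_Algebra.Polynomial" "HOL-Computational_Algebra.Fraction_Field"
    "HOL-Library.Function_Algebras"
begin

section \<open>The ground field K = Q(q^(1/(2N)))\<close>

type_synonym kk = "rat poly fract"
type_synonym vec = "int list \<Rightarrow> kk"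

text \<open>qr is the indeterminate q^(1/(2N)); the field rat poly fract is Q(qr).\<close>
definition qr :: kk where "qr = Fract [:0, 1:] 1"

definition qq :: "nat \<Rightarrow> kk" where "qq N = qr ^ (2 * N)"

definition zpow :: "kk \<Rightarrow> int \<Rightarrow> kk" where
  "zpow x k = (if 0 \<le> k then x ^ nat k else inverse (x ^ nat (- k)))"

definition dl :: "bool \<Rightarrow> int" where "dl b = (if b then 1 else 0)"

definition cgr :: "nat \<Rightarrow> int \<Rightarrow> int \<Rightarrow> bool" where
  "cgr P x y = ((x - y) mod int P = 0)"

definition nrm :: "nat \<Rightarrow> int \<Rightarrow> int" where "nrm P x = (x - 1) mod int P + 1"

section \<open>Indexing: k = bar k - N (dot k + L under k)\<close>

definition barr :: "nat \<Rightarrow> int \<Rightarrow> int" where "barr N k = (k - 1) mod int N + 1"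
definition rst :: "nat \<Rightarrow> nat \<Rightarrow> int \<Rightarrow> int" where
  "rst N L k = (barr N k - k) div int N"
definition dott :: "nat \<Rightarrow> nat \<Rightarrow> int \<Rightarrow> int" where
  "dott N L k = (rst N L k - 1) mod int L + 1"
definition undr :: "nat \<Rightarrow> nat \<Rightarrow> int \<Rightarrow> int" where
  "undr N L k = (rst N L k - dott N L k) div int L"
text \<open>enc m a e is the index k with u_k = z^m e_a v_e\<close>
definition enc :: "nat \<Rightarrow> nat \<Rightarrow> int \<Rightarrow> int \<Rightarrow> int \<Rightarrow> int" where
  "enc N L m a e = e - int N * (a + int L * m)"

section \<open>Finitely supported vectors; basis of V_aff^{tensor n} is int lists of length n\<close>

definition supp :: "('a \<Rightarrow> kk) \<Rightarrow> 'a set" where "supp v = {x. v x \<noteq> 0}"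

definition bvec :: "'a \<Rightarrow> 'a \<Rightarrow> kk" where "bvec x = (\<lambda>y. if y = x then 1 else 0)"

definition sc :: "kk \<Rightarrow> ('a \<Rightarrow> kk) \<Rightarrow> 'a \<Rightarrow> kk" where "sc c v = (\<lambda>y. c * v y)"

definition lin :: "('a \<Rightarrow> 'b \<Rightarrow> kk) \<Rightarrow> ('a \<Rightarrow> kk) \<Rightarrow> 'b \<Rightarrow> kk" where
  "lin F v = (\<lambda>y. \<Sum>x\<in>supp v. v x * F x y)"

definition tens :: "nat \<Rightarrow> vec set" where
  "tens n = {v. finite (supp v) \<and> (\<forall>xs\<in>supp v. length xs = n)}"

definition kexp :: "nat \<Rightarrow> int \<Rightarrow> int \<Rightarrow> int" where
  "kexp N i k = dl (cgr N (barr N k) i) - dl (cgr N (barr N k) (i + 1))"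
definition e1 :: "nat \<Rightarrow> nat \<Rightarrow> int \<Rightarrow> int \<Rightarrow> int option" where
  "e1 N L i k = (if cgr N (barr N k) (i + 1)
     then Some (enc N L (undr N L k + dl (i = 0)) (dott N L k) (nrm N (barr N k - 1))) else None)"
definition f1 :: "nat \<Rightarrow> nat \<Rightarrow> int \<Rightarrow> int \<Rightarrow> int option" where
  "f1 N L i k = (if cgr N (barr N k) i
     then Some (enc N L (undr N L k - dl (i = 0)) (dott N L k) (nrm N (barr N k + 1))) else None)"

definition kdexp :: "nat \<Rightarrow> nat \<Rightarrow> int \<Rightarrow> int \<Rightarrow> int" where
  "kdexp N L a k = dl (cgr L (dott N L k) (int L - a + 1)) - dl (cgr L (dott N L k) (int L - a))"
definition ed1 :: "nat \<Rightarrow> nat \<Rightarrow> int \<Rightarrow> int \<Rightarrow> int option" where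
  "ed1 N L a k = (if cgr L (dott N L k) (int L - a)
     then Some (enc N L (undr N L k + dl (a = 0)) (nrm L (dott N L k + 1)) (barr N k)) else None)"
definition fd1 :: "nat \<Rightarrow> nat \<Rightarrow> int \<Rightarrow> int \<Rightarrow> int option" where
  "fd1 N L a k = (if cgr L (dott N L k) (int L - a + 1)
     then Some (enc N L (undr N L k - dl (a = 0)) (nrm L (dott N L k - 1)) (barr N k)) else None)"

definition copr :: "(int \<Rightarrow> int option) \<Rightarrow> (nat \<Rightarrow> int list \<Rightarrow> kk) \<Rightarrow> int list \<Rightarrow> vec" where
  "copr g c xs = (\<lambda>ys. \<Sum>j<length xs. (case g (xs ! j) of None \<Rightarrow> 0
      | Some y \<Rightarrow> c j xs * bvec (xs[j := y]) ys))"

definition cafter :: "kk \<Rightarrow> (int \<Rightarrow> int) \<Rightarrow> nat \<Rightarrow> int list \<Rightarrow> kk" where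
  "cafter q kf j xs = (\<Prod>l\<in>{Suc j..<length xs}. zpow q (kf (xs ! l)))"
definition cbefore :: "kk \<Rightarrow> (int \<Rightarrow> int) \<Rightarrow> nat \<Rightarrow> int list \<Rightarrow> kk" where
  "cbefore q kf j xs = (\<Prod>l<j. zpow q (kf (xs ! l)))"
definition diagop :: "kk \<Rightarrow> (int \<Rightarrow> int) \<Rightarrow> vec \<Rightarrow> vec" where
  "diagop q kf = lin (\<lambda>xs. sc (\<Prod>l<length xs. zpow q (kf (xs ! l))) (bvec xs))"

definition tE :: "nat \<Rightarrow> nat \<Rightarrow> int \<Rightarrow> vec \<Rightarrow> vec" where
  "tE N L i = lin (copr (e1 N L i) (cafter (qq N) (kexp N i)))"
definition tF :: "nat \<Rightarrow> nat \<Rightarrow> int \<Rightarrow> vec \<Rightarrow> vec" where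
  "tF N L i = lin (copr (f1 N L i) (cbefore (qq N) (\<lambda>k. - kexp N i k)))"
definition tK :: "nat \<Rightarrow> nat \<Rightarrow> int \<Rightarrow> vec \<Rightarrow> vec" where
  "tK N L i = diagop (qq N) (kexp N i)"
definition tKi :: "nat \<Rightarrow> nat \<Rightarrow> int \<Rightarrow> vec \<Rightarrow> vec" where
  "tKi N L i = diagop (qq N) (\<lambda>k. - kexp N i k)"
definition tD :: "nat \<Rightarrow> nat \<Rightarrow> vec \<Rightarrow> vec" where
  "tD N L = lin (\<lambda>xs. sc (of_int (\<Sum>l<length xs. undr N L (xs ! l))) (bvec xs))"

definition tEd :: "nat \<Rightarrow> nat \<Rightarrow> int \<Rightarrow> vec \<Rightarrow> vec" where
  "tEd N L a = lin (copr (ed1 N L a) (cbefore (qq N) (kdexp N L a)))"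
definition tFd :: "nat \<Rightarrow> nat \<Rightarrow> int \<Rightarrow> vec \<Rightarrow> vec" where
  "tFd N L a = lin (copr (fd1 N L a) (cafter (qq N) (\<lambda>k. - kdexp N L a k)))"
definition tKd :: "nat \<Rightarrow> nat \<Rightarrow> int \<Rightarrow> vec \<Rightarrow> vec" where
  "tKd N L a = diagop (qq N) (kdexp N L a)"
definition tKdi :: "nat \<Rightarrow> nat \<Rightarrow> int \<Rightarrow> vec \<Rightarrow> vec" where
  "tKdi N L a = diagop (qq N) (\<lambda>k. - kdexp N L a k)"

text \<open>Multiplication by z1, z2: z u_k = u_(k - N L)\<close>
definition mz1 :: "nat \<Rightarrow> nat \<Rightarrow> vec \<Rightarrow> vec" where
  "mz1 N L f = (\<lambda>ys. case ys of [k1, k2] \<Rightarrow> f [k1 + int (N * L), k2] | _ \<Rightarrow> 0)"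
definition mz2 :: "nat \<Rightarrow> nat \<Rightarrow> vec \<Rightarrow> vec" where
  "mz2 N L f = (\<lambda>ys. case ys of [k1, k2] \<Rightarrow> f [k1, k2 + int (N * L)] | _ \<Rightarrow> 0)"

text \<open>s exchanges the (K[z] tensor K^L)-parts of the two factors, keeping the K^N-parts\<close>
definition swz :: "nat \<Rightarrow> nat \<Rightarrow> vec \<Rightarrow> vec" where
  "swz N L = lin (\<lambda>xs. case xs of [k1, k2] \<Rightarrow>
      bvec [enc N L (undr N L k2) (dott N L k2) (barr N k1), enc N L (undr N L k1) (dott N L k1) (barr N k2)]
    | _ \<Rightarrow> 0)"

definition Rb :: "nat \<Rightarrow> nat \<Rightarrow> int list \<Rightarrow> vec" where
  "Rb N L xs = (case xs of [k1, k2] \<Rightarrow>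
     (let q = qq N; x = bvec [k1, k2]; a1 = dott N L k1; a2 = dott N L k2;
          y = bvec [enc N L (undr N L k1) a2 (barr N k1), enc N L (undr N L k2) a1 (barr N k2)] in
      if a1 = a2 then sc (q^2) (mz1 N L x) - mz2 N L x
      else sc q (mz1 N L x - mz2 N L x)
           + sc (q^2 - 1) (if a2 < a1 then mz1 N L y else mz2 N L y))
   | _ \<Rightarrow> 0)"
definition Rop :: "nat \<Rightarrow> nat \<Rightarrow> vec \<Rightarrow> vec" where "Rop N L = lin (Rb N L)"

text \<open>T^c f is the unique g with (z1-z2)(q^2 z2 - z1)(g + f) = (z1 - q^2 z2)((q^2 z2 - z1) f - s(R f)),
  i.e. g + f = (z1 - q^2 z2)/(z1 - z2) (1 - s R(z1,z2)/(q^2 z1 - z2)) f.\<close>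
definition mB :: "nat \<Rightarrow> nat \<Rightarrow> vec \<Rightarrow> vec" where
  "mB N L h = sc ((qq N)^2) (mz2 N L h) - mz1 N L h"
definition mA :: "nat \<Rightarrow> nat \<Rightarrow> vec \<Rightarrow> vec" where
  "mA N L h = mz1 N L (mB N L h) - mz2 N L (mB N L h)"
definition mP :: "nat \<Rightarrow> nat \<Rightarrow> vec \<Rightarrow> vec" where
  "mP N L h = mz1 N L h - sc ((qq N)^2) (mz2 N L h)"
definition Tc :: "nat \<Rightarrow> nat \<Rightarrow> vec \<Rightarrow> vec" where
  "Tc N L f = (THE g. g \<in> tens 2 \<and> mA N L (g + f) = mP N L (mB N L f - swz N L (Rop N L f)))"

definition Tsb :: "nat \<Rightarrow> nat \<Rightarrow> int list \<Rightarrow> vec" where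
  "Tsb N L xs = (case xs of [k1, k2] \<Rightarrow>
     (let q = qq N; x = bvec [k1, k2]; e1 = barr N k1; e2 = barr N k2;
          y = bvec [enc N L (undr N L k1) (dott N L k1) e2, enc N L (undr N L k2) (dott N L k2) e1] in
      if e1 = e2 then sc (q^2) x
      else if e1 < e2 then sc q y
      else sc q y + sc (q^2 - 1) x)
   | _ \<Rightarrow> 0)"
definition Ts :: "nat \<Rightarrow> nat \<Rightarrow> vec \<Rightarrow> vec" where "Ts N L = lin (Tsb N L)"

text \<open>A two-site operator acting in factors j+1, j+2 (0-based positions j, j+1)\<close>
definition liftp :: "(vec \<Rightarrow> vec) \<Rightarrow> nat \<Rightarrow> vec \<Rightarrow> vec" where
  "liftp A j = lin (\<lambda>xs ys. if length ys = length xs \<and> take j ys = take j xs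
       \<and> drop (j + 2) ys = drop (j + 2) xs
     then A (bvec [xs ! j, xs ! Suc j]) [ys ! j, ys ! Suc j] else 0)"

definition Wsp :: "nat \<Rightarrow> nat \<Rightarrow> nat \<Rightarrow> vec set" where
  "Wsp N L n = {\<Sum>j<n - 1. liftp (\<lambda>f. Tc N L f - Ts N L f) j (w j) | w. \<forall>j. w j \<in> tens n}"

text \<open>A pair (n, v), v in V_aff^{tensor n}, represents v wedge u_(M-n) wedge u_(M-n-1) wedge ...\<close>
definition tailv :: "int \<Rightarrow> nat \<Rightarrow> nat \<Rightarrow> int list" where
  "tailv M n p = map (\<lambda>j. M - int j) [n..<p]"
definition extv :: "int \<Rightarrow> nat \<Rightarrow> nat \<Rightarrow> vec \<Rightarrow> vec" where
  "extv M n p v = (\<lambda>ys. if length ys = p \<and> drop n ys = tailv M n p then v (take n ys) else 0)"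

definition reps :: "(nat \<times> vec) set" where "reps = {(n, v). v \<in> tens n}"

definition frel :: "nat \<Rightarrow> nat \<Rightarrow> int \<Rightarrow> ((nat \<times> vec) \<times> (nat \<times> vec)) set" where
  "frel N L M = {((n, v), (n', v')). (n, v) \<in> reps \<and> (n', v') \<in> reps \<and>
     (\<exists>p \<ge> max n n'. extv M n p v - extv M n' p v' \<in> Wsp N L p)}"

type_synonym fel = "(nat \<times> vec) set"

definition fock :: "nat \<Rightarrow> nat \<Rightarrow> int \<Rightarrow> fel set" where "fock N L M = reps // frel N L M"
definition fcl :: "nat \<Rightarrow> nat \<Rightarrow> int \<Rightarrow> nat \<times> vec \<Rightarrow> fel" where "fcl N L M x = frel N L M `` {x}"

definition fadd :: "nat \<Rightarrow> nat \<Rightarrow> int \<Rightarrow> fel \<Rightarrow> fel \<Rightarrow> fel" where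
  "fadd N L M C D = (let x = (SOME x. x \<in> C); y = (SOME y. y \<in> D); p = max (fst x) (fst y) in
     fcl N L M (p, extv M (fst x) p (snd x) + extv M (fst y) p (snd y)))"
definition fsc :: "nat \<Rightarrow> nat \<Rightarrow> int \<Rightarrow> kk \<Rightarrow> fel \<Rightarrow> fel" where
  "fsc N L M c C = (let x = (SOME x. x \<in> C) in fcl N L M (fst x, sc c (snd x)))"
definition fzero :: "nat \<Rightarrow> nat \<Rightarrow> int \<Rightarrow> fel" where "fzero N L M = fcl N L M (0, 0)"

section \<open>Operators on F_M via presentations v wedge |m>> with v in wedge^(M+NLm)\<close>

definition mof :: "nat \<Rightarrow> nat \<Rightarrow> int \<Rightarrow> nat \<Rightarrow> int" where
  "mof N L M n = (int n - M) div int (N * L)"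

definition vbar :: "nat \<Rightarrow> nat \<Rightarrow> int \<Rightarrow> vec" where
  "vbar N L m = bvec (map (\<lambda>j. - (int (N * L) * m) - int j) [0..<N * L])"

definition tensv :: "nat \<Rightarrow> vec \<Rightarrow> vec \<Rightarrow> vec" where
  "tensv n v w = (\<lambda>ys. if n \<le> length ys then v (take n ys) * w (drop n ys) else 0)"

definition rE :: "nat \<Rightarrow> nat \<Rightarrow> int \<Rightarrow> int \<Rightarrow> nat \<times> vec \<Rightarrow> nat \<times> vec" where
  "rE N L M i x = (fst x, sc (zpow (qq N) (int L * dl (i = 0))) (tE N L i (snd x)))"
definition rF :: "nat \<Rightarrow> nat \<Rightarrow> int \<Rightarrow> int \<Rightarrow> nat \<times> vec \<Rightarrow> nat \<times> vec" where
  "rF N L M i x = (let n = fst x; v = snd x; m = mof N L M n in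
     (n + N * L, extv M n (n + N * L) (tF N L i v)
        + (if i = 0 then tensv n (tKi N L i v) (tF N L 0 (vbar N L m)) else 0)))"
definition rK :: "nat \<Rightarrow> nat \<Rightarrow> int \<Rightarrow> int \<Rightarrow> nat \<times> vec \<Rightarrow> nat \<times> vec" where
  "rK N L M i x = (fst x, sc (zpow (qq N) (int L * dl (i = 0))) (tK N L i (snd x)))"
definition rKi :: "nat \<Rightarrow> nat \<Rightarrow> int \<Rightarrow> int \<Rightarrow> nat \<times> vec \<Rightarrow> nat \<times> vec" where
  "rKi N L M i x = (fst x, sc (zpow (qq N) (- int L * dl (i = 0))) (tKi N L i (snd x)))"
definition rD :: "nat \<Rightarrow> nat \<Rightarrow> int \<Rightarrow> nat \<times> vec \<Rightarrow> nat \<times> vec" where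
  "rD N L M x = (let m = mof N L M (fst x) in
     (fst x, tD N L (snd x) + sc (of_int (int (N * L) * m * (1 - m) div 2)) (snd x)))"

definition rEd :: "nat \<Rightarrow> nat \<Rightarrow> int \<Rightarrow> int \<Rightarrow> nat \<times> vec \<Rightarrow> nat \<times> vec" where
  "rEd N L M a x = (fst x, tEd N L a (snd x))"
definition rFd :: "nat \<Rightarrow> nat \<Rightarrow> int \<Rightarrow> int \<Rightarrow> nat \<times> vec \<Rightarrow> nat \<times> vec" where
  "rFd N L M a x = (let n = fst x; v = snd x; m = mof N L M n in
     (n + N * L, extv M n (n + N * L) (sc (zpow (qq N) (- int N * dl (a = 0))) (tFd N L a v))
        + (if a = 0 then sc (zpow (qq N) (- int N)) (tensv n v (tFd N L 0 (vbar N L m))) else 0)))"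
definition rKd :: "nat \<Rightarrow> nat \<Rightarrow> int \<Rightarrow> int \<Rightarrow> nat \<times> vec \<Rightarrow> nat \<times> vec" where
  "rKd N L M a x = (fst x, sc (zpow (qq N) (int N * dl (a = 0))) (tKd N L a (snd x)))"
definition rKdi :: "nat \<Rightarrow> nat \<Rightarrow> int \<Rightarrow> int \<Rightarrow> nat \<times> vec \<Rightarrow> nat \<times> vec" where
  "rKdi N L M a x = (fst x, sc (zpow (qq N) (- int N * dl (a = 0))) (tKdi N L a (snd x)))"
definition rDd :: "nat \<Rightarrow> nat \<Rightarrow> int \<Rightarrow> nat \<times> vec \<Rightarrow> nat \<times> vec" where
  "rDd N L M x = (let m = mof N L M (fst x) in
     (fst x, tD N L (snd x) + sc (of_int (int (N * L) * m * (1 - m) div 2)) (snd x)))"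

definition liftF :: "nat \<Rightarrow> nat \<Rightarrow> int \<Rightarrow> (nat \<times> vec \<Rightarrow> nat \<times> vec) \<Rightarrow> fel \<Rightarrow> fel" where
  "liftF N L M f C = fcl N L M (f (SOME x. x \<in> C \<and> (int (fst x) - M) mod int (N * L) = 0))"

definition cartan :: "nat \<Rightarrow> int \<Rightarrow> int \<Rightarrow> int" where
  "cartan P i j = 2 * dl (cgr P i j) - dl (cgr P i (j + 1)) - dl (cgr P i (j - 1))"

definition qint :: "kk \<Rightarrow> nat \<Rightarrow> kk" where
  "qint q k = (q ^ k - inverse q ^ k) / (q - inverse q)"
definition qfact :: "kk \<Rightarrow> nat \<Rightarrow> kk" where "qfact q k = (\<Prod>j = 1..k. qint q j)"
definition qbin :: "kk \<Rightarrow> nat \<Rightarrow> nat \<Rightarrow> kk" where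
  "qbin q n k = qfact q n / (qfact q k * qfact q (n - k))"

definition uq_rels ::
  "nat \<Rightarrow> kk \<Rightarrow> 'v set \<Rightarrow> ('v \<Rightarrow> 'v \<Rightarrow> 'v) \<Rightarrow> (kk \<Rightarrow> 'v \<Rightarrow> 'v) \<Rightarrow> 'v \<Rightarrow>
   (int \<Rightarrow> 'v \<Rightarrow> 'v) \<Rightarrow> (int \<Rightarrow> 'v \<Rightarrow> 'v) \<Rightarrow> (int \<Rightarrow> 'v \<Rightarrow> 'v) \<Rightarrow> (int \<Rightarrow> 'v \<Rightarrow> 'v) \<Rightarrow>
   ('v \<Rightarrow> 'v) \<Rightarrow> bool" where
  "uq_rels P q S ad sm z E F K Ki D \<longleftrightarrow>
    (let I = {0..<int P}; sub = (\<lambda>x y. ad x (sm (-1) y)) in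
     (\<forall>w\<in>S. \<forall>i\<in>I. E i w \<in> S \<and> F i w \<in> S \<and> K i w \<in> S \<and> Ki i w \<in> S) \<and> (\<forall>w\<in>S. D w \<in> S) \<and>
     (\<forall>w\<in>S. \<forall>i\<in>I. \<forall>j\<in>I.
        K i (K j w) = K j (K i w) \<and> K i (Ki j w) = Ki j (K i w) \<and> Ki i (Ki j w) = Ki j (Ki i w)) \<and>
     (\<forall>w\<in>S. \<forall>i\<in>I. D (K i w) = K i (D w) \<and> D (Ki i w) = Ki i (D w)) \<and>
     (\<forall>w\<in>S. \<forall>i\<in>I. K i (Ki i w) = w \<and> Ki i (K i w) = w) \<and>
     (\<forall>w\<in>S. \<forall>i\<in>I. \<forall>j\<in>I.
        K i (E j w) = sm (zpow q (cartan P i j)) (E j (K i w)) \<and>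
        K i (F j w) = sm (zpow q (- cartan P i j)) (F j (K i w))) \<and>
     (\<forall>w\<in>S. \<forall>i\<in>I.
        sub (D (E i w)) (E i (D w)) = sm (of_int (dl (i = 0))) (E i w) \<and>
        sub (D (F i w)) (F i (D w)) = sm (- of_int (dl (i = 0))) (F i w)) \<and>
     (\<forall>w\<in>S. \<forall>i\<in>I. \<forall>j\<in>I.
        sub (E i (F j w)) (F j (E i w)) =
          sm (of_int (dl (i = j)) / (q - inverse q)) (sub (K i w) (Ki i w))) \<and>
     (\<forall>w\<in>S. \<forall>i\<in>I. \<forall>j\<in>I. i \<noteq> j \<longrightarrow>
        (let n = nat (1 - cartan P i j) in
         \<forall>X\<in>{E, F}. foldr ad (map (\<lambda>k. sm ((-1) ^ k * qbin q n k)
               ((X i ^^ (n - k)) (X j ((X i ^^ k) w)))) [0..<Suc n]) z = z)))"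

definition weightvec ::
  "nat \<Rightarrow> kk \<Rightarrow> (kk \<Rightarrow> 'v \<Rightarrow> 'v) \<Rightarrow> (int \<Rightarrow> 'v \<Rightarrow> 'v) \<Rightarrow> ('v \<Rightarrow> 'v) \<Rightarrow> 'v \<Rightarrow> bool" where
  "weightvec P q sm K D w \<longleftrightarrow>
    (\<exists>lam :: int \<Rightarrow> int. \<exists>d :: int. (\<forall>i\<in>{0..<int P}. K i w = sm (zpow q (lam i)) w) \<and> D w = sm (of_int d) w)"

definition integrable ::
  "nat \<Rightarrow> kk \<Rightarrow> 'v set \<Rightarrow> ('v \<Rightarrow> 'v \<Rightarrow> 'v) \<Rightarrow> (kk \<Rightarrow> 'v \<Rightarrow> 'v) \<Rightarrow> 'v \<Rightarrow>
   (int \<Rightarrow> 'v \<Rightarrow> 'v) \<Rightarrow> (int \<Rightarrow> 'v \<Rightarrow> 'v) \<Rightarrow> (int \<Rightarrow> 'v \<Rightarrow> 'v) \<Rightarrow> ('v \<Rightarrow> 'v) \<Rightarrow> bool" where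
  "integrable P q S ad sm z E F K D \<longleftrightarrow>
    (\<forall>w\<in>S. \<forall>i\<in>{0..<int P}. (\<exists>n. (E i ^^ n) w = z) \<and> (\<exists>n. (F i ^^ n) w = z)) \<and>
    (\<forall>w\<in>S. \<exists>ws. set ws \<subseteq> S \<and> (\<forall>x\<in>set ws. weightvec P q sm K D x) \<and> w = foldr ad ws z)"

definition integrable_uq_module where
  "integrable_uq_module P q S ad sm z E F K Ki D \<longleftrightarrow>
     uq_rels P q S ad sm z E F K Ki D \<and> integrable P q S ad sm z E F K D"

end

theory Submission
  imports Defs
begin

text \<open>
  Write an index as \<open>k = \<epsilon> - N p\<close> with colour \<open>\<epsilon>\<close> and position \<open>p = dot + L und\<close>; the dotted generators
  move positions, the undotted ones move colours.  All relations are first checked on tensor powers, where the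
  generators act by total pull-back operators; the space of wedge relations is stable under them because it is
  so for two factors.

  The wedge relations straighten \<open>u\<^sub>k \<and> u\<^sub>l\<close> with \<open>k < l\<close> into \<open>u\<^sub>l \<and> u\<^sub>k\<close> plus terms with indices strictly between,
  which preserve the weight.  Hence a wedge of \<open>n\<close> vectors with indices in an interval of length \<open>n\<close> is zero unless it
  has the weight of the full interval, and is otherwise a multiple of the full wedge, the multiple being a sign at
  \<open>q = 1\<close>.  This controls how the operators interact with the tail \<open>u\<^sub>M\<^sub>-\<^sub>n \<and> u\<^sub>M\<^sub>-\<^sub>n\<^sub>-\<^sub>1 \<and> \<dots>\<close> of a semi-infinite wedge.
  The relation for \<open>[E\<^sub>0, F\<^sub>0]\<close> comes out only up to a scalar correction that vanishes at \<open>q = 1\<close>;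
  it is killed by an \<open>sl\<^sub>2\<close>-string argument, which uses the local nilpotency of \<open>E\<^sub>0\<close> and \<open>F\<^sub>0\<close>.
\<close>

section \<open>Scalars\<close>

text \<open>A lowering operator changes the number of factors in a presentation, so E_0 F_0 and F_0
  E_0 are computed over different pieces of the vacuum. Comparing them leaves a cross term: E_0 on
  one block of N L vacuum indices wedged with F_0 on the next block. It is a multiple of the vacuum,
  but its exact coefficient would require straightening words in 2 N L vectors. At q = 1 the wedge
  becomes an ordinary exterior product and the coefficient is a signed count of transpositions; this
  value is all that is computed. Consequently the local nilpotency of F_0 has to be obtained without
  the commutator. An energy bound of Pauli type does this: each application of F_0 lowers an energy
  that is bounded below on words with distinct entries. A second obstacle is that T^c is given by a
  division by z_1 - z_2. The quotient is written down as a finite geometric sum, which serves for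
  straightening; for commutation relations only its uniqueness is used.\<close>

lemma zpow_eq_power_int: "zpow x k = x powi k"
  by (simp add: zpow_def power_int_def power_inverse)

lemma qr_nonzero: "qr \<noteq> 0"
  by (simp add: qr_def Zero_fract_def eq_fract)

lemma qq_nonzero [simp]: "qq N \<noteq> 0"
  by (simp add: qq_def qr_nonzero)

text \<open>Specialisation of the indeterminate \<open>qr\<close>, hence of q, to 1. It is a
  relation because an element with a pole at 1 has no value. Powers of q get the value 1 and quantum
  integers the integer itself, so scalars can be shown to be nonzero, and integers read off, without
  computing them.\<close>

definition ev1 :: "kk \<Rightarrow> rat \<Rightarrow> bool" where
  "ev1 x r \<longleftrightarrow> (\<exists>a b. x = Fract a b \<and> poly b 1 \<noteq> 0 \<and> poly a 1 = r * poly b 1)"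

lemma ev1_unique:
  assumes "ev1 x r" "ev1 x s"
  shows "r = s"
proof -
  from assms obtain a b c d where x: "x = Fract a b" "poly b 1 \<noteq> 0" "poly a 1 = r * poly b 1"
    and y: "x = Fract c d" "poly d 1 \<noteq> 0" "poly c 1 = s * poly d 1"
    unfolding ev1_def by blast
  have "b \<noteq> 0" "d \<noteq> 0" using x y by auto
  with x y have "a * d = c * b" by (simp add: eq_fract)
  then have "poly (a * d) 1 = poly (c * b) 1" by simp
  with x y show ?thesis by simp
qed

lemma ev1_of_rat_poly: "poly a 1 = r \<Longrightarrow> ev1 (Fract a 1) r"
  unfolding ev1_def by (rule exI[of _ a], rule exI[of _ 1]) simp

lemma ev1_0 [simp]: "ev1 0 0"
  using ev1_of_rat_poly[of 0 0] by (simp add: Zero_fract_def)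

lemma ev1_1 [simp]: "ev1 1 1"
  using ev1_of_rat_poly[of 1 1] by (simp add: One_fract_def)

lemma ev1_add: "ev1 x r \<Longrightarrow> ev1 y s \<Longrightarrow> ev1 (x + y) (r + s)"
proof -
  assume "ev1 x r" "ev1 y s"
  then obtain a b c d where x: "x = Fract a b" "poly b 1 \<noteq> 0" "poly a 1 = r * poly b 1"
    and y: "y = Fract c d" "poly d 1 \<noteq> 0" "poly c 1 = s * poly d 1"
    unfolding ev1_def by blast
  have "b \<noteq> 0" "d \<noteq> 0" using x y by auto
  then have "x + y = Fract (a * d + c * b) (b * d)" using x y by simp
  then show ?thesis unfolding ev1_def using x y
    by (intro exI[of _ "a * d + c * b"] exI[of _ "b * d"]) (simp add: algebra_simps)
qed

lemma ev1_mult: "ev1 x r \<Longrightarrow> ev1 y s \<Longrightarrow> ev1 (x * y) (r * s)"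
proof -
  assume "ev1 x r" "ev1 y s"
  then obtain a b c d where x: "x = Fract a b" "poly b 1 \<noteq> 0" "poly a 1 = r * poly b 1"
    and y: "y = Fract c d" "poly d 1 \<noteq> 0" "poly c 1 = s * poly d 1"
    unfolding ev1_def by blast
  then have "x * y = Fract (a * c) (b * d)" by simp
  then show ?thesis unfolding ev1_def using x y
    by (intro exI[of _ "a * c"] exI[of _ "b * d"]) (simp add: algebra_simps)
qed

lemma ev1_minus_one: "ev1 (- 1) (- 1)"
  using ev1_of_rat_poly[of "-1" "-1"] by (simp add: One_fract_def)

lemma ev1_uminus: "ev1 x r \<Longrightarrow> ev1 (- x) (- r)"
  using ev1_mult[OF ev1_minus_one] by fastforce

lemma ev1_diff: "ev1 x r \<Longrightarrow> ev1 y s \<Longrightarrow> ev1 (x - y) (r - s)"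
  using ev1_add[OF _ ev1_uminus] by fastforce

lemma ev1_inverse: "ev1 x r \<Longrightarrow> r \<noteq> 0 \<Longrightarrow> ev1 (inverse x) (inverse r)"
proof -
  assume "ev1 x r" and r: "r \<noteq> 0"
  then obtain a b where x: "x = Fract a b" "poly b 1 \<noteq> 0" "poly a 1 = r * poly b 1"
    unfolding ev1_def by blast
  then have "inverse x = Fract b a" by simp
  then show ?thesis unfolding ev1_def using x r
    by (intro exI[of _ b] exI[of _ a]) simp
qed

lemma ev1_power: "ev1 x r \<Longrightarrow> ev1 (x ^ n) (r ^ n)"
  by (induction n) (auto intro: ev1_mult)

lemma ev1_power_int: "ev1 x 1 \<Longrightarrow> ev1 (x powi k) 1"
  using ev1_power[of x 1] ev1_power[OF ev1_inverse[of x 1]] by (auto simp: power_int_def)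

lemma ev1_sum: "(\<And>i. i \<in> A \<Longrightarrow> ev1 (f i) (g i)) \<Longrightarrow> ev1 (sum f A) (sum g A)"
  by (induction A rule: infinite_finite_induct) (auto intro: ev1_add)

lemma ev1_qq: "ev1 (qq N) 1"
  using ev1_power[OF ev1_of_rat_poly[of "[:0,1:]" 1]] by (simp add: qq_def qr_def)

lemma ev1_qq_powi: "ev1 (qq N powi k) 1"
  by (intro ev1_power_int ev1_qq)

lemma qr_power: "qr ^ n = Fract ([:0, 1:] ^ n) 1"
  by (induction n) (simp_all add: qr_def One_fract_def)

text \<open>The value at 1 cannot separate q^2 from 1, so the polynomial identity is refuted at the
  point 0.\<close>

lemma qq_sq_neq_one: assumes "N > 0" shows "qq N ^ 2 \<noteq> 1"
proof
  assume "qq N ^ 2 = 1"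
  then have "qr ^ (2 * N * 2) = 1" unfolding qq_def by (simp only: power_mult)
  then have "[:0, 1::rat:] ^ (2 * N * 2) = 1"
    by (simp add: qr_power One_fract_def eq_fract)
  then have "poly ([:0, 1::rat:] ^ (2 * N * 2)) 0 = poly 1 0" by (simp only:)
  then show False using assms by (simp add: poly_power zero_power)
qed

lemma qq_minus_inverse: assumes "N > 0" shows "qq N - inverse (qq N) \<noteq> 0"
proof
  assume "qq N - inverse (qq N) = 0"
  then have "qq N * qq N = qq N * inverse (qq N)" by simp
  then show False using qq_sq_neq_one[OF assms] by (simp add: power2_eq_square)
qed

lemma qq_sq_plus_one: "qq N ^ 2 + 1 \<noteq> 0"
proof
  assume a: "qq N ^ 2 + 1 = 0"
  have "ev1 (qq N ^ 2 + 1) (1 ^ 2 + 1)" by (intro ev1_add ev1_power ev1_qq ev1_1)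
  with a have "ev1 0 (2::rat)" by simp
  then have "(2::rat) = 0" using ev1_unique ev1_0 by blast
  then show False by simp
qed

section \<open>Quantum integers\<close>

definition qi :: "kk \<Rightarrow> int \<Rightarrow> kk" where
  "qi q k = (q powi k - q powi (- k)) / (q - inverse q)"

lemma qi_uminus: "qi q (- k) = - qi q k"
  by (simp add: qi_def minus_divide_left)

lemma qi_0 [simp]: "qi q 0 = 0" by (simp add: qi_def)

text \<open>The coproduct of (K - K^-1)/(q - q^-1), split in its two possible ways:
  \<open>nu = - 1\<close> will belong to the coproduct with K to the right of E,
  \<open>nu = 1\<close> to the one with K to the left.\<close>

lemma qi_add:
  assumes "q \<noteq> 0" "nu = 1 \<or> nu = - 1"
  shows "qi q (k + l) = q powi (- nu * l) * qi q k + q powi (nu * k) * qi q l"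
proof -
  have "q powi (k + l) - q powi (- (k + l)) =
     q powi (- nu * l) * (q powi k - q powi (- k)) + q powi (nu * k) * (q powi l - q powi (- l))"
    using assms by (auto simp: algebra_simps power_int_add[symmetric] power_int_minus_divide[symmetric])
  then show ?thesis by (simp add: qi_def add_divide_distrib[symmetric])
qed

lemma qi_1: "q - inverse q \<noteq> 0 \<Longrightarrow> qi q 1 = 1"
  by (simp add: qi_def power_int_minus)

lemma ev1_qi: assumes "N > 0" shows "ev1 (qi (qq N) k) (of_int k)"
proof -
  have nat: "ev1 (qi (qq N) (int n)) (of_nat n)" for n
  proof (induction n)
    case (Suc n)
    have "qi (qq N) (int n + 1) = qq N powi (-1) * qi (qq N) (int n) + qq N powi (int n) * qi (qq N) 1"
      using qi_add[of "qq N" 1 "int n" 1] by simp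
    also have "qi (qq N) 1 = 1" using qi_1 qq_minus_inverse assms by blast
    finally have eq: "qi (qq N) (int (Suc n)) = qq N powi (-1) * qi (qq N) (int n) + qq N powi (int n) * 1"
      by (simp add: add.commute)
    have "ev1 (qi (qq N) (int (Suc n))) (1 * of_nat n + 1 * 1)"
      unfolding eq by (intro ev1_add ev1_mult ev1_qq_powi Suc ev1_1)
    then show ?case by (simp add: add.commute)
  qed simp
  show ?thesis
  proof (cases "k \<ge> 0")
    case True then show ?thesis using nat[of "nat k"] by simp
  next
    case False then show ?thesis using ev1_uminus[OF nat[of "nat (- k)"]] by (simp add: qi_uminus)
  qed
qed

section \<open>Finitely supported vectors\<close>

lemma sum_fun_apply: "(\<Sum>i\<in>A. f i) x = (\<Sum>i\<in>A. f i x :: 'b::comm_monoid_add)"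
  by (induction A rule: infinite_finite_induct) auto

lemma sc_apply [simp]: "sc c v x = c * v x" by (simp add: sc_def)

lemma sc_0_left [simp]: "sc 0 v = 0" by (simp add: fun_eq_iff)
lemma sc_0_right [simp]: "sc c 0 = 0" by (simp add: fun_eq_iff)
lemma sc_1 [simp]: "sc 1 v = v" by (simp add: fun_eq_iff)
lemma sc_sc [simp]: "sc c (sc d v) = sc (c * d) v" by (simp add: fun_eq_iff)
lemma sc_add: "sc c (v + w) = sc c v + sc c w" by (simp add: fun_eq_iff algebra_simps)
lemma sc_diff: "sc c (v - w) = sc c v - sc c w" by (simp add: fun_eq_iff algebra_simps)
lemma sc_add_left: "sc (c + d) v = sc c v + sc d v" by (simp add: fun_eq_iff algebra_simps)
lemma sc_minus_one: "sc (- 1) v = - v" by (simp add: fun_eq_iff)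
lemma sc_sum: "sc c (\<Sum>i\<in>A. f i) = (\<Sum>i\<in>A. sc c (f i))"
  by (simp add: fun_eq_iff sum_fun_apply sum_distrib_left)

abbreviation fs :: "('a \<Rightarrow> kk) \<Rightarrow> bool" where "fs v \<equiv> finite (supp v)"

lemma fs_0 [simp]: "fs 0" by (simp add: supp_def)
lemma fs_bvec [simp]: "fs (bvec x)" by (simp add: supp_def bvec_def)
lemma fs_add [simp]: "fs v \<Longrightarrow> fs w \<Longrightarrow> fs (v + w)"
  by (rule finite_subset[of _ "supp v \<union> supp w"]) (auto simp: supp_def)
lemma fs_sc [simp]: "fs v \<Longrightarrow> fs (sc c v)"
  by (rule finite_subset[of _ "supp v"]) (auto simp: supp_def)
lemma vec_expand: assumes "fs v" shows "v = (\<Sum>x\<in>supp v. sc (v x) (bvec x))"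
proof
  fix y
  have "(\<Sum>x\<in>supp v. sc (v x) (bvec x)) y = (\<Sum>x\<in>supp v. if y = x then v x else 0)"
    by (auto simp: sum_fun_apply bvec_def intro!: sum.cong)
  also have "\<dots> = v y" using assms by (auto simp: supp_def)
  finally show "v y = (\<Sum>x\<in>supp v. sc (v x) (bvec x)) y" by simp
qed

lemma lin_superset:
  assumes "finite A" "supp v \<subseteq> A"
  shows "lin F v = (\<Sum>x\<in>A. sc (v x) (F x))"
  unfolding lin_def fun_eq_iff sum_fun_apply sc_apply
  using assms by (intro allI sum.mono_neutral_left) (auto simp: supp_def)

lemma lin_bvec [simp]: "lin F (bvec x) = F x"
  by (subst lin_superset[of "{x}"]) (auto simp: supp_def bvec_def sc_def)

lemma lin_0 [simp]: "lin F 0 = 0"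
  by (simp add: lin_def supp_def fun_eq_iff)

lemma lin_add: assumes "fs v" "fs w" shows "lin F (v + w) = lin F v + lin F w"
proof -
  let ?A = "supp v \<union> supp w"
  have "finite ?A" "supp (v + w) \<subseteq> ?A" using assms by (auto simp: supp_def)
  then show ?thesis using assms
    by (simp add: lin_superset[of ?A] sc_add_left sum.distrib)
qed

lemma lin_sc: assumes "fs v" shows "lin F (sc c v) = sc c (lin F v)"
proof -
  have "supp (sc c v) \<subseteq> supp v" by (auto simp: supp_def)
  then show ?thesis using assms by (simp add: lin_superset[of "supp v"] sc_sum)
qed

lemma tens_0 [simp]: "0 \<in> tens n" by (simp add: tens_def supp_def)
lemma tens_add [simp]: "v \<in> tens n \<Longrightarrow> w \<in> tens n \<Longrightarrow> v + w \<in> tens n"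
  by (auto simp: tens_def) (auto simp: supp_def, metis add.left_neutral)
lemma tens_sc [simp]: "v \<in> tens n \<Longrightarrow> sc c v \<in> tens n"
  by (auto simp: tens_def) (auto simp: supp_def)
lemma tens_diff [simp]: "v \<in> tens n \<Longrightarrow> w \<in> tens n \<Longrightarrow> v - w \<in> tens n"
  using tens_add[of v n "sc (-1) w"] tens_sc[of w n "-1"] by (simp add: sc_minus_one)
lemma tens_bvec [simp]: "length xs = n \<Longrightarrow> bvec xs \<in> tens n"
  by (simp add: tens_def) (simp add: supp_def bvec_def)
lemma tens_sum: "(\<And>i. i \<in> A \<Longrightarrow> f i \<in> tens n) \<Longrightarrow> (\<Sum>i\<in>A. f i) \<in> tens n"
  by (induction A rule: infinite_finite_induct) auto
lemma tens_fs: "v \<in> tens n \<Longrightarrow> fs v" by (simp add: tens_def)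
lemma tens_length: "v \<in> tens n \<Longrightarrow> length xs \<noteq> n \<Longrightarrow> v xs = 0"
  by (auto simp: tens_def supp_def)

lemma tens_induct [consumes 1, case_names zero add]:
  assumes "v \<in> tens n" "P 0"
    and "\<And>v c xs. v \<in> tens n \<Longrightarrow> P v \<Longrightarrow> length xs = n \<Longrightarrow> P (v + sc c (bvec xs))"
  shows "P v"
proof -
  have "P (\<Sum>x\<in>X. sc (v x) (bvec x)) \<and> (\<Sum>x\<in>X. sc (v x) (bvec x)) \<in> tens n" if "X \<subseteq> supp v" for X
    using that
  proof (induction X rule: infinite_finite_induct)
    case (insert x X)
    then have "length x = n" using assms(1) by (auto simp: tens_def)
    moreover have "P (\<Sum>x\<in>X. sc (v x) (bvec x)) \<and> (\<Sum>x\<in>X. sc (v x) (bvec x)) \<in> tens n"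
      using insert by blast
    ultimately have "P ((\<Sum>x\<in>X. sc (v x) (bvec x)) + sc (v x) (bvec x)) \<and>
        (\<Sum>x\<in>X. sc (v x) (bvec x)) + sc (v x) (bvec x) \<in> tens n"
      using assms(3) tens_add tens_sc tens_bvec by blast
    then show ?case by (simp only: sum.insert[OF insert(1,2)] add.commute)
  qed (use assms in auto)
  then show ?thesis using vec_expand[OF tens_fs[OF assms(1)]] by force
qed

text \<open>Pointwise rules are kept out of the simpset: they would unfold vector identities under binders.\<close>

lemmas fapp = plus_fun_apply zero_fun_apply minus_apply uminus_apply sc_apply

declare plus_fun_apply [simp del] zero_fun_apply [simp del] minus_apply [simp del]
  uminus_apply [simp del] sc_apply [simp del]

section \<open>Operators on tensor powers\<close>

abbreviation sm :: "(int \<Rightarrow> int) \<Rightarrow> int list \<Rightarrow> int" where "sm f xs \<equiv> sum_list (map f xs)"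

definition kop :: "kk \<Rightarrow> (int \<Rightarrow> int) \<Rightarrow> vec \<Rightarrow> vec" where
  "kop q f v = (\<lambda>xs. q powi (sm f xs) * v xs)"

definition dop :: "(int \<Rightarrow> int) \<Rightarrow> vec \<Rightarrow> vec" where
  "dop f v = (\<lambda>xs. of_int (sm f xs) * v xs)"

text \<open>The sum over all factors of \<open>q\<^sup>b\<^sup>f \<otimes> \<dots> \<otimes> q\<^sup>b\<^sup>f \<otimes> X \<otimes> q\<^sup>a\<^sup>f \<otimes> \<dots> \<otimes> q\<^sup>a\<^sup>f\<close>, where the basis vector \<open>x\<close>
  is sent by \<open>X\<close> to \<open>y\<close> iff \<open>h y = Some x\<close>. Describing \<open>X\<close> by the inverse partial map \<open>h\<close> makes
  the operator total and linear on all functions, without any finiteness of supports.\<close>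

fun opx :: "kk \<Rightarrow> (int \<Rightarrow> int) \<Rightarrow> (int \<Rightarrow> int) \<Rightarrow> (int \<Rightarrow> int option) \<Rightarrow> vec \<Rightarrow> vec" where
  "opx q bf af h v [] = 0"
| "opx q bf af h v (y # ys) = (case h y of None \<Rightarrow> 0 | Some x \<Rightarrow> q powi (sm af ys) * v (x # ys))
     + q powi (bf y) * opx q bf af h (\<lambda>zs. v (y # zs)) ys"

definition lnr :: "(vec \<Rightarrow> vec) \<Rightarrow> bool" where
  "lnr A \<longleftrightarrow> (\<forall>v w. A (v + w) = A v + A w) \<and> (\<forall>c v. A (sc c v) = sc c (A v))"

lemma lnrD: "lnr A \<Longrightarrow> A (v + w) = A v + A w" "lnr A \<Longrightarrow> A (sc c v) = sc c (A v)"
  by (simp_all add: lnr_def)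

lemma lnr_zero: "lnr A \<Longrightarrow> A 0 = 0"
  using lnrD(2)[of A 0 0] by simp

lemma lnr_uminus: "lnr A \<Longrightarrow> A (- v) = - A v"
  using lnrD(2)[of A "-1" v] by (simp add: sc_minus_one)

lemma lnr_diff: "lnr A \<Longrightarrow> A (v - w) = A v - A w"
  using lnrD(1)[of A v "- w"] by (simp add: lnr_uminus)

lemma lnr_sum: "lnr A \<Longrightarrow> A (\<Sum>i\<in>I. f i) = (\<Sum>i\<in>I. A (f i))"
  by (induction I rule: infinite_finite_induct) (simp_all add: lnr_zero lnrD(1))

lemma opx_plus: "opx q bf af h (\<lambda>zs. v zs + w zs) ys = opx q bf af h v ys + opx q bf af h w ys"
proof (induction ys arbitrary: v w)
  case (Cons y ys)
  show ?case by (simp add: Cons algebra_simps split: option.split)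
qed simp

lemma opx_scale: "opx q bf af h (\<lambda>zs. c * v zs) ys = c * opx q bf af h v ys"
proof (induction ys arbitrary: v)
  case (Cons y ys)
  show ?case by (simp add: Cons algebra_simps split: option.split)
qed simp

lemma lnr_opx: "lnr (opx q bf af h)"
  by (simp add: lnr_def fun_eq_iff plus_fun_def sc_def opx_plus opx_scale)

lemma lnr_kop: "lnr (kop q f)" by (simp add: lnr_def kop_def fun_eq_iff fapp algebra_simps)
lemma lnr_dop: "lnr (dop f)" by (simp add: lnr_def dop_def fun_eq_iff fapp algebra_simps)

lemma opx_zero [simp]: "opx q bf af h (\<lambda>zs. 0) ys = 0"
  using opx_scale[of q bf af h 0 "\<lambda>zs. 0" ys] by simp

lemma opx_cong: "(\<And>zs. length zs = length ys \<Longrightarrow> v zs = w zs) \<Longrightarrow> opx q bf af h v ys = opx q bf af h w ys"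
proof (induction ys arbitrary: v w)
  case (Cons y ys)
  have "opx q bf af h (\<lambda>zs. v (y # zs)) ys = opx q bf af h (\<lambda>zs. w (y # zs)) ys"
    by (rule Cons.IH) (simp add: Cons.prems)
  moreover have "v (x # ys) = w (x # ys)" for x by (simp add: Cons.prems)
  ultimately show ?case by (cases "h y") simp_all
qed simp

lemma opx_nonzero:
  "opx q bf af h v ys \<noteq> 0 \<Longrightarrow> \<exists>us y vs x. ys = us @ y # vs \<and> h y = Some x \<and> v (us @ x # vs) \<noteq> 0"
proof (induction ys arbitrary: v)
  case (Cons y ys)
  show ?case
  proof (cases "(case h y of None \<Rightarrow> 0 | Some x \<Rightarrow> q powi (sm af ys) * v (x # ys)) = 0")
    case True
    then have "opx q bf af h (\<lambda>zs. v (y # zs)) ys \<noteq> 0" using Cons.prems by auto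
    from Cons.IH[OF this] obtain us y' vs x where "ys = us @ y' # vs" "h y' = Some x" "v (y # us @ x # vs) \<noteq> 0"
      by blast
    then show ?thesis by (intro exI[of _ "y # us"] exI[of _ y'] exI[of _ vs] exI[of _ x]) simp
  next
    case False
    then obtain x where "h y = Some x" "v (x # ys) \<noteq> 0" by (auto split: option.splits)
    then show ?thesis by (intro exI[of _ "[]"] exI[of _ y] exI[of _ ys] exI[of _ x]) simp
  qed
qed simp

lemma opx_append:
  assumes q: "q \<noteq> 0"
  shows "opx q bf af h v (ys @ zs) = q powi (sm af zs) * opx q bf af h (\<lambda>u. v (u @ zs)) ys
    + q powi (sm bf ys) * opx q bf af h (\<lambda>u. v (ys @ u)) zs"
proof (induction ys arbitrary: v)
  case (Cons y ys)
  show ?case using q by (simp add: Cons power_int_add algebra_simps split: option.split)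
qed simp

lemma kop_opx:
  assumes q: "q \<noteq> 0" and h: "\<And>y x. h y = Some x \<Longrightarrow> f y = f x + a"
  shows "kop q f (opx q bf af h v) = sc (q powi a) (opx q bf af h (kop q f v))"
proof
  fix ys
  show "kop q f (opx q bf af h v) ys = sc (q powi a) (opx q bf af h (kop q f v)) ys"
  proof (induction ys arbitrary: v)
    case (Cons y ys)
    have "(\<lambda>zs. kop q f v (y # zs)) = (\<lambda>zs. q powi f y * kop q f (\<lambda>zs. v (y # zs)) zs)"
      using q by (simp add: kop_def fun_eq_iff power_int_add algebra_simps)
    then have "opx q bf af h (\<lambda>zs. kop q f v (y # zs)) ys = q powi f y * opx q bf af h (kop q f (\<lambda>zs. v (y # zs))) ys"
      by (simp only: opx_scale)
    then show ?case using Cons[of "\<lambda>zs. v (y # zs)"] q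
      by (auto simp: kop_def fapp power_int_add h algebra_simps split: option.split)
  qed (simp add: kop_def fapp)
qed

lemma dop_opx:
  assumes h: "\<And>y x. h y = Some x \<Longrightarrow> f y = f x + a"
  shows "dop f (opx q bf af h v) = opx q bf af h (dop f v) + sc (of_int a) (opx q bf af h v)"
proof
  fix ys
  show "dop f (opx q bf af h v) ys = (opx q bf af h (dop f v) + sc (of_int a) (opx q bf af h v)) ys"
  proof (induction ys arbitrary: v)
    case (Cons y ys)
    have "(\<lambda>zs. dop f v (y # zs)) = (\<lambda>zs. of_int (f y) * v (y # zs) + dop f (\<lambda>zs. v (y # zs)) zs)"
      by (simp add: dop_def fun_eq_iff algebra_simps)
    then have "opx q bf af h (\<lambda>zs. dop f v (y # zs)) ys = of_int (f y) * opx q bf af h (\<lambda>zs. v (y # zs)) ys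
        + opx q bf af h (dop f (\<lambda>zs. v (y # zs))) ys"
      by (simp only: opx_plus opx_scale)
    then show ?case using Cons[of "\<lambda>zs. v (y # zs)"]
      by (auto simp: dop_def fapp h algebra_simps split: option.split)
  qed (simp add: dop_def fapp)
qed

text \<open>The two operators almost commute: the defect lives on single factors.\<close>

lemma opx_opx_Cons:
  assumes q: "q \<noteq> 0"
    and a1: "\<And>y x. h2 y = Some x \<Longrightarrow> a1 y = a1 x + d" and b2: "\<And>y x. h1 y = Some x \<Longrightarrow> b2 y = b2 x + d"
    and a2: "\<And>y x. h1 y = Some x \<Longrightarrow> a2 y = a2 x + d'" and b1: "\<And>y x. h2 y = Some x \<Longrightarrow> b1 y = b1 x + d'"
  shows "opx q b1 a1 h1 (opx q b2 a2 h2 v) (y # ys) - opx q b2 a2 h2 (opx q b1 a1 h1 v) (y # ys) =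
     q powi (sm a1 ys + sm a2 ys) *
       ((case Option.bind (h1 y) h2 of None \<Rightarrow> 0 | Some x \<Rightarrow> v (x # ys))
        - (case Option.bind (h2 y) h1 of None \<Rightarrow> 0 | Some x \<Rightarrow> v (x # ys)))
     + q powi (b1 y + b2 y) * (opx q b1 a1 h1 (opx q b2 a2 h2 (\<lambda>zs. v (y # zs))) ys
        - opx q b2 a2 h2 (opx q b1 a1 h1 (\<lambda>zs. v (y # zs))) ys)"
proof -
  have k: "opx q b a h (\<lambda>zs. case g of None \<Rightarrow> 0 | Some x \<Rightarrow> q powi (sm f zs) * v (x # zs)) ys =
     (case g of None \<Rightarrow> 0 | Some x \<Rightarrow> q powi (sm f ys - c) * opx q b a h (\<lambda>zs. v (x # zs)) ys)"
    if "\<And>y x. h y = Some x \<Longrightarrow> f y = f x + c" for b a h f g c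
  proof (cases g)
    case (Some x)
    have "kop q f (opx q b a h (\<lambda>zs. v (x # zs))) ys = sc (q powi c) (opx q b a h (kop q f (\<lambda>zs. v (x # zs)))) ys"
      using kop_opx[OF q that] by simp
    then show ?thesis using Some q by (simp add: kop_def fapp power_int_diff field_simps)
  qed simp
  have e: "(\<lambda>zs. opx q b a h v (y # zs)) = (\<lambda>zs. (case h y of None \<Rightarrow> 0 | Some x \<Rightarrow> q powi (sm a zs) * v (x # zs))
     + q powi (b y) * opx q b a h (\<lambda>zs. v (y # zs)) zs)" for b a h
    by simp
  show ?thesis
    apply (simp only: opx.simps(2)[of q b1 a1 h1 "opx q b2 a2 h2 v"] opx.simps(2)[of q b2 a2 h2 "opx q b1 a1 h1 v"] e opx_plus opx_scale)
    apply (subst k[of h1 a2, OF a2], assumption)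
    apply (subst k[of h2 a1, OF a1], assumption)
    using q by (cases "h1 y"; cases "h2 y") (auto simp: a1 a2 b1 b2 power_int_add power_int_diff field_simps split: option.split)
qed

text \<open>The hypotheses equate, for the two orders of application, the powers of q on the cross
  terms in which the operators act in different factors. What remains acts in a single factor and
  vanishes by \<open>c\<close>.\<close>

lemma opx_commute:
  assumes q: "q \<noteq> 0"
    and a1: "\<And>y x. h2 y = Some x \<Longrightarrow> a1 y = a1 x + d" and b2: "\<And>y x. h1 y = Some x \<Longrightarrow> b2 y = b2 x + d"
    and a2: "\<And>y x. h1 y = Some x \<Longrightarrow> a2 y = a2 x + d'" and b1: "\<And>y x. h2 y = Some x \<Longrightarrow> b1 y = b1 x + d'"
    and c: "\<And>y. Option.bind (h1 y) h2 = Option.bind (h2 y) h1"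
  shows "opx q b1 a1 h1 (opx q b2 a2 h2 v) = opx q b2 a2 h2 (opx q b1 a1 h1 v)"
proof -
  have "opx q b1 a1 h1 (opx q b2 a2 h2 v) ys - opx q b2 a2 h2 (opx q b1 a1 h1 v) ys = 0" for ys
  proof (induction ys arbitrary: v)
    case (Cons y ys)
    show ?case by (subst opx_opx_Cons[OF q a1 b2 a2 b1]) (simp_all add: Cons c)
  qed simp
  then show ?thesis by (simp add: fun_eq_iff fapp)
qed

text \<open>Pull-back along \<open>f\<close> is the raising operator, pull-back along
  \<open>e\<close> the lowering one. Induction on the number of factors: cross terms cancel, the
  first factor contributes \<open>qi q (k y)\<close> because \<open>k y\<close> is -1, 0 or 1, and
  \<open>qi_add\<close> joins this to the other factors.\<close>

lemma opx_commutator: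
  assumes q: "q \<noteq> 0" "q - inverse q \<noteq> 0"
    and ab: "al = 0 \<and> be = 1 \<or> al = 1 \<and> be = 0"
    and inv: "\<And>x y. e x = Some y \<longleftrightarrow> f y = Some x"
    and k: "\<And>x. k x = dl (f x \<noteq> None) - dl (e x \<noteq> None)"
    and ke: "\<And>x y. e x = Some y \<Longrightarrow> k y = k x + 2"
  shows "opx q (\<lambda>x. al * k x) (\<lambda>x. be * k x) f (opx q (\<lambda>x. - be * k x) (\<lambda>x. - al * k x) e v) ys
       - opx q (\<lambda>x. - be * k x) (\<lambda>x. - al * k x) e (opx q (\<lambda>x. al * k x) (\<lambda>x. be * k x) f v) ys
     = qi q (sm k ys) * v ys"
proof (induction ys arbitrary: v)
  case (Cons y ys)
  have s: "sm (\<lambda>x. c * k x) ys = c * sm k ys" for c by (simp add: sum_list_const_mult)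
  have site: "(case Option.bind (f y) e of None \<Rightarrow> 0 | Some x \<Rightarrow> v (x # ys))
        - (case Option.bind (e y) f of None \<Rightarrow> 0 | Some x \<Rightarrow> v (x # ys)) = qi q (k y) * v (y # ys)"
  proof -
    have "Option.bind (f y) e = (if f y = None then None else Some y)"
    proof (cases "f y")
      case (Some x)
      then have "e x = Some y" using inv by blast
      with Some show ?thesis by simp
    qed simp
    moreover have "Option.bind (e y) f = (if e y = None then None else Some y)"
    proof (cases "e y")
      case (Some x)
      then have "f x = Some y" using inv by blast
      with Some show ?thesis by simp
    qed simp
    ultimately show ?thesis using qi_1[OF q(2)] qi_uminus[of q 1] by (auto simp: k dl_def)
  qed
  have d: "c * k y = c * k x + - 2 * c" if "e y = Some x" for x y c
    using ke[OF that] by (simp add: algebra_simps)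
  have d': "- c * k y = - c * k x + - 2 * c" if "f y = Some x" for x y c
  proof -
    have "e x = Some y" using that inv by blast
    then have "k y = k x + 2" by (rule ke)
    then show ?thesis by (simp add: algebra_simps)
  qed
  have "opx q (\<lambda>x. al * k x) (\<lambda>x. be * k x) f (opx q (\<lambda>x. - be * k x) (\<lambda>x. - al * k x) e v) (y # ys)
       - opx q (\<lambda>x. - be * k x) (\<lambda>x. - al * k x) e (opx q (\<lambda>x. al * k x) (\<lambda>x. be * k x) f v) (y # ys)
     = q powi (be * sm k ys + - al * sm k ys) * (qi q (k y) * v (y # ys))
       + q powi (al * k y + - be * k y) * (qi q (sm k ys) * v (y # ys))"
    by (subst opx_opx_Cons[where d="- 2 * be" and d'="- 2 * al", OF q(1) d d' d' d]) (simp_all only: site Cons s)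
  also have "\<dots> = qi q (k y + sm k ys) * v (y # ys)"
  proof -
    have "q powi (be * sm k ys + - al * sm k ys) * qi q (k y) + q powi (al * k y + - be * k y) * qi q (sm k ys)
        = qi q (k y + sm k ys)"
    proof (cases "al = 0")
      case True
      then show ?thesis using ab qi_add[OF q(1), of "-1" "k y" "sm k ys"] by simp
    next
      case False
      then show ?thesis using ab qi_add[OF q(1), of 1 "k y" "sm k ys"] by simp
    qed
    then show ?thesis by (simp only: mult.assoc[symmetric] distrib_right[symmetric])
  qed
  finally show ?case by simp
qed simp

subsection \<open>Serre relations\<close>

definition qcomm :: "kk \<Rightarrow> (vec \<Rightarrow> vec) \<Rightarrow> (vec \<Rightarrow> vec) \<Rightarrow> vec \<Rightarrow> vec" where
  "qcomm c X Z v = X (Z v) - sc c (Z (X v))"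

lemma lnr_qcomm: "lnr X \<Longrightarrow> lnr Z \<Longrightarrow> lnr (qcomm c X Z)"
  by (simp add: lnr_def qcomm_def, simp add: fun_eq_iff fapp algebra_simps)

text \<open>The coefficients are the elementary symmetric functions of the parameters, so the order
  of the parameters can be chosen freely; for t^-2, 1, t^2 they are those of the cubic Serre
  relation.\<close>

lemma qcomm_thrice:
  assumes "lnr X"
  shows "qcomm c3 X (qcomm c2 X (qcomm c1 X Y)) v = X (X (X (Y v))) + sc (- (c1 + c2 + c3)) (X (X (Y (X v))))
     + sc (c1 * c2 + c1 * c3 + c2 * c3) (X (Y (X (X v)))) - sc (c1 * c2 * c3) (Y (X (X (X v))))"
  by (simp add: qcomm_def lnr_diff[OF assms] lnrD(2)[OF assms], simp add: fun_eq_iff fapp algebra_simps)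

lemma qcomm_twice:
  assumes "lnr X"
  shows "qcomm c2 X (qcomm c1 X Y) v = X (X (Y v)) + sc (- (c1 + c2)) (X (Y (X v))) + sc (c1 * c2) (Y (X (X v)))"
  by (simp add: qcomm_def lnr_diff[OF assms] lnrD(2)[OF assms], simp add: fun_eq_iff fapp algebra_simps)

text \<open>A Serre polynomial is an iterated q-commutator; in a suitable order of the parameters
  one of the two summands of \<open>X\<close> drops out at every step.\<close>

lemma q_serre_square_left:
  assumes l: "lnr A" "lnr B" "lnr Y" and t: "t \<noteq> 0"
    and AB: "\<And>v. A (B v) = sc (t^2) (B (A v))" "\<And>v. A (Y v) = sc (inverse t) (Y (A v))"
    and X: "\<And>v. X v = A v + B v"
  shows "X (X (Y v)) + sc (- (t + inverse t)) (X (Y (X v))) + Y (X (X v))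
    = B (B (Y v)) + sc (- (t + inverse t)) (B (Y (B v))) + Y (B (B v))"
proof -
  have X': "X = (\<lambda>v. A v + B v)" using X by auto
  have lX: "lnr X" using l(1,2) unfolding X' lnr_def by (simp add: sc_add algebra_simps)
  define Z1 where "Z1 = qcomm (inverse t) B Y"
  have l1: "lnr Z1" unfolding Z1_def by (intro lnr_qcomm l)
  have e1: "qcomm (inverse t) X Y = Z1"
    by (simp add: fun_eq_iff qcomm_def Z1_def X l[THEN lnrD(1)] AB fapp algebra_simps)
  have a1: "A (Z1 w) = sc t (Z1 (A w))" for w
    unfolding Z1_def qcomm_def by (simp add: lnr_diff l AB lnrD(2))
      (simp add: fun_eq_iff fapp field_simps power2_eq_square t)
  have e2: "qcomm t X Z1 = qcomm t B Z1"
    by (simp add: fun_eq_iff qcomm_def X l1[THEN lnrD(1)] a1 fapp algebra_simps)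
  have "qcomm t X (qcomm (inverse t) X Y) v = qcomm t B (qcomm (inverse t) B Y) v"
    unfolding e1 e2 unfolding Z1_def ..
  then show ?thesis using t by (simp add: qcomm_twice[OF lX] qcomm_twice[OF l(2)] add.commute)
qed

text \<open>Here B is the summand that passes Y, so the parameter \<open>t\<close> comes first and B
  drops out. The left version is meant for a Y acting in the later factors, this one for a Y acting
  in the first factor; likewise for the cubic pair.\<close>

lemma q_serre_square_right:
  assumes l: "lnr A" "lnr B" "lnr Y" and t: "t \<noteq> 0"
    and AB: "\<And>v. A (B v) = sc (t^2) (B (A v))" "\<And>v. Y (B v) = sc (inverse t) (B (Y v))"
    and X: "\<And>v. X v = A v + B v"
  shows "X (X (Y v)) + sc (- (t + inverse t)) (X (Y (X v))) + Y (X (X v))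
    = A (A (Y v)) + sc (- (t + inverse t)) (A (Y (A v))) + Y (A (A v))"
proof -
  have X': "X = (\<lambda>v. A v + B v)" using X by auto
  have lX: "lnr X" using l(1,2) unfolding X' lnr_def by (simp add: sc_add algebra_simps)
  define Z1 where "Z1 = qcomm t A Y"
  have l1: "lnr Z1" unfolding Z1_def by (intro lnr_qcomm l)
  have e1: "qcomm t X Y = Z1"
    by (simp add: fun_eq_iff qcomm_def Z1_def X l[THEN lnrD(1)] AB sc_add t)
  have a1: "Z1 (B w) = sc t (B (Z1 w))" for w
    unfolding Z1_def qcomm_def by (simp add: lnr_diff l AB lnrD(2))
      (simp add: fun_eq_iff fapp field_simps power2_eq_square t)
  have e2: "qcomm (inverse t) X Z1 = qcomm (inverse t) A Z1"
    by (simp add: fun_eq_iff qcomm_def X l1[THEN lnrD(1)] a1 sc_add t)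
  have "qcomm (inverse t) X (qcomm t X Y) v = qcomm (inverse t) A (qcomm t A Y) v"
    unfolding e1 e2 unfolding Z1_def ..
  then show ?thesis using t by (simp add: qcomm_twice[OF lX] qcomm_twice[OF l(1)] add.commute)
qed

lemma q_serre_cubic_left:
  assumes l: "lnr A" "lnr B" "lnr Y" and t: "t \<noteq> 0"
    and AB: "\<And>v. A (B v) = sc (t^2) (B (A v))" "\<And>v. A (Y v) = sc (inverse t ^ 2) (Y (A v))"
    and X: "\<And>v. X v = A v + B v"
    and c: "c = t^2 + 1 + inverse t ^ 2"
  shows "X (X (X (Y v))) + sc (- c) (X (X (Y (X v)))) + sc c (X (Y (X (X v)))) - Y (X (X (X v)))
    = B (B (B (Y v))) + sc (- c) (B (B (Y (B v)))) + sc c (B (Y (B (B v)))) - Y (B (B (B v)))"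
proof -
  have X': "X = (\<lambda>v. A v + B v)" using X by auto
  have lX: "lnr X" using l(1,2) unfolding X' lnr_def by (simp add: sc_add algebra_simps)
  have tt: "t^2 * inverse t ^ 2 = 1" using t by (simp add: power_mult_distrib[symmetric])
  have cc: "c = inverse t ^ 2 + 1 + t ^ 2" "c = inverse t ^ 2 * 1 + inverse t ^ 2 * t ^ 2 + 1 * t ^ 2"
    "inverse t ^ 2 * 1 * t ^ 2 = 1" using c tt by (simp_all add: algebra_simps)
  define Z1 where "Z1 = qcomm (inverse t ^ 2) B Y"
  define Z2 where "Z2 = qcomm 1 B Z1"
  have l1: "lnr Z1" "lnr Z2" unfolding Z1_def Z2_def by (intro lnr_qcomm l)+
  have e1: "qcomm (inverse t ^ 2) X Y = Z1"
    by (simp add: fun_eq_iff qcomm_def Z1_def X l[THEN lnrD(1)] AB fapp algebra_simps)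
  have a1: "A (Z1 w) = Z1 (A w)" for w
    unfolding Z1_def qcomm_def by (simp add: lnr_diff l AB lnrD(2) mult.assoc[symmetric] tt)
      (simp add: fun_eq_iff fapp field_simps t)
  have e2: "qcomm 1 X Z1 = Z2"
    by (simp add: fun_eq_iff qcomm_def Z2_def X l1[THEN lnrD(1)] a1 fapp)
  have a2: "A (Z2 w) = sc (t^2) (Z2 (A w))" for w
    unfolding Z2_def qcomm_def by (simp add: lnr_diff l AB lnrD(2)[OF l1(1)] a1 sc_diff)
  have e3: "qcomm (t^2) X Z2 = qcomm (t^2) B Z2"
    by (simp add: fun_eq_iff qcomm_def X l1[THEN lnrD(1)] a2 fapp algebra_simps)
  have "qcomm (t^2) X (qcomm 1 X (qcomm (inverse t ^ 2) X Y)) v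
      = qcomm (t^2) B (qcomm 1 B (qcomm (inverse t ^ 2) B Y)) v"
    unfolding e1 e2 e3 unfolding Z1_def Z2_def ..
  then show ?thesis unfolding qcomm_thrice[OF lX] qcomm_thrice[OF l(2)] cc(1)[symmetric] cc(2)[symmetric] cc(3) sc_1 .
qed

lemma q_serre_cubic_right:
  assumes l: "lnr A" "lnr B" "lnr Y" and t: "t \<noteq> 0"
    and AB: "\<And>v. A (B v) = sc (t^2) (B (A v))" "\<And>v. Y (B v) = sc (inverse t ^ 2) (B (Y v))"
    and X: "\<And>v. X v = A v + B v"
    and c: "c = t^2 + 1 + inverse t ^ 2"
  shows "X (X (X (Y v))) + sc (- c) (X (X (Y (X v)))) + sc c (X (Y (X (X v)))) - Y (X (X (X v)))
    = A (A (A (Y v))) + sc (- c) (A (A (Y (A v)))) + sc c (A (Y (A (A v)))) - Y (A (A (A v)))"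
proof -
  have X': "X = (\<lambda>v. A v + B v)" using X by auto
  have lX: "lnr X" using l(1,2) unfolding X' lnr_def by (simp add: sc_add algebra_simps)
  have tt: "t^2 * inverse t ^ 2 = 1" "inverse t ^ 2 * t^2 = 1" using t by (simp_all add: power_mult_distrib[symmetric])
  have cc: "c = t ^ 2 + 1 + inverse t ^ 2" "c = t ^ 2 * 1 + t ^ 2 * inverse t ^ 2 + 1 * inverse t ^ 2"
    "t ^ 2 * 1 * inverse t ^ 2 = 1" using c tt by (simp_all add: algebra_simps)
  define Z1 where "Z1 = qcomm (t ^ 2) A Y"
  define Z2 where "Z2 = qcomm 1 A Z1"
  have l1: "lnr Z1" "lnr Z2" unfolding Z1_def Z2_def by (intro lnr_qcomm l)+
  have e1: "qcomm (t ^ 2) X Y = Z1"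
    by (simp add: fun_eq_iff qcomm_def Z1_def X l[THEN lnrD(1)] AB sc_add tt)
  have a1: "Z1 (B w) = B (Z1 w)" for w
    unfolding Z1_def qcomm_def by (simp add: lnr_diff l AB lnrD(2) mult.assoc[symmetric] tt)
  have e2: "qcomm 1 X Z1 = Z2"
    by (simp add: fun_eq_iff qcomm_def Z2_def X l1[THEN lnrD(1)] a1 fapp)
  have a2: "Z2 (B w) = sc (t^2) (B (Z2 w))" for w
    unfolding Z2_def qcomm_def by (simp add: lnr_diff l AB lnrD(2)[OF l1(1)] a1 sc_diff)
  have e3: "qcomm (inverse t^2) X Z2 = qcomm (inverse t^2) A Z2"
    by (simp add: fun_eq_iff qcomm_def X l1[THEN lnrD(1)] a2 sc_add tt)
  have "qcomm (inverse t^2) X (qcomm 1 X (qcomm (t ^ 2) X Y)) v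
      = qcomm (inverse t^2) A (qcomm 1 A (qcomm (t ^ 2) A Y)) v"
    unfolding e1 e2 e3 unfolding Z1_def Z2_def ..
  then show ?thesis unfolding qcomm_thrice[OF lX] qcomm_thrice[OF l(1)] cc(1)[symmetric] cc(2)[symmetric] cc(3) sc_1 .
qed

lemma q_serre_mixed1:
  assumes l: "lnr A" "lnr B" "lnr A'" "lnr B'"
    and AB: "\<And>v. A (B' v) = B' (A v)" "\<And>v. A' (B v) = B (A' v)"
    and X: "\<And>v. X v = A v + B v" "\<And>v. Y v = A' v + B' v"
  shows "X (Y v) - Y (X v) = (A (A' v) - A' (A v)) + (B (B' v) - B' (B v))"
  by (simp add: X l[THEN lnrD(1)] l[THEN lnrD(2)] AB)

text \<open>The two summands of a coproduct: \<open>opA\<close> acts in the first factor and by a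
  power of q on the others, \<open>opB\<close> by a power of q on the first factor and by the given
  operator on the rest. They commute up to a power of q, as the identities for q-commutators
  require.\<close>

definition opA :: "kk \<Rightarrow> (int \<Rightarrow> int) \<Rightarrow> (int \<Rightarrow> int option) \<Rightarrow> vec \<Rightarrow> vec" where
  "opA q af h v ys = (case ys of [] \<Rightarrow> 0 | y # zs \<Rightarrow> (case h y of None \<Rightarrow> 0 | Some x \<Rightarrow> q powi (sm af zs) * v (x # zs)))"
definition opB :: "kk \<Rightarrow> (int \<Rightarrow> int) \<Rightarrow> (vec \<Rightarrow> vec) \<Rightarrow> vec \<Rightarrow> vec" where
  "opB q bf X v ys = (case ys of [] \<Rightarrow> 0 | y # zs \<Rightarrow> q powi (bf y) * X (\<lambda>u. v (y # u)) zs)"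

lemma opx_eq_opA_opB: "opx q bf af h v = opA q af h v + opB q bf (opx q bf af h) v"
proof
  show "opx q bf af h v ys = (opA q af h v + opB q bf (opx q bf af h) v) ys" for ys
    by (cases ys) (simp_all add: opA_def opB_def fapp)
qed

lemma lnr_opA: "lnr (opA q af h)"
  by (auto simp: lnr_def fun_eq_iff fapp opA_def algebra_simps split: list.split option.split)

lemma lnr_opB: "lnr (opB q bf (opx q bf' af h))"
  by (auto simp: lnr_def fun_eq_iff fapp opB_def algebra_simps opx_plus opx_scale split: list.split)

lemma opA_opB:
  assumes q: "q \<noteq> 0" and s: "\<And>y x. h2 y = Some x \<Longrightarrow> a1 y = a1 x + s"
    and r: "\<And>y x. h1 y = Some x \<Longrightarrow> b2 y = b2 x + r"
  shows "opA q a1 h1 (opB q b2 (opx q b2 a2 h2) v) = sc (q powi (s - r)) (opB q b2 (opx q b2 a2 h2) (opA q a1 h1 v))"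
proof
  fix ys
  show "opA q a1 h1 (opB q b2 (opx q b2 a2 h2) v) ys = sc (q powi (s - r)) (opB q b2 (opx q b2 a2 h2) (opA q a1 h1 v)) ys"
  proof (cases ys)
    case (Cons y zs)
    show ?thesis
    proof (cases "h1 y")
      case None
      then show ?thesis using Cons by (simp add: opA_def opB_def fapp)
    next
      case (Some x)
      have "kop q a1 (opx q b2 a2 h2 (\<lambda>u. v (x # u))) zs = sc (q powi s) (opx q b2 a2 h2 (kop q a1 (\<lambda>u. v (x # u)))) zs"
        using kop_opx[OF q s] by simp
      then show ?thesis using Some Cons q r[OF Some]
        by (simp add: opA_def opB_def fapp kop_def power_int_diff power_int_add field_simps)
    qed
  qed (simp add: opA_def opB_def fapp)
qed

lemma opB_Cons: "opB q bf X v (y # zs) = q powi (bf y) * X (\<lambda>u. v (y # u)) zs"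
  by (simp add: opB_def)

lemma opA_zero2: "opA q a h (opA q a' h' v) = 0" if "\<And>x y. h x = Some y \<Longrightarrow> h' y = None"
  using that by (auto simp: fun_eq_iff fapp opA_def split: list.split option.split)

lemma opA_zero3: "opA q a h (opA q a' h' (opA q a'' h'' v)) = 0"
  if "\<And>x y z. h x = Some y \<Longrightarrow> h' y = Some z \<Longrightarrow> h'' z = None"
  using that by (auto simp: fun_eq_iff fapp opA_def split: list.split option.split)

lemma opA_0 [simp]: "opA q a h 0 = 0" by (simp add: lnr_zero lnr_opA)

text \<open>The integer \<open>a\<close> is the Cartan entry. The parameter \<open>t\<close> is q or
  its inverse, depending on the coproduct and on whether raising or lowering operators are meant;
  the Serre coefficients do not distinguish the two. The exponents are such that A passes B with t^2
  and B' with t^a. By \<open>h11\<close> the square of X vanishes on a single factor.\<close>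

locale serre_pair =
  fixes q :: kk and b1 a1 b2 a2 :: "int \<Rightarrow> int" and h1 h2 :: "int \<Rightarrow> int option"
    and a s r s1 r1 s2 r2 :: int and t :: kk
  assumes q: "q \<noteq> 0"
    and t: "t = q \<or> t = inverse q"
    and c11: "\<And>y x. h1 y = Some x \<Longrightarrow> a1 y = a1 x + s" "\<And>y x. h1 y = Some x \<Longrightarrow> b1 y = b1 x + r"
    and t2: "q powi (s - r) = t ^ 2"
    and c12: "\<And>y x. h2 y = Some x \<Longrightarrow> a1 y = a1 x + s1" "\<And>y x. h1 y = Some x \<Longrightarrow> b2 y = b2 x + r1"
    and c21: "\<And>y x. h1 y = Some x \<Longrightarrow> a2 y = a2 x + s2" "\<And>y x. h2 y = Some x \<Longrightarrow> b1 y = b1 x + r2"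
    and t1: "q powi (s1 - r1) = t powi a" "q powi (s2 - r2) = t powi a"
    and h11: "\<And>x y. h1 x = Some y \<Longrightarrow> h1 y = None"
begin

abbreviation "X \<equiv> opx q b1 a1 h1"
abbreviation "Y \<equiv> opx q b2 a2 h2"
abbreviation "A \<equiv> opA q a1 h1"
abbreviation "A' \<equiv> opA q a2 h2"
abbreviation "B \<equiv> opB q b1 X"
abbreviation "B' \<equiv> opB q b2 Y"

lemma AB: "A (B v) = sc (t^2) (B (A v))" "A (B' v) = sc (t powi a) (B' (A v))" "A' (B v) = sc (t powi a) (B (A' v))"
  using opA_opB[OF q c11] opA_opB[OF q c12] opA_opB[OF q c21] t2 t1 by simp_all

lemma AA: "A (A v) = 0" by (rule opA_zero2) (rule h11)

lemma t_nonzero: "t \<noteq> 0" using q t by auto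

lemma B_words: "B w (y # zs) = q powi (b1 y) * X (\<lambda>u. w (y # u)) zs"
  "B' w (y # zs) = q powi (b2 y) * Y (\<lambda>u. w (y # u)) zs" for w y zs
  by (simp_all add: opB_Cons)

lemma serre1:
  assumes "a = 0" and "\<And>x y. h1 x = Some y \<Longrightarrow> h2 y = None" "\<And>x y. h2 x = Some y \<Longrightarrow> h1 y = None"
  shows "X (Y v) - Y (X v) = 0"
proof -
  have "X (Y v) ys - Y (X v) ys = 0" for ys
  proof (induction ys arbitrary: v)
    case (Cons y zs)
    have m: "X (Y v) - Y (X v) = (A (A' v) - A' (A v)) + (B (B' v) - B' (B v))"
      by (rule q_serre_mixed1) (use AB assms(1) in \<open>simp_all add: lnr_opA lnr_opB opx_eq_opA_opB[symmetric]\<close>)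
    have z: "A (A' v) = 0" "A' (A v) = 0" using opA_zero2 assms by blast+
    have "(X (Y v) - Y (X v)) (y # zs) = (B (B' v) - B' (B v)) (y # zs)" unfolding m z by (simp add: fapp)
    also have "\<dots> = q powi (b1 y) * q powi (b2 y) * (X (Y (\<lambda>u. v (y # u))) zs - Y (X (\<lambda>u. v (y # u))) zs)"
      by (simp add: B_words opx_scale fapp algebra_simps)
    finally show ?case using Cons by (simp add: fapp)
  qed (simp add: fapp)
  then show ?thesis by (simp add: fun_eq_iff fapp)
qed

text \<open>Up to powers of q, the Serre polynomial is additive over a tensor product: it is the sum
  of the one on the first factor and the one on the others. Induction thus reduces it to one factor,
  where XX = 0, and XYX = 0 by \<open>z\<close>.\<close>

lemma serre2:
  assumes a: "a = - 1" and z: "\<And>x y z. h1 x = Some y \<Longrightarrow> h2 y = Some z \<Longrightarrow> h1 z = None"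
  shows "X (X (Y v)) + sc (- (q + inverse q)) (X (Y (X v))) + Y (X (X v)) = 0"
proof -
  have tq: "q + inverse q = t + inverse t" using t by auto
  have "(X (X (Y v)) + sc (- (q + inverse q)) (X (Y (X v))) + Y (X (X v))) ys = 0" for ys
  proof (induction ys arbitrary: v)
    case (Cons y zs)
    let ?S = "\<lambda>X Y. X (X (Y v)) + sc (- (t + inverse t)) (X (Y (X v))) + Y (X (X v))"
    note l = lnr_opA lnr_opB
    have ti: "t powi - 1 = inverse t" by (simp add: power_int_def)
    have "?S X Y = ?S X A' + ?S X B'"
      by (simp only: opx_eq_opA_opB[of q b2 a2 h2] lnr_opx[THEN lnrD(1)] lnr_opx[THEN lnrD(2)] sc_add) (simp add: algebra_simps)
    moreover have "?S X A' = ?S A A'"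
      by (rule q_serre_square_right[OF l(1) l(2) l(1) t_nonzero AB(1)]) (use AB(3) a ti in \<open>simp_all add: opx_eq_opA_opB[symmetric]\<close>)
    moreover have "?S X B' = ?S B B'"
      by (rule q_serre_square_left[OF l(1) l(2) l(2) t_nonzero AB(1)]) (use AB(2) a ti in \<open>simp_all add: opx_eq_opA_opB[symmetric]\<close>)
    ultimately have m: "?S X Y = ?S A A' + ?S B B'" by (simp only:)
    have z: "A (A' (A v)) = 0" using opA_zero3 z by blast
    have "(X (X (Y v)) + sc (- (q + inverse q)) (X (Y (X v))) + Y (X (X v))) (y # zs)
      = (B (B (B' v)) + sc (- (q + inverse q)) (B (B' (B v))) + B' (B (B v))) (y # zs)"
      unfolding m tq z AA by (simp add: lnr_zero lnr_opA fapp)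
    also have "\<dots> = q powi (b1 y) * q powi (b1 y) * q powi (b2 y) *
       (X (X (Y (\<lambda>u. v (y # u)))) + sc (- (q + inverse q)) (X (Y (X (\<lambda>u. v (y # u))))) + Y (X (X (\<lambda>u. v (y # u))))) zs"
      by (simp add: B_words opx_scale fapp algebra_simps)
    finally show ?case using Cons by (simp add: fapp)
  qed (simp add: fapp)
  then show ?thesis by (simp add: fun_eq_iff fapp)
qed

text \<open>The Cartan entry -2 occurs when E_0 and E_1 are the only raising generators. On one
  factor every word in three X and one Y contains XX.\<close>

lemma serre3:
  assumes a: "a = - 2" and c: "c = q^2 + 1 + inverse q ^ 2"
  shows "X (X (X (Y v))) + sc (- c) (X (X (Y (X v)))) + sc c (X (Y (X (X v)))) - Y (X (X (X v))) = 0"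
proof -
  have tq: "c = t^2 + 1 + inverse t ^ 2" using t c by auto
  have "(X (X (X (Y v))) + sc (- c) (X (X (Y (X v)))) + sc c (X (Y (X (X v)))) - Y (X (X (X v)))) ys = 0" for ys
  proof (induction ys arbitrary: v)
    case (Cons y zs)
    have ti: "t powi - 2 = inverse t ^ 2" by (simp add: power_int_def)
    let ?S = "\<lambda>X Y. X (X (X (Y v))) + sc (- c) (X (X (Y (X v)))) + sc c (X (Y (X (X v)))) - Y (X (X (X v)))"
    note l = lnr_opA lnr_opB
    have "?S X Y = ?S X A' + ?S X B'"
      by (simp only: opx_eq_opA_opB[of q b2 a2 h2] lnr_opx[THEN lnrD(1)] lnr_opx[THEN lnrD(2)] sc_add) (simp add: algebra_simps)
    moreover have "?S X A' = ?S A A'"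
      by (rule q_serre_cubic_right[OF l(1) l(2) l(1) t_nonzero AB(1) _ _ tq]) (use AB(3) a ti in \<open>simp_all add: opx_eq_opA_opB[symmetric]\<close>)
    moreover have "?S X B' = ?S B B'"
      by (rule q_serre_cubic_left[OF l(1) l(2) l(2) t_nonzero AB(1) _ _ tq]) (use AB(2) a ti in \<open>simp_all add: opx_eq_opA_opB[symmetric]\<close>)
    ultimately have m: "?S X Y = ?S A A' + ?S B B'" by (simp only:)
    have "(X (X (X (Y v))) + sc (- c) (X (X (Y (X v)))) + sc c (X (Y (X (X v)))) - Y (X (X (X v)))) (y # zs)
      = (B (B (B (B' v))) + sc (- c) (B (B (B' (B v)))) + sc c (B (B' (B (B v)))) - B' (B (B (B v)))) (y # zs)"
      unfolding m AA by (simp add: lnr_zero lnr_opA fapp)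
    also have "\<dots> = q powi (b1 y) * q powi (b1 y) * q powi (b1 y) * q powi (b2 y) *
       (X (X (X (Y (\<lambda>u. v (y # u))))) + sc (- c) (X (X (Y (X (\<lambda>u. v (y # u))))))
       + sc c (X (Y (X (X (\<lambda>u. v (y # u)))))) - Y (X (X (X (\<lambda>u. v (y # u)))))) zs"
      by (simp add: B_words opx_scale fapp algebra_simps)
    finally show ?case using Cons by (simp add: fapp)
  qed (simp add: fapp)
  then show ?thesis by (simp add: fun_eq_iff fapp)
qed

end

section \<open>Action on basis vectors\<close>

definition cns :: "int \<Rightarrow> vec \<Rightarrow> vec" where
  "cns x v ys = (case ys of [] \<Rightarrow> 0 | y # zs \<Rightarrow> if y = x then v zs else 0)"

lemma bvec_Cons: "bvec (x # xs) (y # ys) = (if y = x then bvec xs ys else 0)"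
  "bvec (x # xs) [] = 0" "bvec [] (y # ys) = 0"
  by (simp_all add: bvec_def)

lemma opx_bvec_Cons:
  assumes inv: "\<And>x y. g x = Some y \<longleftrightarrow> h y = Some x"
  shows "opx q bf af h (bvec (x # xs)) = (case g x of None \<Rightarrow> 0 | Some y \<Rightarrow> sc (q powi sm af xs) (bvec (y # xs)))
     + sc (q powi bf x) (cns x (opx q bf af h (bvec xs)))"
proof
  fix zs
  show "opx q bf af h (bvec (x # xs)) zs = ((case g x of None \<Rightarrow> 0 | Some y \<Rightarrow> sc (q powi sm af xs) (bvec (y # xs)))
     + sc (q powi bf x) (cns x (opx q bf af h (bvec xs)))) zs"
  proof (cases zs)
    case Nil
    then show ?thesis by (simp add: fapp cns_def bvec_def split: option.split)
  next
    case (Cons y ys)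
    have "(\<lambda>zs. bvec (x # xs) (y # zs)) = (if y = x then bvec xs else (\<lambda>_. 0))"
      by (auto simp: bvec_Cons)
    then have *: "opx q bf af h (\<lambda>zs. bvec (x # xs) (y # zs)) ys = (if y = x then opx q bf af h (bvec xs) ys else 0)"
      by simp
    have **: "(case h y of None \<Rightarrow> 0 | Some x' \<Rightarrow> q powi sm af ys * bvec (x # xs) (x' # ys))
        = (case g x of None \<Rightarrow> 0 | Some y' \<Rightarrow> q powi sm af xs * bvec (y' # xs) (y # ys))"
    proof (cases "h y = Some x")
      case True
      then have "g x = Some y" using inv by blast
      with True show ?thesis by (auto simp: bvec_def)
    next
      case False
      then have "g x \<noteq> Some y" using inv by blast
      with False show ?thesis by (auto simp: bvec_def split: option.split)
    qed
    show ?thesis using Cons * ** by (auto simp: fapp cns_def split: option.split)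
  qed
qed

lemma cns_lin: "cns x (v + w) = cns x v + cns x w" "cns x (sc c v) = sc c (cns x v)" "cns x 0 = 0"
  "cns x (bvec xs) = bvec (x # xs)"
  by (auto simp: fun_eq_iff cns_def fapp bvec_def split: list.split)

lemma cns_sum: "cns x (\<Sum>i\<in>I. f i) = (\<Sum>i\<in>I. cns x (f i))"
  by (induction I rule: infinite_finite_induct) (simp_all add: cns_lin)

text \<open>Translates the pull-back along \<open>h\<close> into a sum over places of the
  push-forward along \<open>g\<close>. This is the shape of the tensor operators in the statement,
  and it gives finiteness of supports.\<close>

lemma opx_bvec:
  assumes q: "q \<noteq> 0" and inv: "\<And>x y. g x = Some y \<longleftrightarrow> h y = Some x"
  shows "opx q bf af h (bvec xs) = (\<Sum>j<length xs. case g (xs ! j) of None \<Rightarrow> 0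
     | Some y \<Rightarrow> sc (q powi sm bf (take j xs) * q powi sm af (drop (Suc j) xs)) (bvec (xs[j := y])))"
proof (induction xs)
  case Nil
  have "opx q bf af h (bvec []) ys = 0" for ys
    by (cases ys) (simp_all add: bvec_Cons split: option.split)
  then show ?case by (simp add: fun_eq_iff fapp)
next
  case (Cons x xs)
  have "sc (q powi bf x) (cns x (case g (xs ! j) of None \<Rightarrow> 0
     | Some y \<Rightarrow> sc (q powi sm bf (take j xs) * q powi sm af (drop (Suc j) xs)) (bvec (xs[j := y]))))
     = (case g ((x # xs) ! Suc j) of None \<Rightarrow> 0
     | Some y \<Rightarrow> sc (q powi sm bf (take (Suc j) (x # xs)) * q powi sm af (drop (Suc (Suc j)) (x # xs))) (bvec ((x # xs)[Suc j := y])))" for j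
    using q by (simp add: cns_lin power_int_add mult.assoc split: option.split)
  then show ?case
    unfolding opx_bvec_Cons[OF inv] Cons cns_sum sc_sum by (simp add: sum.lessThan_Suc_shift del: sum.lessThan_Suc split: option.split)
qed

lemma opx_bvec2:
  assumes q: "q \<noteq> 0" and inv: "\<And>x y. g x = Some y \<longleftrightarrow> h y = Some x"
  shows "opx q bf af h (bvec [k1, k2]) = (case g k1 of None \<Rightarrow> 0 | Some y \<Rightarrow> sc (q powi af k2) (bvec [y, k2]))
     + (case g k2 of None \<Rightarrow> 0 | Some y \<Rightarrow> sc (q powi bf k1) (bvec [k1, y]))"
  by (subst opx_bvec[OF q inv]) (auto simp: lessThan_Suc eval_nat_numeral add.commute split: option.split)

lemma fs_opx_bvec:
  assumes q: "q \<noteq> 0" and inv: "\<And>x y. g x = Some y \<longleftrightarrow> h y = Some x"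
  shows "opx q bf af h (bvec xs) \<in> tens (length xs)"
  unfolding opx_bvec[OF q inv] by (rule tens_sum) (auto split: option.split)

lemma opx_tens:
  assumes q: "q \<noteq> 0" and inv: "\<And>x y. g x = Some y \<longleftrightarrow> h y = Some x" and "v \<in> tens n"
  shows "opx q bf af h v \<in> tens n"
  using assms(3)
proof (induction rule: tens_induct)
  case (add v c xs)
  then show ?case using fs_opx_bvec[OF q inv] by (auto simp: lnrD[OF lnr_opx] intro!: tens_add tens_sc)
qed (simp add: lnr_zero[OF lnr_opx])

lemma kop_bvec: "kop q f (bvec xs) = sc (q powi sm f xs) (bvec xs)"
  by (auto simp: fun_eq_iff kop_def fapp bvec_def)

lemma kop_tens: "v \<in> tens n \<Longrightarrow> kop q f v \<in> tens n"
proof (induction rule: tens_induct)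
  case (add v c xs)
  then show ?case by (simp add: lnrD[OF lnr_kop] kop_bvec)
qed (simp add: lnr_zero[OF lnr_kop])

lemma dop_bvec: "dop f (bvec xs) = sc (of_int (sm f xs)) (bvec xs)"
  by (auto simp: fun_eq_iff dop_def fapp bvec_def)

lemma dop_tens: "v \<in> tens n \<Longrightarrow> dop f v \<in> tens n"
proof (induction rule: tens_induct)
  case (add v c xs)
  then show ?case by (simp add: lnrD[OF lnr_dop] dop_bvec)
qed (simp add: lnr_zero[OF lnr_dop])

section \<open>The two-factor exchange operators\<close>

locale nl =
  fixes N L :: nat
  assumes N2: "2 \<le> N" and L2: "2 \<le> L"
begin

abbreviation q :: kk where "q \<equiv> qq N"
abbreviation iN :: int where "iN \<equiv> int N"
abbreviation iL :: int where "iL \<equiv> int L"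
abbreviation bar :: "int \<Rightarrow> int" where "bar \<equiv> barr N"
abbreviation dot :: "int \<Rightarrow> int" where "dot \<equiv> dott N L"
abbreviation und :: "int \<Rightarrow> int" where "und \<equiv> undr N L"
abbreviation pos :: "int \<Rightarrow> int" where "pos \<equiv> rst N L"

lemma bar_range: "1 \<le> bar k" "bar k \<le> iN"
proof -
  have "0 \<le> (k - 1) mod iN" "(k - 1) mod iN < iN" using N2 by simp_all
  then show "1 \<le> bar k" "bar k \<le> iN" by (simp_all add: barr_def)
qed

lemma pos_bar: "k = bar k - iN * pos k"
proof -
  have "(k - 1) mod iN = k - 1 - iN * ((k - 1) div iN)" by (simp add: minus_mult_div_eq_mod)
  then have "bar k - k = iN * (- ((k - 1) div iN))" by (simp add: barr_def)
  then show ?thesis by (simp add: rst_def)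
qed

lemma bar_of: "1 \<le> e \<Longrightarrow> e \<le> iN \<Longrightarrow> bar (e - iN * p) = e"
proof -
  assume e: "1 \<le> e" "e \<le> iN"
  have "e - iN * p - 1 = (e - 1) + iN * (- p)" by simp
  then have "(e - iN * p - 1) mod iN = (e - 1) mod iN" by (simp only: mod_mult_self2)
  also have "\<dots> = e - 1" using e by simp
  finally show ?thesis by (simp add: barr_def)
qed

lemma pos_of: "1 \<le> e \<Longrightarrow> e \<le> iN \<Longrightarrow> pos (e - iN * p) = p"
  using N2 by (simp add: rst_def bar_of)

lemma dot_pos: "dot k = (pos k - 1) mod iL + 1" by (simp add: dott_def)

lemma dot_range: "1 \<le> dot k" "dot k \<le> iL"
proof -
  have "0 \<le> (pos k - 1) mod iL" "(pos k - 1) mod iL < iL" using L2 by simp_all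
  then show "1 \<le> dot k" "dot k \<le> iL" by (simp_all add: dot_pos)
qed

lemma pos_dot: "pos k = dot k + iL * und k"
proof -
  have "(pos k - 1) mod iL = pos k - 1 - iL * ((pos k - 1) div iL)" by (simp add: minus_mult_div_eq_mod)
  then have "pos k - dot k = iL * ((pos k - 1) div iL)" by (simp add: dot_pos)
  then show ?thesis using L2 by (simp add: undr_def)
qed

lemma und_pos: "und k = (pos k - 1) div iL"
proof -
  have "(pos k - 1) mod iL = pos k - 1 - iL * ((pos k - 1) div iL)" by (simp add: minus_mult_div_eq_mod)
  then have "pos k - dot k = iL * ((pos k - 1) div iL)" by (simp add: dot_pos)
  then show ?thesis using L2 by (simp add: undr_def)
qed

lemma dot_und_unique: "1 \<le> a \<Longrightarrow> a \<le> iL \<Longrightarrow> pos k = a + iL * m \<Longrightarrow> dot k = a \<and> und k = m"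
proof -
  assume a: "1 \<le> a" "a \<le> iL" "pos k = a + iL * m"
  then have "pos k - 1 = (a - 1) + iL * m" by simp
  then have "(pos k - 1) mod iL = (a - 1) mod iL" "(pos k - 1) div iL = m + (a - 1) div iL"
    using L2 by (simp_all only: mod_mult_self2 div_mult_self2)
  then show ?thesis using a by (simp add: dot_pos und_pos)
qed

lemma enc_und_dot: "enc N L (und k) (dot k) e = e - iN * pos k"
  by (simp add: enc_def pos_dot)

lemma bar_enc: "1 \<le> e \<Longrightarrow> e \<le> iN \<Longrightarrow> bar (enc N L m a e) = e"
  by (simp add: enc_def bar_of)
lemma pos_enc: "1 \<le> e \<Longrightarrow> e \<le> iN \<Longrightarrow> pos (enc N L m a e) = a + iL * m"
  by (simp add: enc_def pos_of)

text \<open>\<open>bb p\<^sub>1 e\<^sub>1 p\<^sub>2 e\<^sub>2\<close> is the basis vector with colours \<open>e\<^sub>i\<close> and positions \<open>p\<^sub>i = dot + L * und\<close>.\<close>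

definition bb :: "int \<Rightarrow> int \<Rightarrow> int \<Rightarrow> int \<Rightarrow> vec" where
  "bb p1 ea p2 eb = bvec [ea - iN * p1, eb - iN * p2]"

definition col :: "int \<Rightarrow> bool" where "col e \<longleftrightarrow> 1 \<le> e \<and> e \<le> iN"

lemma col_bar [simp]: "col (bar k)" by (simp add: col_def bar_range)

lemma bvec_bb: "bvec [k1, k2] = bb (pos k1) (bar k1) (pos k2) (bar k2)"
  by (simp add: bb_def pos_bar[symmetric])

lemma bb_tens [simp]: "bb p1 ea p2 eb \<in> tens 2" by (simp add: bb_def)
lemma coords [simp]: "col e \<Longrightarrow> bar (e - iN * p) = e" "col e \<Longrightarrow> pos (e - iN * p) = p"
  by (simp_all add: col_def bar_of pos_of)

text \<open>\<open>zz i\<close> multiplies by powers of \<open>z\<^sub>i\<close>.\<close>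

definition zz1 :: "int \<Rightarrow> vec \<Rightarrow> vec" where
  "zz1 t f = (\<lambda>ys. case ys of [k1, k2] \<Rightarrow> f [k1 + t * int (N * L), k2] | _ \<Rightarrow> 0)"
definition zz2 :: "int \<Rightarrow> vec \<Rightarrow> vec" where
  "zz2 t f = (\<lambda>ys. case ys of [k1, k2] \<Rightarrow> f [k1, k2 + t * int (N * L)] | _ \<Rightarrow> 0)"

lemma mz_zz: "mz1 N L = zz1 1" "mz2 N L = zz2 1"
  by (auto simp: fun_eq_iff mz1_def mz2_def zz1_def zz2_def split: list.split)

lemma lnr_zz [simp]: "lnr (zz1 t)" "lnr (zz2 t)"
  by (auto simp: lnr_def fun_eq_iff zz1_def zz2_def fapp split: list.split)

lemma zz_bb: "zz1 t (bb p1 ea p2 eb) = bb (p1 + t * iL) ea p2 eb" "zz2 t (bb p1 ea p2 eb) = bb p1 ea (p2 + t * iL) eb"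
  by (auto simp: fun_eq_iff zz1_def zz2_def bb_def bvec_def algebra_simps split: list.split)

lemma tens2_induct [consumes 1, case_names zero add]:
  assumes "v \<in> tens 2" "P 0"
    and "\<And>v c p1 ea p2 eb. v \<in> tens 2 \<Longrightarrow> P v \<Longrightarrow> col ea \<Longrightarrow> col eb \<Longrightarrow> P (v + sc c (bb p1 ea p2 eb))"
  shows "P v"
  using assms(1)
proof (induction rule: tens_induct)
  case (add v c xs)
  then obtain k1 k2 where "xs = [k1, k2]" by (auto simp: length_Suc_conv eval_nat_numeral)
  then show ?case using assms(3)[of v "bar k1" "bar k2"] add by (simp add: bvec_bb)
qed fact

text \<open>Linearity is asked for on finitely supported vectors only, because \<open>lin\<close> is
  not additive on infinite supports.\<close>

definition lnt :: "(vec \<Rightarrow> vec) \<Rightarrow> bool" where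
  "lnt A \<longleftrightarrow> (\<forall>v\<in>tens 2. A v \<in> tens 2) \<and> (\<forall>v\<in>tens 2. \<forall>w\<in>tens 2. A (v + w) = A v + A w) \<and> (\<forall>c. \<forall>v\<in>tens 2. A (sc c v) = sc c (A v))"

lemma lntD: assumes "lnt A" "v \<in> tens 2" shows "A v \<in> tens 2" "A (sc c v) = sc c (A v)" "w \<in> tens 2 \<Longrightarrow> A (v + w) = A v + A w"
   "w \<in> tens 2 \<Longrightarrow> A (v - w) = A v - A w"
proof -
  show *: "A v \<in> tens 2" "A (sc c v) = sc c (A v)" "w \<in> tens 2 \<Longrightarrow> A (v + w) = A v + A w" for c w
    using assms by (auto simp: lnt_def)
  show "w \<in> tens 2 \<Longrightarrow> A (v - w) = A v - A w"
  proof -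
    assume w: "w \<in> tens 2"
    have "A (v + sc (-1) w) = A v + sc (-1) (A w)" using assms w by (simp add: lnt_def)
    then show ?thesis by (simp add: sc_minus_one)
  qed
qed

lemma lnt_zero: "lnt A \<Longrightarrow> A 0 = 0"
  using lntD(2)[of A 0 0] by simp

lemma lnt_eqI:
  assumes "lnt A" "lnt B" "\<And>p1 ea p2 eb. col ea \<Longrightarrow> col eb \<Longrightarrow> A (bb p1 ea p2 eb) = B (bb p1 ea p2 eb)" "v \<in> tens 2"
  shows "A v = B v"
  using assms(4)
proof (induction rule: tens2_induct)
  case (add v c p1 ea p2 eb)
  then show ?case using assms(3) by (simp add: lntD[OF assms(1)] lntD[OF assms(2)])
qed (simp add: lnt_zero assms)

lemma lntI: assumes "lnr A" "\<And>p1 ea p2 eb. col ea \<Longrightarrow> col eb \<Longrightarrow> A (bb p1 ea p2 eb) \<in> tens 2" shows "lnt A"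
proof -
  have "A v \<in> tens 2" if "v \<in> tens 2" for v using that
    by (induction rule: tens2_induct) (simp_all add: lnr_zero lnrD assms)
  then show ?thesis using assms(1) by (simp add: lnt_def lnr_def)
qed

lemma lnt_lin: assumes "\<And>k1 k2. F [k1, k2] \<in> tens 2" shows "lnt (lin F)"
proof -
  have "lin F v \<in> tens 2" if "v \<in> tens 2" for v
    unfolding lin_superset[OF tens_fs[OF that] order_refl]
  proof (rule tens_sum)
    fix xs assume "xs \<in> supp v"
    then have "length xs = 2" using that by (simp add: tens_def)
    then obtain k1 k2 where "xs = [k1, k2]" by (auto simp: length_Suc_conv eval_nat_numeral)
    then show "sc (v xs) (F xs) \<in> tens 2" using assms by simp
  qed
  then show ?thesis by (auto simp: lnt_def lin_add lin_sc tens_fs)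
qed

lemma lnt_zz [simp]: "lnt (zz1 t)" "lnt (zz2 t)"
  by (auto intro!: lntI simp: zz_bb)

lemma lnt_comp: "lnt A \<Longrightarrow> lnt B \<Longrightarrow> lnt (\<lambda>v. A (B v))"
  by (simp add: lnt_def)
lemma lnt_add: "lnt A \<Longrightarrow> lnt B \<Longrightarrow> lnt (\<lambda>v. A v + B v)"
  by (simp add: lnt_def sc_add algebra_simps)
lemma lnt_sub: "lnt A \<Longrightarrow> lnt B \<Longrightarrow> lnt (\<lambda>v. A v - B v)"
  by (simp add: lnt_def sc_diff algebra_simps)
lemma lnt_sc: "lnt A \<Longrightarrow> lnt (\<lambda>v. sc c (A v))"
  by (simp add: lnt_def sc_add mult.commute)
lemma lnt_id: "lnt (\<lambda>v. v)" by (simp add: lnt_def)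

lemma zz_zz: assumes v: "v \<in> tens 2"
  shows "zz1 s (zz1 t v) = zz1 (s + t) v" "zz2 s (zz2 t v) = zz2 (s + t) v" "zz1 s (zz2 t v) = zz2 t (zz1 s v)"
  by (rule lnt_eqI[of "\<lambda>v. zz1 s (zz1 t v)" "zz1 (s + t)", OF _ _ _ v]
        lnt_eqI[of "\<lambda>v. zz2 s (zz2 t v)" "zz2 (s + t)", OF _ _ _ v]
        lnt_eqI[of "\<lambda>v. zz1 s (zz2 t v)" "\<lambda>v. zz2 t (zz1 s v)", OF _ _ _ v];
      simp add: zz_bb algebra_simps lnt_comp)+

lemma zz_0: assumes v: "v \<in> tens 2" shows "zz1 0 v = v" "zz2 0 v = v"
  by (rule lnt_eqI[of "zz1 0" "\<lambda>v. v", OF _ _ _ v] lnt_eqI[of "zz2 0" "\<lambda>v. v", OF _ _ _ v]; simp add: zz_bb lnt_id)+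

text \<open>For the largest first index \<open>k1\<close> in the support, the equation forces an
  entry whose first index is larger by N L. This makes division by z_1 - z_2, and by q^2 z_2 - z_1,
  unique.\<close>

lemma zz_injective:
  assumes g: "g \<in> tens 2" and c: "c \<noteq> 0" and eq: "zz1 1 g = sc c (zz2 1 g)"
  shows "g = 0"
proof (rule ccontr)
  assume "g \<noteq> 0"
  let ?S = "{k1. \<exists>k2. g [k1, k2] \<noteq> 0}"
  have fin: "finite ?S"
  proof (rule finite_subset)
    show "?S \<subseteq> hd ` supp g"
    proof
      fix x assume "x \<in> ?S"
      then obtain k2 where "[x, k2] \<in> supp g" by (auto simp: supp_def)
      then show "x \<in> hd ` supp g" by (metis imageI list.sel(1))
    qed
    show "finite (hd ` supp g)" using g by (simp add: tens_def)
  qed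
  from \<open>g \<noteq> 0\<close> obtain xs where xs: "g xs \<noteq> 0" by (auto simp: fun_eq_iff fapp)
  then have "length xs = 2" using tens_length[OF g] by blast
  then obtain a b where "xs = [a, b]" by (auto simp: length_Suc_conv eval_nat_numeral)
  with xs have ne: "?S \<noteq> {}" by blast
  define k1 where "k1 = Max ?S"
  have "k1 \<in> ?S" unfolding k1_def using fin ne by (rule Max_in)
  then obtain k2 where k: "g [k1, k2] \<noteq> 0" by blast
  have "zz1 1 g [k1, k2 - int (N * L)] = sc c (zz2 1 g) [k1, k2 - int (N * L)]" using eq by simp
  then have "g [k1 + int (N * L), k2 - int (N * L)] = c * g [k1, k2]"
    by (simp add: zz1_def zz2_def fapp)
  then have "g [k1 + int (N * L), k2 - int (N * L)] \<noteq> 0" using k c by simp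
  then have "k1 + int (N * L) \<in> ?S" by blast
  then have "k1 + int (N * L) \<le> k1" unfolding k1_def using fin by (intro Max_ge)
  moreover have "0 < N * L" using N2 L2 by simp
  ultimately show False by linarith
qed

lemma zz_diff_injective:
  assumes "g \<in> tens 2" "g' \<in> tens 2" "zz1 1 g - zz2 1 g = zz1 1 g' - zz2 1 g'"
  shows "g = g'"
proof -
  have "zz1 1 (g - g') = sc 1 (zz2 1 (g - g'))"
    using assms(3) by (simp add: lnr_diff algebra_simps)
  then have "g - g' = 0" using zz_injective[of "g - g'" 1] assms by simp
  then show ?thesis by simp
qed

definition SR :: "vec \<Rightarrow> vec" where "SR f = swz N L (Rop N L f)"

text \<open>The operator s R in terms of positions instead of labels and powers of z. In both
  off-diagonal cases of R the exchange of labels takes p1, p2 to p1 + L - r, p2 + r, because the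
  factor z_1 or z_2 absorbs the wrap-around; so only the residue r of p1 - p2 matters.\<close>

definition SRb :: "int \<Rightarrow> int \<Rightarrow> int \<Rightarrow> int \<Rightarrow> vec" where
  "SRb p1 ea p2 eb = (let r = (p1 - p2) mod iL in
     if r = 0 then sc (q^2) (bb p2 ea (p1 + iL) eb) - bb (p2 + iL) ea p1 eb
     else sc q (bb p2 ea (p1 + iL) eb) - sc q (bb (p2 + iL) ea p1 eb)
       + sc (q^2 - 1) (bb (p2 + r) ea (p1 + iL - r) eb))"

lemma swz_bb: "col ea \<Longrightarrow> col eb \<Longrightarrow> swz N L (bb p1 ea p2 eb) = bb p2 ea p1 eb"
  by (simp add: swz_def bb_def enc_und_dot)

lemma lnt_swz: "lnt (swz N L)"
  unfolding swz_def by (rule lnt_lin) simp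

lemma Rb_tens: "Rb N L [k1, k2] \<in> tens 2"
proof -
  have *: "bvec [a, b] \<in> tens 2" for a b by simp
  have "zz1 1 (bvec [a, b]) \<in> tens 2" "zz2 1 (bvec [a, b]) \<in> tens 2" for a b using lntD(1)[OF lnt_zz(1) *] lntD(1)[OF lnt_zz(2) *] by blast+
  then show ?thesis by (simp add: Rb_def Let_def mz_zz)
qed

lemma lnt_Rop: "lnt (Rop N L)"
  unfolding Rop_def by (rule lnt_lin) (rule Rb_tens)

lemma lnt_SR: "lnt SR"
  unfolding SR_def[abs_def] by (rule lnt_comp[OF lnt_swz lnt_Rop])

lemma SR_bb:
  assumes e: "col ea" "col eb"
  shows "SR (bb p1 ea p2 eb) = SRb p1 ea p2 eb"
proof -
  define k1 k2 where k: "k1 = ea - iN * p1" "k2 = eb - iN * p2"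
  define a1 a2 m1 m2 where am: "a1 = dot k1" "a2 = dot k2" "m1 = und k1" "m2 = und k2"
  have d: "p1 = a1 + iL * m1" "p2 = a2 + iL * m2"
    using pos_dot[of k1] pos_dot[of k2] e by (simp_all add: k am)
  have r: "(p1 - p2) mod iL = (a1 - a2) mod iL"
  proof -
    have "p1 - p2 = (a1 - a2) + iL * (m1 - m2)" using d by (simp add: algebra_simps)
    then show ?thesis by simp
  qed
  have rng: "1 \<le> a1" "a1 \<le> iL" "1 \<le> a2" "a2 \<le> iL" unfolding am by (rule dot_range)+
  have x: "bvec [k1, k2] = bb p1 ea p2 eb" by (simp add: bb_def k)
  have y: "bvec [enc N L (und k1) (dot k2) (bar k1), enc N L (und k2) (dot k1) (bar k2)]
      = bb (a2 + iL * m1) ea (a1 + iL * m2) eb"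
    using e by (simp add: bb_def enc_def am) (simp add: k)
  have R: "Rop N L (bb p1 ea p2 eb) = (if a1 = a2 then sc (q^2) (bb (p1 + iL) ea p2 eb) - bb p1 ea (p2 + iL) eb
      else sc q (bb (p1 + iL) ea p2 eb - bb p1 ea (p2 + iL) eb)
           + sc (q^2 - 1) (if a2 < a1 then bb (a2 + iL * m1 + iL) ea (a1 + iL * m2) eb
               else bb (a2 + iL * m1) ea (a1 + iL * m2 + iL) eb))"
    unfolding x[symmetric] Rop_def lin_bvec Rb_def list.case Let_def y unfolding x mz_zz am(1,2)[symmetric] by (simp add: zz_bb)
  note sw = lntD[OF lnt_swz] swz_bb[OF e]
  consider "a1 = a2" | "a2 < a1" | "a1 < a2" by linarith
  then show ?thesis
  proof cases
    case 1
    then show ?thesis unfolding SR_def R SRb_def Let_def r by (simp add: sw)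
  next
    case 2
    then have 1: "(a1 - a2) mod iL = a1 - a2" using rng by simp
    have eq: "a1 + iL * m2 = p2 + (a1 - a2)" "a2 + iL * m1 + iL = p1 + iL - (a1 - a2)"
      using d by linarith+
    show ?thesis unfolding SR_def R SRb_def Let_def r 1 eq using 2 by (simp add: sw sc_diff)
  next
    case 3
    have "(a1 - a2) mod iL = (a1 - a2 + iL) mod iL" by simp
    also have "\<dots> = a1 - a2 + iL" using rng 3 by (intro mod_pos_pos_trivial) auto
    finally have 1: "(a1 - a2) mod iL = a1 - a2 + iL" .
    have eq: "a1 + iL * m2 + iL = p2 + (a1 - a2 + iL)" "a2 + iL * m1 = p1 + iL - (a1 - a2 + iL)"
      using d by linarith+
    have "a1 - a2 + iL \<noteq> 0" "\<not> a2 < a1" "a1 \<noteq> a2" using 3 rng by auto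
    then show ?thesis unfolding SR_def R SRb_def Let_def r 1 eq by (simp add: sw sc_diff)
  qed
qed

text \<open>The quotient by z_1 - z_2 is a finite geometric sum. The number of its terms is the
  quotient \<open>d\<close> of p1 - p2 by L; for negative \<open>d\<close> it runs the other way
  with the opposite sign.\<close>

definition TCb :: "int \<Rightarrow> int \<Rightarrow> int \<Rightarrow> int \<Rightarrow> vec" where
  "TCb p1 ea p2 eb = (let r = (p1 - p2) mod iL; d = (p1 - p2) div iL in
     sc (if r = 0 then - 1 else - q) (bb p2 ea p1 eb)
     + sc (1 - q^2) (if 0 \<le> d then (\<Sum>j<nat d. bb (p2 + r + iL * int j) ea (p1 - r - iL * int j) eb)
         else - (\<Sum>j<nat (- d). bb (p1 + iL * int j) ea (p2 - iL * int j) eb)))"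

definition TC :: "vec \<Rightarrow> vec" where
  "TC = lin (\<lambda>xs. case xs of [k1, k2] \<Rightarrow> TCb (pos k1) (bar k1) (pos k2) (bar k2) | _ \<Rightarrow> 0)"

lemma tens_uminus [simp]: "v \<in> tens n \<Longrightarrow> - v \<in> tens n"
  using tens_sc[of v n "-1"] by (simp add: sc_minus_one)

lemma TCb_tens [simp]: "TCb p1 ea p2 eb \<in> tens 2"
  by (auto simp: TCb_def Let_def intro!: tens_add tens_sc tens_uminus tens_sum)

lemma lnt_TC: "lnt TC"
  unfolding TC_def by (rule lnt_lin) simp

lemma TC_bb: "col ea \<Longrightarrow> col eb \<Longrightarrow> TC (bb p1 ea p2 eb) = TCb p1 ea p2 eb"
  by (simp add: TC_def bb_def)

lemma TCb_eq:
  "zz1 1 (TCb p1 ea p2 eb) - zz2 1 (TCb p1 ea p2 eb) = sc (1 - q^2) (bb p1 ea (p2 + iL) eb) + SRb p1 ea p2 eb"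
proof -
  define r d where "r = (p1 - p2) mod iL" and "d = (p1 - p2) div iL"
  have rd: "p1 = p2 + r + iL * d" unfolding r_def d_def using mult_div_mod_eq[of iL "p1 - p2"] by linarith
  define Z where "Z = (\<lambda>v. zz1 1 v - zz2 1 v)"
  have lZ: "lnr Z"
    unfolding lnr_def Z_def by (simp add: lnrD[OF lnr_zz(1)] lnrD[OF lnr_zz(2)] sc_diff algebra_simps)
  have tel: "Z (\<Sum>j<n. bb (a + iL * int j) ea (b - iL * int j) eb)
     = bb (a + iL * int n) ea (b + iL - iL * int n) eb - bb a ea (b + iL) eb" for a b n
  proof -
    have "Z (bb (a + iL * int j) ea (b - iL * int j) eb) = bb (a + iL * int (Suc j)) ea (b + iL - iL * int (Suc j)) eb
        - bb (a + iL * int j) ea (b + iL - iL * int j) eb" for j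
      by (simp add: Z_def zz_bb algebra_simps)
    then show ?thesis
      by (simp only: lnr_sum[OF lZ] sum_lessThan_telescope[of "\<lambda>j. bb (a + iL * int j) ea (b + iL - iL * int j) eb"]) simp
  qed
  \<comment> \<open>Both directions of the sum telescope to the same difference of two
    endpoints.\<close>
  have G: "Z (if 0 \<le> d then (\<Sum>j<nat d. bb (p2 + r + iL * int j) ea (p1 - r - iL * int j) eb)
         else - (\<Sum>j<nat (- d). bb (p1 + iL * int j) ea (p2 - iL * int j) eb))
     = bb p1 ea (p2 + iL) eb - bb (p2 + r) ea (p1 - r + iL) eb"
  proof (cases "0 \<le> d")
    case True
    have "p2 + r + iL * int (nat d) = p1" "p1 - r + iL - iL * int (nat d) = p2 + iL" using True rd by simp_all
    with True tel[of "p2 + r" "p1 - r" "nat d"] show ?thesis by (simp only: if_True)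
  next
    case False
    have "p1 + iL * int (nat (- d)) = p2 + r" "p2 + iL - iL * int (nat (- d)) = p1 - r + iL" using False rd by simp_all
    with False tel[of "p1" "p2" "nat (- d)"] show ?thesis by (simp only: if_False lnr_uminus[OF lZ] minus_diff_eq)
  qed
  have "Z (TCb p1 ea p2 eb) = sc (if r = 0 then - 1 else - q) (Z (bb p2 ea p1 eb))
     + sc (1 - q^2) (bb p1 ea (p2 + iL) eb - bb (p2 + r) ea (p1 - r + iL) eb)"
    unfolding TCb_def Let_def r_def[symmetric] d_def[symmetric] lnrD[OF lZ] G ..
  also have "Z (bb p2 ea p1 eb) = bb (p2 + iL) ea p1 eb - bb p2 ea (p1 + iL) eb"
    by (simp add: Z_def zz_bb)
  finally have F: "Z (TCb p1 ea p2 eb) = sc (if r = 0 then - 1 else - q) (bb (p2 + iL) ea p1 eb - bb p2 ea (p1 + iL) eb)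
     + sc (1 - q^2) (bb p1 ea (p2 + iL) eb - bb (p2 + r) ea (p1 + iL - r) eb)" by (simp add: algebra_simps)
  have "Z (TCb p1 ea p2 eb) = sc (1 - q^2) (bb p1 ea (p2 + iL) eb) + SRb p1 ea p2 eb"
    unfolding F SRb_def Let_def r_def[symmetric]
    by (cases "r = 0") (simp_all add: sc_diff, simp_all add: fun_eq_iff fapp, simp_all add: algebra_simps)
  then show ?thesis by (simp add: Z_def)
qed

text \<open>The exchange s turns the denominator q^2 z_1 - z_2 into q^2 z_2 - z_1, which cancels
  against the prefactor z_1 - q^2 z_2 up to sign. Hence (z_1 - z_2)(T^c + 1) = z_1 - q^2 z_2 + s R,
  and only the division by z_1 - z_2 remains.\<close>

lemma TC_eq: "v \<in> tens 2 \<Longrightarrow> zz1 1 (TC v) - zz2 1 (TC v) = sc (1 - q^2) (zz2 1 v) + SR v"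
  by (rule lnt_eqI[of "\<lambda>v. zz1 1 (TC v) - zz2 1 (TC v)" "\<lambda>v. sc (1 - q^2) (zz2 1 v) + SR v"])
    (simp_all add: lnt_sub[OF lnt_comp[OF lnt_zz(1) lnt_TC] lnt_comp[OF lnt_zz(2) lnt_TC]]
      lnt_add[OF lnt_sc[OF lnt_zz(2)] lnt_SR] TC_bb TCb_eq SR_bb zz_bb)

lemma TC_unique: "v \<in> tens 2 \<Longrightarrow> g \<in> tens 2 \<Longrightarrow> zz1 1 g - zz2 1 g = sc (1 - q^2) (zz2 1 v) + SR v \<Longrightarrow> TC v = g"
  using zz_diff_injective[of g "TC v"] TC_eq[of v] lntD(1)[OF lnt_TC, of v] by simp

end

section \<open>Agreement of the closed form with the defining one\<close>

context nl begin

lemma Tc_TC: assumes f: "f \<in> tens 2" shows "Tc N L f = TC f"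
proof -
  have z: "mA N L (g + f) = mP N L (mB N L f - swz N L (Rop N L f)) \<longleftrightarrow> zz1 1 g - zz2 1 g = sc (1 - q^2) (zz2 1 f) + SR f"
    if g: "g \<in> tens 2" for g
  proof -
    note Z = lntD[OF lnt_zz(1)[of 1]] lntD[OF lnt_zz(2)[of 1]]
    have S: "SR f \<in> tens 2" using lntD(1)[OF lnt_SR f] .
    \<comment> \<open>Both sides of the defining equation are values of the injective operator q^2
      z_2 - z_1, namely at (z_1 - z_2)(g + f) and at minus the argument of \<open>mP\<close>.
      Cancelling it leaves the equation of \<open>TC_eq\<close>.\<close>
    define B where "B = (\<lambda>h. sc (q^2) (zz2 1 h) - zz1 1 h)"
    have B: "lnt B" unfolding B_def by (rule lnt_sub[OF lnt_sc[OF lnt_zz(2)] lnt_zz(1)])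
    have mB: "mB N L = B" by (simp add: fun_eq_iff mB_def B_def mz_zz)
    have Binj: "B h = B h' \<Longrightarrow> h = h'" if "h \<in> tens 2" "h' \<in> tens 2" for h h'
    proof -
      assume "B h = B h'"
      then have "B (h - h') = 0" using lntD(4)[OF B that] by simp
      then have "zz1 1 (h - h') = sc (q^2) (zz2 1 (h - h'))" by (simp add: B_def)
      then have "h - h' = 0" using zz_injective[of "h - h'" "q^2"] that by simp
      then show ?thesis by simp
    qed
    have mA: "mA N L h = B (zz1 1 h - zz2 1 h)" if "h \<in> tens 2" for h
      using that by (simp add: mA_def mB B_def mz_zz Z lnr_diff lnrD zz_zz sc_diff)
    have mP: "mP N L h = B (- h)" if "h \<in> tens 2" for h
      by (simp add: mP_def B_def mz_zz lnr_uminus) (simp add: fun_eq_iff fapp)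
    have "mA N L (g + f) = mP N L (mB N L f - swz N L (Rop N L f)) \<longleftrightarrow>
        B (zz1 1 (g + f) - zz2 1 (g + f)) = B (- (B f - SR f))"
      using mA[of "g + f"] mP[of "B f - SR f"] g f S lntD(1)[OF B f] by (simp add: mB SR_def)
    also have "\<dots> \<longleftrightarrow> zz1 1 (g + f) - zz2 1 (g + f) = - (B f - SR f)"
      using Binj[of "zz1 1 (g + f) - zz2 1 (g + f)" "- (B f - SR f)"] g f S Z lntD(1)[OF B f] by auto
    also have "\<dots> \<longleftrightarrow> zz1 1 g - zz2 1 g = sc (1 - q^2) (zz2 1 f) + SR f"
      by (simp add: lnrD B_def fun_eq_iff fapp algebra_simps)
    finally show ?thesis .
  qed
  show ?thesis unfolding Tc_def
  proof (rule the_equality)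
    show "TC f \<in> tens 2 \<and> mA N L (TC f + f) = mP N L (mB N L f - swz N L (Rop N L f))"
      using z[of "TC f"] TC_eq[OF f] lntD(1)[OF lnt_TC f] by simp
  next
    fix g assume "g \<in> tens 2 \<and> mA N L (g + f) = mP N L (mB N L f - swz N L (Rop N L f))"
    then show "g = TC f" using z[of g] TC_unique[OF f, of g] by simp
  qed
qed

definition TS :: "vec \<Rightarrow> vec" where "TS = Ts N L"

lemma TS_bb: "col ea \<Longrightarrow> col eb \<Longrightarrow> TS (bb p1 ea p2 eb) = (if ea = eb then sc (q^2) (bb p1 ea p2 eb)
    else if ea < eb then sc q (bb p1 eb p2 ea) else sc q (bb p1 eb p2 ea) + sc (q^2 - 1) (bb p1 ea p2 eb))"
  by (simp add: TS_def Ts_def bb_def Tsb_def Let_def enc_und_dot)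

lemma lnt_TS: "lnt TS"
  unfolding TS_def Ts_def by (rule lnt_lin) (simp add: Tsb_def Let_def)

definition W2 :: "vec set" where "W2 = (\<lambda>f. TC f - TS f) ` tens 2"

lemma W2_tens: "w \<in> W2 \<Longrightarrow> w \<in> tens 2"
  by (auto simp: W2_def intro!: tens_diff lntD(1)[OF lnt_TC] lntD(1)[OF lnt_TS])

lemma W2_add: "w \<in> W2 \<Longrightarrow> w' \<in> W2 \<Longrightarrow> w + w' \<in> W2"
proof -
  assume "w \<in> W2" "w' \<in> W2"
  then obtain f f' where f: "f \<in> tens 2" "f' \<in> tens 2" "w = TC f - TS f" "w' = TC f' - TS f'"
    by (auto simp: W2_def)
  then have "w + w' = TC (f + f') - TS (f + f')"
    by (simp add: lntD[OF lnt_TC] lntD[OF lnt_TS])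
  then show ?thesis using f by (auto simp: W2_def)
qed

lemma W2_sc: "w \<in> W2 \<Longrightarrow> sc c w \<in> W2"
proof -
  assume "w \<in> W2"
  then obtain f where f: "f \<in> tens 2" "w = TC f - TS f" by (auto simp: W2_def)
  then have "sc c w = TC (sc c f) - TS (sc c f)"
    by (simp add: lntD[OF lnt_TC] lntD[OF lnt_TS] sc_diff)
  then show ?thesis using f by (auto simp: W2_def)
qed

subsection \<open>Commutation with the exchange operators\<close>

text \<open>\<open>X (TC f)\<close> solves the division problem posed by \<open>X f\<close>, and the
  quotient is unique.\<close>

lemma TC_commute:
  assumes X: "lnt X" and f: "f \<in> tens 2"
    and z: "\<And>v. v \<in> tens 2 \<Longrightarrow> X (zz1 1 v) = zz1 1 (X v)" "\<And>v. v \<in> tens 2 \<Longrightarrow> X (zz2 1 v) = zz2 1 (X v)"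
    and SR: "X (SR f) = SR (X f)"
  shows "TC (X f) = X (TC f)"
proof (rule TC_unique)
  note T = lntD(1)[OF lnt_TC f] and Z = lntD(1)[OF lnt_zz(1)[of 1]] lntD(1)[OF lnt_zz(2)[of 1]]
  show "X f \<in> tens 2" "X (TC f) \<in> tens 2" using lntD(1)[OF X] f T by blast+
  have "zz1 1 (X (TC f)) - zz2 1 (X (TC f)) = X (zz1 1 (TC f) - zz2 1 (TC f))"
    using T Z by (simp add: lntD[OF X] z)
  also have "\<dots> = X (sc (1 - q^2) (zz2 1 f) + SR f)" by (simp add: TC_eq f)
  also have "\<dots> = sc (1 - q^2) (zz2 1 (X f)) + SR (X f)"
    using f Z lntD(1)[OF lnt_SR f] by (simp add: lntD[OF X] z SR)
  finally show "zz1 1 (X (TC f)) - zz2 1 (X (TC f)) = sc (1 - q^2) (zz2 1 (X f)) + SR (X f)" .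
qed

lemma SR_zz: assumes f: "f \<in> tens 2"
  shows "SR (zz1 1 f) = zz2 1 (SR f)" "SR (zz2 1 f) = zz1 1 (SR f)"
proof -
  have r: "(p1 + iL - p2) mod iL = (p1 - p2) mod iL" "(p1 - (p2 + iL)) mod iL = (p1 - p2) mod iL" for p1 p2
  proof -
    have "p1 + iL - p2 = (p1 - p2) + iL" "p1 - (p2 + iL) = (p1 - p2) - iL" by simp_all
    then show "(p1 + iL - p2) mod iL = (p1 - p2) mod iL" "(p1 - (p2 + iL)) mod iL = (p1 - p2) mod iL"
      by (simp_all only: mod_add_self2 minus_mod_self2)
  qed
  show "SR (zz1 1 f) = zz2 1 (SR f)"
    by (rule lnt_eqI[of "\<lambda>f. SR (zz1 1 f)" "\<lambda>f. zz2 1 (SR f)", OF _ _ _ f])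
      (auto simp: lnt_comp lnt_SR SR_bb zz_bb SRb_def Let_def r lnrD lnr_diff algebra_simps)
  show "SR (zz2 1 f) = zz1 1 (SR f)"
    by (rule lnt_eqI[of "\<lambda>f. SR (zz2 1 f)" "\<lambda>f. zz1 1 (SR f)", OF _ _ _ f])
      (auto simp: lnt_comp lnt_SR SR_bb zz_bb SRb_def Let_def r lnrD lnr_diff algebra_simps)
qed

text \<open>The cross relations of the affine Hecke algebra between its finite generator and z_1,
  z_2, again by uniqueness of the quotient. They are needed for E_0, whose action involves z; the
  version with inverse powers serves F_0.\<close>

lemma TC_zz: assumes f: "f \<in> tens 2"
  shows "zz2 1 (TC f) = TC (zz1 1 f) - sc (1 - q^2) (zz2 1 f)"
    "zz1 1 (TC f) = TC (zz2 1 f) + sc (1 - q^2) (zz2 1 f)"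
proof -
  note T = lntD(1)[OF lnt_TC f] and Z = lntD(1)[OF lnt_zz(1)[of 1]] lntD(1)[OF lnt_zz(2)[of 1]]
  have l: "lnr (zz1 1)" "lnr (zz2 1)" by simp_all
  have "TC (zz1 1 f) = zz2 1 (TC f) + sc (1 - q^2) (zz2 1 f)"
  proof (rule TC_unique)
    show "zz1 1 f \<in> tens 2" "zz2 1 (TC f) + sc (1 - q^2) (zz2 1 f) \<in> tens 2" using f T Z by simp_all
    have "zz1 1 (zz2 1 (TC f)) - zz2 1 (zz2 1 (TC f)) = zz2 1 (sc (1 - q^2) (zz2 1 f) + SR f)"
      using TC_eq[OF f, symmetric] T by (simp add: lnr_diff zz_zz)
    then show "zz1 1 (zz2 1 (TC f) + sc (1 - q\<^sup>2) (zz2 1 f)) - zz2 1 (zz2 1 (TC f) + sc (1 - q\<^sup>2) (zz2 1 f)) =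
      sc (1 - q\<^sup>2) (zz2 1 (zz1 1 f)) + SR (zz1 1 f)"
      using f by (simp add: lnrD SR_zz zz_zz) (simp add: fun_eq_iff fapp algebra_simps)
  qed
  then show "zz2 1 (TC f) = TC (zz1 1 f) - sc (1 - q^2) (zz2 1 f)" by simp
  have "TC (zz2 1 f) = zz1 1 (TC f) - sc (1 - q^2) (zz2 1 f)"
  proof (rule TC_unique)
    show "zz2 1 f \<in> tens 2" "zz1 1 (TC f) - sc (1 - q^2) (zz2 1 f) \<in> tens 2" using f T Z by simp_all
    have "zz1 1 (zz1 1 (TC f)) - zz1 1 (zz2 1 (TC f)) = zz1 1 (sc (1 - q^2) (zz2 1 f) + SR f)"
      using TC_eq[OF f, symmetric] T by (simp add: lnr_diff)
    then show "zz1 1 (zz1 1 (TC f) - sc (1 - q\<^sup>2) (zz2 1 f)) - zz2 1 (zz1 1 (TC f) - sc (1 - q\<^sup>2) (zz2 1 f)) =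
      sc (1 - q\<^sup>2) (zz2 1 (zz2 1 f)) + SR (zz2 1 f)"
      using f T by (simp add: lnrD lnr_diff SR_zz zz_zz) (simp add: fun_eq_iff fapp algebra_simps)
  qed
  then show "zz1 1 (TC f) = TC (zz2 1 f) + sc (1 - q^2) (zz2 1 f)" by simp
qed

lemma TC_zz_inverse: assumes f: "f \<in> tens 2"
  shows "zz2 (-1) (TC f) = TC (zz1 (-1) f) + sc (1 - q^2) (zz1 (-1) f)"
    "zz1 (-1) (TC f) = TC (zz2 (-1) f) - sc (1 - q^2) (zz1 (-1) f)"
proof -
  let ?g = "zz1 (-1) f" and ?h = "zz2 (-1) f"
  have g: "?g \<in> tens 2" "?h \<in> tens 2" using lntD(1)[OF lnt_zz(1) f] lntD(1)[OF lnt_zz(2) f] by blast+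
  have fg: "zz1 1 ?g = f" "zz2 1 ?h = f" using f by (simp_all add: zz_zz zz_0)
  have T: "TC ?g \<in> tens 2" "TC ?h \<in> tens 2" using lntD(1)[OF lnt_TC] g by blast+
  have "zz2 (-1) (zz2 1 (TC ?g)) = zz2 (-1) (TC f - sc (1 - q^2) (zz2 1 ?g))" using TC_zz(1)[OF g(1)] fg by simp
  then show "zz2 (-1) (TC f) = TC ?g + sc (1 - q^2) ?g"
    using T g by (simp add: zz_zz zz_0 lnr_diff lnrD)
  have "zz1 (-1) (zz1 1 (TC ?h)) = zz1 (-1) (TC f + sc (1 - q^2) f)" using TC_zz(2)[OF g(2)] fg by simp
  then show "zz1 (-1) (TC f) = TC ?h - sc (1 - q^2) ?g"
    using T g by (simp add: zz_zz zz_0 lnr_diff lnrD)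
qed

text \<open>The colour part of a generator in one of the two factors, with the power of z stripped
  off. What is left does not touch positions and therefore commutes with T^c. The weight
  \<open>w\<close> of the other colour supplies the q-power of the coproduct.\<close>

definition colA :: "(int \<Rightarrow> int) \<Rightarrow> (int \<Rightarrow> int option) \<Rightarrow> vec \<Rightarrow> vec" where
  "colA w g = lin (\<lambda>xs. case xs of [k1, k2] \<Rightarrow> (case g (bar k1) of None \<Rightarrow> 0
     | Some e \<Rightarrow> sc (q powi w (bar k2)) (bb (pos k1) e (pos k2) (bar k2))) | _ \<Rightarrow> 0)"
definition colB :: "(int \<Rightarrow> int) \<Rightarrow> (int \<Rightarrow> int option) \<Rightarrow> vec \<Rightarrow> vec" where
  "colB w g = lin (\<lambda>xs. case xs of [k1, k2] \<Rightarrow> (case g (bar k2) of None \<Rightarrow> 0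
     | Some e \<Rightarrow> sc (q powi w (bar k1)) (bb (pos k1) (bar k1) (pos k2) e)) | _ \<Rightarrow> 0)"

lemma colA_bb: "col ea \<Longrightarrow> col eb \<Longrightarrow> colA w g (bb p1 ea p2 eb) =
    (case g ea of None \<Rightarrow> 0 | Some e \<Rightarrow> sc (q powi w eb) (bb p1 e p2 eb))"
  by (cases "g ea") (simp_all add: colA_def bb_def)
lemma colB_bb: "col ea \<Longrightarrow> col eb \<Longrightarrow> colB w g (bb p1 ea p2 eb) =
    (case g eb of None \<Rightarrow> 0 | Some e \<Rightarrow> sc (q powi w ea) (bb p1 ea p2 e))"
  by (cases "g eb") (simp_all add: colB_def bb_def)

lemma lnt_col: "lnt (colA w g)" "lnt (colB w g)"
  unfolding colA_def colB_def by (rule lnt_lin; simp split: option.split)+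

lemma col_zz:
  assumes v: "v \<in> tens 2" and g: "\<And>e e'. col e \<Longrightarrow> g e = Some e' \<Longrightarrow> col e'"
  shows "colA w g (zz1 t v) = zz1 t (colA w g v)" "colA w g (zz2 t v) = zz2 t (colA w g v)"
    "colB w g (zz1 t v) = zz1 t (colB w g v)" "colB w g (zz2 t v) = zz2 t (colB w g v)"
  by (rule lnt_eqI[of "\<lambda>v. colA w g (zz1 t v)" "\<lambda>v. zz1 t (colA w g v)", OF _ _ _ v]
        lnt_eqI[of "\<lambda>v. colA w g (zz2 t v)" "\<lambda>v. zz2 t (colA w g v)", OF _ _ _ v]
        lnt_eqI[of "\<lambda>v. colB w g (zz1 t v)" "\<lambda>v. zz1 t (colB w g v)", OF _ _ _ v]
        lnt_eqI[of "\<lambda>v. colB w g (zz2 t v)" "\<lambda>v. zz2 t (colB w g v)", OF _ _ _ v];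
      simp add: zz_bb colA_bb colB_bb lnrD lnr_zero lnt_comp lnt_col split: option.split)+

lemma SRb_eq: "SRb p1 ea p2 eb = sc (if (p1 - p2) mod iL = 0 then q^2 else q) (bb p2 ea (p1 + iL) eb)
    + sc (if (p1 - p2) mod iL = 0 then - 1 else - q) (bb (p2 + iL) ea p1 eb)
    + sc (if (p1 - p2) mod iL = 0 then 0 else q^2 - 1) (bb (p2 + (p1 - p2) mod iL) ea (p1 + iL - (p1 - p2) mod iL) eb)"
  by (auto simp: SRb_def Let_def fun_eq_iff fapp algebra_simps)

lemma col_SR:
  assumes v: "v \<in> tens 2" and g: "\<And>e e'. col e \<Longrightarrow> g e = Some e' \<Longrightarrow> col e'"
  shows "colA w g (SR v) = SR (colA w g v)" "colB w g (SR v) = SR (colB w g v)"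
proof -
  show "colA w g (SR v) = SR (colA w g v)"
  proof (rule lnt_eqI[of "\<lambda>v. colA w g (SR v)" "\<lambda>v. SR (colA w g v)", OF _ _ _ v])
    fix p1 ea p2 eb assume "col ea" "col eb"
    then show "colA w g (SR (bb p1 ea p2 eb)) = SR (colA w g (bb p1 ea p2 eb))"
      by (cases "g ea") (simp_all add: SR_bb colA_bb SRb_eq lntD[OF lnt_col(1)] lntD[OF lnt_SR] g lnt_zero[OF lnt_SR] sc_add mult.commute)
  qed (simp_all add: lnt_comp lnt_col lnt_SR)
  show "colB w g (SR v) = SR (colB w g v)"
  proof (rule lnt_eqI[of "\<lambda>v. colB w g (SR v)" "\<lambda>v. SR (colB w g v)", OF _ _ _ v])
    fix p1 ea p2 eb assume "col ea" "col eb"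
    then show "colB w g (SR (bb p1 ea p2 eb)) = SR (colB w g (bb p1 ea p2 eb))"
      by (cases "g eb") (simp_all add: SR_bb colB_bb SRb_eq lntD[OF lnt_col(2)] lntD[OF lnt_SR] g lnt_zero[OF lnt_SR] sc_add mult.commute)
  qed (simp_all add: lnt_comp lnt_col lnt_SR)
qed

lemma col_TC:
  assumes v: "v \<in> tens 2" and g: "\<And>e e'. col e \<Longrightarrow> g e = Some e' \<Longrightarrow> col e'"
  shows "TC (colA w g v) = colA w g (TC v)" "TC (colB w g v) = colB w g (TC v)"
proof -
  have A: "colA w g (zz1 1 v) = zz1 1 (colA w g v)" "colA w g (zz2 1 v) = zz2 1 (colA w g v)"
    "colB w g (zz1 1 v) = zz1 1 (colB w g v)" "colB w g (zz2 1 v) = zz2 1 (colB w g v)" if "v \<in> tens 2" for v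
    using col_zz[OF that, of g] g by blast+
  have B: "colA w g (SR v) = SR (colA w g v)" "colB w g (SR v) = SR (colB w g v)"
    using col_SR[OF v, of g] g by blast+
  show "TC (colA w g v) = colA w g (TC v)" by (rule TC_commute[OF lnt_col(1) v A(1,2) B(1)])
  show "TC (colB w g v) = colB w g (TC v)" by (rule TC_commute[OF lnt_col(2) v A(3,4) B(2)])
qed

lemma TS_zz: assumes v: "v \<in> tens 2" shows "TS (zz1 t v) = zz1 t (TS v)" "TS (zz2 t v) = zz2 t (TS v)"
  by (rule lnt_eqI[of "\<lambda>v. TS (zz1 t v)" "\<lambda>v. zz1 t (TS v)", OF _ _ _ v]
        lnt_eqI[of "\<lambda>v. TS (zz2 t v)" "\<lambda>v. zz2 t (TS v)", OF _ _ _ v];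
      simp add: zz_bb TS_bb lnrD lnt_comp lnt_TS)+

end

section \<open>The generators in terms of colours and positions\<close>

context nl begin

lemma cgr_col: "col e \<Longrightarrow> 1 \<le> i \<Longrightarrow> i \<le> iN \<Longrightarrow> cgr N e i \<longleftrightarrow> e = i"
proof
  assume e: "col e" "1 \<le> i" "i \<le> iN" and "cgr N e i"
  then have "iN dvd e - i" by (simp add: cgr_def dvd_eq_mod_eq_0)
  moreover have "\<bar>e - i\<bar> < iN" using e by (auto simp: col_def)
  ultimately show "e = i" using dvd_imp_le_int[of "e - i" iN] by fastforce
qed (simp add: cgr_def)

definition ci :: "int \<Rightarrow> int" where "ci i = (if i = 0 then iN else i)"

lemma cgr_ci: "col e \<Longrightarrow> 0 \<le> i \<Longrightarrow> i < iN \<Longrightarrow> cgr N e i \<longleftrightarrow> e = ci i"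
proof -
  assume e: "col e" "0 \<le> i" "i < iN"
  have "cgr N e 0 \<longleftrightarrow> cgr N e iN" by (simp add: cgr_def)
  then show ?thesis using cgr_col[OF e(1), of iN] cgr_col[OF e(1), of i] e N2 by (auto simp: ci_def)
qed

lemma nrm_ci: "0 \<le> i \<Longrightarrow> i < iN \<Longrightarrow> nrm N (i + 1 - 1) = ci i" "0 \<le> i \<Longrightarrow> i < iN \<Longrightarrow> nrm N (ci i + 1) = i + 1"
proof -
  assume i: "0 \<le> i" "i < iN"
  have "(i - 1) mod iN = (if i = 0 then iN - 1 else i - 1)"
    using i zmod_minus1[of iN] N2 by auto
  then show "nrm N (i + 1 - 1) = ci i" by (auto simp: nrm_def ci_def)
  show "nrm N (ci i + 1) = i + 1" using i by (auto simp: nrm_def ci_def)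
qed

definition ce :: "int \<Rightarrow> int \<Rightarrow> int option" where "ce i e = (if e = i + 1 then Some (ci i) else None)"
definition cf :: "int \<Rightarrow> int \<Rightarrow> int option" where "cf i e = (if e = ci i then Some (i + 1) else None)"
definition kc :: "int \<Rightarrow> int \<Rightarrow> int" where "kc i e = dl (e = ci i) - dl (e = i + 1)"

lemma col_ci: "0 \<le> i \<Longrightarrow> i < iN \<Longrightarrow> col (ci i)" "0 \<le> i \<Longrightarrow> i < iN \<Longrightarrow> col (i + 1)"
  using N2 by (auto simp: ci_def col_def)

lemma e1_eq: "0 \<le> i \<Longrightarrow> i < iN \<Longrightarrow> e1 N L i k = (if bar k = i + 1 then Some (ci i - iN * (pos k + iL * dl (i = 0))) else None)"
  using cgr_col[OF col_bar, of "i + 1" k] nrm_ci(1)[of i] by (simp add: e1_def enc_def pos_dot algebra_simps)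

lemma f1_eq: "0 \<le> i \<Longrightarrow> i < iN \<Longrightarrow> f1 N L i k = (if bar k = ci i then Some (i + 1 - iN * (pos k - iL * dl (i = 0))) else None)"
  using cgr_ci[OF col_bar, of i k] nrm_ci(2)[of i] by (simp add: f1_def enc_def pos_dot algebra_simps)

lemma kexp_eq: "0 \<le> i \<Longrightarrow> i < iN \<Longrightarrow> kexp N i k = kc i (bar k)"
  using cgr_col[OF col_bar, of "i + 1" k] cgr_ci[OF col_bar, of i k] by (simp add: kexp_def kc_def)

lemma e1_f1: assumes i: "0 \<le> i" "i < iN" shows "e1 N L i x = Some y \<longleftrightarrow> f1 N L i y = Some x"
proof -
  have x: "x = bar x - iN * pos x" and y: "y = bar y - iN * pos y" by (rule pos_bar)+
  show ?thesis
  proof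
    assume "e1 N L i x = Some y"
    then have *: "bar x = i + 1" "y = ci i - iN * (pos x + iL * dl (i = 0))" by (auto simp: e1_eq[OF i] split: if_splits)
    then have "bar y = ci i" "pos y = pos x + iL * dl (i = 0)" using col_ci[OF i] by simp_all
    then show "f1 N L i y = Some x" using * x by (simp add: f1_eq[OF i])
  next
    assume "f1 N L i y = Some x"
    then have *: "bar y = ci i" "x = i + 1 - iN * (pos y - iL * dl (i = 0))" by (auto simp: f1_eq[OF i] split: if_splits)
    then have "bar x = i + 1" "pos x = pos y - iL * dl (i = 0)" using coords[OF col_ci(2)[OF i]] by simp_all
    then show "e1 N L i x = Some y" using * y by (simp add: e1_eq[OF i])
  qed
qed

lemma pos_cgr: "cgr L (dot k) x \<longleftrightarrow> (pos k - x) mod iL = 0"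
proof -
  have "pos k - x = (dot k - x) + iL * und k" by (simp add: pos_dot)
  then have "(pos k - x) mod iL = (dot k - x) mod iL" by (simp only: mod_mult_self2)
  then show ?thesis by (simp add: cgr_def)
qed

definition zl :: "int \<Rightarrow> bool" where "zl x \<longleftrightarrow> x mod iL = 0"

lemma pos_L: "(pos k - (iL - a)) mod iL = (pos k + a) mod iL" "(pos k - (iL - a + 1)) mod iL = (pos k + a - 1) mod iL"
proof -
  have *: "pos k - (iL - a) = (pos k + a) - iL" "pos k - (iL - a + 1) = (pos k + a - 1) - iL" by simp_all
  show "(pos k - (iL - a)) mod iL = (pos k + a) mod iL" "(pos k - (iL - a + 1)) mod iL = (pos k + a - 1) mod iL"
    unfolding * by (rule minus_mod_self2)+
qed

lemma mod_range_0: "x mod iL = 0 \<Longrightarrow> - iL < x \<Longrightarrow> x < iL \<Longrightarrow> x = 0"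
proof -
  assume x: "x mod iL = 0" "- iL < x" "x < iL"
  show "x = 0"
  proof (cases "0 \<le> x")
    case True then show ?thesis using x by simp
  next
    case False
    have "x mod iL = (x + iL) mod iL" by simp
    also have "\<dots> = x + iL" using x False by (intro mod_pos_pos_trivial) auto
    finally show ?thesis using x by simp
  qed
qed

text \<open>Raising the label, with a factor z when it wraps around, is the uniform step from
  position p to p + 1, that is from index k to k - N.\<close>

lemma ed1_eq: assumes a: "0 \<le> a" "a < iL"
  shows "ed1 N L a k = (if zl (pos k + a) then Some (k - iN) else None)"
proof (cases "zl (pos k + a)")
  case True
  then have "(dot k - (iL - a)) mod iL = 0" using pos_cgr[of k "iL - a"] pos_L(1)[of k a] by (simp add: zl_def cgr_def)
  moreover have "- iL < dot k - (iL - a)" "dot k - (iL - a) < iL" using dot_range[of k] a by linarith+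
  ultimately have "dot k - (iL - a) = 0" by (rule mod_range_0)
  then have d: "dot k = iL - a" by simp
  have "enc N L (und k + dl (a = 0)) (nrm L (dot k + 1)) (bar k) = bar k - iN * (pos k + 1)"
    using a d L2 by (auto simp: enc_def nrm_def pos_dot dl_def algebra_simps)
  also have "\<dots> = k - iN" using pos_bar[of k] by (simp add: algebra_simps)
  finally show ?thesis using True pos_cgr[of k "iL - a"] pos_L(1)[of k a] by (simp add: ed1_def zl_def)
next
  case False
  then show ?thesis using pos_cgr[of k "iL - a"] pos_L(1)[of k a] by (simp add: ed1_def zl_def)
qed

lemma fd1_eq: assumes a: "0 \<le> a" "a < iL"
  shows "fd1 N L a k = (if zl (pos k + a - 1) then Some (k + iN) else None)"
proof (cases "zl (pos k + a - 1)")
  case True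
  then have "(dot k - (iL - a + 1)) mod iL = 0" using pos_cgr[of k "iL - a + 1"] pos_L(2)[of k a] by (simp add: zl_def cgr_def)
  moreover have "dot k - (iL - a + 1) + iL = dot k - (1 - a)" by simp
  then have "(dot k - (1 - a)) mod iL = (dot k - (iL - a + 1)) mod iL" by (metis mod_add_self2)
  ultimately have *: "(dot k - (iL - a + 1)) mod iL = 0" "(dot k - (1 - a)) mod iL = 0" by simp_all
  have d: "dot k = (if a = 0 then 1 else iL - a + 1)"
  proof (cases "a = 0")
    case True
    then show ?thesis using mod_range_0[OF *(2)] dot_range[of k] L2 by simp
  next
    case False
    then show ?thesis using mod_range_0[OF *(1)] dot_range[of k] a L2 by simp
  qed
  have "nrm L (dot k - 1) + iL * (und k - dl (a = 0)) = pos k - 1"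
  proof (cases "a = 0")
    case True
    have "(- 1) mod iL = iL - 1" using zmod_minus1[of iL] L2 by simp
    then show ?thesis using True d by (simp add: nrm_def pos_dot dl_def algebra_simps)
  next
    case False
    then have "(dot k - 1 - 1) mod iL = dot k - 1 - 1" using d a by (intro mod_pos_pos_trivial) auto
    then show ?thesis using False by (simp add: nrm_def pos_dot dl_def)
  qed
  then have "enc N L (und k - dl (a = 0)) (nrm L (dot k - 1)) (bar k) = bar k - iN * (pos k - 1)"
    by (simp add: enc_def)
  also have "\<dots> = k + iN" using pos_bar[of k] by (simp add: algebra_simps)
  finally show ?thesis using True pos_cgr[of k "iL - a + 1"] pos_L(2)[of k a] by (simp add: fd1_def zl_def)
next
  case False
  then show ?thesis using pos_cgr[of k "iL - a + 1"] pos_L(2)[of k a] by (simp add: fd1_def zl_def)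
qed

lemma kdexp_eq: "kdexp N L a k = dl (zl (pos k + a - 1)) - dl (zl (pos k + a))"
  using pos_cgr[of k "iL - a + 1"] pos_cgr[of k "iL - a"] pos_L[of k a] by (simp add: kdexp_def zl_def)

lemma pos_shift: "pos (k - iN) = pos k + 1" "pos (k + iN) = pos k - 1" "bar (k - iN) = bar k" "bar (k + iN) = bar k"
proof -
  have k: "k = bar k - iN * pos k" by (rule pos_bar)
  have "k - iN = bar k - iN * (pos k + 1)" "k + iN = bar k - iN * (pos k - 1)" using k by (simp_all add: algebra_simps)
  then show "pos (k - iN) = pos k + 1" "pos (k + iN) = pos k - 1" "bar (k - iN) = bar k" "bar (k + iN) = bar k"
    by (simp_all only: coords[OF col_bar])
qed

lemma ed1_fd1: assumes a: "0 \<le> a" "a < iL" shows "ed1 N L a x = Some y \<longleftrightarrow> fd1 N L a y = Some x"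
proof -
  have "zl (pos (k - iN) + a - 1) = zl (pos k + a)" "zl (pos (k + iN) + a) = zl (pos k + a - 1)" for k
    by (simp_all add: pos_shift algebra_simps)
  then show ?thesis by (auto simp: ed1_eq[OF a] fd1_eq[OF a] split: if_splits)
qed

subsection \<open>Invariance of the two-factor relations\<close>

text \<open>For i > 0 this is the commutation of the Hecke generator with the finite quantum group.
  The cases are the places of the two colours relative to i and i + 1, which decide the branch of
  T^s before and after the colour change.\<close>

lemma TS_ce:
  fixes p1 p2 :: int
  assumes i: "0 < i" "i < iN" and c: "col ea" "col eb"
  defines "b \<equiv> bb p1 ea p2 eb"
  shows "TS (colA (kc i) (ce i) b + colB (\<lambda>_. 0) (ce i) b) = colA (kc i) (ce i) (TS b) + colB (\<lambda>_. 0) (ce i) (TS b)"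
proof -
  have ci: "ci i = i" using i by (simp add: ci_def)
  have col: "col i" "col (i + 1)" using i by (auto simp: col_def)
  note S = b_def TS_bb colA_bb colB_bb c col ce_def kc_def dl_def ci lntD[OF lnt_TS] lntD[OF lnt_col(1)] lntD[OF lnt_col(2)] lnt_zero[OF lnt_TS] lnt_zero[OF lnt_col(1)] lnt_zero[OF lnt_col(2)]
  consider "ea = i + 1" "eb = i + 1" | "ea = i + 1" "eb = i" | "ea = i" "eb = i + 1" | "ea = i + 1" "eb < i" | "ea = i + 1" "eb > i + 1"
    | "eb = i + 1" "ea < i" | "eb = i + 1" "ea > i + 1" | "ea \<noteq> i + 1" "eb \<noteq> i + 1" by linarith
  then show ?thesis
    by cases (auto simp: S, auto simp: fun_eq_iff fapp power_int_minus field_simps power2_eq_square)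
qed

lemma TS_cf:
  fixes p1 p2 :: int
  assumes i: "0 < i" "i < iN" and c: "col ea" "col eb"
  defines "b \<equiv> bb p1 ea p2 eb"
  shows "TS (colA (\<lambda>_. 0) (cf i) b + colB (\<lambda>e. - kc i e) (cf i) b) = colA (\<lambda>_. 0) (cf i) (TS b) + colB (\<lambda>e. - kc i e) (cf i) (TS b)"
proof -
  have ci: "ci i = i" using i by (simp add: ci_def)
  have col: "col i" "col (i + 1)" using i by (auto simp: col_def)
  note S = b_def TS_bb colA_bb colB_bb c col cf_def kc_def dl_def ci lntD[OF lnt_TS] lntD[OF lnt_col(1)] lntD[OF lnt_col(2)] lnt_zero[OF lnt_TS] lnt_zero[OF lnt_col(1)] lnt_zero[OF lnt_col(2)]
  consider "ea = i" "eb = i" | "ea = i + 1" "eb = i" | "ea = i" "eb = i + 1" | "ea = i" "eb < i" | "ea = i" "eb > i + 1"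
    | "eb = i" "ea < i" | "eb = i" "ea > i + 1" | "ea \<noteq> i" "eb \<noteq> i" by linarith
  then show ?thesis
    by cases (auto simp: S, auto simp: fun_eq_iff fapp power_int_minus field_simps power2_eq_square)
qed

text \<open>E_0 takes colour 1 to colour N, against the order that enters T^s, so T^s does not
  commute with A + B. It interchanges the two summands up to a term with 1 - q^2: the counterpart
  for colours of the cross relations between T^c and z_1, z_2.\<close>

lemma TS_ce0:
  fixes p1 p2 :: int
  assumes c: "col ea" "col eb"
  defines "b \<equiv> bb p1 ea p2 eb" and "A \<equiv> colA (kc 0) (ce 0)" and "B \<equiv> colB (\<lambda>_. 0) (ce 0)"
  shows "TS (B b) = A (TS b)" "TS (A b) + sc (1 - q^2) (A b - B b) = B (TS b)"
proof -
  have col: "col iN" "col 1" "Suc 0 < N" "N \<noteq> Suc 0" "N \<noteq> 0" using N2 by (auto simp: col_def)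
  have r: "1 \<le> ea" "ea \<le> iN" "1 \<le> eb" "eb \<le> iN" using c by (auto simp: col_def)
  note S = b_def A_def B_def TS_bb colA_bb colB_bb c col ce_def kc_def dl_def ci_def lntD[OF lnt_TS] lntD[OF lnt_col(1)] lntD[OF lnt_col(2)] lnt_zero[OF lnt_TS] lnt_zero[OF lnt_col(1)] lnt_zero[OF lnt_col(2)]
  consider "ea = 1" "eb = 1" | "ea = 1" "eb = iN" | "ea = iN" "eb = 1" | "ea = 1" "1 < eb" "eb < iN"
    | "eb = 1" "1 < ea" "ea < iN" | "ea \<noteq> 1" "eb \<noteq> 1" using r by linarith
  then show "TS (B b) = A (TS b)"
    by cases (auto simp: S, (auto simp: fun_eq_iff fapp power_int_minus field_simps power2_eq_square)?)
  consider "ea = 1" "eb = 1" | "ea = 1" "eb = iN" | "ea = iN" "eb = 1" | "ea = 1" "1 < eb" "eb < iN"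
    | "eb = 1" "1 < ea" "ea < iN" | "ea \<noteq> 1" "eb \<noteq> 1" using r by linarith
  then show "TS (A b) + sc (1 - q^2) (A b - B b) = B (TS b)"
    by cases (auto simp: S, (auto simp: fun_eq_iff fapp power_int_minus field_simps power2_eq_square)?)
qed

lemma TS_cf0:
  fixes p1 p2 :: int
  assumes c: "col ea" "col eb"
  defines "b \<equiv> bb p1 ea p2 eb" and "A \<equiv> colA (\<lambda>_. 0) (cf 0)" and "B \<equiv> colB (\<lambda>e. - kc 0 e) (cf 0)"
  shows "TS (A b) = B (TS b)" "TS (B b) + sc (1 - q^2) (B b - A b) = A (TS b)"
proof -
  have col: "col iN" "col 1" "Suc 0 < N" "N \<noteq> Suc 0" "N \<noteq> 0" using N2 by (auto simp: col_def)
  have r: "1 \<le> ea" "ea \<le> iN" "1 \<le> eb" "eb \<le> iN" using c by (auto simp: col_def)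
  note S = b_def A_def B_def TS_bb colA_bb colB_bb c col cf_def kc_def dl_def ci_def lntD[OF lnt_TS] lntD[OF lnt_col(1)] lntD[OF lnt_col(2)] lnt_zero[OF lnt_TS] lnt_zero[OF lnt_col(1)] lnt_zero[OF lnt_col(2)]
  consider "ea = iN" "eb = iN" | "ea = 1" "eb = iN" | "ea = iN" "eb = 1" | "ea = iN" "1 < eb" "eb < iN"
    | "eb = iN" "1 < ea" "ea < iN" | "ea \<noteq> iN" "eb \<noteq> iN" using r by linarith
  then show "TS (A b) = B (TS b)"
    by cases (auto simp: S, (auto simp: fun_eq_iff fapp power_int_minus field_simps power2_eq_square)?)
  consider "ea = iN" "eb = iN" | "ea = 1" "eb = iN" | "ea = iN" "eb = 1" | "ea = iN" "1 < eb" "eb < iN"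
    | "eb = iN" "1 < ea" "ea < iN" | "ea \<noteq> iN" "eb \<noteq> iN" using r by linarith
  then show "TS (B b) + sc (1 - q^2) (B b - A b) = A (TS b)"
    by cases (auto simp: S, (auto simp: fun_eq_iff fapp power_int_minus field_simps power2_eq_square)?)
qed

lemma W2_I: "f \<in> tens 2 \<Longrightarrow> w = TC f - TS f \<Longrightarrow> w \<in> W2" by (auto simp: W2_def)

lemma ce_col: "0 \<le> i \<Longrightarrow> i < iN \<Longrightarrow> ce i e = Some e' \<Longrightarrow> col e'"
  "0 \<le> i \<Longrightarrow> i < iN \<Longrightarrow> cf i e = Some e' \<Longrightarrow> col e'"
  using col_ci by (auto simp: ce_def cf_def split: if_splits)

lemma lnt_opx:
  assumes "\<And>x y. g x = Some y \<longleftrightarrow> h y = Some x"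
  shows "lnt (opx q bf af h)"
  using opx_tens[OF qq_nonzero assms] lnr_opx[of q bf af h] by (simp add: lnt_def lnr_def)

lemma opx_E_two:
  assumes i: "0 \<le> i" "i < iN" and v: "v \<in> tens 2"
  shows "opx q (\<lambda>_. 0) (kexp N i) (f1 N L i) v =
     zz1 (dl (i = 0)) (colA (kc i) (ce i) v) + zz2 (dl (i = 0)) (colB (\<lambda>_. 0) (ce i) v)"
proof (rule lnt_eqI[of "opx q (\<lambda>_. 0) (kexp N i) (f1 N L i)" "\<lambda>v. zz1 (dl (i = 0)) (colA (kc i) (ce i) v) + zz2 (dl (i = 0)) (colB (\<lambda>_. 0) (ce i) v)", OF _ _ _ v])
  show "lnt (opx q (\<lambda>_. 0) (kexp N i) (f1 N L i))" by (rule lnt_opx[OF e1_f1[OF i]])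
  show "lnt (\<lambda>v. zz1 (dl (i = 0)) (colA (kc i) (ce i) v) + zz2 (dl (i = 0)) (colB (\<lambda>_. 0) (ce i) v))"
    by (rule lnt_add[OF lnt_comp[OF lnt_zz(1) lnt_col(1)] lnt_comp[OF lnt_zz(2) lnt_col(2)]])
  fix p1 ea p2 eb assume c: "col ea" "col eb"
  show "opx q (\<lambda>_. 0) (kexp N i) (f1 N L i) (bb p1 ea p2 eb) =
     zz1 (dl (i = 0)) (colA (kc i) (ce i) (bb p1 ea p2 eb)) + zz2 (dl (i = 0)) (colB (\<lambda>_. 0) (ce i) (bb p1 ea p2 eb))"
    unfolding bb_def[of p1 ea p2 eb] opx_bvec2[OF qq_nonzero e1_f1[OF i]] unfolding bb_def[of p1 ea p2 eb, symmetric]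
    using c coords[OF col_ci(2)[OF i]]
    by (simp add: e1_eq[OF i] kexp_eq[OF i] colA_bb colB_bb ce_def lnrD lnr_zero zz_bb)
      (simp add: bb_def mult.commute[of iL])
qed

lemma opx_F_two:
  assumes i: "0 \<le> i" "i < iN" and v: "v \<in> tens 2"
  shows "opx q (\<lambda>k. - kexp N i k) (\<lambda>_. 0) (e1 N L i) v =
     zz1 (- dl (i = 0)) (colA (\<lambda>_. 0) (cf i) v) + zz2 (- dl (i = 0)) (colB (\<lambda>e. - kc i e) (cf i) v)"
proof (rule lnt_eqI[of "opx q (\<lambda>k. - kexp N i k) (\<lambda>_. 0) (e1 N L i)" "\<lambda>v. zz1 (- dl (i = 0)) (colA (\<lambda>_. 0) (cf i) v) + zz2 (- dl (i = 0)) (colB (\<lambda>e. - kc i e) (cf i) v)", OF _ _ _ v])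
  have fe: "f1 N L i x = Some y \<longleftrightarrow> e1 N L i y = Some x" for x y using e1_f1[OF i] by blast
  show "lnt (opx q (\<lambda>k. - kexp N i k) (\<lambda>_. 0) (e1 N L i))" by (rule lnt_opx[OF fe])
  show "lnt (\<lambda>v. zz1 (- dl (i = 0)) (colA (\<lambda>_. 0) (cf i) v) + zz2 (- dl (i = 0)) (colB (\<lambda>e. - kc i e) (cf i) v))"
    by (rule lnt_add[OF lnt_comp[OF lnt_zz(1) lnt_col(1)] lnt_comp[OF lnt_zz(2) lnt_col(2)]])
  fix p1 ea p2 eb assume c: "col ea" "col eb"
  show "opx q (\<lambda>k. - kexp N i k) (\<lambda>_. 0) (e1 N L i) (bb p1 ea p2 eb) =
     zz1 (- dl (i = 0)) (colA (\<lambda>_. 0) (cf i) (bb p1 ea p2 eb)) + zz2 (- dl (i = 0)) (colB (\<lambda>e. - kc i e) (cf i) (bb p1 ea p2 eb))"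
    unfolding bb_def[of p1 ea p2 eb] opx_bvec2[OF qq_nonzero fe] unfolding bb_def[of p1 ea p2 eb, symmetric]
    using c coords[OF col_ci(1)[OF i]]
    by (simp add: f1_eq[OF i] kexp_eq[OF i] colA_bb colB_bb cf_def lnrD lnr_zero zz_bb)
      (simp add: bb_def mult.commute[of iL])
qed

lemma W2_E:
  assumes i: "0 \<le> i" "i < iN" and f: "f \<in> tens 2"
  shows "opx q (\<lambda>_. 0) (kexp N i) (f1 N L i) (TC f - TS f) \<in> W2"
proof -
  define A B where "A = colA (kc i) (ce i)" and "B = colB (\<lambda>_. 0) (ce i)"
  have l: "lnt A" "lnt B" by (simp_all add: A_def B_def lnt_col)
  have t: "A f \<in> tens 2" "B f \<in> tens 2" "TC f \<in> tens 2" "TS f \<in> tens 2" "A (TC f) \<in> tens 2" "B (TC f) \<in> tens 2"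
    "A (TS f) \<in> tens 2" "B (TS f) \<in> tens 2" "TC (A f) \<in> tens 2" "TC (B f) \<in> tens 2" "TS (A f) \<in> tens 2" "TS (B f) \<in> tens 2"
    using f by (simp_all add: lntD(1)[OF l(1)] lntD(1)[OF l(2)] lntD(1)[OF lnt_TC] lntD(1)[OF lnt_TS])
  have com: "A (TC f) = TC (A f)" "B (TC f) = TC (B f)"
    unfolding A_def B_def using col_TC[OF f, of "ce i"] ce_col(1)[OF i] by metis+
  have X: "opx q (\<lambda>_. 0) (kexp N i) (f1 N L i) v = zz1 (dl (i = 0)) (A v) + zz2 (dl (i = 0)) (B v)" if "v \<in> tens 2" for v
    unfolding A_def B_def by (rule opx_E_two[OF i that])
  have X': "opx q (\<lambda>_. 0) (kexp N i) (f1 N L i) (TC f - TS f) = zz1 (dl (i = 0)) (A (TC f)) + zz2 (dl (i = 0)) (B (TC f))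
      - (zz1 (dl (i = 0)) (A (TS f)) + zz2 (dl (i = 0)) (B (TS f)))"
    using X t by (simp add: lnr_diff[OF lnr_opx])
  show ?thesis
  proof (cases "i = 0")
    case False
    then have d: "dl (i = 0) = 0" by (simp add: dl_def)
    have "TS (A f + B f) = A (TS f) + B (TS f)"
      using TS_ce[of i] i False unfolding A_def B_def
      by (intro lnt_eqI[of "\<lambda>f. TS (colA (kc i) (ce i) f + colB (\<lambda>_. 0) (ce i) f)" "\<lambda>f. colA (kc i) (ce i) (TS f) + colB (\<lambda>_. 0) (ce i) (TS f)", OF _ _ _ f])
        (simp_all add: lnt_comp[OF lnt_TS lnt_add[OF lnt_col(1) lnt_col(2)]] lnt_add[OF lnt_comp[OF lnt_col(1) lnt_TS] lnt_comp[OF lnt_col(2) lnt_TS]])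
    then have "opx q (\<lambda>_. 0) (kexp N i) (f1 N L i) (TC f - TS f) = TC (A f + B f) - TS (A f + B f)"
      unfolding X' d using t f com by (simp add: zz_0 lntD[OF lnt_TC])
    then show ?thesis using t by (intro W2_I[of "A f + B f"]) simp_all
  next
    case True
    then have d: "dl (i = 0) = 1" by (simp add: dl_def)
    have T1: "TS (B f) = A (TS f)"
      using TS_ce0(1) True unfolding A_def B_def
      by (intro lnt_eqI[of "\<lambda>f. TS (colB (\<lambda>_. 0) (ce i) f)" "\<lambda>f. colA (kc i) (ce i) (TS f)", OF _ _ _ f])
        (simp_all add: lnt_comp[OF lnt_TS lnt_col(2)] lnt_comp[OF lnt_col(1) lnt_TS])
    have T2: "TS (A f) + sc (1 - q^2) (A f - B f) = B (TS f)"
      using TS_ce0(2) True unfolding A_def B_def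
      by (intro lnt_eqI[of "\<lambda>f. TS (colA (kc i) (ce i) f) + sc (1 - q^2) (colA (kc i) (ce i) f - colB (\<lambda>_. 0) (ce i) f)" "\<lambda>f. colB (\<lambda>_. 0) (ce i) (TS f)", OF _ _ _ f])
        (simp_all add: lnt_add[OF lnt_comp[OF lnt_TS lnt_col(1)] lnt_sc[OF lnt_sub[OF lnt_col(1) lnt_col(2)]]] lnt_comp[OF lnt_col(2) lnt_TS])
    \<comment> \<open>The preimage carries z_1 and z_2 the other way round than E_0 f does, since
      T^c exchanges them while T^s exchanges A and B. The terms with 1 - q^2 from
      \<open>TC_zz\<close> and from \<open>T2\<close> then cancel.\<close>
    let ?g = "zz2 1 (A f) + zz1 1 (B f)"
    have Z: "zz2 1 (A f) \<in> tens 2" "zz1 1 (B f) \<in> tens 2" using t lntD(1)[OF lnt_zz(1)] lntD(1)[OF lnt_zz(2)] by blast+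
    have "opx q (\<lambda>_. 0) (kexp N i) (f1 N L i) (TC f - TS f) = TC ?g - TS ?g"
      unfolding X' d com T1[symmetric] T2[symmetric] TC_zz(1)[OF t(2)] TC_zz(2)[OF t(1)]
      using Z t by (simp add: lntD[OF lnt_TC] lntD[OF lnt_TS] TS_zz lnrD lnr_diff)
         (simp add: fun_eq_iff fapp algebra_simps)
    then show ?thesis using Z by (intro W2_I[of ?g]) simp_all
  qed
qed

lemma W2_F:
  assumes i: "0 \<le> i" "i < iN" and f: "f \<in> tens 2"
  shows "opx q (\<lambda>k. - kexp N i k) (\<lambda>_. 0) (e1 N L i) (TC f - TS f) \<in> W2"
proof -
  define A B where "A = colA (\<lambda>_. 0) (cf i)" and "B = colB (\<lambda>e. - kc i e) (cf i)"
  have l: "lnt A" "lnt B" by (simp_all add: A_def B_def lnt_col)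
  have t: "A f \<in> tens 2" "B f \<in> tens 2" "TC f \<in> tens 2" "TS f \<in> tens 2" "A (TC f) \<in> tens 2" "B (TC f) \<in> tens 2"
    "A (TS f) \<in> tens 2" "B (TS f) \<in> tens 2" "TC (A f) \<in> tens 2" "TC (B f) \<in> tens 2" "TS (A f) \<in> tens 2" "TS (B f) \<in> tens 2"
    using f by (simp_all add: lntD(1)[OF l(1)] lntD(1)[OF l(2)] lntD(1)[OF lnt_TC] lntD(1)[OF lnt_TS])
  have com: "A (TC f) = TC (A f)" "B (TC f) = TC (B f)"
    unfolding A_def B_def using col_TC[OF f, of "cf i"] ce_col(2)[OF i] by metis+
  have X: "opx q (\<lambda>k. - kexp N i k) (\<lambda>_. 0) (e1 N L i) v = zz1 (- dl (i = 0)) (A v) + zz2 (- dl (i = 0)) (B v)" if "v \<in> tens 2" for v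
    unfolding A_def B_def by (rule opx_F_two[OF i that])
  have X': "opx q (\<lambda>k. - kexp N i k) (\<lambda>_. 0) (e1 N L i) (TC f - TS f) = zz1 (- dl (i = 0)) (A (TC f)) + zz2 (- dl (i = 0)) (B (TC f))
      - (zz1 (- dl (i = 0)) (A (TS f)) + zz2 (- dl (i = 0)) (B (TS f)))"
    using X t by (simp add: lnr_diff[OF lnr_opx])
  show ?thesis
  proof (cases "i = 0")
    case False
    then have d: "- dl (i = 0) = 0" by (simp add: dl_def)
    have "TS (A f + B f) = A (TS f) + B (TS f)"
      using TS_cf[of i] i False unfolding A_def B_def
      by (intro lnt_eqI[of "\<lambda>f. TS (colA (\<lambda>_. 0) (cf i) f + colB (\<lambda>e. - kc i e) (cf i) f)" "\<lambda>f. colA (\<lambda>_. 0) (cf i) (TS f) + colB (\<lambda>e. - kc i e) (cf i) (TS f)", OF _ _ _ f])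
        (simp_all add: lnt_comp[OF lnt_TS lnt_add[OF lnt_col(1) lnt_col(2)]] lnt_add[OF lnt_comp[OF lnt_col(1) lnt_TS] lnt_comp[OF lnt_col(2) lnt_TS]])
    then have "opx q (\<lambda>k. - kexp N i k) (\<lambda>_. 0) (e1 N L i) (TC f - TS f) = TC (A f + B f) - TS (A f + B f)"
      unfolding X' d using t f com by (simp add: zz_0 lntD[OF lnt_TC])
    then show ?thesis using t by (intro W2_I[of "A f + B f"]) simp_all
  next
    case True
    then have d: "- dl (i = 0) = - 1" by (simp add: dl_def)
    have T1: "TS (A f) = B (TS f)"
      using TS_cf0(1) True unfolding A_def B_def
      by (intro lnt_eqI[of "\<lambda>f. TS (colA (\<lambda>_. 0) (cf i) f)" "\<lambda>f. colB (\<lambda>e. - kc i e) (cf i) (TS f)", OF _ _ _ f])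
        (simp_all add: lnt_comp[OF lnt_TS lnt_col(1)] lnt_comp[OF lnt_col(2) lnt_TS])
    have T2: "TS (B f) + sc (1 - q^2) (B f - A f) = A (TS f)"
      using TS_cf0(2) True unfolding A_def B_def
      by (intro lnt_eqI[of "\<lambda>f. TS (colB (\<lambda>e. - kc i e) (cf i) f) + sc (1 - q^2) (colB (\<lambda>e. - kc i e) (cf i) f - colA (\<lambda>_. 0) (cf i) f)" "\<lambda>f. colA (\<lambda>_. 0) (cf i) (TS f)", OF _ _ _ f])
        (simp_all add: lnt_add[OF lnt_comp[OF lnt_TS lnt_col(2)] lnt_sc[OF lnt_sub[OF lnt_col(2) lnt_col(1)]]] lnt_comp[OF lnt_col(1) lnt_TS])
    let ?g = "zz2 (-1) (A f) + zz1 (-1) (B f)"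
    have Z: "zz2 (-1) (A f) \<in> tens 2" "zz1 (-1) (B f) \<in> tens 2" using t lntD(1)[OF lnt_zz(1)] lntD(1)[OF lnt_zz(2)] by blast+
    have "opx q (\<lambda>k. - kexp N i k) (\<lambda>_. 0) (e1 N L i) (TC f - TS f) = TC ?g - TS ?g"
      unfolding X' d com T1[symmetric] T2[symmetric] TC_zz_inverse(1)[OF t(2)] TC_zz_inverse(2)[OF t(1)]
      using Z t by (simp add: lntD[OF lnt_TC] lntD[OF lnt_TS] TS_zz lnrD lnr_diff)
         (simp add: fun_eq_iff fapp algebra_simps)
    then show ?thesis using Z by (intro W2_I[of ?g]) simp_all
  qed
qed

end

section \<open>The dotted generators on two factors\<close>

context nl begin

definition pz :: "int \<Rightarrow> int \<Rightarrow> bool" where "pz a p \<longleftrightarrow> zl (p + a)"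

lemma pz_shift: "pz a (p + iL) = pz a p"
proof -
  have "p + iL + a = (p + a) + iL" by simp
  then have "(p + iL + a) mod iL = (p + a) mod iL" by (simp only: mod_add_self2)
  then show ?thesis by (simp add: pz_def zl_def)
qed

lemma pz_mod: "pz a (p2 + (p1 - p2) mod iL) = pz a p1" "pz a (p1 + iL - (p1 - p2) mod iL) = pz a p2"
proof -
  define c where "c = (p1 - p2) div iL"
  have r: "(p1 - p2) mod iL = p1 - p2 - iL * c" by (simp add: c_def minus_mult_div_eq_mod)
  have "p2 + (p1 - p2) mod iL + a = (p1 + a) + iL * (- c)"
    "p1 + iL - (p1 - p2) mod iL + a = (p2 + a) + iL * (1 + c)"
    unfolding r by (simp_all add: algebra_simps)
  then have "(p2 + (p1 - p2) mod iL + a) mod iL = (p1 + a) mod iL"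
    "(p1 + iL - (p1 - p2) mod iL + a) mod iL = (p2 + a) mod iL"
    by (simp_all only: mod_mult_self2)
  then show "pz a (p2 + (p1 - p2) mod iL) = pz a p1" "pz a (p1 + iL - (p1 - p2) mod iL) = pz a p2"
    by (simp_all add: pz_def zl_def)
qed

lemma pz_exclusive: "pz a p \<Longrightarrow> \<not> pz (a - 1) p" "pz (a - 1) p \<Longrightarrow> \<not> pz a p"
proof -
  have False if "pz a p" "pz (a - 1) p"
  proof -
    have "iL dvd p + a" "iL dvd p + (a - 1)" using that by (simp_all add: pz_def zl_def dvd_eq_mod_eq_0)
    then have "iL dvd (p + a) - (p + (a - 1))" by (rule dvd_diff)
    then show False using L2 by simp
  qed
  then show "pz a p \<Longrightarrow> \<not> pz (a - 1) p" "pz (a - 1) p \<Longrightarrow> \<not> pz a p" by blast+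
qed

lemma mod_eqI: "0 \<le> r \<Longrightarrow> r < iL \<Longrightarrow> iL dvd x - r \<Longrightarrow> x mod iL = r"
  by (metis mod_eq_dvd_iff mod_pos_pos_trivial)

lemma pz_dvd: "pz a p \<longleftrightarrow> iL dvd p + a" by (simp add: pz_def zl_def dvd_eq_mod_eq_0)

lemma pz_diff: "pz a p \<Longrightarrow> pz b p' \<Longrightarrow> iL dvd (p - p') + (a - b)"
proof -
  assume "pz a p" "pz b p'"
  then have "iL dvd (p + a) - (p' + b)" unfolding pz_dvd by (rule dvd_diff)
  then show ?thesis by (simp add: algebra_simps)
qed

lemma pz_transfer: "pz a p1 \<Longrightarrow> (p1 - p2 + c) mod iL = 0 \<Longrightarrow> pz (a - c) p2"
  "pz a p2 \<Longrightarrow> (p1 - p2 + c) mod iL = 0 \<Longrightarrow> pz (a + c) p1"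
proof -
  assume "pz a p1" "(p1 - p2 + c) mod iL = 0"
  then have "iL dvd (p1 + a) - (p1 - p2 + c)" unfolding pz_dvd dvd_eq_mod_eq_0[symmetric] by (rule dvd_diff)
  then show "pz (a - c) p2" by (simp add: pz_dvd algebra_simps)
next
  assume "pz a p2" "(p1 - p2 + c) mod iL = 0"
  then have "iL dvd (p2 + a) + (p1 - p2 + c)" unfolding pz_dvd dvd_eq_mod_eq_0[symmetric] by (rule dvd_add)
  then show "pz (a + c) p1" by (simp add: pz_dvd algebra_simps)
qed

lemma mod_eqI': "iL dvd y \<Longrightarrow> x = y + r + iL * c \<Longrightarrow> 0 \<le> r \<Longrightarrow> r < iL \<Longrightarrow> x mod iL = r"
  by (rule mod_eqI) (auto intro!: dvd_add)

lemma mod_step: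
  shows "(p1 - p2) mod iL \<noteq> 0 \<Longrightarrow> (p1 - p2 - 1) mod iL = (p1 - p2) mod iL - 1"
    and "(p1 - p2 + 1) mod iL \<noteq> 0 \<Longrightarrow> (p1 - p2 + 1) mod iL = (p1 - p2) mod iL + 1"
proof -
  have L: "0 < iL" using L2 by simp
  have r: "0 \<le> x mod iL" "x mod iL < iL" "iL dvd x - x mod iL" for x
    using L by (simp_all add: minus_mod_eq_mult_div)
  {
    assume "(p1 - p2) mod iL \<noteq> 0"
    then show "(p1 - p2 - 1) mod iL = (p1 - p2) mod iL - 1"
      using r[of "p1 - p2"] by (intro mod_eqI) (auto simp: algebra_simps)
  next
    assume a: "(p1 - p2 + 1) mod iL \<noteq> 0"
    have "(p1 - p2 + 1 - 1) mod iL = (p1 - p2 + 1) mod iL - 1"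
      using r[of "p1 - p2 + 1"] a by (intro mod_eqI) (auto simp: algebra_simps)
    then show "(p1 - p2 + 1) mod iL = (p1 - p2) mod iL + 1" by simp
  }
qed

definition XE :: "int \<Rightarrow> vec \<Rightarrow> vec" where "XE a = opx q (kdexp N L a) (\<lambda>_. 0) (fd1 N L a)"
definition XF :: "int \<Rightarrow> vec \<Rightarrow> vec" where "XF a = opx q (\<lambda>_. 0) (\<lambda>k. - kdexp N L a k) (ed1 N L a)"

definition kp :: "int \<Rightarrow> int \<Rightarrow> int" where "kp a p = dl (pz (a - 1) p) - dl (pz a p)"

lemma kdexp_kp: "kdexp N L a k = kp a (pos k)"
  by (simp add: kdexp_eq kp_def pz_def algebra_simps)

lemma XE_bb: assumes a: "0 \<le> a" "a < iL" and c: "col ea" "col eb"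
  shows "XE a (bb p1 ea p2 eb) = sc (if pz a p1 then 1 else 0) (bb (p1 + 1) ea p2 eb)
     + sc (if pz a p2 then q powi (kp a p1) else 0) (bb p1 ea (p2 + 1) eb)"
proof -
  have pz: "zl (p + a) = pz a p" for p by (simp add: pz_def)
  show ?thesis
    unfolding XE_def bb_def[of p1 ea p2 eb] opx_bvec2[OF qq_nonzero ed1_fd1[OF a]]
    using c by (simp add: ed1_eq[OF a] kdexp_kp pz bb_def) (simp add: algebra_simps)
qed

lemma XF_bb: assumes a: "0 \<le> a" "a < iL" and c: "col ea" "col eb"
  shows "XF a (bb p1 ea p2 eb) = sc (if pz (a - 1) p1 then q powi (- kp a p2) else 0) (bb (p1 - 1) ea p2 eb)
     + sc (if pz (a - 1) p2 then 1 else 0) (bb p1 ea (p2 - 1) eb)"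
proof -
  have fe: "fd1 N L a x = Some y \<longleftrightarrow> ed1 N L a y = Some x" for x y using ed1_fd1[OF a] by blast
  have pz: "zl (p + a - 1) = pz (a - 1) p" for p by (simp add: pz_def add_diff_eq)
  show ?thesis
  unfolding XF_def bb_def[of p1 ea p2 eb] opx_bvec2[OF qq_nonzero fe]
  using c by (simp add: fd1_eq[OF a] kdexp_kp pz bb_def) (simp add: algebra_simps)
qed

lemma lnr_X: "lnr (XE a)" "lnr (XF a)" unfolding XE_def XF_def by (rule lnr_opx)+

lemma lnt_X: "0 \<le> a \<Longrightarrow> a < iL \<Longrightarrow> lnt (XE a)" "0 \<le> a \<Longrightarrow> a < iL \<Longrightarrow> lnt (XF a)"
  unfolding XE_def XF_def by (rule lnt_opx[OF ed1_fd1], assumption+) (rule lnt_opx[of "fd1 N L a"], use ed1_fd1 in blast)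

text \<open>A dotted generator acts on positions and T^s on colours, so everything depends on s R.
  The six cases record whether a position can be raised (\<open>pz a\<close>) or is the result of a
  raising (\<open>pz (a - 1)\<close>); this determines how the residue of p1 - p2, and with it the
  off-diagonal term of \<open>SRb_eq\<close>, changes.\<close>

lemma XE_SR:
  assumes a: "0 \<le> a" "a < iL" and c: "col ea" "col eb"
  shows "XE a (SR (bb p1 ea p2 eb)) = SR (XE a (bb p1 ea p2 eb))"
proof -
  note l = lnrD[OF lnr_X(1)] lnr_diff[OF lnr_X(1)] lntD[OF lnt_SR] lnt_zero[OF lnt_SR]
  note S = SR_bb[OF c] XE_bb[OF a c] SRb_eq pz_shift pz_mod kp_def l
  have e: "p1 + 1 - p2 = p1 - p2 + 1" "p1 - (p2 + 1) = p1 - p2 - 1" by simp_all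
  note fin = fun_eq_iff fapp power_int_minus dl_def field_simps power2_eq_square
  have L: "(1::int) < iL" "iL \<noteq> 1" "iL \<noteq> 0" "(0::int) \<le> 1" "(0::int) \<le> iL - 1" "iL - 1 < iL" "iL - 1 \<noteq> 0" "0 < iL" using L2 by simp_all
  consider (A) "pz a p1" "pz a p2" | (B) "pz a p1" "pz (a - 1) p2" | (C) "pz a p1" "\<not> pz a p2" "\<not> pz (a - 1) p2"
    | (D) "pz (a - 1) p1" "pz a p2" | (E) "\<not> pz a p1" "\<not> pz (a - 1) p1" "pz a p2" | (F) "\<not> pz a p1" "\<not> pz a p2"
    by blast
  then show ?thesis
  proof cases
    case A
    note d = pz_diff[OF A]
    have r1: "(p1 - p2) mod iL = 0" by (rule mod_eqI'[OF d, where c="0"]; use L in simp)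
    have r2: "(p1 - p2 + 1) mod iL = 1" by (rule mod_eqI'[OF d, where c="0"]; use L in simp)
    have r3: "(p1 - p2 - 1) mod iL = iL - 1" by (rule mod_eqI'[OF d, where c="-1"]; use L in simp)
    note r = r1 r2 r3
    show ?thesis using A pz_exclusive(1)[OF A(1)] pz_exclusive(1)[OF A(2)] L by (simp add: S e r) (simp add: fin)
  next
    case B
    note d = pz_diff[OF B]
    have r1: "(p1 - p2) mod iL = iL - 1" by (rule mod_eqI'[OF d, where c="-1"]; use L in simp)
    have r2: "(p1 - p2 + 1) mod iL = 0" by (rule mod_eqI'[OF d, where c="0"]; use L in simp)
    note r = r1 r2
    show ?thesis using B pz_exclusive(1)[OF B(1)] pz_exclusive(2)[OF B(2)] pz_mod[of _ p2 p1, unfolded r] pz_mod[of _ p1 p2, unfolded r] L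
      by (simp add: S e r) (simp add: fin)
  next
    case C
    have n: "(p1 - p2) mod iL \<noteq> 0" "(p1 - p2 + 1) mod iL \<noteq> 0"
      using C pz_transfer(1)[of a p1 p2 0] pz_transfer(1)[of a p1 p2 1] by auto
    show ?thesis using C pz_exclusive(1)[OF C(1)] n by (simp add: S e mod_step(2)[OF n(2)]) (simp add: fin)
  next
    case D
    note d = pz_diff[OF D]
    have r1: "(p1 - p2) mod iL = 1" by (rule mod_eqI'[OF d, where c="0"]; use L in simp)
    have r2: "(p1 - p2 - 1) mod iL = 0" by (rule mod_eqI'[OF d, where c="0"]; use L in simp)
    note r = r1 r2
    show ?thesis using D pz_exclusive(2)[OF D(1)] pz_exclusive(1)[OF D(2)] pz_mod[of _ p2 p1, unfolded r] pz_mod[of _ p1 p2, unfolded r] L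
      by (simp add: S e r) (simp add: fin)
  next
    case E
    have n: "(p1 - p2) mod iL \<noteq> 0" "(p1 - p2 - 1) mod iL \<noteq> 0"
      using E pz_transfer(2)[of a p2 p1 0] pz_transfer(2)[of a p2 p1 "-1"] by auto
    show ?thesis using E pz_exclusive(1)[OF E(3)] n by (simp add: S e mod_step(1)[OF n(1)]) (simp add: fin)
  next
    case F
    then show ?thesis by (simp add: S)
  qed
qed

lemma XF_SR:
  assumes a: "0 \<le> a" "a < iL" and c: "col ea" "col eb"
  shows "XF a (SR (bb p1 ea p2 eb)) = SR (XF a (bb p1 ea p2 eb))"
proof -
  note l = lnrD[OF lnr_X(2)] lnr_diff[OF lnr_X(2)] lntD[OF lnt_SR] lnt_zero[OF lnt_SR]
  note S = SR_bb[OF c] XF_bb[OF a c] SRb_eq pz_shift pz_mod kp_def l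
  have e: "p1 - 1 - p2 = p1 - p2 - 1" "p1 - (p2 - 1) = p1 - p2 + 1" by simp_all
  note fin = fun_eq_iff fapp power_int_minus dl_def field_simps power2_eq_square
  have L: "(1::int) < iL" "iL \<noteq> 1" "iL \<noteq> 0" "(0::int) \<le> 1" "(0::int) \<le> iL - 1" "iL - 1 < iL" "iL - 1 \<noteq> 0" "0 < iL" using L2 by simp_all
  let ?b = "a - 1"
  consider (A) "pz ?b p1" "pz ?b p2" | (B) "pz ?b p1" "pz a p2" | (C) "pz ?b p1" "\<not> pz a p2" "\<not> pz ?b p2"
    | (D) "pz a p1" "pz ?b p2" | (E) "\<not> pz a p1" "\<not> pz ?b p1" "pz ?b p2" | (F) "\<not> pz ?b p1" "\<not> pz ?b p2"
    by blast
  then show ?thesis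
  proof cases
    case A
    note d = pz_diff[OF A]
    have r1: "(p1 - p2) mod iL = 0" by (rule mod_eqI'[OF d, where c="0"]; use L in simp)
    have r2: "(p1 - p2 + 1) mod iL = 1" by (rule mod_eqI'[OF d, where c="0"]; use L in simp)
    have r3: "(p1 - p2 - 1) mod iL = iL - 1" by (rule mod_eqI'[OF d, where c="-1"]; use L in simp)
    note r = r1 r2 r3
    show ?thesis using A pz_exclusive(2)[OF A(1)] pz_exclusive(2)[OF A(2)] L by (simp add: S e r) (simp add: fin)
  next
    case B
    note d = pz_diff[OF B]
    have r1: "(p1 - p2) mod iL = 1" by (rule mod_eqI'[OF d, where c="0"]; use L in simp)
    have r2: "(p1 - p2 - 1) mod iL = 0" by (rule mod_eqI'[OF d, where c="0"]; use L in simp)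
    note r = r1 r2
    show ?thesis using B pz_exclusive(2)[OF B(1)] pz_exclusive(1)[OF B(2)] pz_mod[of _ p2 p1, unfolded r] pz_mod[of _ p1 p2, unfolded r] L
      by (simp add: S e r) (simp add: fin)
  next
    case C
    have n: "(p1 - p2) mod iL \<noteq> 0" "(p1 - p2 - 1) mod iL \<noteq> 0"
      using C pz_transfer(1)[of ?b p1 p2 0] pz_transfer(1)[of ?b p1 p2 "-1"] by auto
    show ?thesis using C pz_exclusive(2)[OF C(1)] n by (simp add: S e mod_step(1)[OF n(1)]) (simp add: fin)
  next
    case D
    note d = pz_diff[OF D]
    have r1: "(p1 - p2) mod iL = iL - 1" by (rule mod_eqI'[OF d, where c="-1"]; use L in simp)
    have r2: "(p1 - p2 + 1) mod iL = 0" by (rule mod_eqI'[OF d, where c="0"]; use L in simp)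
    note r = r1 r2
    show ?thesis using D pz_exclusive(1)[OF D(1)] pz_exclusive(2)[OF D(2)] pz_mod[of _ p2 p1, unfolded r] pz_mod[of _ p1 p2, unfolded r] L
      by (simp add: S e r) (simp add: fin)
  next
    case E
    have n: "(p1 - p2) mod iL \<noteq> 0" "(p1 - p2 + 1) mod iL \<noteq> 0"
      using E pz_transfer(2)[of ?b p2 p1 0] pz_transfer(2)[of ?b p2 p1 1] by auto
    show ?thesis using E pz_exclusive(2)[OF E(3)] n by (simp add: S e mod_step(2)[OF n(2)]) (simp add: fin)
  next
    case F
    then show ?thesis by (simp add: S)
  qed
qed

lemma X_zz:
  assumes a: "0 \<le> a" "a < iL" and v: "v \<in> tens 2"
  shows "XE a (zz1 1 v) = zz1 1 (XE a v)" "XE a (zz2 1 v) = zz2 1 (XE a v)"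
    "XF a (zz1 1 v) = zz1 1 (XF a v)" "XF a (zz2 1 v) = zz2 1 (XF a v)"
proof -
  have k: "kp a (p + iL) = kp a p" for p by (simp add: kp_def pz_shift)
  have r: "p + iL + 1 = p + 1 + iL" "p + iL - 1 = p - 1 + iL" for p by simp_all
  note S = zz_bb XE_bb[OF a] XF_bb[OF a] lnrD lnr_X pz_shift k r lnt_comp lnt_X[OF a]
  show "XE a (zz1 1 v) = zz1 1 (XE a v)"
    by (rule lnt_eqI[of "\<lambda>v. XE a (zz1 1 v)" "\<lambda>v. zz1 1 (XE a v)", OF _ _ _ v]) (simp_all add: S)
  show "XE a (zz2 1 v) = zz2 1 (XE a v)"
    by (rule lnt_eqI[of "\<lambda>v. XE a (zz2 1 v)" "\<lambda>v. zz2 1 (XE a v)", OF _ _ _ v]) (simp_all add: S)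
  show "XF a (zz1 1 v) = zz1 1 (XF a v)"
    by (rule lnt_eqI[of "\<lambda>v. XF a (zz1 1 v)" "\<lambda>v. zz1 1 (XF a v)", OF _ _ _ v]) (simp_all add: S)
  show "XF a (zz2 1 v) = zz2 1 (XF a v)"
    by (rule lnt_eqI[of "\<lambda>v. XF a (zz2 1 v)" "\<lambda>v. zz2 1 (XF a v)", OF _ _ _ v]) (simp_all add: S)
qed

lemma X_TS:
  assumes a: "0 \<le> a" "a < iL" and v: "v \<in> tens 2"
  shows "XE a (TS v) = TS (XE a v)" "XF a (TS v) = TS (XF a v)"
proof -
  note S = TS_bb XE_bb[OF a] XF_bb[OF a] lnrD lnr_X lnt_comp lnt_X[OF a] lnt_TS lntD(2,3)[OF lnt_TS] sc_add mult.commute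
  show "XE a (TS v) = TS (XE a v)"
    by (rule lnt_eqI[of "\<lambda>v. XE a (TS v)" "\<lambda>v. TS (XE a v)", OF _ _ _ v]) (simp_all add: S add_ac)
  show "XF a (TS v) = TS (XF a v)"
    by (rule lnt_eqI[of "\<lambda>v. XF a (TS v)" "\<lambda>v. TS (XF a v)", OF _ _ _ v]) (simp_all add: S add_ac)
qed

lemma W2_XE_XF:
  assumes a: "0 \<le> a" "a < iL" and f: "f \<in> tens 2"
  shows "XE a (TC f - TS f) \<in> W2" "XF a (TC f - TS f) \<in> W2"
proof -
  have t: "TC f \<in> tens 2" "TS f \<in> tens 2" "XE a f \<in> tens 2" "XF a f \<in> tens 2"
    using f by (simp_all add: lntD(1)[OF lnt_TC] lntD(1)[OF lnt_TS] lntD(1)[OF lnt_X(1)[OF a]] lntD(1)[OF lnt_X(2)[OF a]])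
  have S: "XE a (SR f) = SR (XE a f)" "XF a (SR f) = SR (XF a f)"
    by (rule lnt_eqI[of "\<lambda>v. XE a (SR v)" "\<lambda>v. SR (XE a v)", OF _ _ _ f]
        lnt_eqI[of "\<lambda>v. XF a (SR v)" "\<lambda>v. SR (XF a v)", OF _ _ _ f];
      simp add: lnt_comp lnt_X[OF a] lnt_SR XE_SR[OF a] XF_SR[OF a])+
  have "XE a (TC f - TS f) = TC (XE a f) - TS (XE a f)"
    using TC_commute[OF lnt_X(1)[OF a] f X_zz(1,2)[OF a] S(1)] X_TS(1)[OF a f] t by (simp add: lnr_diff lnr_X)
  then show "XE a (TC f - TS f) \<in> W2" using t by (auto intro: W2_I)
  have "XF a (TC f - TS f) = TC (XF a f) - TS (XF a f)"
    using TC_commute[OF lnt_X(2)[OF a] f X_zz(3,4)[OF a] S(2)] X_TS(2)[OF a f] t by (simp add: lnr_diff lnr_X)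
  then show "XF a (TC f - TS f) \<in> W2" using t by (auto intro: W2_I)
qed

end

section \<open>The relation spaces of the wedge powers\<close>

lemma tensv_add: "tensv n (v + v') w = tensv n v w + tensv n v' w" "tensv n v (w + w') = tensv n v w + tensv n v w'"
  by (auto simp: fun_eq_iff tensv_def fapp algebra_simps)
lemma tensv_sc: "tensv n (sc c v) w = sc c (tensv n v w)" "tensv n v (sc c w) = sc c (tensv n v w)"
  by (auto simp: fun_eq_iff tensv_def fapp)
lemma tensv_0 [simp]: "tensv n 0 w = 0" "tensv n v 0 = 0"
  by (auto simp: fun_eq_iff tensv_def fapp)
lemma tensv_diff: "tensv n (v - v') w = tensv n v w - tensv n v' w" "tensv n v (w - w') = tensv n v w - tensv n v w'"
  by (auto simp: fun_eq_iff tensv_def fapp algebra_simps)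
lemma tensv_sum: "tensv n (\<Sum>i\<in>I. f i) w = (\<Sum>i\<in>I. tensv n (f i) w)" "tensv n v (\<Sum>i\<in>I. f i) = (\<Sum>i\<in>I. tensv n v (f i))"
  by (induction I rule: infinite_finite_induct) (simp_all add: tensv_add)

lemma tensv_assoc: "tensv n v (tensv m w x) = tensv (n + m) (tensv n v w) x"
proof
  fix ys
  show "tensv n v (tensv m w x) ys = tensv (n + m) (tensv n v w) x ys"
  proof (cases "n + m \<le> length ys")
    case True
    have "take m (drop n ys) = drop n (take (n + m) ys)" by (simp add: take_drop add.commute)
    moreover have "m \<le> length ys - n" "n \<le> length ys" using True by simp_all
    ultimately show ?thesis using True by (simp add: tensv_def add.commute min_def mult.assoc)
  qed (auto simp: tensv_def)
qed

lemma tensv_bvec: "tensv (length us) (bvec us) (bvec vs) = bvec (us @ vs)"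
proof
  fix ys
  show "tensv (length us) (bvec us) (bvec vs) ys = bvec (us @ vs) ys"
  proof (cases "length us \<le> length ys")
    case True
    then have "ys = us @ vs \<longleftrightarrow> take (length us) ys = us \<and> drop (length us) ys = vs"
      by (metis append_eq_conv_conj append_take_drop_id)
    then show ?thesis using True by (auto simp: tensv_def bvec_def)
  qed (auto simp: tensv_def bvec_def)
qed

lemma tensv_bvec': "length us = n \<Longrightarrow> tensv n (bvec us) (bvec vs) = bvec (us @ vs)"
  using tensv_bvec by blast

lemma tensv_tens: "v \<in> tens n \<Longrightarrow> w \<in> tens m \<Longrightarrow> tensv n v w \<in> tens (n + m)"
proof (induction v rule: tens_induct)
  case (add v c xs)
  have "tensv n (bvec xs) w \<in> tens (n + m)" using add.prems
  proof (induction w rule: tens_induct)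
    case (add w d zs)
    then show ?case using \<open>length xs = n\<close> by (simp add: tensv_add tensv_sc tensv_bvec')
  qed simp
  with add show ?case by (simp add: tensv_add tensv_sc)
qed simp

lemma opx_tensv:
  assumes q: "q \<noteq> 0" and v: "v \<in> tens n"
  shows "opx q bf af h (tensv n v w) = tensv n (opx q bf af h v) (kop q af w) + tensv n (kop q bf v) (opx q bf af h w)"
proof
  fix ys
  show "opx q bf af h (tensv n v w) ys = (tensv n (opx q bf af h v) (kop q af w) + tensv n (kop q bf v) (opx q bf af h w)) ys"
  proof (cases "n \<le> length ys")
    case True
    define us zs where uz: "us = take n ys" "zs = drop n ys"
    have ys: "ys = us @ zs" "length us = n" using True by (simp_all add: uz)
    have 1: "opx q bf af h (\<lambda>u. tensv n v w (u @ zs)) us = opx q bf af h (\<lambda>u. w zs * v u) us"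
      by (rule opx_cong) (simp add: ys tensv_def)
    have 2: "(\<lambda>u. tensv n v w (us @ u)) = (\<lambda>u. v us * w u)"
      by (auto simp: fun_eq_iff ys tensv_def)
    show ?thesis unfolding ys(1) opx_append[OF q] 1 2 opx_scale
      using ys(2) by (simp add: tensv_def fapp kop_def)
  next
    case False
    have "opx q bf af h (tensv n v w) ys = opx q bf af h (\<lambda>_. 0) ys"
      using False by (intro opx_cong) (simp add: tensv_def)
    then show ?thesis using False by (simp add: tensv_def fapp)
  qed
qed

lemma kop_tensv:
  assumes q: "q \<noteq> 0"
  shows "kop q f (tensv n v w) = tensv n (kop q f v) (kop q f w)"
proof
  fix ys
  show "kop q f (tensv n v w) ys = tensv n (kop q f v) (kop q f w) ys"
  proof (cases "n \<le> length ys")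
    case True
    define us zs where uz: "us = take n ys" "zs = drop n ys"
    have ys: "ys = us @ zs" "length us = n" using True by (simp_all add: uz)
    show ?thesis unfolding ys(1) using ys(2) q by (simp add: kop_def tensv_def power_int_add)
  qed (simp add: kop_def tensv_def)
qed

lemma dop_tensv: "dop f (tensv n v w) = tensv n (dop f v) w + tensv n v (dop f w)"
proof
  fix ys
  show "dop f (tensv n v w) ys = (tensv n (dop f v) w + tensv n v (dop f w)) ys"
  proof (cases "n \<le> length ys")
    case True
    define us zs where uz: "us = take n ys" "zs = drop n ys"
    have ys: "ys = us @ zs" "length us = n" using True by (simp_all add: uz)
    show ?thesis unfolding ys(1) using ys(2) by (simp add: dop_def tensv_def fapp algebra_simps)
  qed (simp add: dop_def tensv_def fapp)
qed

context nl begin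

definition pad :: "int list \<Rightarrow> vec \<Rightarrow> int list \<Rightarrow> vec" where
  "pad us g vs = tensv (length us) (bvec us) (tensv 2 g (bvec vs))"

lemma pad_lin: "pad us (g + g') vs = pad us g vs + pad us g' vs" "pad us (sc c g) vs = sc c (pad us g vs)"
  "pad us 0 vs = 0" "pad us (g - g') vs = pad us g vs - pad us g' vs"
  by (simp_all add: pad_def tensv_add tensv_sc tensv_diff)

lemma pad_bvec: "pad us (bvec [k1, k2]) vs = bvec (us @ k1 # k2 # vs)"
  by (simp add: pad_def tensv_bvec')

lemma pad_tens: "g \<in> tens 2 \<Longrightarrow> length us + 2 + length vs = n \<Longrightarrow> pad us g vs \<in> tens n"
  unfolding pad_def using tensv_tens[OF tens_bvec[OF refl, of us] tensv_tens[of g 2 "bvec vs" "length vs"]] by (simp add: add.assoc)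

text \<open>The space of wedge relations, built up from one padded two-factor relation at a time;
  \<open>Wsp_WW\<close> identifies it with the defining sum of images. In this form, closure under
  tensor products and under the operators is an induction.\<close>

inductive_set WW :: "nat \<Rightarrow> vec set" for n where
  zero: "0 \<in> WW n"
| pad: "w \<in> WW n \<Longrightarrow> g \<in> W2 \<Longrightarrow> length us + 2 + length vs = n \<Longrightarrow> w + pad us g vs \<in> WW n"

lemma WW_tens: "w \<in> WW n \<Longrightarrow> w \<in> tens n"
  by (induction rule: WW.induct) (simp_all add: pad_tens W2_tens)

lemma WW_pad: "g \<in> W2 \<Longrightarrow> length us + 2 + length vs = n \<Longrightarrow> pad us g vs \<in> WW n"
  using WW.pad[OF WW.zero] by force

lemma WW_add: assumes "w \<in> WW n" "w' \<in> WW n" shows "w + w' \<in> WW n"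
  using assms(2,1)
proof (induction rule: WW.induct)
  case (pad w' g us vs)
  then show ?case using WW.pad[of "w + w'" n g us vs] by (simp add: add.assoc)
qed simp

lemma WW_sc: "w \<in> WW n \<Longrightarrow> sc c w \<in> WW n"
proof (induction rule: WW.induct)
  case (pad w g us vs)
  then show ?case using WW.pad[OF pad.IH W2_sc[OF pad.hyps(2)]] by (simp add: sc_add pad_lin)
qed (simp add: WW.zero)

lemma WW_uminus: "w \<in> WW n \<Longrightarrow> - w \<in> WW n"
  using WW_sc[of w n "-1"] by (simp add: sc_minus_one)

lemma WW_sum: "(\<And>i. i \<in> I \<Longrightarrow> f i \<in> WW n) \<Longrightarrow> (\<Sum>i\<in>I. f i) \<in> WW n"
  by (induction I rule: infinite_finite_induct) (simp_all add: WW.zero WW_add)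

lemma WW_of_basis: "fs v \<Longrightarrow> (\<And>xs. v xs \<noteq> 0 \<Longrightarrow> bvec xs \<in> WW n) \<Longrightarrow> v \<in> WW n"
proof -
  assume v: "fs v" and b: "\<And>xs. v xs \<noteq> 0 \<Longrightarrow> bvec xs \<in> WW n"
  have "(\<Sum>x\<in>supp v. sc (v x) (bvec x)) \<in> WW n"
    using b by (intro WW_sum WW_sc) (simp add: supp_def)
  then show ?thesis using vec_expand[OF v] by simp
qed

lemma WW_left: assumes "x \<in> tens a" "w \<in> WW b" shows "tensv a x w \<in> WW (a + b)"
  using assms
proof (induction x rule: tens_induct)
  case (add x c xs)
  have "tensv a (bvec xs) w \<in> WW (a + b)" using add.prems
  proof (induction rule: WW.induct)
    case (pad w g us vs)
    have "tensv a (bvec xs) (pad us g vs) = pad (xs @ us) g vs"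
      unfolding pad_def tensv_assoc[of a] tensv_bvec'[OF \<open>length xs = a\<close>] length_append \<open>length xs = a\<close> ..
    then show ?case using WW.pad[OF pad.IH pad.hyps(2), of "xs @ us" vs] pad.hyps(3) add.hyps
      by (simp add: tensv_add)
  qed (simp add: WW.zero)
  then show ?case using add by (simp add: tensv_add tensv_sc WW_add WW_sc)
qed (simp add: WW.zero)

lemma WW_right: assumes "y \<in> tens b" "w \<in> WW a" shows "tensv a w y \<in> WW (a + b)"
  using assms
proof (induction y rule: tens_induct)
  case (add y c ys)
  have "tensv a w (bvec ys) \<in> WW (a + b)" using add.prems
  proof (induction rule: WW.induct)
    case (pad w g us vs)
    have "tensv a (pad us g vs) (bvec ys) = tensv (length us + 2 + length vs) (tensv (length us + 2) (tensv (length us) (bvec us) g) (bvec vs)) (bvec ys)"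
      using pad.hyps(3) by (simp add: pad_def tensv_assoc)
    also have "\<dots> = pad us g (vs @ ys)"
      unfolding pad_def tensv_bvec[symmetric] by (simp only: tensv_assoc add.assoc)
    finally show ?case using WW.pad[OF pad.IH pad.hyps(2), of us "vs @ ys"] pad.hyps(3) add.hyps
      by (simp add: tensv_add)
  qed (simp add: WW.zero)
  then show ?case using add by (simp add: tensv_add tensv_sc WW_add WW_sc)
qed (simp add: WW.zero)

text \<open>By the coproduct the operator acts on the left part, on the two factors of the relation,
  or on the right part, and by powers of q elsewhere; every summand still contains a two-factor
  relation.\<close>

lemma WW_opx:
  assumes inv: "\<And>x y. g x = Some y \<longleftrightarrow> h y = Some x"
    and W: "\<And>w. w \<in> W2 \<Longrightarrow> opx q bf af h w \<in> W2" "\<And>w. w \<in> W2 \<Longrightarrow> kop q bf w \<in> W2" "\<And>w. w \<in> W2 \<Longrightarrow> kop q af w \<in> W2"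
    and w: "w \<in> WW n"
  shows "opx q bf af h w \<in> WW n"
  using w
proof (induction rule: WW.induct)
  case zero
  then show ?case by (simp add: lnr_zero[OF lnr_opx] WW.zero)
next
  case (pad w d us vs)
  have W2W: "x \<in> W2 \<Longrightarrow> x \<in> WW 2" for x
  proof -
    have "tensv 0 (bvec []) (tensv 2 x (bvec [])) = x" if "x \<in> tens 2" for x
    proof
      show "tensv 0 (bvec []) (tensv 2 x (bvec [])) ys = x ys" for ys
        using tens_length[OF that, of ys] by (auto simp: tensv_def bvec_def)
    qed
    then show "x \<in> W2 \<Longrightarrow> x \<in> WW 2" using WW_pad[of x "[]" "[]" 2] W2_tens[of x] by (simp add: pad_def)
  qed
  note q = qq_nonzero[of N]
  have d: "d \<in> tens 2" using pad.hyps W2_tens by blast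
  have b: "bvec us \<in> tens (length us)" "bvec vs \<in> tens (length vs)" by simp_all
  have e: "opx q bf af h (tensv (length us) (bvec us) (tensv 2 d (bvec vs))) =
     tensv (length us) (opx q bf af h (bvec us)) (tensv 2 (kop q af d) (kop q af (bvec vs)))
     + tensv (length us) (kop q bf (bvec us)) (tensv 2 (opx q bf af h d) (kop q af (bvec vs)) + tensv 2 (kop q bf d) (opx q bf af h (bvec vs)))"
    by (simp add: opx_tensv[OF q b(1)] opx_tensv[OF q d] kop_tensv[OF q])
  have t: "opx q bf af h (bvec us) \<in> tens (length us)" "opx q bf af h (bvec vs) \<in> tens (length vs)"
    by (rule opx_tens[OF q inv b(1)] opx_tens[OF q inv b(2)])+
  have "tensv (length us) (opx q bf af h (bvec us)) (tensv 2 (kop q af d) (kop q af (bvec vs))) \<in> WW (length us + (2 + length vs))"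
    using W(3)[OF pad.hyps(2)] by (intro WW_left WW_right t kop_tens b W2W)
  moreover have "tensv (length us) (kop q bf (bvec us)) (tensv 2 (opx q bf af h d) (kop q af (bvec vs)) + tensv 2 (kop q bf d) (opx q bf af h (bvec vs))) \<in> WW (length us + (2 + length vs))"
    using W(1,2)[OF pad.hyps(2)] by (intro WW_left WW_right WW_add t kop_tens b W2W)
  ultimately have "opx q bf af h (tensv (length us) (bvec us) (tensv 2 d (bvec vs))) \<in> WW n"
    unfolding e using pad.hyps(3) by (simp add: WW_add add.assoc)
  then show ?case using pad.IH by (simp add: lnrD[OF lnr_opx] WW_add pad_def)
qed

subsection \<open>Comparison with the defining spaces\<close>

definition dd :: "int \<Rightarrow> int \<Rightarrow> vec" where "dd k1 k2 = TC (bvec [k1, k2]) - TS (bvec [k1, k2])"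

lemma dd_W2: "dd k1 k2 \<in> W2" by (auto simp: dd_def W2_def)

lemma liftp_kernel:
  assumes "j + 2 \<le> length xs"
  shows "(\<lambda>ys. if length ys = length xs \<and> take j ys = take j xs \<and> drop (j + 2) ys = drop (j + 2) xs
     then (Tc N L (bvec [xs ! j, xs ! Suc j]) - Ts N L (bvec [xs ! j, xs ! Suc j])) [ys ! j, ys ! Suc j] else 0)
     = pad (take j xs) (dd (xs ! j) (xs ! Suc j)) (drop (j + 2) xs)"
proof
  fix ys
  have b: "bvec [xs ! j, xs ! Suc j] \<in> tens 2" by simp
  have l: "length (take j xs) = j" using assms by simp
  show "(if length ys = length xs \<and> take j ys = take j xs \<and> drop (j + 2) ys = drop (j + 2) xs
     then (Tc N L (bvec [xs ! j, xs ! Suc j]) - Ts N L (bvec [xs ! j, xs ! Suc j])) [ys ! j, ys ! Suc j] else 0)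
     = pad (take j xs) (dd (xs ! j) (xs ! Suc j)) (drop (j + 2) xs) ys"
  proof (cases "j + 2 \<le> length ys")
    case True
    have t: "take 2 (drop j ys) = [ys ! j, ys ! Suc j]"
      using True by (intro nth_equalityI) (auto simp: nth_Cons' less_2_cases_iff)
    have len: "drop (j + 2) ys = drop (j + 2) xs \<Longrightarrow> length ys = length xs"
      using True assms by (metis add_right_cancel le_add_diff_inverse2 length_drop)
    have P: "pad (take j xs) g (drop (j + 2) xs) ys =
        bvec (take j xs) (take j ys) * (g [ys ! j, ys ! Suc j] * bvec (drop (j + 2) xs) (drop (j + 2) ys))" for g
      using True unfolding pad_def tensv_def l drop_drop t by (simp add: t)
    have A: "Tc N L (bvec [xs ! j, xs ! Suc j]) - Ts N L (bvec [xs ! j, xs ! Suc j]) = dd (xs ! j) (xs ! Suc j)"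
      by (simp only: dd_def Tc_TC[OF b] TS_def)
    show ?thesis
    proof (cases "take j ys = take j xs \<and> drop (j + 2) ys = drop (j + 2) xs")
      case True
      then show ?thesis unfolding P A using len by (simp only: bvec_def) simp
    next
      case False
      then have "bvec (take j xs) (take j ys) = 0 \<or> bvec (drop (j + 2) xs) (drop (j + 2) ys) = 0"
        unfolding bvec_def by argo
      then have "pad (take j xs) (dd (xs ! j) (xs ! Suc j)) (drop (j + 2) xs) ys = 0" unfolding P by fastforce
      with False show ?thesis by argo
    qed
  next
    case False
    then show ?thesis using assms l by (auto simp: pad_def tensv_def)
  qed
qed

lemma liftp_WW:
  assumes w: "w \<in> tens n" and j: "j < n - 1"
  shows "liftp (\<lambda>f. Tc N L f - Ts N L f) j w \<in> WW n"
  unfolding liftp_def lin_superset[OF tens_fs[OF w] order_refl]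
proof (rule WW_sum, rule WW_sc)
  fix xs assume "xs \<in> supp w"
  then have l: "length xs = n" using w by (simp add: tens_def)
  then have j2: "j + 2 \<le> length xs" using j by simp
  show "(\<lambda>ys. if length ys = length xs \<and> take j ys = take j xs \<and> drop (j + 2) ys = drop (j + 2) xs
     then (Tc N L (bvec [xs ! j, xs ! Suc j]) - Ts N L (bvec [xs ! j, xs ! Suc j])) [ys ! j, ys ! Suc j] else 0) \<in> WW n"
    unfolding liftp_kernel[OF j2] using dd_W2 l j2 by (intro WW_pad) simp_all
qed

lemma pad_dd_liftp: "pad us (dd k1 k2) vs = liftp (\<lambda>f. Tc N L f - Ts N L f) (length us) (bvec (us @ k1 # k2 # vs))"
  unfolding liftp_def lin_bvec using liftp_kernel[of "length us" "us @ k1 # k2 # vs"]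
  by (simp add: nth_append)

lemma liftp_add: "v \<in> tens n \<Longrightarrow> w \<in> tens n \<Longrightarrow> liftp A j (v + w) = liftp A j v + liftp A j w"
  unfolding liftp_def by (rule lin_add[OF tens_fs tens_fs])
lemma liftp_sc: "v \<in> tens n \<Longrightarrow> liftp A j (sc c v) = sc c (liftp A j v)"
  unfolding liftp_def by (rule lin_sc[OF tens_fs])
lemma liftp_0: "liftp A j 0 = 0"
  unfolding liftp_def by (rule lin_0)

lemma Wsp_add: "v \<in> Wsp N L n \<Longrightarrow> w \<in> Wsp N L n \<Longrightarrow> v + w \<in> Wsp N L n"
proof -
  let ?A = "\<lambda>f. Tc N L f - Ts N L f"
  assume "v \<in> Wsp N L n" "w \<in> Wsp N L n"
  then obtain a b where a: "v = (\<Sum>j<n - 1. liftp ?A j (a j))" "\<forall>j. a j \<in> tens n"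
    and b: "w = (\<Sum>j<n - 1. liftp ?A j (b j))" "\<forall>j. b j \<in> tens n"
    by (auto simp: Wsp_def)
  have "v + w = (\<Sum>j<n - 1. liftp ?A j (a j + b j))"
  proof -
    have "liftp ?A j (a j + b j) = liftp ?A j (a j) + liftp ?A j (b j)" for j
      using a(2) b(2) by (intro liftp_add[of _ n]) blast+
    then show ?thesis by (simp only: a(1) b(1) sum.distrib)
  qed
  then show ?thesis unfolding Wsp_def using a(2) b(2) by (intro CollectI exI[of _ "\<lambda>j. a j + b j"]) simp
qed

lemma Wsp_pad_dd: "length us + 2 + length vs = n \<Longrightarrow> sc c (pad us (dd k1 k2) vs) \<in> Wsp N L n"
proof -
  let ?A = "\<lambda>f. Tc N L f - Ts N L f"
  assume n: "length us + 2 + length vs = n"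
  define w where "w = (\<lambda>j. if j = length us then sc c (bvec (us @ k1 # k2 # vs)) else 0)"
  have "(\<Sum>j<n - 1. liftp ?A j (w j)) = (\<Sum>j<n - 1. if j = length us then sc c (pad us (dd k1 k2) vs) else 0)"
    by (rule sum.cong) (auto simp: w_def pad_dd_liftp liftp_0 liftp_sc[OF tens_bvec[OF refl]])
  also have "\<dots> = sc c (pad us (dd k1 k2) vs)" using n by (simp add: sum.delta)
  finally have eq: "sc c (pad us (dd k1 k2) vs) = (\<Sum>j<n - 1. liftp ?A j (w j))" by (rule sym)
  have "\<forall>j. w j \<in> tens n" using n by (simp add: w_def)
  with eq show ?thesis unfolding Wsp_def by (intro CollectI exI[of _ w]) simp
qed

lemma Wsp_zero: "0 \<in> Wsp N L n"
proof -
  have "(\<Sum>j<n - 1. liftp (\<lambda>f. Tc N L f - Ts N L f) j 0) = 0" by (simp add: liftp_0)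
  then show ?thesis unfolding Wsp_def by (intro CollectI exI[of _ "\<lambda>j. 0"]) simp
qed

lemma Wsp_WW: "Wsp N L n = WW n"
proof
  show "Wsp N L n \<subseteq> WW n" unfolding Wsp_def by (auto intro!: WW_sum liftp_WW)
  show "WW n \<subseteq> Wsp N L n"
  proof
    fix w assume "w \<in> WW n"
    then show "w \<in> Wsp N L n"
    proof (induction rule: WW.induct)
      case (pad w g us vs)
      from pad.hyps(2) obtain f where f: "f \<in> tens 2" "g = TC f - TS f" by (auto simp: W2_def)
      have "pad us (TC f - TS f) vs \<in> Wsp N L n" using f(1)
      proof (induction rule: tens_induct)
        case zero
        then show ?case by (simp add: lnt_zero[OF lnt_TC] lnt_zero[OF lnt_TS] pad_lin Wsp_zero)
      next
        case (add v c xs)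
        then obtain k1 k2 where xs: "xs = [k1, k2]" by (auto simp: length_Suc_conv eval_nat_numeral)
        have "TC (v + sc c (bvec xs)) - TS (v + sc c (bvec xs)) = (TC v - TS v) + sc c (dd k1 k2)"
          using add by (simp add: lntD[OF lnt_TC] lntD[OF lnt_TS] dd_def xs sc_diff)
        then show ?case using Wsp_add[OF add.IH Wsp_pad_dd[OF pad.hyps(3)]] by (simp add: pad_lin)
      qed
      then show ?case using Wsp_add[OF pad.IH] f by simp
    qed (rule Wsp_zero)
  qed
qed

end

section \<open>Straightening\<close>

text \<open>Remainders of straightening: all coefficients vanish at q = 1, so such terms do not
  influence values there.\<close>

definition small :: "('a \<Rightarrow> bool) \<Rightarrow> ('a \<Rightarrow> kk) \<Rightarrow> bool" where
  "small P h \<longleftrightarrow> fs h \<and> (\<forall>x. h x \<noteq> 0 \<longrightarrow> P x) \<and> (\<forall>x. ev1 (h x) 0)"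

lemma small_0: "small P 0" by (simp add: small_def fapp)
lemma small_add: "small P h \<Longrightarrow> small P h' \<Longrightarrow> small P (h + h')"
proof -
  assume h: "small P h" "small P h'"
  have "P x" if "h x + h' x \<noteq> 0" for x using that h by (metis add.left_neutral small_def)
  moreover have "ev1 (h x + h' x) 0" for x using h ev1_add[of "h x" 0 "h' x" 0] by (simp add: small_def)
  ultimately show ?thesis using h by (simp add: small_def fapp)
qed
lemma small_sc: "ev1 c r \<Longrightarrow> small P h \<Longrightarrow> small P (sc c h)"
  using ev1_mult[of c r _ 0] by (auto simp: small_def fapp)
lemma small_bvec: "ev1 c 0 \<Longrightarrow> P x \<Longrightarrow> small P (sc c (bvec x))"
  using fs_sc[OF fs_bvec[of x], of c] by (auto simp: small_def fapp bvec_def)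
lemma small_sum: "(\<And>i. i \<in> I \<Longrightarrow> small P (f i)) \<Longrightarrow> small P (\<Sum>i\<in>I. f i)"
  by (induction I rule: infinite_finite_induct) (auto intro: small_0 small_add)
lemma small_mono: "small P h \<Longrightarrow> (\<And>x. P x \<Longrightarrow> Q x) \<Longrightarrow> small Q h"
  by (auto simp: small_def)

context nl begin

text \<open>Equality of weight for both algebras at once: colours give the undotted weight, labels
  the dotted one, and the sum of the indices then fixes the degree in z. The sum is also the
  quickest way to see that a word does not have the weight of the vacuum.\<close>

definition samew :: "int list \<Rightarrow> int list \<Rightarrow> bool" where
  "samew xs ys \<longleftrightarrow> mset (map bar xs) = mset (map bar ys) \<and> mset (map dot xs) = mset (map dot ys) \<and> sum_list xs = sum_list ys"

definition wfun :: "(int \<Rightarrow> int) \<Rightarrow> bool" where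
  "wfun f \<longleftrightarrow> (\<forall>xs ys. samew xs ys \<longrightarrow> sm f xs = sm f ys)"

lemma sm_mset: "mset (map g xs) = mset (map g ys) \<Longrightarrow> sm (\<lambda>k. f (g k)) xs = sm (\<lambda>k. f (g k)) ys"
proof -
  assume "mset (map g xs) = mset (map g ys)"
  then have "mset (map f (map g xs)) = mset (map f (map g ys))" by (simp only: mset_map)
  then have "sum_list (map f (map g xs)) = sum_list (map f (map g ys))" by (metis sum_mset_sum_list)
  then show ?thesis by (simp add: o_def)
qed

lemma wfun_bar: "wfun (\<lambda>k. f (bar k))" and wfun_dot: "wfun (\<lambda>k. f (dot k))"
  unfolding wfun_def samew_def using sm_mset[of bar _ _ f] sm_mset[of dot _ _ f] by blast+

lemma wfun_mult: "wfun f \<Longrightarrow> wfun (\<lambda>k. c * f k)"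
  by (simp add: wfun_def sum_list_const_mult)

text \<open>Summing \<open>k = bar k - iN * (dot k + iL * und k)\<close> over a word expresses the
  total power of z through the invariants in \<open>samew\<close>.\<close>

lemma wfun_und: "wfun und"
  unfolding wfun_def
proof (intro allI impI)
  fix xs ys assume w: "samew xs ys"
  have k: "k = bar k - iN * (dot k + iL * und k)" for k using pos_bar[of k] by (simp add: pos_dot)
  have s: "sum_list zs = sm bar zs - iN * (sm dot zs + iL * sm und zs)" for zs
  proof (induction zs)
    case (Cons z zs)
    have "sum_list (z # zs) = (bar z - iN * (dot z + iL * und z)) + (sm bar zs - iN * (sm dot zs + iL * sm und zs))"
      using k[of z] Cons by simp
    then show ?case by (simp add: algebra_simps)
  qed simp
  have "sm bar xs = sm bar ys" "sm dot xs = sm dot ys" using w sm_mset[of bar xs ys id] sm_mset[of dot xs ys id] by (simp_all add: samew_def)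
  moreover have "sum_list xs = sum_list ys" using w by (simp add: samew_def)
  ultimately have "sm bar ys - iN * (sm dot ys + iL * sm und xs) = sm bar ys - iN * (sm dot ys + iL * sm und ys)"
    using s[of xs] s[of ys] by argo
  then have "iN * (sm dot ys + iL * sm und xs) = iN * (sm dot ys + iL * sm und ys)" by linarith
  then show "sm und xs = sm und ys" using N2 L2 by simp
qed

lemma dot_cong: "iL dvd pos k - pos l \<Longrightarrow> dot k = dot l"
proof -
  assume "iL dvd pos k - pos l"
  then have "iL dvd (pos k - 1) - (pos l - 1)" by simp
  then have "(pos k - 1) mod iL = (pos l - 1) mod iL" by (simp only: mod_eq_dvd_iff)
  then show ?thesis by (simp add: dot_pos)
qed

lemma samew_two:
  assumes c: "col ea" "col eb" and p: "p1' + p2' = p1 + p2"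
    and e: "ea' = ea \<and> eb' = eb \<or> ea' = eb \<and> eb' = ea"
    and d: "iL dvd p1' - p2 \<and> iL dvd p2' - p1 \<or> iL dvd p1' - p1 \<and> iL dvd p2' - p2"
  shows "samew [ea - iN * p1, eb - iN * p2] [ea' - iN * p1', eb' - iN * p2']"
proof -
  have c': "col ea'" "col eb'" using c e by auto
  have s: "ea - iN * p1 + (eb - iN * p2) = ea' - iN * p1' + (eb' - iN * p2')"
  proof -
    have "iN * p1 + iN * p2 = iN * p1' + iN * p2'" using p by (simp add: distrib_left[symmetric])
    then show ?thesis using e by auto
  qed
  have "dot (ea' - iN * p1') = dot (eb - iN * p2) \<and> dot (eb' - iN * p2') = dot (ea - iN * p1) \<or>
     dot (ea' - iN * p1') = dot (ea - iN * p1) \<and> dot (eb' - iN * p2') = dot (eb - iN * p2)"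
    using d c c' by (auto intro!: dot_cong)
  then show ?thesis using c c' e s by (auto simp: samew_def add_mset_commute)
qed

lemma TCb_supp:
  assumes "TCb p1 ea p2 eb ys \<noteq> 0"
  shows "\<exists>p1' p2'. ys = [ea - iN * p1', eb - iN * p2'] \<and> p1' + p2' = p1 + p2 \<and>
     (iL dvd p1' - p2 \<and> iL dvd p2' - p1 \<or> iL dvd p1' - p1 \<and> iL dvd p2' - p2)" (is "?Q ys")
proof -
  define r d where "r = (p1 - p2) mod iL" and "d = (p1 - p2) div iL"
  have rd: "p1 = p2 + r + iL * d" unfolding r_def d_def using mult_div_mod_eq[of iL "p1 - p2"] by linarith
  have B: "?Q ys" if "bb p1' ea p2' eb ys \<noteq> 0" "p1' + p2' = p1 + p2"
     "iL dvd p1' - p2 \<and> iL dvd p2' - p1 \<or> iL dvd p1' - p1 \<and> iL dvd p2' - p2" for p1' p2'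
    using that by (auto simp: bb_def bvec_def split: if_splits)
  have S: "\<exists>j\<in>A. f j ys \<noteq> 0" if "(\<Sum>j\<in>A. f j :: vec) ys \<noteq> 0" for A :: "nat set" and f
  proof (rule ccontr)
    assume "\<not> (\<exists>j\<in>A. f j ys \<noteq> 0)"
    then have "(\<Sum>j\<in>A. f j ys) = 0" by (intro sum.neutral) blast
    then show False using that by (simp add: sum_fun_apply)
  qed
  from assms have "bb p2 ea p1 eb ys \<noteq> 0 \<or> (\<Sum>j<nat d. bb (p2 + r + iL * int j) ea (p1 - r - iL * int j) eb) ys \<noteq> 0
     \<or> (\<Sum>j<nat (- d). bb (p1 + iL * int j) ea (p2 - iL * int j) eb) ys \<noteq> 0"
    unfolding TCb_def Let_def r_def[symmetric] d_def[symmetric] by (auto simp: fapp split: if_splits)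
  then consider "bb p2 ea p1 eb ys \<noteq> 0"
    | j where "bb (p2 + r + iL * int j) ea (p1 - r - iL * int j) eb ys \<noteq> 0"
    | j where "bb (p1 + iL * int j) ea (p2 - iL * int j) eb ys \<noteq> 0"
    using S by blast
  then show ?thesis
  proof cases
    case 1 then show ?thesis by (rule B) simp_all
  next
    case 2
    have "p2 + r + iL * int j - p1 = iL * (int j - d)" "p1 - r - iL * int j - p2 = iL * (d - int j)"
      using rd by (simp_all add: algebra_simps)
    with 2 show ?thesis by (intro B[OF 2]) simp_all
  next
    case 3 then show ?thesis by (rule B) simp_all
  qed
qed

lemma dd_supp: assumes "dd k1 k2 ys \<noteq> 0" shows "samew [k1, k2] ys"
proof -
  have k: "k1 = bar k1 - iN * pos k1" "k2 = bar k2 - iN * pos k2" by (rule pos_bar)+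
  from assms have "TC (bvec [k1, k2]) ys \<noteq> 0 \<or> TS (bvec [k1, k2]) ys \<noteq> 0"
    unfolding dd_def by (auto simp: fapp)
  then show ?thesis
  proof
    assume "TC (bvec [k1, k2]) ys \<noteq> 0"
    then have "TCb (pos k1) (bar k1) (pos k2) (bar k2) ys \<noteq> 0" by (simp add: bvec_bb TC_bb)
    from TCb_supp[OF this] obtain p1' p2' where p: "ys = [bar k1 - iN * p1', bar k2 - iN * p2']"
      "p1' + p2' = pos k1 + pos k2"
      "iL dvd p1' - pos k2 \<and> iL dvd p2' - pos k1 \<or> iL dvd p1' - pos k1 \<and> iL dvd p2' - pos k2" by blast
    have "samew [bar k1 - iN * pos k1, bar k2 - iN * pos k2] ys"
      unfolding p(1) by (rule samew_two[OF col_bar col_bar p(2) _ p(3)]) simp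
    then show ?thesis by (simp only: k[symmetric])
  next
    assume "TS (bvec [k1, k2]) ys \<noteq> 0"
    then have "bb (pos k1) (bar k1) (pos k2) (bar k2) ys \<noteq> 0 \<or> bb (pos k1) (bar k2) (pos k2) (bar k1) ys \<noteq> 0"
      by (auto simp: bvec_bb TS_bb fapp split: if_splits)
    then have "ys = [bar k1 - iN * pos k1, bar k2 - iN * pos k2] \<or> ys = [bar k2 - iN * pos k1, bar k1 - iN * pos k2]"
      by (auto simp: bb_def bvec_def split: if_splits)
    moreover have "samew [bar k1 - iN * pos k1, bar k2 - iN * pos k2] [bar k1 - iN * pos k1, bar k2 - iN * pos k2]"
      "samew [bar k1 - iN * pos k1, bar k2 - iN * pos k2] [bar k2 - iN * pos k1, bar k1 - iN * pos k2]"
      by (rule samew_two[OF col_bar col_bar]; simp)+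
    ultimately have "samew [bar k1 - iN * pos k1, bar k2 - iN * pos k2] ys" by blast
    then show ?thesis by (simp only: k[symmetric])
  qed
qed

text \<open>The generators \<open>dd k1 k2\<close> are homogeneous, so a diagonal operator only
  rescales each of them.\<close>

lemma W2_weight:
  assumes lin: "lnr A" and b: "\<And>k1 k2. \<exists>c. A (dd k1 k2) = sc c (dd k1 k2)" and w: "w \<in> W2"
  shows "A w \<in> W2"
proof -
  from w obtain f where f: "f \<in> tens 2" "w = TC f - TS f" by (auto simp: W2_def)
  have "A (TC f - TS f) \<in> W2" using f(1)
  proof (induction rule: tens_induct)
    case zero
    show ?case by (simp add: lnt_zero[OF lnt_TC] lnt_zero[OF lnt_TS] lnr_zero[OF lin] W2_I[of 0])
  next
    case (add v c xs)
    then obtain k1 k2 where xs: "xs = [k1, k2]" by (auto simp: length_Suc_conv eval_nat_numeral)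
    have "TC (v + sc c (bvec xs)) - TS (v + sc c (bvec xs)) = (TC v - TS v) + sc c (dd k1 k2)"
      using add by (simp add: lntD[OF lnt_TC] lntD[OF lnt_TS] dd_def xs sc_diff)
    moreover obtain c' where "A (dd k1 k2) = sc c' (dd k1 k2)" using b by blast
    ultimately show ?case using add.IH by (simp add: lnrD[OF lin] W2_add W2_sc dd_W2)
  qed
  then show ?thesis using f by simp
qed

lemma W2_kop: assumes "wfun f" "w \<in> W2" shows "kop q f w \<in> W2"
proof (rule W2_weight[OF lnr_kop _ assms(2)])
  fix k1 k2
  have "kop q f (dd k1 k2) = sc (q powi sm f [k1, k2]) (dd k1 k2)"
  proof
    fix ys
    show "kop q f (dd k1 k2) ys = sc (q powi sm f [k1, k2]) (dd k1 k2) ys"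
    proof (cases "dd k1 k2 ys = 0")
      case False
      then have "sm f ys = sm f [k1, k2]" using dd_supp assms(1) unfolding wfun_def by metis
      then show ?thesis by (simp only: kop_def sc_def)
    qed (simp add: kop_def sc_def)
  qed
  then show "\<exists>c. kop q f (dd k1 k2) = sc c (dd k1 k2)" by blast
qed

lemma W2_dop: assumes "wfun f" "w \<in> W2" shows "dop f w \<in> W2"
proof (rule W2_weight[OF lnr_dop _ assms(2)])
  fix k1 k2
  have "dop f (dd k1 k2) = sc (of_int (sm f [k1, k2])) (dd k1 k2)"
  proof
    fix ys
    show "dop f (dd k1 k2) ys = sc (of_int (sm f [k1, k2])) (dd k1 k2) ys"
    proof (cases "dd k1 k2 ys = 0")
      case False
      then have "sm f ys = sm f [k1, k2]" using dd_supp assms(1) unfolding wfun_def by metis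
      then show ?thesis by (simp only: dop_def sc_def)
    qed (simp add: dop_def sc_def)
  qed
  then show "\<exists>c. dop f (dd k1 k2) = sc c (dd k1 k2)" by blast
qed

lemma W2_WW: assumes "x \<in> W2" shows "x \<in> WW 2"
proof -
  have "tensv 0 (bvec []) (tensv 2 x (bvec [])) = x"
  proof
    show "tensv 0 (bvec []) (tensv 2 x (bvec [])) ys = x ys" for ys
      using tens_length[OF W2_tens[OF assms], of ys] by (auto simp: tensv_def bvec_def)
  qed
  then show ?thesis using WW_pad[OF assms, of "[]" "[]" 2] by (simp add: pad_def)
qed

lemma WW_kop: assumes f: "wfun f" and w: "w \<in> WW n" shows "kop q f w \<in> WW n"
  using w
proof (induction rule: WW.induct)
  case (pad w g us vs)
  have "kop q f (pad us g vs) = tensv (length us) (kop q f (bvec us)) (tensv 2 (kop q f g) (kop q f (bvec vs)))"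
    by (simp add: pad_def kop_tensv)
  also have "\<dots> \<in> WW (length us + (2 + length vs))"
    using W2_kop[OF f pad.hyps(2)] by (intro WW_left WW_right kop_tens tens_bvec refl W2_WW)
  finally show ?case using pad.IH pad.hyps(3) by (simp add: lnrD[OF lnr_kop] WW_add add.assoc)
qed (simp add: lnr_zero[OF lnr_kop] WW.zero)

lemma WW_dop: assumes f: "wfun f" and w: "w \<in> WW n" shows "dop f w \<in> WW n"
  using w
proof (induction rule: WW.induct)
  case (pad w g us vs)
  have "dop f (pad us g vs) = tensv (length us) (dop f (bvec us)) (tensv 2 g (bvec vs)) +
    tensv (length us) (bvec us) (tensv 2 (dop f g) (bvec vs) + tensv 2 g (dop f (bvec vs)))"
    by (simp add: pad_def dop_tensv)
  also have "\<dots> \<in> WW (length us + (2 + length vs))"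
    using W2_dop[OF f pad.hyps(2)] pad.hyps(2) by (intro WW_left WW_right WW_add dop_tens tens_bvec refl W2_WW)
  finally show ?case using pad.IH pad.hyps(3) by (simp add: lnrD[OF lnr_dop] WW_add add.assoc)
qed (simp add: lnr_zero[OF lnr_dop] WW.zero)

subsection \<open>Two factors\<close>

definition mu :: "int \<Rightarrow> int \<Rightarrow> kk" where "mu p1 p2 = (if (p1 - p2) mod iL = 0 then - (q^2) else - q)"

definition between :: "int \<Rightarrow> int \<Rightarrow> int \<Rightarrow> int \<Rightarrow> int list \<Rightarrow> bool" where
  "between p1 ea p2 eb ys \<longleftrightarrow> (\<exists>p1' p2'. ys = [ea - iN * p1', eb - iN * p2'] \<and> p2 < p1' \<and> p1' < p1 \<and> p2 < p2' \<and> p2' < p1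
     \<and> p1' + p2' = p1 + p2 \<and> iL dvd p1' - p1 \<and> iL dvd p2' - p2)"

lemma ev1_mu: "ev1 (mu p1 p2) (- 1)"
  using ev1_uminus[OF ev1_qq[of N]] ev1_uminus[OF ev1_power[OF ev1_qq[of N], of 2]] by (simp add: mu_def)

lemma ev1_q2: "ev1 (1 - q^2) 0" "ev1 (inverse (q^2) - 1) 0" "ev1 (inverse q) 1" "ev1 (inverse (q^2)) 1"
  using ev1_diff[OF ev1_1 ev1_power[OF ev1_qq[of N], of 2]] ev1_inverse[OF ev1_qq[of N]]
    ev1_inverse[OF ev1_power[OF ev1_qq[of N], of 2]] ev1_diff[OF ev1_inverse[OF ev1_power[OF ev1_qq[of N], of 2]] ev1_1] by simp_all

lemma TC_down:
  assumes p: "p2 < p1" and c: "col ea" "col eb"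
  shows "\<exists>h. small (between p1 ea p2 eb) h \<and> TC (bb p1 ea p2 eb) = sc (mu p1 p2) (bb p2 ea p1 eb) + h"
proof -
  define r d where "r = (p1 - p2) mod iL" and "d = (p1 - p2) div iL"
  have L: "0 < iL" using L2 by simp
  have rd: "p1 = p2 + r + iL * d" unfolding r_def d_def using mult_div_mod_eq[of iL "p1 - p2"] by linarith
  have r: "0 \<le> r" "r < iL" using L by (simp_all add: r_def)
  have d: "0 \<le> d" unfolding d_def using p L by (simp add: pos_imp_zdiv_nonneg_iff)
  let ?b = "\<lambda>j. bb (p2 + r + iL * int j) ea (p1 - r - iL * int j) eb"
  have B: "between p1 ea p2 eb [ea - iN * (p2 + r + iL * int j), eb - iN * (p1 - r - iL * int j)]"
    if "j < nat d" "r \<noteq> 0 \<or> j \<noteq> 0" for j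
  proof -
    have j: "int j + 1 \<le> d" using that by linarith
    have "iL * (int j + 1) \<le> iL * d" using j L by simp
    then have 1: "iL * int j + iL \<le> iL * d" by (simp add: algebra_simps)
    have 2: "0 \<le> iL * int j" by simp
    have 3: "0 < r \<or> 0 < iL * int j" using that r L by auto
    have "p2 + r + iL * int j - p1 = iL * (int j - d)" "p1 - r - iL * int j - p2 = iL * (d - int j)"
      using rd by (simp_all add: algebra_simps)
    then have "iL dvd p2 + r + iL * int j - p1" "iL dvd p1 - r - iL * int j - p2" by simp_all
    moreover have "p2 < p2 + r + iL * int j" "p2 + r + iL * int j < p1" "p2 < p1 - r - iL * int j" "p1 - r - iL * int j < p1"
      "p2 + r + iL * int j + (p1 - r - iL * int j) = p1 + p2" using 1 2 3 rd r L by linarith+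
    ultimately show ?thesis unfolding between_def by blast
  qed
  have T: "TC (bb p1 ea p2 eb) = sc (if r = 0 then - 1 else - q) (bb p2 ea p1 eb) + sc (1 - q^2) (\<Sum>j<nat d. ?b j)"
    using d by (simp add: TC_bb[OF c] TCb_def Let_def r_def[symmetric] d_def[symmetric])
  have sm: "small (between p1 ea p2 eb) (sc (1 - q^2) (\<Sum>j\<in>A. ?b j))" if "\<And>j. j \<in> A \<Longrightarrow> j < nat d \<and> (r \<noteq> 0 \<or> j \<noteq> 0)" for A
    unfolding sc_sum using that B by (intro small_sum) (simp add: bb_def small_bvec ev1_q2)
  show ?thesis
  proof (cases "r = 0")
    case False
    then show ?thesis using sm[of "{..<nat d}"] T by (auto simp: mu_def r_def[symmetric])
  next
    case True
    have "0 < d" using rd p True d L by (cases "d = 0") auto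
    then obtain n where n: "nat d = Suc n" by (cases "nat d") auto
    \<comment> \<open>For r = 0 the term j = 0 is the exchanged vector itself, and - 1 + (1 - q^2) =
      - q^2 is the value of \<open>mu\<close>.\<close>
    have "(\<Sum>j<nat d. ?b j) = ?b 0 + (\<Sum>j\<in>{1..<nat d}. ?b j)"
      unfolding n by (subst lessThan_atLeast0) (simp add: sum.atLeast_Suc_lessThan del: sum.op_ivl_Suc)
    then have "TC (bb p1 ea p2 eb) = sc (mu p1 p2) (bb p2 ea p1 eb) + sc (1 - q^2) (\<Sum>j\<in>{1..<nat d}. ?b j)"
      unfolding T using True by (simp add: mu_def r_def[symmetric] sc_add) (simp add: fun_eq_iff fapp algebra_simps)
    moreover have "small (between p1 ea p2 eb) (sc (1 - q^2) (\<Sum>j\<in>{1..<nat d}. ?b j))" by (rule sm) auto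
    ultimately show ?thesis by blast
  qed
qed

definition inner :: "int \<Rightarrow> int \<Rightarrow> int list \<Rightarrow> bool" where
  "inner k1 k2 ys \<longleftrightarrow> (\<exists>l1 l2. ys = [l1, l2] \<and> k1 < l1 \<and> l1 < k2 \<and> k1 < l2 \<and> l2 < k2 \<and> samew [k1, k2] ys)"

lemma samew_swap: "samew [a, b] [b, a]" by (simp add: samew_def add_mset_commute)
lemma between_inner:
  assumes c: "col ea" "col eb" "col ea'" "col eb'" and e: "ea' = ea \<and> eb' = eb \<or> ea' = eb \<and> eb' = ea"
    and b: "between p1 ea' p2 eb' ys"
  shows "inner (ea - iN * p1) (eb - iN * p2) ys"
proof -
  from b obtain p1' p2' where p: "ys = [ea' - iN * p1', eb' - iN * p2']" "p2 < p1'" "p1' < p1" "p2 < p2'" "p2' < p1"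
     "p1' + p2' = p1 + p2" "iL dvd p1' - p1" "iL dvd p2' - p2" by (auto simp: between_def)
  have w: "samew [ea - iN * p1, eb - iN * p2] ys"
    unfolding p(1) using samew_two[OF c(1,2) p(6) e] p(7,8) by blast
  have lt: "x - iN * s < y - iN * t" if "col x" "col y" "t < s" for x y s t
  proof -
    have "iN * (t + 1) \<le> iN * s" using that by (intro mult_left_mono) auto
    then show ?thesis using that by (simp add: col_def algebra_simps)
  qed
  show ?thesis unfolding inner_def using p(1) w lt c p(2-5)
    by (intro exI[of _ "ea' - iN * p1'"] exI[of _ "eb' - iN * p2'"]) auto
qed

text \<open>If p2 < p1, the relation used is that of minus the preimage of the given vector under
  T^s: the vector itself appears with coefficient 1, and T^c contributes the exchanged vector
  together with inner ones. If p1 = p2, then T^c is -1 on the vector and T^s exchanges its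
  colours.\<close>

lemma straight2:
  assumes "k1 < k2"
  shows "\<exists>c h. ev1 c (- 1) \<and> small (inner k1 k2) h \<and> bvec [k1, k2] - sc c (bvec [k2, k1]) - h \<in> W2"
proof -
  define p1 p2 ea eb where pe: "p1 = pos k1" "p2 = pos k2" "ea = bar k1" "eb = bar k2"
  have k: "k1 = ea - iN * p1" "k2 = eb - iN * p2" unfolding pe by (rule pos_bar)+
  have c: "col ea" "col eb" by (simp_all add: pe)
  have b: "bvec [k1, k2] = bb p1 ea p2 eb" "bvec [k2, k1] = bb p2 eb p1 ea" by (simp_all add: bb_def k)
  have q: "q \<noteq> 0" by simp
  have "p2 \<le> p1"
  proof (rule ccontr)
    assume "\<not> p2 \<le> p1"
    then have "iN * (p1 + 1) \<le> iN * p2" by (intro mult_left_mono) auto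
    then show False using assms c unfolding k by (simp add: col_def algebra_simps)
  qed
  then consider "p1 = p2" | "p2 < p1" by linarith
  then show ?thesis
  proof cases
    case 1
    then have lt: "ea < eb" using assms unfolding k by simp
    have "TC (bb p1 ea p2 eb) = - bb p1 ea p2 eb" using c 1
      by (simp add: TC_bb TCb_def sc_minus_one)
    moreover have "TS (bb p1 ea p2 eb) = sc q (bb p1 eb p2 ea)" using c lt by (simp add: TS_bb)
    ultimately have "- (bb p1 ea p2 eb) - sc q (bb p2 eb p1 ea) \<in> W2"
      using 1 by (intro W2_I[of "bb p1 ea p2 eb"]) simp_all
    then have "sc (-1) (- (bb p1 ea p2 eb) - sc q (bb p2 eb p1 ea)) \<in> W2" by (rule W2_sc)
    moreover have "sc (-1) (- (bb p1 ea p2 eb) - sc q (bb p2 eb p1 ea)) = bb p1 ea p2 eb - sc (- q) (bb p2 eb p1 ea) - 0"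
      by (simp add: fun_eq_iff fapp)
    ultimately show ?thesis unfolding b using ev1_uminus[OF ev1_qq[of N]] small_0[of "inner k1 k2"]
      by (intro exI[of _ "- q"] exI[of _ 0]) simp
  next
    case 2
    obtain h where h: "small (between p1 ea p2 eb) h" "TC (bb p1 ea p2 eb) = sc (mu p1 p2) (bb p2 ea p1 eb) + h"
      using TC_down[OF 2 c] by blast
    obtain h' where h': "small (between p1 eb p2 ea) h'" "TC (bb p1 eb p2 ea) = sc (mu p1 p2) (bb p2 eb p1 ea) + h'"
      using TC_down[OF 2 c(2,1)] by blast
    have sh: "small (inner k1 k2) h" "small (inner k1 k2) h'"
      using h(1) h'(1) between_inner[OF c c] between_inner[OF c c(2,1)] unfolding k by (auto elim!: small_mono)
    consider (eq) "ea = eb" | (gt) "eb < ea" | (lt) "ea < eb" by linarith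
    then show ?thesis
    proof cases
      case eq
      let ?f = "sc (- inverse (q^2)) (bb p1 ea p2 eb)"
      have "TC ?f - TS ?f = bb p1 ea p2 eb - sc (inverse (q^2) * mu p1 p2) (bb p2 eb p1 ea) - sc (inverse (q^2)) h"
        using c eq h by (simp add: lntD[OF lnt_TC] lntD[OF lnt_TS] TS_bb sc_add) (simp add: fun_eq_iff fapp algebra_simps)
      then have "bb p1 ea p2 eb - sc (inverse (q^2) * mu p1 p2) (bb p2 eb p1 ea) - sc (inverse (q^2)) h \<in> W2"
        by (intro W2_I[of ?f]) simp_all
      moreover have "ev1 (inverse (q^2) * mu p1 p2) (1 * - 1)" by (intro ev1_mult ev1_q2 ev1_mu)
      moreover have "small (inner k1 k2) (sc (inverse (q^2)) h)" by (rule small_sc[OF ev1_q2(4) sh(1)])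
      ultimately show ?thesis unfolding b by auto
    next
      case gt
      let ?f = "sc (- inverse q) (bb p1 eb p2 ea)"
      have "TC ?f - TS ?f = bb p1 ea p2 eb - sc (inverse q * mu p1 p2) (bb p2 eb p1 ea) - sc (inverse q) h'"
        using c gt h' by (simp add: lntD[OF lnt_TC] lntD[OF lnt_TS] TS_bb sc_add) (simp add: fun_eq_iff fapp algebra_simps)
      then have "bb p1 ea p2 eb - sc (inverse q * mu p1 p2) (bb p2 eb p1 ea) - sc (inverse q) h' \<in> W2"
        by (intro W2_I[of ?f]) simp_all
      moreover have "ev1 (inverse q * mu p1 p2) (1 * - 1)" by (intro ev1_mult ev1_q2 ev1_mu)
      moreover have "small (inner k1 k2) (sc (inverse q) h')" by (rule small_sc[OF ev1_q2(3) sh(2)])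
      ultimately show ?thesis unfolding b by auto
    next
      case lt
      \<comment> \<open>The second summand cancels the Hecke term that T^s produces from the first.
        Its price is the vector with only the positions exchanged, which is inner as well and has a
        coefficient vanishing at q = 1.\<close>
      let ?f = "sc (- inverse q) (bb p1 eb p2 ea) - sc (inverse (q^2) - 1) (bb p1 ea p2 eb)"
      let ?h = "sc (inverse q) h' + sc (inverse (q^2) - 1) (sc (mu p1 p2) (bb p2 ea p1 eb) + h)"
      have "TC ?f - TS ?f = bb p1 ea p2 eb - sc (inverse q * mu p1 p2) (bb p2 eb p1 ea) - ?h"
        using c lt h h' by (simp add: lntD[OF lnt_TC] lntD[OF lnt_TS] TS_bb sc_add)
          (simp add: fun_eq_iff fapp field_simps power2_eq_square)
      then have "bb p1 ea p2 eb - sc (inverse q * mu p1 p2) (bb p2 eb p1 ea) - ?h \<in> W2"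
        by (intro W2_I[of ?f]) simp_all
      moreover have "ev1 (inverse q * mu p1 p2) (1 * - 1)" by (intro ev1_mult ev1_q2 ev1_mu)
      moreover have "small (inner k1 k2) ?h"
      proof -
        have "iN * p2 < iN * p1" using 2 N2 by simp
        then have "inner k1 k2 [ea - iN * p2, eb - iN * p1]"
          unfolding inner_def k using lt samew_two[OF c, of p2 p1 p1 p2 ea eb] by auto
        then have "small (inner k1 k2) (sc ((inverse (q^2) - 1) * mu p1 p2) (bb p2 ea p1 eb))"
          unfolding bb_def using ev1_mult[OF ev1_q2(2) ev1_mu[of p1 p2]] by (intro small_bvec) simp_all
        moreover have "small (inner k1 k2) (sc (inverse (q^2) - 1) h)" by (rule small_sc[OF ev1_q2(2) sh(1)])
        moreover have "small (inner k1 k2) (sc (inverse q) h')" by (rule small_sc[OF ev1_q2(3) sh(2)])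
        ultimately show ?thesis by (simp add: sc_add small_add)
      qed
      ultimately show ?thesis unfolding b by auto
    qed
  qed
qed

text \<open>On this vector T^c has the eigenvalue -1 and T^s the eigenvalue q^2, and these
  differ.\<close>

lemma straight2_eq: "bvec [k, k] \<in> W2"
proof -
  let ?b = "bb (pos k) (bar k) (pos k) (bar k)"
  have "TC ?b - TS ?b = sc (- (q^2 + 1)) ?b"
    by (simp add: TC_bb TCb_def TS_bb) (simp add: fun_eq_iff fapp algebra_simps)
  then have "sc (- (q^2 + 1)) ?b \<in> W2" by (intro W2_I[of ?b]) simp_all
  then have "sc (- inverse (q^2 + 1)) (sc (- (q^2 + 1)) ?b) \<in> W2" by (rule W2_sc)
  moreover have "sc (- inverse (q^2 + 1)) (sc (- (q^2 + 1)) ?b) = ?b"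
    using qq_sq_plus_one[of N] by (simp only: sc_sc minus_mult_minus left_inverse sc_1 not_False_eq_True)
  ultimately show ?thesis by (simp add: bvec_bb)
qed

end

section \<open>Straightening of words of any length\<close>

lemma not_decreasing_split:
  "\<not> sorted_wrt (>) xs \<Longrightarrow> \<exists>us k1 k2 vs. xs = us @ k1 # k2 # vs \<and> k1 \<le> (k2 :: int)"
proof (induction xs)
  case (Cons x xs)
  show ?case
  proof (cases "sorted_wrt (>) xs")
    case False
    then obtain us k1 k2 vs where "xs = us @ k1 # k2 # vs" "k1 \<le> k2" using Cons.IH by blast
    then show ?thesis by (intro exI[of _ "x # us"]) auto
  next
    case True
    then obtain y where y: "y \<in> set xs" "x \<le> y" using Cons.prems by (auto simp: not_less)
    then obtain k2 vs where xs: "xs = k2 # vs" by (cases xs) auto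
    have "y \<le> k2" using y True xs by (auto simp: less_imp_le)
    then show ?thesis using xs y by (intro exI[of _ "[]"]) auto
  qed
qed simp

text \<open>The sum of i x_i with i counted from 0, the termination measure of straightening. It
  drops when the larger index moves forward, and is bounded below as soon as the entries
  are.\<close>

fun ws :: "int list \<Rightarrow> int" where
  "ws [] = 0" | "ws (x # xs) = ws xs + sum_list xs"

lemma ws_append: "ws (us @ vs) = ws us + int (length us) * sum_list vs + ws vs"
  by (induction us) (auto simp: algebra_simps)

lemma ws_lower: "(\<And>x. x \<in> set xs \<Longrightarrow> A \<le> x) \<Longrightarrow> ws (replicate (length xs) A) \<le> ws xs"
proof (induction xs)
  case (Cons x xs)
  have "sum_list (replicate (length xs) A) \<le> sum_list xs" using Cons.prems
  proof (induction xs)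
    case (Cons y ys)
    then show ?case using Cons.IH Cons.prems by (auto intro: add_mono)
  qed simp
  then show ?case using Cons by simp
qed simp

text \<open>The sign of a sequence as a permutation of its decreasing rearrangement; zero if an entry is repeated.\<close>

fun sg :: "int list \<Rightarrow> rat" where
  "sg [] = 1" | "sg (x # xs) = (\<Prod>y\<leftarrow>xs. of_int (sgn (x - y))) * sg xs"

lemma sg_repeated: "\<not> distinct xs \<Longrightarrow> sg xs = 0"
proof (induction xs)
  case (Cons x xs)
  then consider "x \<in> set xs" | "\<not> distinct xs" by auto
  then show ?case
  proof cases
    case 1
    then have "(\<Prod>y\<leftarrow>xs. of_int (sgn (x - y)) :: rat) = 0" by (induction xs) auto
    then show ?thesis by simp
  qed (simp add: Cons.IH)
qed simp

lemma sg_decreasing: "sorted_wrt (>) xs \<Longrightarrow> sg xs = 1"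
proof (induction xs)
  case (Cons x xs)
  have "(\<Prod>y\<leftarrow>xs. of_int (sgn (x - y)) :: rat) = 1" using Cons.prems by (induction xs) auto
  then show ?case using Cons by simp
qed simp

lemma sg_swap_adjacent: "k1 \<noteq> k2 \<Longrightarrow> sg (us @ k1 # k2 # vs) = - sg (us @ k2 # k1 # vs)"
proof (induction us)
  case Nil
  have "of_int (sgn (k2 - k1)) = (- of_int (sgn (k1 - k2)) :: rat)" by (auto simp: sgn_if)
  then show ?case by simp
qed (simp add: mult_ac)

lemma sg_swap: "distinct (us @ x # vs @ y # zs) \<Longrightarrow> sg (us @ x # vs @ y # zs) = - sg (us @ y # vs @ x # zs)"
proof (induction vs arbitrary: us)
  case Nil
  then show ?case using sg_swap_adjacent[of x y us zs] by simp
next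
  case (Cons v vs)
  have "sg (us @ x # v # vs @ y # zs) = - sg (us @ v # x # vs @ y # zs)" using Cons.prems by (intro sg_swap_adjacent) auto
  also have "sg (us @ v # x # vs @ y # zs) = - sg (us @ v # y # vs @ x # zs)"
    using Cons.IH[of "us @ [v]"] Cons.prems by auto
  also have "sg (us @ v # y # vs @ x # zs) = - sg (us @ y # v # vs @ x # zs)" using Cons.prems by (intro sg_swap_adjacent) auto
  finally show ?case by simp
qed

context nl begin

text \<open>One straightening step, with the exchange and the inner terms treated alike. As
  \<open>samew\<close> keeps the sum of the two entries, the strict \<open>l2 < k2\<close> makes
  \<open>ws\<close> decrease.\<close>

definition mv :: "int list \<Rightarrow> int list \<Rightarrow> bool" where
  "mv xs ys \<longleftrightarrow> (\<exists>us k1 k2 l1 l2 vs. xs = us @ k1 # k2 # vs \<and> ys = us @ l1 # l2 # vs \<and> k1 < k2 \<and>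
     k1 \<le> l1 \<and> l1 \<le> k2 \<and> k1 \<le> l2 \<and> l2 < k2 \<and> samew [k1, k2] [l1, l2])"

lemma mv_length: "mv xs ys \<Longrightarrow> length ys = length xs" by (auto simp: mv_def)

lemma mv_samew: "mv xs ys \<Longrightarrow> samew xs ys"
  by (auto simp: mv_def samew_def)

lemma mv_set: "mv xs ys \<Longrightarrow> set xs \<subseteq> {a..b} \<Longrightarrow> set ys \<subseteq> {a..b}"
  by (force simp: mv_def)

lemma mv_lower: "mv xs ys \<Longrightarrow> (\<And>x. x \<in> set xs \<Longrightarrow> a \<le> x) \<Longrightarrow> y \<in> set ys \<Longrightarrow> a \<le> y"
  by (fastforce simp: mv_def)

lemma mv_ws: "mv xs ys \<Longrightarrow> ws ys < ws xs"
proof -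
  assume "mv xs ys"
  then obtain us k1 k2 l1 l2 vs where m: "xs = us @ k1 # k2 # vs" "ys = us @ l1 # l2 # vs" "l2 < k2" "samew [k1, k2] [l1, l2]"
    unfolding mv_def by blast
  then have s: "sum_list (l1 # l2 # vs) = sum_list (k1 # k2 # vs)" by (simp add: samew_def)
  show ?thesis unfolding m(1,2) ws_append s using m(3) by simp
qed

lemma straighten_step:
  assumes "k1 < k2"
  obtains c h where "ev1 c (- 1)" "small (inner k1 k2) h"
    "bvec (us @ k1 # k2 # vs) - sc c (bvec (us @ k2 # k1 # vs)) - (\<Sum>l\<in>supp h. sc (h l) (bvec (us @ l @ vs)))
       \<in> WW (length (us @ k1 # k2 # vs))"
    "\<And>l. l \<in> supp h \<Longrightarrow> mv (us @ k1 # k2 # vs) (us @ l @ vs)"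
    "mv (us @ k1 # k2 # vs) (us @ k2 # k1 # vs)"
proof -
  obtain c h where c: "ev1 c (- 1)" "small (inner k1 k2) h" "bvec [k1, k2] - sc c (bvec [k2, k1]) - h \<in> W2"
    using straight2[OF assms] by blast
  have in2: "\<exists>l1 l2. l = [l1, l2] \<and> inner k1 k2 l" if "l \<in> supp h" for l
    using that c(2) by (auto simp: supp_def small_def inner_def)
  have "fs h" using c(2) by (simp add: small_def)
  then have "h = (\<Sum>l\<in>supp h. sc (h l) (bvec l))" by (rule vec_expand)
  then have "pad us h vs = pad us (\<Sum>l\<in>supp h. sc (h l) (bvec l)) vs" by simp
  also have "\<dots> = (\<Sum>l\<in>supp h. sc (h l) (pad us (bvec l) vs))"
    by (simp add: pad_def tensv_sum tensv_sc)
  also have "\<dots> = (\<Sum>l\<in>supp h. sc (h l) (bvec (us @ l @ vs)))"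
  proof (rule sum.cong[OF refl])
    fix l assume "l \<in> supp h"
    from in2[OF this] obtain l1 l2 where "l = [l1, l2]" by blast
    then show "sc (h l) (pad us (bvec l) vs) = sc (h l) (bvec (us @ l @ vs))" by (simp add: pad_bvec)
  qed
  finally have ph: "pad us h vs = (\<Sum>l\<in>supp h. sc (h l) (bvec (us @ l @ vs)))" .
  have "pad us (bvec [k1, k2] - sc c (bvec [k2, k1]) - h) vs \<in> WW (length (us @ k1 # k2 # vs))"
    by (rule WW_pad[OF c(3)]) simp
  then have W: "bvec (us @ k1 # k2 # vs) - sc c (bvec (us @ k2 # k1 # vs)) - (\<Sum>l\<in>supp h. sc (h l) (bvec (us @ l @ vs)))
       \<in> WW (length (us @ k1 # k2 # vs))"
    by (simp only: pad_lin pad_bvec ph)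
  have m1: "mv (us @ k1 # k2 # vs) (us @ l @ vs)" if "l \<in> supp h" for l
  proof -
    from in2[OF that] obtain l1 l2 where "l = [l1, l2]" "inner k1 k2 [l1, l2]" by auto
    then show ?thesis unfolding mv_def inner_def using assms
      by (intro exI[of _ us] exI[of _ k1] exI[of _ k2] exI[of _ l1] exI[of _ l2] exI[of _ vs]) auto
  qed
  have m2: "mv (us @ k1 # k2 # vs) (us @ k2 # k1 # vs)"
    unfolding mv_def using assms samew_swap[of k1 k2]
    by (intro exI[of _ us] exI[of _ k1] exI[of _ k2] exI[of _ k2] exI[of _ k1] exI[of _ vs]) auto
  show ?thesis using that[OF c(1,2) W m1 m2] .
qed

lemma straighten_repeated: "bvec (us @ k # k # vs) \<in> WW (length (us @ k # k # vs))"
  using WW_pad[OF straight2_eq[of k], of us vs "length (us @ k # k # vs)"] by (simp add: pad_bvec)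

lemma straighten_induct:
  assumes P: "P xs" and mv: "\<And>xs ys. P xs \<Longrightarrow> mv xs ys \<Longrightarrow> P ys" and low: "\<And>xs x. P xs \<Longrightarrow> x \<in> set xs \<Longrightarrow> A \<le> x"
    and step: "\<And>xs. P xs \<Longrightarrow> (\<And>ys. mv xs ys \<Longrightarrow> Q ys) \<Longrightarrow> Q xs"
  shows "Q xs"
  using P
proof (induction "nat (ws xs - ws (replicate (length xs) A))" arbitrary: xs rule: less_induct)
  case less
  show ?case
  proof (rule step[OF less.prems])
    fix ys assume m: "mv xs ys"
    have Pys: "P ys" using mv[OF less.prems m] .
    have "ws (replicate (length xs) A) \<le> ws ys" using ws_lower[of ys A] low[OF Pys] mv_length[OF m] by simp
    then have "nat (ws ys - ws (replicate (length ys) A)) < nat (ws xs - ws (replicate (length xs) A))"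
      using mv_ws[OF m] mv_length[OF m] by simp
    then show "Q ys" using less.hyps Pys by blast
  qed
qed

text \<open>Straightening stops only at strictly decreasing words or at equal neighbours, and the
  latter are relations. A stable class of words without decreasing members leaves only the second
  possibility.\<close>

lemma straighten_zero:
  assumes "P xs" and mv: "\<And>xs ys. P xs \<Longrightarrow> mv xs ys \<Longrightarrow> P ys" and low: "\<And>xs x. P xs \<Longrightarrow> x \<in> set xs \<Longrightarrow> A \<le> x"
    and no: "\<And>xs. P xs \<Longrightarrow> \<not> sorted_wrt (>) xs"
  shows "bvec xs \<in> WW (length xs)"
  using assms(1) mv low
proof (rule straighten_induct)
  fix xs assume P: "P xs" and IH: "\<And>ys. mv xs ys \<Longrightarrow> bvec ys \<in> WW (length ys)"
  obtain us k1 k2 vs where xs: "xs = us @ k1 # k2 # vs" "k1 \<le> k2" using not_decreasing_split[OF no[OF P]] by blast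
  show "bvec xs \<in> WW (length xs)"
  proof (cases "k1 = k2")
    case True
    then show ?thesis using straighten_repeated xs by simp
  next
    case False
    then have lt: "k1 < k2" using xs by simp
    from straighten_step[OF lt, of us vs] obtain c h where ch: "ev1 c (- 1)" "small (inner k1 k2) h"
      "bvec xs - sc c (bvec (us @ k2 # k1 # vs)) - (\<Sum>l\<in>supp h. sc (h l) (bvec (us @ l @ vs))) \<in> WW (length xs)"
      "\<And>l. l \<in> supp h \<Longrightarrow> mv xs (us @ l @ vs)" "mv xs (us @ k2 # k1 # vs)"
      unfolding xs(1) by blast
    have "bvec (us @ k2 # k1 # vs) \<in> WW (length xs)" using IH[OF ch(5)] mv_length[OF ch(5)] by simp
    moreover have "(\<Sum>l\<in>supp h. sc (h l) (bvec (us @ l @ vs))) \<in> WW (length xs)"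
    proof (intro WW_sum WW_sc)
      fix l assume "l \<in> supp h"
      from ch(4)[OF this] show "bvec (us @ l @ vs) \<in> WW (length xs)" using IH mv_length by metis
    qed
    ultimately have "(bvec xs - sc c (bvec (us @ k2 # k1 # vs)) - (\<Sum>l\<in>supp h. sc (h l) (bvec (us @ l @ vs))))
       + (sc c (bvec (us @ k2 # k1 # vs)) + (\<Sum>l\<in>supp h. sc (h l) (bvec (us @ l @ vs)))) \<in> WW (length xs)"
      using ch(3) by (intro WW_add WW_sc)
    then show ?thesis by simp
  qed
qed

text \<open>Only the value of the scalar at q = 1 is found: there each exchange contributes -1 and
  all inner terms disappear, which leaves the sign of the rearrangement.\<close>

lemma straighten_single:
  assumes "P xs" and mv: "\<And>xs ys. P xs \<Longrightarrow> mv xs ys \<Longrightarrow> P ys" and low: "\<And>xs x. P xs \<Longrightarrow> x \<in> set xs \<Longrightarrow> A \<le> x"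
    and single: "\<And>xs. P xs \<Longrightarrow> sorted_wrt (>) xs \<Longrightarrow> xs = T"
  shows "\<exists>c. ev1 c (sg xs) \<and> bvec xs - sc c (bvec T) \<in> WW (length xs)"
  using assms(1) mv low
proof (rule straighten_induct)
  fix xs assume P: "P xs" and IH: "\<And>ys. mv xs ys \<Longrightarrow> \<exists>c. ev1 c (sg ys) \<and> bvec ys - sc c (bvec T) \<in> WW (length ys)"
  show "\<exists>c. ev1 c (sg xs) \<and> bvec xs - sc c (bvec T) \<in> WW (length xs)"
  proof (cases "sorted_wrt (>) xs")
    case True
    then have "xs = T" "sg xs = 1" using single[OF P] sg_decreasing by blast+
    then show ?thesis by (intro exI[of _ 1]) (simp add: WW.zero)
  next
    case False
    obtain us k1 k2 vs where xs: "xs = us @ k1 # k2 # vs" "k1 \<le> k2" using not_decreasing_split[OF False] by blast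
    show ?thesis
    proof (cases "k1 = k2")
      case True
      then have "sg xs = 0" using xs by (intro sg_repeated) auto
      then show ?thesis using straighten_repeated xs True by (intro exI[of _ 0]) simp
    next
      case False
      then have lt: "k1 < k2" using xs by simp
      from straighten_step[OF lt, of us vs] obtain c h where ch: "ev1 c (- 1)" "small (inner k1 k2) h"
        "bvec xs - sc c (bvec (us @ k2 # k1 # vs)) - (\<Sum>l\<in>supp h. sc (h l) (bvec (us @ l @ vs))) \<in> WW (length xs)"
        "\<And>l. l \<in> supp h \<Longrightarrow> mv xs (us @ l @ vs)" "mv xs (us @ k2 # k1 # vs)"
        unfolding xs(1) by blast
      obtain c1 where c1: "ev1 c1 (sg (us @ k2 # k1 # vs))" "bvec (us @ k2 # k1 # vs) - sc c1 (bvec T) \<in> WW (length xs)"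
        using IH[OF ch(5)] mv_length[OF ch(5)] by auto
      have "\<forall>l\<in>supp h. \<exists>c. ev1 c (sg (us @ l @ vs)) \<and> bvec (us @ l @ vs) - sc c (bvec T) \<in> WW (length xs)"
        using IH ch(4) mv_length by metis
      then obtain cl where cl: "\<And>l. l \<in> supp h \<Longrightarrow> ev1 (cl l) (sg (us @ l @ vs)) \<and> bvec (us @ l @ vs) - sc (cl l) (bvec T) \<in> WW (length xs)"
        by metis
      define C where "C = c * c1 + (\<Sum>l\<in>supp h. h l * cl l)"
      have "ev1 (\<Sum>l\<in>supp h. h l * cl l) (\<Sum>l\<in>supp h. 0 * sg (us @ l @ vs))"
        using ch(2) cl by (intro ev1_sum ev1_mult) (auto simp: small_def)
      then have "ev1 C (- 1 * sg (us @ k2 # k1 # vs) + (\<Sum>l\<in>supp h. 0 * sg (us @ l @ vs)))"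
        unfolding C_def using ch(1) c1 by (intro ev1_add ev1_mult)
      then have e: "ev1 C (sg xs)" using sg_swap_adjacent[of k1 k2 us vs] lt xs by simp
      have "(bvec xs - sc c (bvec (us @ k2 # k1 # vs)) - (\<Sum>l\<in>supp h. sc (h l) (bvec (us @ l @ vs))))
         + (sc c (bvec (us @ k2 # k1 # vs) - sc c1 (bvec T)) + (\<Sum>l\<in>supp h. sc (h l) (bvec (us @ l @ vs) - sc (cl l) (bvec T))))
           \<in> WW (length xs)"
        using ch(3) c1 cl by (intro WW_add WW_sc WW_sum) auto
      moreover have "(bvec xs - sc c (bvec (us @ k2 # k1 # vs)) - (\<Sum>l\<in>supp h. sc (h l) (bvec (us @ l @ vs))))
         + (sc c (bvec (us @ k2 # k1 # vs) - sc c1 (bvec T)) + (\<Sum>l\<in>supp h. sc (h l) (bvec (us @ l @ vs) - sc (cl l) (bvec T))))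
         = bvec xs - sc C (bvec T)"
        unfolding C_def by (simp add: fun_eq_iff fapp sum_fun_apply algebra_simps sum_subtractf sum_distrib_left)
      ultimately show ?thesis using e by auto
    qed
  qed
qed

definition dlist :: "int \<Rightarrow> nat \<Rightarrow> int list" where "dlist b n = map (\<lambda>j. b - int j) [0..<n]"

lemma dlist_desc: "sorted_wrt (>) (dlist b n)"
  by (auto simp: dlist_def sorted_wrt_map sorted_wrt_iff_nth_less)

lemma dlist_unique:
  assumes "sorted_wrt (>) xs" "length xs = n" "set xs \<subseteq> {b - int n + 1..b}"
  shows "xs = dlist b n"
proof -
  have d: "distinct xs" using assms(1) by (induction xs) auto
  have c: "card {b - int n + 1..b} = n" by simp
  have "set xs = {b - int n + 1..b}"
    using assms d c by (intro card_subset_eq) (auto simp: distinct_card)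
  moreover have "set (dlist b n) \<subseteq> {b - int n + 1..b}" by (auto simp: dlist_def)
  moreover have "distinct (dlist b n)" using dlist_desc by (induction "dlist b n") (auto simp: dlist_def distinct_map inj_on_def)
  ultimately have s: "set xs = set (dlist b n)"
  proof -
    assume sx: "set xs = {b - int n + 1..b}" and sub: "set (dlist b n) \<subseteq> {b - int n + 1..b}" and dd: "distinct (dlist b n)"
    have "card (set (dlist b n)) = n" using distinct_card[OF dd] by (simp add: dlist_def)
    then have "set (dlist b n) = {b - int n + 1..b}" using sub c by (intro card_subset_eq) auto
    then show ?thesis using sx by simp
  qed
  have "sorted_wrt (<) (rev xs)" "sorted_wrt (<) (rev (dlist b n))"
    using assms(1) dlist_desc by (simp_all add: sorted_wrt_rev)
  then have "rev xs = rev (dlist b n)" using s by (intro strict_sorted_equal) auto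
  then show ?thesis by simp
qed

lemma interval_zero:
  assumes "length xs = n" "set xs \<subseteq> {b - int n + 1..b}" "\<not> samew (dlist b n) xs"
  shows "bvec xs \<in> WW n"
proof -
  let ?P = "\<lambda>xs. length xs = n \<and> set xs \<subseteq> {b - int n + 1..b} \<and> \<not> samew (dlist b n) xs"
  have "bvec xs \<in> WW (length xs)"
  proof (rule straighten_zero[where P = ?P and A = "b - int n + 1"])
    show "?P xs" using assms by simp
    fix xs ys assume P: "?P xs" and m: "mv xs ys"
    show "?P ys" using P mv_length[OF m] mv_set[OF m] mv_samew[OF m] by (auto simp: samew_def)
  next
    fix xs x assume "?P xs" "x \<in> set xs"
    then show "b - int n + 1 \<le> x" by auto
  next
    fix xs assume P: "?P xs"
    show "\<not> sorted_wrt (>) xs"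
    proof
      assume "sorted_wrt (>) xs"
      then have "xs = dlist b n" using dlist_unique P by blast
      then show False using P by (simp add: samew_def)
    qed
  qed
  then show ?thesis using assms by simp
qed

lemma interval_single:
  assumes "length xs = n" "set xs \<subseteq> {b - int n + 1..b}"
  shows "\<exists>c. ev1 c (sg xs) \<and> bvec xs - sc c (bvec (dlist b n)) \<in> WW n"
proof -
  let ?P = "\<lambda>xs. length xs = n \<and> set xs \<subseteq> {b - int n + 1..b}"
  have "\<exists>c. ev1 c (sg xs) \<and> bvec xs - sc c (bvec (dlist b n)) \<in> WW (length xs)"
  proof (rule straighten_single[where P = ?P and A = "b - int n + 1"])
    show "?P xs" using assms by simp
    fix xs ys assume P: "?P xs" and m: "mv xs ys"
    show "?P ys" using P mv_length[OF m] mv_set[OF m] by simp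
  next
    fix xs x assume "?P xs" "x \<in> set xs"
    then show "b - int n + 1 \<le> x" by auto
  next
    fix xs assume "?P xs" "sorted_wrt (>) xs"
    then show "xs = dlist b n" using dlist_unique by blast
  qed
  then show ?thesis using assms by simp
qed

end

section \<open>Blocks of N L consecutive indices\<close>

context nl begin

definition NL :: int where "NL = int (N * L)"

lemma NL_pos: "0 < NL" using N2 L2 by (simp add: NL_def)

lemma und_bounds: "- (NL * (und k + 1)) < k" "k \<le> - (NL * und k)"
proof -
  have k: "k = bar k - iN * dot k - NL * und k" using pos_bar[of k] by (simp add: pos_dot NL_def algebra_simps)
  have a: "iN * 1 \<le> iN * dot k" "iN * dot k \<le> iN * iL" using dot_range[of k] by (intro mult_left_mono; simp)+
  have "NL * (und k + 1) = NL * und k + iN * iL" by (simp add: NL_def algebra_simps)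
  then show "- (NL * (und k + 1)) < k" "k \<le> - (NL * und k)" using k a bar_range[of k] by linarith+
qed

lemma und_le_iff: "und k \<le> B \<longleftrightarrow> - (NL * (B + 1)) < k"
proof
  assume "und k \<le> B"
  then have "NL * (und k + 1) \<le> NL * (B + 1)" using NL_pos by (intro mult_left_mono) auto
  then show "- (NL * (B + 1)) < k" using und_bounds(1)[of k] by linarith
next
  assume a: "- (NL * (B + 1)) < k"
  show "und k \<le> B"
  proof (rule ccontr)
    assume "\<not> und k \<le> B"
    then have "NL * (B + 1) \<le> NL * und k" using NL_pos by (intro mult_left_mono) auto
    then show False using a und_bounds(2)[of k] by linarith
  qed
qed

lemma dlist_length [simp]: "length (dlist b n) = n" by (simp add: dlist_def)

lemma dlist_set: "set (dlist b n) = {b - int n + 1..b}"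
proof
  show "set (dlist b n) \<subseteq> {b - int n + 1..b}" by (auto simp: dlist_def)
  show "{b - int n + 1..b} \<subseteq> set (dlist b n)"
  proof
    fix x assume x: "x \<in> {b - int n + 1..b}"
    then have "x = b - int (nat (b - x))" "nat (b - x) \<in> {0..<n}" by auto
    then show "x \<in> set (dlist b n)" unfolding dlist_def set_map set_upt by blast
  qed
qed

lemma dlist_append: "dlist b (n + m) = dlist b n @ dlist (b - int n) m"
proof (rule nth_equalityI)
  fix i assume "i < length (dlist b (n + m))"
  then show "dlist b (n + m) ! i = (dlist b n @ dlist (b - int n) m) ! i"
    by (auto simp: dlist_def nth_append)
qed simp

lemma dlist_distinct: "distinct (dlist b n)"
  by (simp add: dlist_def distinct_map inj_on_def)

definition blk :: "int \<Rightarrow> int list" where "blk m = dlist (- (NL * m)) (N * L)"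

lemma vbar_blk: "vbar N L m = bvec (blk m)" by (simp add: vbar_def blk_def dlist_def NL_def)

lemma blk_length [simp]: "length (blk m) = N * L" by (simp add: blk_def)

lemma blk_set: "x \<in> set (blk m) \<longleftrightarrow> und x = m"
proof -
  have "und x = m \<longleftrightarrow> und x \<le> m \<and> \<not> und x \<le> m - 1" by auto
  then show ?thesis unfolding und_le_iff blk_def dlist_set NL_def[symmetric] by (auto simp: algebra_simps)
qed

lemma blocks_set: "x \<in> set (dlist (- (NL * m)) (R * (N * L))) \<longleftrightarrow> m \<le> und x \<and> und x < m + int R"
proof -
  have "m \<le> und x \<and> und x < m + int R \<longleftrightarrow> und x \<le> m + int R - 1 \<and> \<not> und x \<le> m - 1" by auto
  then show ?thesis unfolding und_le_iff dlist_set by (auto simp: NL_def algebra_simps)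
qed

lemma blocks_Suc: "dlist (- (NL * m)) (Suc R * (N * L)) = dlist (- (NL * m)) (R * (N * L)) @ blk (m + int R)"
proof -
  have "Suc R * (N * L) = R * (N * L) + N * L" by simp
  moreover have "- (NL * m) - int (R * (N * L)) = - (NL * (m + int R))" by (simp add: NL_def algebra_simps)
  ultimately show ?thesis unfolding blk_def by (simp only: dlist_append)
qed

section \<open>Energy estimate\<close>

text \<open>Pauli principle: distinct entries attain their least total energy by occupying levels of
  non-positive energy, each at most once, and all negative ones that they may use lie in G.\<close>

lemma distinct_sum_ge:
  fixes th :: "int \<Rightarrow> int"
  assumes "distinct ys" "finite G" "\<And>y. y \<in> set ys \<Longrightarrow> y \<notin> G \<Longrightarrow> 0 \<le> th y" "\<And>y. y \<in> G \<Longrightarrow> th y \<le> 0"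
  shows "sum th G \<le> sm th ys"
proof -
  have "sum th G \<le> sum th (G \<inter> set ys)" using assms(2,4)
    using sum_mono2[of G "G \<inter> set ys" "\<lambda>y. - th y"] by (simp add: sum_negf)
  also have "\<dots> \<le> sum th (set ys)" using assms by (intro sum_mono2) auto
  also have "\<dots> = sm th ys" using assms(1) by (simp add: sum_list_distinct_conv_sum_set)
  finally show ?thesis .
qed

lemma opx_bvec_supp:
  assumes inv: "\<And>x y. g x = Some y \<longleftrightarrow> h y = Some x" and "opx q bf af h (bvec xs) ys \<noteq> 0"
  shows "\<exists>us x y vs. xs = us @ x # vs \<and> ys = us @ y # vs \<and> g x = Some y"
proof -
  from opx_nonzero[OF assms(2)] obtain us y vs x where "ys = us @ y # vs" "h y = Some x" "bvec xs (us @ x # vs) \<noteq> 0"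
    by blast
  then show ?thesis using inv by (auto simp: bvec_def split: if_splits)
qed

text \<open>Every application lowers the energy \<open>th\<close> by at least one, while a strictly
  decreasing word cannot have less energy than the sea of R blocks together with S further levels.
  Straightening preserves the energy, so after \<open>s0\<close> applications nothing survives. It
  matters that \<open>s0\<close> is independent of R, since s applications of F to a class consume s
  blocks of its tail.\<close>

lemma energy_vanishing:
  fixes ck :: "int \<Rightarrow> int" and c1 cN dlt m :: int and S :: nat
  assumes inv: "\<And>x y. g x = Some y \<longleftrightarrow> h y = Some x"
    and g: "\<And>x y. g x = Some y \<Longrightarrow> ck x = cN \<and> ck y = c1 \<and> und y = und x - dlt"
    and d: "0 \<le> dlt" "dlt \<le> 1" and c: "c1 \<noteq> cN"
    and w: "\<And>f. wfun (\<lambda>k. f (ck k))"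
    and S: "\<And>l. finite {y. und y = l \<and> ck y = c1}" "\<And>l. card {y. und y = l \<and> ck y = c1} = S"
  shows "\<exists>s0. \<forall>s\<ge>s0. \<forall>R. (\<forall>x\<in>set xs. und x < m + int R) \<longrightarrow>
    (opx q bf af h ^^ s) (bvec (xs @ dlist (- (NL * m)) (R * (N * L)))) \<in> WW (length xs + R * (N * L))"
proof -
  \<comment> \<open>The first part measures the power of z relative to the level just above the sea.
    F may increase it by \<open>dlt\<close>, at most one, but the change of colour from cN to c1
    lowers the second part by two.\<close>
  define th where "th = (\<lambda>y. (m - 1 - und y) + (dl (ck y = cN) - dl (ck y = c1)))"
  define s0 where "s0 = nat (int S + sm th xs + 1)"
  have thw: "sm th xs = sm th ys" if "samew xs ys" for xs ys
  proof -
    have "length xs = length ys" using that by (metis length_map samew_def size_mset)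
    moreover have "sm und xs = sm und ys" using wfun_und that by (simp add: wfun_def)
    moreover have "sm (\<lambda>y. dl (ck y = cN) - dl (ck y = c1)) xs = sm (\<lambda>y. dl (ck y = cN) - dl (ck y = c1)) ys"
      using w[of "\<lambda>x. dl (x = cN) - dl (x = c1)"] that by (simp add: wfun_def)
    moreover have "sm th zs = int (length zs) * (m - 1) - sm und zs + sm (\<lambda>y. dl (ck y = cN) - dl (ck y = c1)) zs" for zs
      by (induction zs) (simp_all add: th_def algebra_simps)
    ultimately show ?thesis by simp
  qed
  have thg: "th y \<le> th x - 1" if "g x = Some y" for x y
    using g[OF that] d c by (auto simp: th_def dl_def)
  show ?thesis
  proof (intro exI[of _ s0] allI impI)
    fix s R assume s: "s0 \<le> s" and und: "\<forall>x\<in>set xs. und x < m + int R"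
    define T where "T = dlist (- (NL * m)) (R * (N * L))"
    define n where "n = length xs + R * (N * L)"
    \<comment> \<open>Outside the sea only the colour c1 at exponent m - 1 has negative energy,
      namely -1 for each of its S indices.\<close>
    define G where "G = set T \<union> {y. und y = m - 1 \<and> ck y = c1}"
    have disj: "set T \<inter> {y. und y = m - 1 \<and> ck y = c1} = {}" unfolding T_def by (auto simp: blocks_set)
    have "sum th {y. und y = m - 1 \<and> ck y = c1} = sum (\<lambda>_. - 1) {y. und y = m - 1 \<and> ck y = c1}"
      using c by (intro sum.cong) (auto simp: th_def dl_def)
    also have "\<dots> = - int S" using S by simp
    finally have sG: "sum th G = sm th T - int S"
      unfolding G_def using sum.union_disjoint[OF _ S(1) disj, of th] dlist_distinct[of "- (NL * m)" "R * (N * L)"]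
      by (simp add: sum_list_distinct_conv_sum_set T_def)
    let ?P = "\<lambda>ys. (\<forall>y\<in>set ys. und y < m + int R) \<and> sm th ys < sm th T - int S"
    have bW: "bvec ys \<in> WW (length ys)" if "?P ys" for ys
    proof (rule straighten_zero[where P = ?P and A = "- (NL * (m + int R)) + 1"])
      show "?P ys" using that .
      have low: "und y < m + int R \<longleftrightarrow> - (NL * (m + int R)) + 1 \<le> y" for y
        using und_le_iff[of y "m + int R - 1"] by (simp add: algebra_simps) linarith
      fix xs' ys' assume P: "?P xs'" and mv: "mv xs' ys'"
      have "\<forall>y\<in>set ys'. und y < m + int R" unfolding low
        using mv_lower[OF mv, of "- (NL * (m + int R)) + 1"] P unfolding low by blast
      then show "?P ys'" using P thw[OF mv_samew[OF mv]] by simp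
    next
      fix xs' x assume "?P xs'" "x \<in> set xs'"
      then have "und x \<le> m + int R - 1" by auto
      then show "- (NL * (m + int R)) + 1 \<le> x" unfolding und_le_iff by simp
    next
      fix ys assume P: "?P ys"
      show "\<not> sorted_wrt (>) ys"
      proof
        assume "sorted_wrt (>) ys"
        then have "distinct ys" by (induction ys) auto
        then have "sum th G \<le> sm th ys"
        proof (rule distinct_sum_ge)
          show "finite G" unfolding G_def using S(1) by simp
          fix y assume y: "y \<in> set ys" "y \<notin> G"
          then have "\<not> (m \<le> und y \<and> und y < m + int R)" "\<not> (und y = m - 1 \<and> ck y = c1)" "und y < m + int R"
            using P unfolding G_def T_def by (auto simp: blocks_set)
          then show "0 \<le> th y" by (auto simp: th_def dl_def)
        next
          fix y assume "y \<in> G"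
          then have "m \<le> und y \<or> (und y = m - 1 \<and> ck y = c1)" unfolding G_def T_def by (auto simp: blocks_set)
          then show "th y \<le> 0" using c by (auto simp: th_def dl_def)
        qed
        then show False using sG P by simp
      qed
    qed
    have supp: "(opx q bf af h ^^ k) (bvec (xs @ T)) \<in> tens n \<and>
       (\<forall>ys. (opx q bf af h ^^ k) (bvec (xs @ T)) ys \<noteq> 0 \<longrightarrow> (\<forall>y\<in>set ys. und y < m + int R) \<and> sm th ys \<le> sm th xs + sm th T - int k)" for k
    proof (induction k)
      case 0
      have "bvec (xs @ T) \<in> tens n" by (simp add: n_def T_def)
      then show ?case using und by (auto simp: T_def bvec_def blocks_set split: if_splits)
    next
      case (Suc k)
      let ?v = "(opx q bf af h ^^ k) (bvec (xs @ T))"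
      have "opx q bf af h ?v \<in> tens n" using Suc opx_tens[OF qq_nonzero inv] by blast
      moreover have "(\<forall>y\<in>set ys. und y < m + int R) \<and> sm th ys \<le> sm th xs + sm th T - int (Suc k)"
        if "opx q bf af h ?v ys \<noteq> 0" for ys
      proof -
        from opx_nonzero[OF that] obtain us y vs x where u: "ys = us @ y # vs" "h y = Some x" "?v (us @ x # vs) \<noteq> 0" by blast
        then have gx: "g x = Some y" using inv by blast
        have "und y \<le> und x" using g[OF gx] d by simp
        then show ?thesis using Suc u thg[OF gx] by fastforce
      qed
      ultimately show ?case by simp
    qed
    have "(opx q bf af h ^^ s) (bvec (xs @ T)) \<in> WW n"
    proof (rule WW_of_basis)
      show "fs ((opx q bf af h ^^ s) (bvec (xs @ T)))" using supp tens_fs by blast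
      fix ys assume y: "(opx q bf af h ^^ s) (bvec (xs @ T)) ys \<noteq> 0"
      then have "length ys = n" using supp[of s] tens_length by blast
      moreover have "?P ys" using supp[of s] y s unfolding s0_def by fastforce
      ultimately show "bvec ys \<in> WW n" using bW by blast
    qed
    then show "(opx q bf af h ^^ s) (bvec (xs @ dlist (- (NL * m)) (R * (N * L)))) \<in> WW (length xs + R * (N * L))"
      by (simp add: T_def n_def)
  qed
qed

section \<open>Raising and lowering operators on consecutive indices\<close>

definition wop :: "(int \<Rightarrow> int) \<Rightarrow> (int \<Rightarrow> int) \<Rightarrow> (int \<Rightarrow> int option) \<Rightarrow> (int \<Rightarrow> int option) \<Rightarrow> bool" where
  "wop bf af g h \<longleftrightarrow> (\<forall>x y. g x = Some y \<longleftrightarrow> h y = Some x) \<and> (\<forall>w\<in>W2. opx q bf af h w \<in> W2) \<and> wfun bf \<and> wfun af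
     \<and> (\<forall>m. sm bf (blk m) = 0) \<and> (\<forall>m. sm af (blk m) = 0)"

definition Eop where "Eop bf af g h \<longleftrightarrow> wop bf af g h \<and> (\<forall>x y. g x = Some y \<longrightarrow> x - NL \<le> y \<and> y < x)"
definition Fop where "Fop bf af g h \<longleftrightarrow> wop bf af g h \<and> (\<forall>x y. g x = Some y \<longrightarrow> x < y \<and> y \<le> x + NL)"

lemma wop_inv: "wop bf af g h \<Longrightarrow> g x = Some y \<longleftrightarrow> h y = Some x" by (simp add: wop_def)

lemma wop_tens: "wop bf af g h \<Longrightarrow> v \<in> tens n \<Longrightarrow> opx q bf af h v \<in> tens n"
  by (rule opx_tens[OF qq_nonzero wop_inv])

lemma wop_WW: "wop bf af g h \<Longrightarrow> v \<in> WW n \<Longrightarrow> opx q bf af h v \<in> WW n"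
  by (rule WW_opx[OF wop_inv]) (simp_all add: wop_def W2_kop)

text \<open>A raising operator lowers an index by at most N L. With at least one more block behind,
  all indices stay in an interval as long as the word, but their sum has dropped, so the wedge
  vanishes. This is why raising operators kill the vacuum.\<close>

lemma Eop_tail:
  assumes E: "Eop bf af g h" and k: "N * L \<le> k'"
  shows "tensv k (opx q bf af h (bvec (dlist b k))) (bvec (dlist (b - int k) k')) \<in> WW (k + k')"
proof (rule WW_of_basis)
  have t: "tensv k (opx q bf af h (bvec (dlist b k))) (bvec (dlist (b - int k) k')) \<in> tens (k + k')"
    using E wop_tens by (intro tensv_tens) (auto simp: Eop_def)
  then show "fs (tensv k (opx q bf af h (bvec (dlist b k))) (bvec (dlist (b - int k) k')))" by (rule tens_fs)
  fix zs assume z: "tensv k (opx q bf af h (bvec (dlist b k))) (bvec (dlist (b - int k) k')) zs \<noteq> 0"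
  then have len: "length zs = k + k'" using tens_length[OF t] by blast
  define ys where "ys = take k zs"
  from z have "opx q bf af h (bvec (dlist b k)) ys \<noteq> 0" "drop k zs = dlist (b - int k) k'"
    by (auto simp: tensv_def ys_def bvec_def split: if_splits)
  then have zs: "zs = ys @ dlist (b - int k) k'" and o: "opx q bf af h (bvec (dlist b k)) ys \<noteq> 0"
    by (metis append_take_drop_id ys_def)+
  have "\<And>x y. g x = Some y \<longleftrightarrow> h y = Some x" using E wop_inv by (auto simp: Eop_def)
  from opx_bvec_supp[OF this o] obtain us x y vs where u: "dlist b k = us @ x # vs" "ys = us @ y # vs" "g x = Some y" by blast
  have xy: "x - NL \<le> y" "y < x" using E u(3) by (auto simp: Eop_def)
  have set: "set us \<subseteq> {b - int k + 1..b}" "set vs \<subseteq> {b - int k + 1..b}" "b - int k + 1 \<le> x" "x \<le> b"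
    using dlist_set[of b k] unfolding u(1) by auto
  have NLk: "NL \<le> int k'" using k unfolding NL_def by (simp only: zle_int)
  have "set zs \<subseteq> {b - int (k + k') + 1..b}"
  proof
    fix z assume "z \<in> set zs"
    then consider "z \<in> set us \<or> z \<in> set vs" | "z = y" | "z \<in> {b - int k - int k' + 1..b - int k}"
      unfolding zs u(2) dlist_set[symmetric] by auto
    then have "b - int k - int k' + 1 \<le> z \<and> z \<le> b"
      using set xy NLk NL_pos by cases (auto dest!: subsetD)
    then show "z \<in> {b - int (k + k') + 1..b}" by simp
  qed
  moreover have "\<not> samew (dlist b (k + k')) zs"
    unfolding zs dlist_append u(1,2) samew_def using xy by simp
  ultimately show "bvec zs \<in> WW (k + k')" using len by (intro interval_zero)
qed

text \<open>The mirror image: with at least one block in front, the increased index stays inside the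
  interval while the sum has grown. Hence a lowering operator acts on a tail only through its first
  block.\<close>

lemma Fop_tail:
  assumes F: "Fop bf af g h" and k: "N * L \<le> k'"
  shows "tensv k' (bvec (dlist b k')) (opx q bf af h (bvec (dlist (b - int k') k))) \<in> WW (k' + k)"
proof (rule WW_of_basis)
  have t: "tensv k' (bvec (dlist b k')) (opx q bf af h (bvec (dlist (b - int k') k))) \<in> tens (k' + k)"
    using F wop_tens by (intro tensv_tens) (auto simp: Fop_def)
  then show "fs (tensv k' (bvec (dlist b k')) (opx q bf af h (bvec (dlist (b - int k') k))))" by (rule tens_fs)
  fix zs assume z: "tensv k' (bvec (dlist b k')) (opx q bf af h (bvec (dlist (b - int k') k))) zs \<noteq> 0"
  then have len: "length zs = k' + k" using tens_length[OF t] by blast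
  define ys where "ys = drop k' zs"
  from z have "opx q bf af h (bvec (dlist (b - int k') k)) ys \<noteq> 0" "take k' zs = dlist b k'"
    by (auto simp: tensv_def ys_def bvec_def split: if_splits)
  then have zs: "zs = dlist b k' @ ys" and o: "opx q bf af h (bvec (dlist (b - int k') k)) ys \<noteq> 0"
    by (metis append_take_drop_id ys_def)+
  have "\<And>x y. g x = Some y \<longleftrightarrow> h y = Some x" using F wop_inv by (auto simp: Fop_def)
  from opx_bvec_supp[OF this o] obtain us x y vs where u: "dlist (b - int k') k = us @ x # vs" "ys = us @ y # vs" "g x = Some y" by blast
  have xy: "x < y" "y \<le> x + NL" using F u(3) by (auto simp: Fop_def)
  have set: "set us \<subseteq> {b - int k' - int k + 1..b - int k'}" "set vs \<subseteq> {b - int k' - int k + 1..b - int k'}"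
     "b - int k' - int k + 1 \<le> x" "x \<le> b - int k'"
    using dlist_set[of "b - int k'" k] unfolding u(1) by auto
  have NLk: "NL \<le> int k'" using k unfolding NL_def by (simp only: zle_int)
  have "set zs \<subseteq> {b - int (k' + k) + 1..b}"
  proof
    fix z assume "z \<in> set zs"
    then consider "z \<in> set us \<or> z \<in> set vs" | "z = y" | "z \<in> {b - int k' + 1..b}"
      unfolding zs u(2) dlist_set[symmetric] by auto
    then have "b - int k' - int k + 1 \<le> z \<and> z \<le> b"
      using set xy NLk NL_pos by cases (auto dest!: subsetD)
    then show "z \<in> {b - int (k' + k) + 1..b}" by simp
  qed
  moreover have "\<not> samew (dlist b (k' + k)) zs"
    unfolding zs dlist_append u(1,2) samew_def using xy by simp
  ultimately show "bvec zs \<in> WW (k' + k)" using len by (intro interval_zero)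
qed

text \<open>An operator that keeps the power of z turns the block into words in the same indices but
  with another sum; such wedges vanish. This applies to all generators except E_0 and F_0.\<close>

lemma wop_block:
  assumes w: "wop bf af g h" and u: "\<And>x y. g x = Some y \<Longrightarrow> und y = und x" and ne: "\<And>x y. g x = Some y \<Longrightarrow> x \<noteq> y"
  shows "opx q bf af h (bvec (blk m)) \<in> WW (N * L)"
proof (rule WW_of_basis)
  have t: "opx q bf af h (bvec (blk m)) \<in> tens (N * L)" using wop_tens[OF w] by simp
  then show "fs (opx q bf af h (bvec (blk m)))" by (rule tens_fs)
  fix zs assume z: "opx q bf af h (bvec (blk m)) zs \<noteq> 0"
  then have len: "length zs = N * L" using tens_length[OF t] by blast
  from opx_bvec_supp[OF wop_inv[OF w] z] obtain us x y vs where s: "blk m = us @ x # vs" "zs = us @ y # vs" "g x = Some y" by blast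
  have "y \<in> set (blk m)" using blk_set[of x m] blk_set[of y m] u[OF s(3)] s(1) by auto
  then have "set zs \<subseteq> set (blk m)" using s by auto
  then have "set zs \<subseteq> {- (NL * m) - int (N * L) + 1..- (NL * m)}" by (simp add: blk_def dlist_set)
  moreover have "\<not> samew (dlist (- (NL * m)) (N * L)) zs"
    unfolding blk_def[symmetric] s(1,2) samew_def using ne[OF s(3)] by simp
  ultimately show "bvec zs \<in> WW (N * L)" using len by (intro interval_zero)
qed

end

section \<open>The Fock space\<close>

locale fk = nl +
  fixes M :: int
begin

text \<open>The lengths at which the remaining tail begins at a block boundary, as in the
  presentations by which the operators are defined.\<close>

definition good :: "nat \<Rightarrow> bool" where "good n \<longleftrightarrow> (int n - M) mod int (N * L) = 0"

abbreviation mm :: "nat \<Rightarrow> int" where "mm \<equiv> mof N L M"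
abbreviation ex :: "nat \<Rightarrow> nat \<Rightarrow> vec \<Rightarrow> vec" where "ex \<equiv> extv M"
abbreviation cl :: "nat \<Rightarrow> vec \<Rightarrow> fel" where "cl n v \<equiv> fcl N L M (n, v)"
abbreviation FK :: "fel set" where "FK \<equiv> fock N L M"

lemma good_mm: "good n \<Longrightarrow> M - int n = - (NL * mm n)"
proof -
  assume "good n"
  then have "int (N * L) dvd int n - M" by (simp add: good_def dvd_eq_mod_eq_0)
  then have "int n - M = int (N * L) * mm n" unfolding mof_def by (simp only: dvd_mult_div_cancel)
  then show ?thesis by (simp add: NL_def)
qed

lemma good_add: "good (n + R * (N * L)) \<longleftrightarrow> good n"
proof -
  have "int (n + R * (N * L)) - M = (int n - M) + int (N * L) * int R" by simp
  then show ?thesis unfolding good_def by (simp only: mod_mult_self2)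
qed

lemma good_add1: "good (n + N * L) \<longleftrightarrow> good n" using good_add[of n 1] by simp

lemma mm_add: "good n \<Longrightarrow> mm (n + R * (N * L)) = mm n + int R"
proof -
  assume g: "good n"
  have "M - int (n + R * (N * L)) = - (NL * mm (n + R * (N * L)))" using good_mm good_add g by blast
  moreover have "M - int (n + R * (N * L)) = - (NL * (mm n + int R))"
    using good_mm[OF g] by (simp add: NL_def algebra_simps)
  ultimately show ?thesis using NL_pos by simp
qed

lemma mm_add1: "good n \<Longrightarrow> mm (n + N * L) = mm n + 1" using mm_add[of n 1] by simp

lemma good_diff: "good n \<Longrightarrow> good p \<Longrightarrow> n \<le> p \<Longrightarrow> \<exists>R. p = n + R * (N * L)"
proof -
  assume g: "good n" "good p" "n \<le> p"
  then have "int (N * L) dvd (int p - M) - (int n - M)" unfolding good_def dvd_eq_mod_eq_0[symmetric] by (blast intro: dvd_diff)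
  then have "int (N * L) dvd int (p - n)" using g by (simp add: of_nat_diff)
  then have "N * L dvd p - n" by (simp only: int_dvd_int_iff)
  then obtain R where "p - n = N * L * R" by (auto simp: dvd_def)
  then show ?thesis using g by (intro exI[of _ R]) (simp add: mult.commute)
qed

lemma good_exists: "\<exists>p\<ge>k. good p"
proof -
  define p0 where "p0 = nat (M + \<bar>M\<bar> * NL)"
  have "- \<bar>M\<bar> \<le> M" by simp
  moreover have "\<bar>M\<bar> * 1 \<le> \<bar>M\<bar> * NL" using NL_pos by (intro mult_left_mono) auto
  ultimately have "0 \<le> M + \<bar>M\<bar> * NL" by linarith
  then have "int p0 - M = \<bar>M\<bar> * NL" by (simp add: p0_def)
  then have g: "good p0" by (simp add: good_def NL_def)
  have "good (p0 + k * (N * L))" using g good_add by blast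
  moreover have "k * 1 \<le> k * (N * L)" using N2 L2 by (intro mult_left_mono) auto
  then have "k \<le> p0 + k * (N * L)" by linarith
  ultimately show ?thesis by blast
qed

lemma tailv_dlist: "tailv M n p = dlist (M - int n) (p - n)"
  by (rule nth_equalityI) (auto simp: tailv_def dlist_def)

lemma ex_tensv: "n \<le> p \<Longrightarrow> ex n p v = tensv n v (bvec (dlist (M - int n) (p - n)))"
proof
  fix ys assume n: "n \<le> p"
  have "length ys = p" if "n \<le> length ys" "drop n ys = dlist (M - int n) (p - n)"
  proof -
    have "length (drop n ys) = p - n" using that(2) by simp
    then show ?thesis using that(1) n by simp
  qed
  then show "ex n p v ys = tensv n v (bvec (dlist (M - int n) (p - n))) ys"
    using n unfolding extv_def tensv_def bvec_def tailv_dlist by auto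
qed

lemma ex_ex: "n \<le> p \<Longrightarrow> p \<le> p' \<Longrightarrow> ex p p' (ex n p v) = ex n p' v"
proof -
  assume n: "n \<le> p" "p \<le> p'"
  have d: "dlist (M - int n) (p' - n) = dlist (M - int n) (p - n) @ dlist (M - int p) (p' - p)"
    using dlist_append[of "M - int n" "p - n" "p' - p"] n by (simp add: of_nat_diff)
  have "ex p p' (ex n p v) = tensv (n + (p - n)) (tensv n v (bvec (dlist (M - int n) (p - n)))) (bvec (dlist (M - int p) (p' - p)))"
    using n by (simp add: ex_tensv)
  also have "\<dots> = tensv n v (bvec (dlist (M - int n) (p' - n)))"
    unfolding tensv_assoc[symmetric] d by (simp add: tensv_bvec')
  finally show ?thesis using n by (simp add: ex_tensv)
qed

lemma ex_lin: "ex n p (v + w) = ex n p v + ex n p w" "ex n p (sc c v) = sc c (ex n p v)" "ex n p (v - w) = ex n p v - ex n p w"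
  "ex n p 0 = 0"
  by (auto simp: fun_eq_iff extv_def fapp)

lemma ex_tens: "n \<le> p \<Longrightarrow> v \<in> tens n \<Longrightarrow> ex n p v \<in> tens p"
  using tensv_tens[of v n "bvec (dlist (M - int n) (p - n))" "p - n"] by (simp add: ex_tensv)

lemma ex_WW: "n \<le> p \<Longrightarrow> v \<in> WW n \<Longrightarrow> ex n p v \<in> WW p"
  using WW_right[of "bvec (dlist (M - int n) (p - n))" "p - n" v n] by (simp add: ex_tensv)

lemma ex_same: "v \<in> tens n \<Longrightarrow> ex n n v = v"
proof
  fix ys assume "v \<in> tens n"
  then show "ex n n v ys = v ys" using tens_length[of v n ys] by (auto simp: extv_def tailv_def)
qed

lemma frel_iff: "((n, v), (n', v')) \<in> frel N L M \<longleftrightarrow> v \<in> tens n \<and> v' \<in> tens n' \<and> (\<exists>p\<ge>max n n'. ex n p v - ex n' p v' \<in> WW p)"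
  by (simp add: frel_def reps_def Wsp_WW)

lemma frel_raise:
  assumes "p \<ge> max n n'" "ex n p v - ex n' p v' \<in> WW p" "p \<le> p'"
  shows "ex n p' v - ex n' p' v' \<in> WW p'"
  using ex_WW[OF assms(3,2)] assms by (simp add: ex_lin ex_ex)

lemma equiv_frel: "equiv reps (frel N L M)"
proof (rule equivI)
  show "frel N L M \<subseteq> reps \<times> reps" by (auto simp: frel_def)
  show "refl_on reps (frel N L M)"
    by (auto simp: refl_on_def reps_def frel_iff WW.zero intro!: exI[of _ "_::nat"])
  show "sym (frel N L M)"
  proof (rule symI)
    fix x y assume "(x, y) \<in> frel N L M"
    then obtain n v n' v' p where x: "x = (n, v)" "y = (n', v')" "v \<in> tens n" "v' \<in> tens n'" "p \<ge> max n n'" "ex n p v - ex n' p v' \<in> WW p"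
      by (cases x, cases y) (auto simp: frel_iff)
    then have "ex n' p v' - ex n p v \<in> WW p" using WW_uminus[of "ex n p v - ex n' p v'" p] by simp
    then show "(y, x) \<in> frel N L M" using x by (auto simp: frel_iff intro!: exI[of _ p])
  qed
  show "trans (frel N L M)"
  proof (rule transI)
    fix x y z assume "(x, y) \<in> frel N L M" "(y, z) \<in> frel N L M"
    then obtain n v n' v' n'' v'' p p' where x: "x = (n, v)" "y = (n', v')" "z = (n'', v'')" "v \<in> tens n" "v' \<in> tens n'" "v'' \<in> tens n''"
      "p \<ge> max n n'" "ex n p v - ex n' p v' \<in> WW p" "p' \<ge> max n' n''" "ex n' p' v' - ex n'' p' v'' \<in> WW p'"
      by (cases x, cases y, cases z) (auto simp: frel_iff)
    let ?P = "max p p'"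
    have "ex n ?P v - ex n' ?P v' \<in> WW ?P" "ex n' ?P v' - ex n'' ?P v'' \<in> WW ?P"
      using frel_raise[OF x(7,8)] frel_raise[OF x(9,10)] by simp_all
    then have "(ex n ?P v - ex n' ?P v') + (ex n' ?P v' - ex n'' ?P v'') \<in> WW ?P" by (rule WW_add)
    then have "ex n ?P v - ex n'' ?P v'' \<in> WW ?P" by simp
    then show "(x, z) \<in> frel N L M" using x by (auto simp: frel_iff intro!: exI[of _ ?P])
  qed
qed

lemma cl_eq_iff: "v \<in> tens n \<Longrightarrow> v' \<in> tens n' \<Longrightarrow> cl n v = cl n' v' \<longleftrightarrow> ((n, v), (n', v')) \<in> frel N L M"
  unfolding fcl_def using eq_equiv_class_iff[OF equiv_frel, of "(n, v)" "(n', v')"] by (simp add: reps_def)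

lemma cl_eqI: "v \<in> tens n \<Longrightarrow> v' \<in> tens n' \<Longrightarrow> max n n' \<le> p \<Longrightarrow> ex n p v - ex n' p v' \<in> WW p \<Longrightarrow> cl n v = cl n' v'"
  by (auto simp: cl_eq_iff frel_iff)

lemma cl_WW: "v \<in> tens n \<Longrightarrow> v' \<in> tens n \<Longrightarrow> v - v' \<in> WW n \<Longrightarrow> cl n v = cl n v'"
  using cl_eqI[of v n v' n n] by (simp add: ex_same)

lemma cl_ex: "v \<in> tens n \<Longrightarrow> n \<le> p \<Longrightarrow> cl p (ex n p v) = cl n v"
  using cl_eqI[of "ex n p v" p v n p] by (simp add: ex_tens ex_same WW.zero)

lemma cl_FK: "v \<in> tens n \<Longrightarrow> cl n v \<in> FK"
  unfolding fock_def fcl_def by (rule quotientI) (simp add: reps_def)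

lemma FK_cl: assumes "C \<in> FK" shows "\<exists>n\<ge>k. \<exists>v. good n \<and> v \<in> tens n \<and> C = cl n v"
proof -
  from assms obtain n v where nv: "v \<in> tens n" "C = cl n v"
    by (auto simp: fock_def fcl_def reps_def elim!: quotientE)
  obtain p where p: "max k n \<le> p" "good p" using good_exists by blast
  then show ?thesis using nv cl_ex[of v n p] ex_tens[of n p v] by (intro exI[of _ p]) auto
qed

lemma FK_common: assumes "C \<in> FK" "D \<in> FK" shows "\<exists>n\<ge>k. \<exists>v w. good n \<and> v \<in> tens n \<and> w \<in> tens n \<and> C = cl n v \<and> D = cl n w"
proof -
  from FK_cl[OF assms(1), of k] obtain n v where n: "n \<ge> k" "good n" "v \<in> tens n" "C = cl n v" by blast
  from FK_cl[OF assms(2), of n] obtain p w where p: "p \<ge> n" "good p" "w \<in> tens p" "D = cl p w" by blast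
  then show ?thesis using n cl_ex[of v n p] ex_tens[of n p v] by (intro exI[of _ p]) auto
qed

lemma cl_self: "v \<in> tens n \<Longrightarrow> (n, v) \<in> cl n v"
  unfolding fcl_def using equiv_class_self[OF equiv_frel, of "(n, v)"] by (simp add: reps_def)

lemma cl_mem: "v \<in> tens n \<Longrightarrow> (n', v') \<in> cl n v \<Longrightarrow> v' \<in> tens n' \<and> cl n' v' = cl n v"
proof -
  assume v: "v \<in> tens n" and "(n', v') \<in> cl n v"
  then have "((n, v), (n', v')) \<in> frel N L M" by (simp add: fcl_def)
  moreover from this have "v' \<in> tens n'" by (simp add: frel_iff)
  ultimately show ?thesis using v cl_eq_iff by metis
qed

lemma fadd_cl: assumes v: "v \<in> tens n" and w: "w \<in> tens n" shows "fadd N L M (cl n v) (cl n w) = cl n (v + w)"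
proof -
  define x y where "x = (SOME x. x \<in> cl n v)" and "y = (SOME y. y \<in> cl n w)"
  have "x \<in> cl n v" "y \<in> cl n w" unfolding x_def y_def using cl_self[OF v] cl_self[OF w] by (metis someI)+
  moreover obtain nx vx where xy1: "x = (nx, vx)" by (cases x)
  moreover obtain ny vy where xy2: "y = (ny, vy)" by (cases y)
  ultimately have t: "vx \<in> tens nx" "cl nx vx = cl n v" "vy \<in> tens ny" "cl ny vy = cl n w"
    using cl_mem[OF v, of nx vx] cl_mem[OF w, of ny vy] by blast+
  note xy = xy1 xy2
  from t v w have r: "((nx, vx), (n, v)) \<in> frel N L M" "((ny, vy), (n, w)) \<in> frel N L M"
    using cl_eq_iff by blast+
  then obtain p p' where p: "p \<ge> max nx n" "ex nx p vx - ex n p v \<in> WW p" "p' \<ge> max ny n" "ex ny p' vy - ex n p' w \<in> WW p'"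
    by (auto simp: frel_iff)
  let ?P = "max p p'" and ?m = "max nx ny"
  have "ex nx ?P vx - ex n ?P v \<in> WW ?P" "ex ny ?P vy - ex n ?P w \<in> WW ?P"
    using frel_raise[OF p(1,2)] frel_raise[OF p(3,4)] by simp_all
  then have W: "(ex nx ?P vx - ex n ?P v) + (ex ny ?P vy - ex n ?P w) \<in> WW ?P" by (rule WW_add)
  have "cl ?m (ex nx ?m vx + ex ny ?m vy) = cl n (v + w)"
  proof (rule cl_eqI)
    show "ex nx ?m vx + ex ny ?m vy \<in> tens ?m" using t ex_tens by simp
    show "v + w \<in> tens n" using v w by simp
    have P: "nx \<le> ?P" "ny \<le> ?P" "n \<le> ?P" "?m \<le> ?P" using p(1,3) by linarith+
    then show "max ?m n \<le> ?P" by linarith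
    have "ex ?m ?P (ex nx ?m vx + ex ny ?m vy) = ex nx ?P vx + ex ny ?P vy"
      using ex_ex[OF max.cobounded1 P(4)] ex_ex[OF max.cobounded2 P(4)] by (simp only: ex_lin)
    then show "ex ?m ?P (ex nx ?m vx + ex ny ?m vy) - ex n ?P (v + w) \<in> WW ?P"
      using W by (simp add: ex_lin algebra_simps)
  qed
  then show ?thesis unfolding fadd_def Let_def x_def[symmetric] y_def[symmetric] xy by simp
qed

lemma fsc_cl: assumes v: "v \<in> tens n" shows "fsc N L M c (cl n v) = cl n (sc c v)"
proof -
  define x where "x = (SOME x. x \<in> cl n v)"
  have "x \<in> cl n v" unfolding x_def using cl_self[OF v] by (metis someI)
  moreover obtain nx vx where x: "x = (nx, vx)" by (cases x)
  ultimately have t: "vx \<in> tens nx" "cl nx vx = cl n v" using cl_mem[OF v, of nx vx] by blast+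
  then have "((nx, vx), (n, v)) \<in> frel N L M" using cl_eq_iff v by blast
  then obtain p where p: "p \<ge> max nx n" "ex nx p vx - ex n p v \<in> WW p" by (auto simp: frel_iff)
  have "cl nx (sc c vx) = cl n (sc c v)"
    using t v p WW_sc[OF p(2), of c] by (intro cl_eqI[of _ _ _ _ p]) (simp_all add: ex_lin sc_diff)
  then show ?thesis unfolding fsc_def Let_def x_def[symmetric] x by simp
qed

lemma fzero_cl: "fzero N L M = cl n 0"
  unfolding fzero_def using cl_ex[of 0 0 n] by (simp add: ex_lin)

text \<open>The choice in \<open>liftF\<close> returns an unknown representative. Any two become
  equal modulo relations after extension to a common length, so compatibility with relations
  (\<open>W\<close>) and with extension (\<open>e\<close>) suffices; \<open>k\<close> counts the
  blocks that the operator adds.\<close>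

lemma liftF_cl:
  assumes n: "good n" and v: "v \<in> tens n"
    and t: "\<And>n v. good n \<Longrightarrow> v \<in> tens n \<Longrightarrow> f (n, v) = (n + k * (N * L), B n v) \<and> B n v \<in> tens (n + k * (N * L))"
    and W: "\<And>n v v'. good n \<Longrightarrow> v \<in> tens n \<Longrightarrow> v' \<in> tens n \<Longrightarrow> v - v' \<in> WW n \<Longrightarrow> cl (n + k * (N * L)) (B n v) = cl (n + k * (N * L)) (B n v')"
    and e: "\<And>n p v. good n \<Longrightarrow> good p \<Longrightarrow> n \<le> p \<Longrightarrow> v \<in> tens n \<Longrightarrow> cl (p + k * (N * L)) (B p (ex n p v)) = cl (n + k * (N * L)) (B n v)"
  shows "liftF N L M f (cl n v) = cl (n + k * (N * L)) (B n v)"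
proof -
  define x where "x = (SOME x. x \<in> cl n v \<and> (int (fst x) - M) mod int (N * L) = 0)"
  have "(n, v) \<in> cl n v \<and> (int (fst (n, v)) - M) mod int (N * L) = 0" using cl_self[OF v] n by (simp add: good_def)
  then have x: "x \<in> cl n v \<and> (int (fst x) - M) mod int (N * L) = 0" unfolding x_def by (rule someI)
  obtain nx vx where xx: "x = (nx, vx)" by (cases x)
  then have t': "vx \<in> tens nx" "cl nx vx = cl n v" "good nx" using cl_mem[OF v, of nx vx] x by (simp_all add: good_def)
  then have "((nx, vx), (n, v)) \<in> frel N L M" using cl_eq_iff v by blast
  then obtain p where p: "p \<ge> max nx n" "ex nx p vx - ex n p v \<in> WW p" by (auto simp: frel_iff)
  obtain p' where p': "p' \<ge> p" "good p'" using good_exists by blast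
  have W': "ex nx p' vx - ex n p' v \<in> WW p'" using frel_raise[OF p p'(1)] .
  have "f x = (nx + k * (N * L), B nx vx)" using t t' xx by blast
  moreover have "cl (nx + k * (N * L)) (B nx vx) = cl (p' + k * (N * L)) (B p' (ex nx p' vx))"
    using e[OF t'(3) p'(2) _ t'(1)] p p' by simp
  moreover have "\<dots> = cl (p' + k * (N * L)) (B p' (ex n p' v))"
    using W[OF p'(2) _ _ W'] p p' t' v ex_tens by simp
  moreover have "\<dots> = cl (n + k * (N * L)) (B n v)" using e[OF n p'(2) _ v] p p' by simp
  ultimately show ?thesis unfolding liftF_def x_def[symmetric] by simp
qed

end

section \<open>Linear operators on the Fock space\<close>

context fk begin

abbreviation ad :: "fel \<Rightarrow> fel \<Rightarrow> fel" where "ad \<equiv> fadd N L M"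
abbreviation sm' :: "kk \<Rightarrow> fel \<Rightarrow> fel" where "sm' \<equiv> fsc N L M"

definition FL :: "(fel \<Rightarrow> fel) \<Rightarrow> bool" where
  "FL X \<longleftrightarrow> (\<forall>C\<in>FK. X C \<in> FK) \<and> (\<forall>C\<in>FK. \<forall>D\<in>FK. X (ad C D) = ad (X C) (X D)) \<and> (\<forall>C\<in>FK. \<forall>c. X (sm' c C) = sm' c (X C))"

lemma FLD: assumes "FL X" "C \<in> FK" shows "X C \<in> FK" "D \<in> FK \<Longrightarrow> X (ad C D) = ad (X C) (X D)" "X (sm' c C) = sm' c (X C)"
  using assms by (auto simp: FL_def)

lemma FLI:
  assumes "\<And>n v. good n \<Longrightarrow> v \<in> tens n \<Longrightarrow> X (cl n v) = cl (n + k) (B n v)"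
    and "\<And>n v. good n \<Longrightarrow> v \<in> tens n \<Longrightarrow> B n v \<in> tens (n + k)"
    and "\<And>n v w. good n \<Longrightarrow> v \<in> tens n \<Longrightarrow> w \<in> tens n \<Longrightarrow> B n (v + w) = B n v + B n w"
    and "\<And>n v c. good n \<Longrightarrow> v \<in> tens n \<Longrightarrow> B n (sc c v) = sc c (B n v)"
  shows "FL X"
  unfolding FL_def
proof (intro conjI ballI allI)
  fix C assume C: "C \<in> FK"
  obtain n v where n: "good n" "v \<in> tens n" "C = cl n v" using FK_cl[OF C, of 0] by blast
  show "X C \<in> FK" using n assms cl_FK by simp
  fix c show "X (sm' c C) = sm' c (X C)" using n assms by (simp add: fsc_cl)
next
  fix C D assume C: "C \<in> FK" "D \<in> FK"
  obtain n v w where n: "good n" "v \<in> tens n" "w \<in> tens n" "C = cl n v" "D = cl n w" using FK_common[OF C, of 0] by blast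
  show "X (ad C D) = ad (X C) (X D)" using n assms by (simp add: fadd_cl)
qed

lemma FK_ad: "C \<in> FK \<Longrightarrow> D \<in> FK \<Longrightarrow> ad C D \<in> FK"
  using FK_common[of C D 0] by (auto simp: fadd_cl cl_FK)
lemma FK_sm: "C \<in> FK \<Longrightarrow> sm' c C \<in> FK"
  using FK_cl[of C 0] by (auto simp: fsc_cl cl_FK)
lemma FK_zero: "fzero N L M \<in> FK"
  using fzero_cl[of 0] by (simp add: cl_FK)

lemma sm_sm: "C \<in> FK \<Longrightarrow> sm' c (sm' d C) = sm' (c * d) C"
  using FK_cl[of C 0] by (auto simp: fsc_cl)
lemma sm_1: "C \<in> FK \<Longrightarrow> sm' 1 C = C"
  using FK_cl[of C 0] by (auto simp: fsc_cl)
lemma sm_0: "C \<in> FK \<Longrightarrow> sm' 0 C = fzero N L M"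
  using FK_cl[of C 0] fzero_cl by (auto simp: fsc_cl)
lemma sm_fzero: "sm' c (fzero N L M) = fzero N L M"
  using fzero_cl[of 0] by (simp add: fsc_cl)
lemma sm_ad_left: "C \<in> FK \<Longrightarrow> ad (sm' c C) (sm' d C) = sm' (c + d) C"
  using FK_cl[of C 0] by (auto simp: fsc_cl fadd_cl sc_add_left)
lemma ad_fzero: assumes "C \<in> FK" shows "ad C (fzero N L M) = C" "ad (fzero N L M) C = C"
proof -
  obtain n v where n: "v \<in> tens n" "C = cl n v" using FK_cl[OF assms, of 0] by blast
  then show "ad C (fzero N L M) = C" "ad (fzero N L M) C = C" by (simp_all add: fzero_cl[of n] fadd_cl)
qed
lemma sm_eq_fzero: "C \<in> FK \<Longrightarrow> sm' c C = fzero N L M \<Longrightarrow> c \<noteq> 0 \<Longrightarrow> C = fzero N L M"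
  using sm_sm[of C "inverse c" c] sm_1[of C] sm_fzero[of "inverse c"] by simp
lemma FL_fzero: "FL X \<Longrightarrow> X (fzero N L M) = fzero N L M"
  using FLD(3)[of X "fzero N L M" 0] FK_zero sm_0[OF FK_zero] sm_0[OF FLD(1)[OF _ FK_zero, of X]] by simp
lemma FL_funpow: "FL X \<Longrightarrow> C \<in> FK \<Longrightarrow> (X ^^ n) C \<in> FK"
  by (induction n) (auto simp: FLD)
lemma ad_commute: "C \<in> FK \<Longrightarrow> D \<in> FK \<Longrightarrow> ad C D = ad D C"
  using FK_common[of C D 0] by (auto simp: fadd_cl add.commute)
lemma ad_assoc: assumes "C \<in> FK" "D \<in> FK" "E \<in> FK" shows "ad (ad C D) E = ad C (ad D E)"
proof -
  obtain n v w where n: "good n" "v \<in> tens n" "w \<in> tens n" "C = cl n v" "D = cl n w" using FK_common[OF assms(1,2), of 0] by blast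
  obtain p u where p: "p \<ge> n" "u \<in> tens p" "E = cl p u" using FK_cl[OF assms(3), of n] by blast
  have "C = cl p (ex n p v)" "D = cl p (ex n p w)" using n p cl_ex by auto
  then show ?thesis using p n by (simp add: fadd_cl ex_tens add.assoc)
qed
lemma ad_sub: "A \<in> FK \<Longrightarrow> B \<in> FK \<Longrightarrow> ad (ad A B) (sm' (-1) A) = B"
  using FK_common[of A B 0] by (auto simp: fadd_cl fsc_cl sc_minus_one)

subsection \<open>Operators in terms of tensor operators\<close>

lemma sm_blocks: "(\<And>m. sm f (blk m) = 0) \<Longrightarrow> sm f (dlist (- (NL * m)) (R * (N * L))) = 0"
proof (induction R)
  case 0
  then show ?case by (simp add: dlist_def)
next
  case (Suc R)
  then show ?case unfolding blocks_Suc by simp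
qed

lemma kop_tail: "(\<And>m. sm f (blk m) = 0) \<Longrightarrow> good n \<Longrightarrow> kop q f (bvec (dlist (M - int n) (R * (N * L)))) = bvec (dlist (M - int n) (R * (N * L)))"
  unfolding kop_bvec good_mm using sm_blocks[of f "mm n" R] by simp

text \<open>A raising operator acts on a presentation with \<open>n\<close> factors by a tensor operator (\<open>EC\<close>); a lowering operator
  also moves the first block of the tail, so that its value is presented with \<open>N L\<close> more factors (\<open>FC\<close>).\<close>

definition EC :: "(fel \<Rightarrow> fel) \<Rightarrow> kk \<Rightarrow> (int \<Rightarrow> int) \<Rightarrow> (int \<Rightarrow> int) \<Rightarrow> (int \<Rightarrow> int option) \<Rightarrow> bool" where
  "EC X c bf af h \<longleftrightarrow> (\<forall>n v. good n \<longrightarrow> v \<in> tens n \<longrightarrow> X (cl n v) = cl n (sc c (opx q bf af h v)))"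
definition FC :: "(fel \<Rightarrow> fel) \<Rightarrow> kk \<Rightarrow> (int \<Rightarrow> int) \<Rightarrow> (int \<Rightarrow> int) \<Rightarrow> (int \<Rightarrow> int option) \<Rightarrow> bool" where
  "FC X c bf af h \<longleftrightarrow> (\<forall>n v. good n \<longrightarrow> v \<in> tens n \<longrightarrow> X (cl n v) = cl (n + N * L) (sc c (opx q bf af h (ex n (n + N * L) v))))"
definition KC :: "(fel \<Rightarrow> fel) \<Rightarrow> kk \<Rightarrow> (int \<Rightarrow> int) \<Rightarrow> bool" where
  "KC X c f \<longleftrightarrow> (\<forall>n v. good n \<longrightarrow> v \<in> tens n \<longrightarrow> X (cl n v) = cl n (sc c (kop q f v)))"
definition dvac :: "nat \<Rightarrow> int" where "dvac n = int (N * L) * mm n * (1 - mm n) div 2"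
definition DC :: "(fel \<Rightarrow> fel) \<Rightarrow> bool" where
  "DC X \<longleftrightarrow> (\<forall>n v. good n \<longrightarrow> v \<in> tens n \<longrightarrow> X (cl n v) = cl n (dop und v + sc (of_int (dvac n)) v))"

lemma EC_lift:
  assumes E: "Eop bf af g h" and f: "\<And>n v. good n \<Longrightarrow> v \<in> tens n \<Longrightarrow> f (n, v) = (n, sc c (opx q bf af h v))"
  shows "EC (liftF N L M f) c bf af h"
  unfolding EC_def
proof (intro allI impI)
  have w: "wop bf af g h" using E by (simp add: Eop_def)
  have b: "\<And>m. sm af (blk m) = 0" using w by (simp add: wop_def)
  fix n v assume n: "good n" "v \<in> tens n"
  have "liftF N L M f (cl n v) = cl (n + 0 * (N * L)) (sc c (opx q bf af h v))"
  proof (rule liftF_cl[OF n])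
    show "f (n, v) = (n + 0 * (N * L), sc c (opx q bf af h v)) \<and> sc c (opx q bf af h v) \<in> tens (n + 0 * (N * L))"
      if "good n" "v \<in> tens n" for n v using f that wop_tens[OF w] by simp
    show "cl (n + 0 * (N * L)) (sc c (opx q bf af h v)) = cl (n + 0 * (N * L)) (sc c (opx q bf af h v'))"
      if "good n" "v \<in> tens n" "v' \<in> tens n" "v - v' \<in> WW n" for n v v'
    proof -
      have "sc c (opx q bf af h (v - v')) \<in> WW n" using that wop_WW[OF w] WW_sc by blast
      then show ?thesis using that wop_tens[OF w] by (intro cl_WW) (simp_all add: lnr_diff[OF lnr_opx] sc_diff)
    qed
    show "cl (p + 0 * (N * L)) (sc c (opx q bf af h (ex n p v))) = cl (n + 0 * (N * L)) (sc c (opx q bf af h v))"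
      if g: "good n" "good p" "n \<le> p" "v \<in> tens n" for n p v
    proof -
      obtain R where R: "p = n + R * (N * L)" using good_diff g by blast
      let ?T = "bvec (dlist (M - int n) (p - n))" and ?T' = "bvec (dlist (M - int n - int (p - n)) (N * L))"
      have e: "opx q bf af h (ex n p v) = ex n p (opx q bf af h v) + tensv n (kop q bf v) (opx q bf af h ?T)"
        using kop_tail[OF b g(1), of R] g R by (simp add: ex_tensv opx_tensv)
      have x: "ex p (p + N * L) (tensv n (kop q bf v) (opx q bf af h ?T)) = tensv n (kop q bf v) (tensv (p - n) (opx q bf af h ?T) ?T')"
        using g by (simp add: ex_tensv tensv_assoc of_nat_diff)
      \<comment> \<open>The raised tail is a relation only when a further block follows it; the two
        presentations are therefore compared at length p + N L.\<close>
      have "tensv n (kop q bf v) (tensv (p - n) (opx q bf af h ?T) ?T') \<in> WW (n + (p - n + N * L))"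
        using g by (intro WW_left kop_tens Eop_tail[OF E order_refl])
      then have "sc c (ex p (p + N * L) (tensv n (kop q bf v) (opx q bf af h ?T))) \<in> WW (p + N * L)"
        unfolding x using g by (simp add: WW_sc)
      then have "cl p (sc c (opx q bf af h (ex n p v))) = cl n (sc c (opx q bf af h v))"
      proof (intro cl_eqI[of _ _ _ _ "p + N * L"])
        show "sc c (opx q bf af h (ex n p v)) \<in> tens p" "sc c (opx q bf af h v) \<in> tens n"
          using g wop_tens[OF w] ex_tens by simp_all
      qed (use g in \<open>simp_all add: e ex_lin ex_ex sc_add\<close>)
      then show ?thesis by simp
    qed
  qed
  then show "liftF N L M f (cl n v) = cl n (sc c (opx q bf af h v))" by simp
qed

lemma KC_lift:
  assumes w: "wfun k" and b: "\<And>m. sm k (blk m) = 0" and f: "\<And>n v. good n \<Longrightarrow> v \<in> tens n \<Longrightarrow> f (n, v) = (n, sc c (kop q k v))"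
  shows "KC (liftF N L M f) c k"
  unfolding KC_def
proof (intro allI impI)
  fix n v assume n: "good n" "v \<in> tens n"
  have "liftF N L M f (cl n v) = cl (n + 0 * (N * L)) (sc c (kop q k v))"
  proof (rule liftF_cl[OF n])
    show "f (n, v) = (n + 0 * (N * L), sc c (kop q k v)) \<and> sc c (kop q k v) \<in> tens (n + 0 * (N * L))"
      if "good n" "v \<in> tens n" for n v using f that kop_tens by simp
    show "cl (n + 0 * (N * L)) (sc c (kop q k v)) = cl (n + 0 * (N * L)) (sc c (kop q k v'))"
      if "good n" "v \<in> tens n" "v' \<in> tens n" "v - v' \<in> WW n" for n v v'
    proof -
      have "sc c (kop q k (v - v')) \<in> WW n" using that WW_kop[OF w] WW_sc by blast
      then show ?thesis using that kop_tens by (intro cl_WW) (simp_all add: lnr_diff[OF lnr_kop] sc_diff)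
    qed
    show "cl (p + 0 * (N * L)) (sc c (kop q k (ex n p v))) = cl (n + 0 * (N * L)) (sc c (kop q k v))"
      if g: "good n" "good p" "n \<le> p" "v \<in> tens n" for n p v
    proof -
      obtain R where R: "p = n + R * (N * L)" using good_diff g by blast
      have "kop q k (ex n p v) = ex n p (kop q k v)"
        using kop_tail[OF b g(1), of R] g R by (simp add: ex_tensv kop_tensv)
      then show ?thesis using cl_ex[of "sc c (kop q k v)" n p] g kop_tens by (simp add: ex_lin)
    qed
  qed
  then show "liftF N L M f (cl n v) = cl n (sc c (kop q k v))" by simp
qed

text \<open>From m to m + 1 the vacuum eigenvalue N L m (1 - m) / 2 drops by N L m, which is exactly
  the degree of the block that has joined the finite part.\<close>

lemma dvac_add: "good n \<Longrightarrow> dvac (n + R * (N * L)) = dvac n - sm und (dlist (- (NL * mm n)) (R * (N * L)))"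
proof (induction R)
  case 0
  then show ?case by (simp add: dlist_def)
next
  case (Suc R)
  have ev: "even (int (N * L) * m * (1 - m))" for m :: int by simp
  have step: "int (N * L) * (m + 1) * (1 - (m + 1)) div 2 = int (N * L) * m * (1 - m) div 2 - int (N * L) * m" for m
  proof -
    have "int (N * L) * (m + 1) * (1 - (m + 1)) = int (N * L) * m * (1 - m) + 2 * (- int (N * L) * m)" by (simp add: algebra_simps)
    then show ?thesis by simp
  qed
  have "sm und (blk m) = int (N * L) * m" for m
  proof -
    have "map und (blk m) = map (\<lambda>_. m) (blk m)" using blk_set by (intro map_cong) auto
    then show ?thesis by (simp add: map_replicate_const sum_list_replicate)
  qed
  moreover have "mm (n + Suc R * (N * L)) = mm (n + R * (N * L)) + 1" "mm (n + R * (N * L)) = mm n + int R"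
    using mm_add[OF Suc.prems, of R] mm_add[OF Suc.prems, of "Suc R"] by simp_all
  ultimately show ?case using Suc step[of "mm n + int R"] unfolding dvac_def blocks_Suc by simp
qed

lemma DC_lift:
  assumes f: "\<And>n v. good n \<Longrightarrow> v \<in> tens n \<Longrightarrow> f (n, v) = (n, dop und v + sc (of_int (dvac n)) v)"
  shows "DC (liftF N L M f)"
  unfolding DC_def
proof (intro allI impI)
  fix n v assume n: "good n" "v \<in> tens n"
  have "liftF N L M f (cl n v) = cl (n + 0 * (N * L)) (dop und v + sc (of_int (dvac n)) v)"
  proof (rule liftF_cl[OF n])
    show "f (n, v) = (n + 0 * (N * L), dop und v + sc (of_int (dvac n)) v) \<and> dop und v + sc (of_int (dvac n)) v \<in> tens (n + 0 * (N * L))"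
      if "good n" "v \<in> tens n" for n v using f that dop_tens by simp
    show "cl (n + 0 * (N * L)) (dop und v + sc (of_int (dvac n)) v) = cl (n + 0 * (N * L)) (dop und v' + sc (of_int (dvac n)) v')"
      if "good n" "v \<in> tens n" "v' \<in> tens n" "v - v' \<in> WW n" for n v v'
    proof -
      have "dop und (v - v') + sc (of_int (dvac n)) (v - v') \<in> WW n" using that WW_dop[OF wfun_und] WW_sc WW_add by blast
      then show ?thesis using that dop_tens by (intro cl_WW) (simp_all add: lnr_diff[OF lnr_dop] sc_diff algebra_simps)
    qed
    show "cl (p + 0 * (N * L)) (dop und (ex n p v) + sc (of_int (dvac p)) (ex n p v)) = cl (n + 0 * (N * L)) (dop und v + sc (of_int (dvac n)) v)"
      if g: "good n" "good p" "n \<le> p" "v \<in> tens n" for n p v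
    proof -
      obtain R where R: "p = n + R * (N * L)" using good_diff g by blast
      let ?T = "dlist (M - int n) (p - n)"
      have d: "dvac p = dvac n - sm und ?T" using dvac_add[OF g(1), of R] R good_mm[OF g(1)] by simp
      have "dop und (ex n p v) + sc (of_int (dvac p)) (ex n p v) = ex n p (dop und v + sc (of_int (dvac n)) v)"
        using g unfolding d by (simp add: ex_tensv dop_tensv dop_bvec tensv_add tensv_sc) (simp add: fun_eq_iff fapp algebra_simps)
      then show ?thesis using cl_ex[of "dop und v + sc (of_int (dvac n)) v" n p] g dop_tens by simp
    qed
  qed
  then show "liftF N L M f (cl n v) = cl n (dop und v + sc (of_int (dvac n)) v)" by simp
qed

text \<open>The difference is F acting on the tail beyond its first block, and this is a relation by
  \<open>Fop_tail\<close>.\<close>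

lemma Fop_extend:
  assumes F: "Fop bf af g h" and g: "good n" "good p" "n + N * L \<le> p" "v \<in> tens n"
  shows "opx q bf af h (ex n p v) - ex (n + N * L) p (opx q bf af h (ex n (n + N * L) v)) \<in> WW p"
proof -
  have w: "wop bf af g h" using F by (simp add: Fop_def)
  have b: "\<And>m. sm af (blk m) = 0" "\<And>m. sm bf (blk m) = 0" using w by (simp_all add: wop_def)
  let ?n = "n + N * L"
  have gn: "good ?n" using g good_add1 by blast
  obtain R where R: "p = ?n + R * (N * L)" using good_diff[OF gn g(2,3)] by blast
  let ?x = "ex n ?n v" and ?T1 = "bvec (dlist (M - int n) (N * L))" and ?T2 = "bvec (dlist (M - int ?n) (p - ?n))"
  have x: "?x \<in> tens ?n" using g ex_tens by simp
  have x': "?x = tensv n v ?T1" by (simp add: ex_tensv)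
  have T2: "?T2 = bvec (dlist (M - int n - int (N * L)) (p - ?n))" by (simp add: algebra_simps)
  have "ex n p v = ex ?n p ?x" using g by (simp add: ex_ex)
  then have "opx q bf af h (ex n p v) = tensv ?n (opx q bf af h ?x) (kop q af ?T2) + tensv ?n (kop q bf ?x) (opx q bf af h ?T2)"
    using g opx_tensv[OF qq_nonzero x] by (simp add: ex_tensv)
  also have "kop q af ?T2 = ?T2" using kop_tail[OF b(1) gn, of R] R by simp
  also have "kop q bf ?x = tensv n (kop q bf v) ?T1" unfolding x' using kop_tail[OF b(2) g(1), of 1] by (simp add: kop_tensv)
  finally have "opx q bf af h (ex n p v) - ex ?n p (opx q bf af h ?x) = tensv n (kop q bf v) (tensv (N * L) ?T1 (opx q bf af h ?T2))"
    using g by (simp add: ex_tensv tensv_assoc)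
  also have "\<dots> \<in> WW (n + (N * L + (p - ?n)))"
    unfolding T2 using g by (intro WW_left kop_tens Fop_tail[OF F order_refl])
  finally show ?thesis using g by simp
qed

lemma FC_lift:
  assumes F: "Fop bf af g h"
    and f: "\<And>n v. good n \<Longrightarrow> v \<in> tens n \<Longrightarrow> f (n, v) = (n + N * L, B n v) \<and> B n v \<in> tens (n + N * L) \<and>
      B n v - sc c (opx q bf af h (ex n (n + N * L) v)) \<in> WW (n + N * L)"
  shows "FC (liftF N L M f) c bf af h"
  unfolding FC_def
proof (intro allI impI)
  have w: "wop bf af g h" using F by (simp add: Fop_def)
  have t: "sc c (opx q bf af h (ex n (n + N * L) v)) \<in> tens (n + N * L)" if "v \<in> tens n" for n v
    using that wop_tens[OF w] ex_tens by simp
  have Bc: "cl (n + N * L) (B n v) = cl (n + N * L) (sc c (opx q bf af h (ex n (n + N * L) v)))" if "good n" "v \<in> tens n" for n v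
    using f[OF that] t[OF that(2)] by (intro cl_WW) auto
  fix n v assume n: "good n" "v \<in> tens n"
  have "liftF N L M f (cl n v) = cl (n + 1 * (N * L)) (B n v)"
  proof (rule liftF_cl[OF n])
    show "f (n, v) = (n + 1 * (N * L), B n v) \<and> B n v \<in> tens (n + 1 * (N * L))"
      if "good n" "v \<in> tens n" for n v using f that by simp
    show "cl (n + 1 * (N * L)) (B n v) = cl (n + 1 * (N * L)) (B n v')"
      if "good n" "v \<in> tens n" "v' \<in> tens n" "v - v' \<in> WW n" for n v v'
    proof -
      have "sc c (opx q bf af h (ex n (n + N * L) (v - v'))) \<in> WW (n + N * L)"
        using that wop_WW[OF w] WW_sc ex_WW by simp
      then have "cl (n + N * L) (sc c (opx q bf af h (ex n (n + N * L) v))) = cl (n + N * L) (sc c (opx q bf af h (ex n (n + N * L) v')))"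
        using that t by (intro cl_WW) (simp_all add: ex_lin lnr_diff[OF lnr_opx] sc_diff)
      then show ?thesis using Bc that by simp
    qed
    show "cl (p + 1 * (N * L)) (B p (ex n p v)) = cl (n + 1 * (N * L)) (B n v)"
      if g: "good n" "good p" "n \<le> p" "v \<in> tens n" for n p v
    proof -
      let ?q = "p + N * L"
      have "opx q bf af h (ex n ?q v) - ex (n + N * L) ?q (opx q bf af h (ex n (n + N * L) v)) \<in> WW ?q"
        using g good_add1 by (intro Fop_extend[OF F]) auto
      then have W: "sc c (opx q bf af h (ex n ?q v) - ex (n + N * L) ?q (opx q bf af h (ex n (n + N * L) v))) \<in> WW ?q" by (rule WW_sc)
      have "cl ?q (sc c (opx q bf af h (ex p ?q (ex n p v)))) = cl ?q (ex (n + N * L) ?q (sc c (opx q bf af h (ex n (n + N * L) v))))"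
      proof (rule cl_WW)
        show "sc c (opx q bf af h (ex p ?q (ex n p v))) \<in> tens ?q" using t ex_tens g by simp
        show "ex (n + N * L) ?q (sc c (opx q bf af h (ex n (n + N * L) v))) \<in> tens ?q" using t ex_tens g by simp
        show "sc c (opx q bf af h (ex p ?q (ex n p v))) - ex (n + N * L) ?q (sc c (opx q bf af h (ex n (n + N * L) v))) \<in> WW ?q"
          using W g by (simp add: ex_ex ex_lin sc_diff)
      qed
      also have "\<dots> = cl (n + N * L) (sc c (opx q bf af h (ex n (n + N * L) v)))" using cl_ex t g by simp
      finally show ?thesis using Bc g ex_tens by simp
    qed
  qed
  then show "liftF N L M f (cl n v) = cl (n + N * L) (sc c (opx q bf af h (ex n (n + N * L) v)))" using Bc[OF n] by simp
qed

end

context fk begin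

lemma EC_FL: "EC X c bf af h \<Longrightarrow> wop bf af g h \<Longrightarrow> FL X"
  by (rule FLI[of X 0 "\<lambda>n v. sc c (opx q bf af h v)"])
    (auto simp: EC_def wop_tens lnrD[OF lnr_opx] sc_add mult.commute)

lemma FC_FL: "FC X c bf af h \<Longrightarrow> wop bf af g h \<Longrightarrow> FL X"
  by (rule FLI[of X "N * L" "\<lambda>n v. sc c (opx q bf af h (ex n (n + N * L) v))"])
    (auto simp: FC_def wop_tens ex_tens ex_lin lnrD[OF lnr_opx] sc_add mult.commute)

lemma KC_FL: "KC X c f \<Longrightarrow> FL X"
  by (rule FLI[of X 0 "\<lambda>n v. sc c (kop q f v)"])
    (auto simp: KC_def kop_tens lnrD[OF lnr_kop] sc_add mult.commute)

lemma DC_FL: "DC X \<Longrightarrow> FL X"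
  by (rule FLI[of X 0 "\<lambda>n v. dop und v + sc (of_int (dvac n)) v"])
    (auto simp: DC_def dop_tens lnrD[OF lnr_dop] sc_add mult.commute algebra_simps)

subsection \<open>Words in the lowering operators\<close>

text \<open>\<open>rep C n p y\<close>: up to relations, \<open>y\<close> is the extension to \<open>p\<close> factors of a representative of \<open>C\<close>
  with \<open>n\<close> factors.  Each lowering operator uses up one block of the extension.\<close>

definition rep :: "fel \<Rightarrow> nat \<Rightarrow> nat \<Rightarrow> vec \<Rightarrow> bool" where
  "rep C n p y \<longleftrightarrow> good n \<and> good p \<and> n \<le> p \<and> y \<in> tens p \<and> (\<exists>v\<in>tens n. C = cl n v \<and> y - ex n p v \<in> WW p)"

lemma rep_cl: "rep C n p y \<Longrightarrow> C = cl p y"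
proof -
  assume "rep C n p y"
  then obtain v where v: "n \<le> p" "y \<in> tens p" "v \<in> tens n" "C = cl n v" "y - ex n p v \<in> WW p" by (auto simp: rep_def)
  then have "cl p y = cl p (ex n p v)" by (intro cl_WW ex_tens)
  then show ?thesis using v cl_ex by simp
qed

lemma repI: "good n \<Longrightarrow> good p \<Longrightarrow> n \<le> p \<Longrightarrow> v \<in> tens n \<Longrightarrow> rep (cl n v) n p (ex n p v)"
  by (auto simp: rep_def ex_tens WW.zero intro!: bexI[of _ v])

lemma rep_F:
  assumes F: "Fop bf af g h" and Y: "FC Y c bf af h" and r: "rep C n p y" and p: "n + N * L \<le> p"
  shows "rep (Y C) (n + N * L) p (sc c (opx q bf af h y))"
proof -
  have w: "wop bf af g h" using F by (simp add: Fop_def)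
  from r obtain v where v: "good n" "good p" "n \<le> p" "y \<in> tens p" "v \<in> tens n" "C = cl n v" "y - ex n p v \<in> WW p" by (auto simp: rep_def)
  let ?w = "sc c (opx q bf af h (ex n (n + N * L) v))"
  have "opx q bf af h (y - ex n p v) + (opx q bf af h (ex n p v) - ex (n + N * L) p (opx q bf af h (ex n (n + N * L) v))) \<in> WW p"
    using v p wop_WW[OF w] by (intro WW_add Fop_extend[OF F]) auto
  then have "opx q bf af h y - ex (n + N * L) p (opx q bf af h (ex n (n + N * L) v)) \<in> WW p"
    by (simp add: lnr_diff[OF lnr_opx])
  then have "sc c (opx q bf af h y - ex (n + N * L) p (opx q bf af h (ex n (n + N * L) v))) \<in> WW p" by (rule WW_sc)
  moreover have "Y C = cl (n + N * L) ?w" using v Y by (simp add: FC_def)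
  moreover have "?w \<in> tens (n + N * L)" using v wop_tens[OF w] ex_tens by simp
  ultimately show ?thesis unfolding rep_def using v p wop_tens[OF w] good_add1
    by (auto simp: ex_lin sc_diff intro!: bexI[of _ ?w])
qed

lemma rep_funpow:
  assumes F: "Fop bf af g h" and Y: "FC Y c bf af h" and r: "rep C n p y" and p: "n + s * (N * L) \<le> p"
  shows "rep ((Y ^^ s) C) (n + s * (N * L)) p (sc (c ^ s) ((opx q bf af h ^^ s) y))"
  using p
proof (induction s)
  case 0
  then show ?case using r by simp
next
  case (Suc s)
  have "rep (Y ((Y ^^ s) C)) (n + s * (N * L) + N * L) p (sc c (opx q bf af h (sc (c ^ s) ((opx q bf af h ^^ s) y))))"
    using Suc by (intro rep_F[OF F Y]) (simp_all add: algebra_simps)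
  then show ?case by (simp add: lnrD[OF lnr_opx] algebra_simps)
qed

subsection \<open>A raising and a lowering operator\<close>

text \<open>Applying Y first exposes the block \<open>b\<close> to X, applying X first does not.
  Rewriting the second product so that X acts on \<open>b\<close> as well creates a correction;
  modulo relations it is X on \<open>b\<close> wedged with Y on the following block
  \<open>b'\<close>.\<close>

lemma raising_lowering:
  assumes E: "Eop b1 a1 g1 h1" and F: "Fop b2 a2 g2 h2" and X: "EC X c b1 a1 h1" and Y: "FC Y d b2 a2 h2"
    and t: "\<And>y x. h1 y = Some x \<Longrightarrow> b2 y = b2 x + t"
    and n: "good n" "v \<in> tens n"
  defines "b \<equiv> bvec (blk (mm n))" and "b' \<equiv> bvec (blk (mm n + 1))" and "p \<equiv> n + N * L"
  defines "oE \<equiv> opx q b1 a1 h1" and "oF \<equiv> opx q b2 a2 h2"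
  shows "X (Y (cl n v)) = cl (p + N * L) (sc (c * d) (tensv p (oE (oF (tensv n v b))) b'))"
    and "Y (X (cl n v)) = cl (p + N * L) (sc (c * d) (tensv p (oF (oE (tensv n v b))) b'
       + sc (q powi t) (tensv n (kop q b2 (kop q b1 v)) (tensv (N * L) (oE b) (oF b')))))"
proof -
  note q = qq_nonzero[of N]
  have w1: "wop b1 a1 g1 h1" and w2: "wop b2 a2 g2 h2" using E F by (simp_all add: Eop_def Fop_def)
  have bt: "b \<in> tens (N * L)" "b' \<in> tens (N * L)" by (simp_all add: b_def b'_def)
  have gp: "good p" using n good_add1 by (simp add: p_def)
  have mp: "mm p = mm n + 1" using n mm_add1 by (simp add: p_def)
  have exb: "ex n p w = tensv n w b" for w
    by (simp add: ex_tensv p_def b_def blk_def good_mm[OF n(1)])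
  have exb': "ex p (p + N * L) w = tensv p w b'" for w
    by (simp add: ex_tensv b'_def blk_def good_mm[OF gp] mp)
  have kb: "kop q f b = b" "kop q f b' = b'" if "f \<in> {a1, b1, a2, b2}" for f
    using that w1 w2 by (auto simp: b_def b'_def kop_bvec wop_def)
  have tE: "x \<in> tens k \<Longrightarrow> oE x \<in> tens k" and tF: "x \<in> tens k \<Longrightarrow> oF x \<in> tens k" for x k
    unfolding oE_def oF_def using wop_tens[OF w1] wop_tens[OF w2] by blast+
  have WF: "x \<in> WW k \<Longrightarrow> oF x \<in> WW k" for x k unfolding oF_def using wop_WW[OF w2] by blast
  have dE: "oE (tensv k x y) = tensv k (oE x) (kop q a1 y) + tensv k (kop q b1 x) (oE y)" if "x \<in> tens k" for k x y
    unfolding oE_def by (rule opx_tensv[OF q that])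
  have dF: "oF (tensv k x y) = tensv k (oF x) (kop q a2 y) + tensv k (kop q b2 x) (oF y)" if "x \<in> tens k" for k x y
    unfolding oF_def by (rule opx_tensv[OF q that])
  have lE: "oE (sc c x) = sc c (oE x)" and lF: "oF (sc c x) = sc c (oF x)" "oF (x + y) = oF x + oF y" for c x y
    unfolding oE_def oF_def by (simp_all add: lnrD[OF lnr_opx])
  let ?x = "tensv n v b"
  have xt: "?x \<in> tens p" unfolding p_def using n bt by (intro tensv_tens)
  have "Y (cl n v) = cl p (sc d (oF ?x))" using Y n exb unfolding FC_def oF_def p_def by simp
  then have "X (Y (cl n v)) = cl p (sc (c * d) (oE (oF ?x)))"
    using X gp tF[OF xt] by (simp add: EC_def oE_def[symmetric] lE)
  then show "X (Y (cl n v)) = cl (p + N * L) (sc (c * d) (tensv p (oE (oF ?x)) b'))"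
    using cl_ex[of "sc (c * d) (oE (oF ?x))" p "p + N * L"] tE[OF tF[OF xt]] by (simp add: ex_lin exb')
  have "X (cl n v) = cl n (sc c (oE v))" using X n unfolding EC_def oE_def by simp
  then have "Y (X (cl n v)) = cl p (sc d (oF (sc c (tensv n (oE v) b))))"
    using Y n tE[OF n(2)] exb unfolding FC_def oF_def[symmetric] p_def by (simp add: tensv_sc)
  then have YX: "Y (X (cl n v)) = cl p (sc (c * d) (oF (tensv n (oE v) b)))" by (simp add: lF mult.commute)
  have at: "tensv n (oE v) b \<in> tens p" unfolding p_def using n bt tE by (intro tensv_tens)
  define D where "D = kop q b1 v"
  have Dt: "D \<in> tens n" unfolding D_def using n kop_tens by blast
  \<comment> \<open>X on \<open>b\<close> followed by \<open>b'\<close> is a relation. Applying Y to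
    this relation trades Y X on \<open>b\<close> for X on \<open>b\<close> and Y on
    \<open>b'\<close>, which is the use of \<open>e2\<close>.\<close>
  have Eb: "tensv (N * L) (oE b) b' \<in> WW (N * L + N * L)"
  proof -
    have "- (NL * mm n) - int (N * L) = - (NL * (mm n + 1))" by (simp add: NL_def algebra_simps)
    with Eop_tail[OF E order_refl, of "N * L" "- (NL * mm n)"] show ?thesis
      unfolding b_def b'_def blk_def oE_def by (simp only:)
  qed
  have "oE ?x = tensv n (oE v) b + tensv n D (oE b)" using dE[OF n(2)] kb by (simp add: D_def)
  then have "oF (oE ?x) = oF (tensv n (oE v) b) + oF (tensv n D (oE b))" by (simp add: lF)
  moreover have "oF (tensv n D (oE b)) = tensv n (oF D) (kop q a2 (oE b)) + tensv n (kop q b2 D) (oF (oE b))" by (rule dF[OF Dt])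
  ultimately have e1: "oF (tensv n (oE v) b) = oF (oE ?x) - tensv n (oF D) (kop q a2 (oE b)) - tensv n (kop q b2 D) (oF (oE b))" by simp
  have kE: "kop q b2 (oE b) = sc (q powi t) (oE b)"
    using kop_opx[OF q t, where bf = b1 and af = a1 and v = b] kb unfolding oE_def by simp
  have "oF (tensv (N * L) (oE b) b') = tensv (N * L) (oF (oE b)) b' + sc (q powi t) (tensv (N * L) (oE b) (oF b'))"
    using dF[OF tE[OF bt(1)], of b'] kb by (simp add: kE tensv_sc)
  then have e2: "tensv (N * L) (oF (oE b)) b' = oF (tensv (N * L) (oE b) b') - sc (q powi t) (tensv (N * L) (oE b) (oF b'))" by simp
  have e3: "tensv (N * L) (kop q a2 (oE b)) b' = kop q a2 (tensv (N * L) (oE b) b')" using kb by (simp add: kop_tensv)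
  let ?Z = "tensv p (oF (oE ?x)) b' + sc (q powi t) (tensv n (kop q b2 D) (tensv (N * L) (oE b) (oF b')))"
  have as: "tensv p (tensv n y z) b' = tensv n y (tensv (N * L) z b')" for y z by (simp add: p_def tensv_assoc)
  have "tensv p (oF (tensv n (oE v) b)) b' - ?Z = - (tensv n (oF D) (kop q a2 (tensv (N * L) (oE b) b')) + tensv n (kop q b2 D) (oF (tensv (N * L) (oE b) b')))"
    unfolding e1 by (simp add: tensv_diff as e2 e3 tensv_sc)
  also have "\<dots> \<in> WW (n + (N * L + N * L))"
  proof -
    have "wfun a2" using w2 by (simp add: wop_def)
    then show ?thesis
      by (intro WW_uminus WW_add WW_left[OF tF[OF Dt] WW_kop[OF _ Eb]] WW_left[OF kop_tens[OF Dt] WF[OF Eb]])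
  qed
  finally have W: "tensv p (oF (tensv n (oE v) b)) b' - ?Z \<in> WW (p + N * L)" by (simp add: p_def add.assoc)
  have Zt: "?Z \<in> tens (p + N * L)"
  proof -
    have "tensv n (kop q b2 D) (tensv (N * L) (oE b) (oF b')) \<in> tens (n + (N * L + N * L))"
      using Dt bt by (intro tensv_tens kop_tens tE tF)
    moreover have "tensv p (oF (oE ?x)) b' \<in> tens (p + N * L)" using xt bt by (intro tensv_tens tE tF)
    ultimately show ?thesis by (simp add: p_def add.assoc)
  qed
  have "cl p (sc (c * d) (oF (tensv n (oE v) b))) = cl (p + N * L) (ex p (p + N * L) (sc (c * d) (oF (tensv n (oE v) b))))"
    using cl_ex[of "sc (c * d) (oF (tensv n (oE v) b))" p "p + N * L"] tF[OF at] by simp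
  also have "\<dots> = cl (p + N * L) (sc (c * d) ?Z)"
  proof (rule cl_WW)
    show "ex p (p + N * L) (sc (c * d) (oF (tensv n (oE v) b))) \<in> tens (p + N * L)" using tF[OF at] ex_tens by simp
    show "sc (c * d) ?Z \<in> tens (p + N * L)" using Zt by simp
    show "ex p (p + N * L) (sc (c * d) (oF (tensv n (oE v) b))) - sc (c * d) ?Z \<in> WW (p + N * L)"
      using WW_sc[OF W, of "c * d"] by (simp only: ex_lin exb' sc_diff)
  qed
  finally show "Y (X (cl n v)) = cl (p + N * L) (sc (c * d) (tensv p (oF (oE ?x)) b'
       + sc (q powi t) (tensv n (kop q b2 (kop q b1 v)) (tensv (N * L) (oE b) (oF b')))))"
    using YX by (simp add: D_def)
qed

lemma raising_lowering_commute:
  assumes E: "Eop b1 a1 g1 h1" and F: "Fop b2 a2 g2 h2" and X: "EC X c b1 a1 h1" and Y: "FC Y d b2 a2 h2"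
    and t: "\<And>y x. h1 y = Some x \<Longrightarrow> b2 y = b2 x + t"
    and com: "\<And>v. opx q b1 a1 h1 (opx q b2 a2 h2 v) = opx q b2 a2 h2 (opx q b1 a1 h1 v)"
    and mix: "\<And>m. tensv (N * L) (opx q b1 a1 h1 (bvec (blk m))) (opx q b2 a2 h2 (bvec (blk (m + 1)))) \<in> WW (N * L + N * L)"
    and C: "C \<in> FK"
  shows "X (Y C) = Y (X C)"
proof -
  have w1: "wop b1 a1 g1 h1" and w2: "wop b2 a2 g2 h2" using E F by (simp_all add: Eop_def Fop_def)
  obtain n v where n: "good n" "v \<in> tens n" "C = cl n v" using FK_cl[OF C, of 0] by blast
  let ?p = "n + N * L" and ?b = "bvec (blk (mm n))" and ?b' = "bvec (blk (mm n + 1))"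
  let ?Z = "tensv ?p (opx q b2 a2 h2 (opx q b1 a1 h1 (tensv n v ?b))) ?b'"
  let ?W = "tensv n (kop q b2 (kop q b1 v)) (tensv (N * L) (opx q b1 a1 h1 ?b) (opx q b2 a2 h2 ?b'))"
  note r = raising_lowering[OF E F X Y t n(1,2)]
  have W: "sc (c * d) (sc (q powi t) ?W) \<in> WW (?p + N * L)"
    using WW_left[OF kop_tens[OF kop_tens[OF n(2)]] mix] by (simp add: add.assoc WW_sc)
  have Zt: "?Z \<in> tens (?p + N * L)"
    using n(2) by (intro tensv_tens wop_tens[OF w1] wop_tens[OF w2]) simp_all
  have "cl (?p + N * L) (sc (c * d) (?Z + sc (q powi t) ?W)) = cl (?p + N * L) (sc (c * d) ?Z)"
  proof (rule cl_WW)
    show "sc (c * d) (?Z + sc (q powi t) ?W) \<in> tens (?p + N * L)"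
      using Zt WW_tens[OF W] by (simp add: sc_add)
    show "sc (c * d) ?Z \<in> tens (?p + N * L)" using Zt by simp
    show "sc (c * d) (?Z + sc (q powi t) ?W) - sc (c * d) ?Z \<in> WW (?p + N * L)" using W by (simp add: sc_add)
  qed
  then show ?thesis unfolding n(3) using r by (simp only: com)
qed

text \<open>On a vector of weight \<open>kap\<close> the tensor operators contribute
  \<open>qi q kap\<close>, and the cross term between two blocks contributes the multiple
  \<open>gam\<close> of the vacuum. The powers of q arise from the diagonal parts acting on the
  raised block and on the vector.\<close>

lemma raising_lowering_matched:
  assumes E: "Eop (\<lambda>x. al * k x) (\<lambda>x. be * k x) e f" and F: "Fop (\<lambda>x. - be * k x) (\<lambda>x. - al * k x) f e"
    and X: "EC X c (\<lambda>x. al * k x) (\<lambda>x. be * k x) f" and Y: "FC Y d (\<lambda>x. - be * k x) (\<lambda>x. - al * k x) e"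
    and ab: "al = 0 \<and> be = 1 \<or> al = 1 \<and> be = 0"
    and k: "\<And>x. k x = dl (f x \<noteq> None) - dl (e x \<noteq> None)"
    and ke: "\<And>x y. e x = Some y \<Longrightarrow> k y = k x + 2"
    and kb: "\<And>m. sm k (blk m) = 0"
    and n: "good n" "v \<in> tens n" "\<And>ys. v ys \<noteq> 0 \<Longrightarrow> sm k ys = kap"
    and mix: "tensv (N * L) (opx q (\<lambda>x. al * k x) (\<lambda>x. be * k x) f (bvec (blk (mm n))))
        (opx q (\<lambda>x. - be * k x) (\<lambda>x. - al * k x) e (bvec (blk (mm n + 1)))) - sc gam (bvec (blk (mm n) @ blk (mm n + 1))) \<in> WW (N * L + N * L)"
  shows "X (Y (cl n v)) = ad (Y (X (cl n v))) (sm' (c * d * (qi q kap - q powi (- 2 * be) * gam * q powi ((al - be) * kap))) (cl n v))"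
proof -
  define oE oF where "oE = opx q (\<lambda>x. al * k x) (\<lambda>x. be * k x) f" and "oF = opx q (\<lambda>x. - be * k x) (\<lambda>x. - al * k x) e"
  have w1: "wop (\<lambda>x. al * k x) (\<lambda>x. be * k x) e f" and w2: "wop (\<lambda>x. - be * k x) (\<lambda>x. - al * k x) f e" using E F by (simp_all add: Eop_def Fop_def)
  have tE: "x \<in> tens k \<Longrightarrow> oE x \<in> tens k" and tF: "x \<in> tens k \<Longrightarrow> oF x \<in> tens k" for x k
    unfolding oE_def oF_def using wop_tens[OF w1] wop_tens[OF w2] by blast+
  have inv: "e x = Some y \<longleftrightarrow> f y = Some x" for x y using wop_inv[OF w1] .
  have t: "- be * k y = - be * k x + - 2 * be" if "f y = Some x" for x y
  proof -
    have "k y = k x + 2" using ke inv that by blast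
    then show ?thesis by (simp add: algebra_simps)
  qed
  let ?p = "n + N * L" and ?b = "bvec (blk (mm n))" and ?b' = "bvec (blk (mm n + 1))"
  let ?x = "tensv n v ?b"
  note r = raising_lowering[OF E F X Y t n(1,2)]
  have xt: "?x \<in> tens ?p" using n(2) by (intro tensv_tens) simp_all
  have supp: "?x ys \<noteq> 0 \<Longrightarrow> sm k ys = kap" for ys
  proof -
    assume y: "?x ys \<noteq> 0"
    define us zs where uz: "us = take n ys" "zs = drop n ys"
    have ys: "ys = us @ zs" by (simp add: uz)
    have "v us \<noteq> 0" "?b zs \<noteq> 0" using y by (auto simp: tensv_def uz split: if_splits)
    then have "sm k us = kap" "zs = blk (mm n)" using n(3) by (auto simp: bvec_def split: if_splits)
    then show ?thesis unfolding ys using kb by simp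
  qed
  have com: "oE (oF ?x) = oF (oE ?x) + sc (qi q kap) ?x"
  proof
    fix ys
    have "oE (oF ?x) ys - oF (oE ?x) ys = qi q (sm k ys) * ?x ys"
      unfolding oE_def oF_def using N2 by (intro opx_commutator[OF qq_nonzero qq_minus_inverse ab inv k ke]) auto
    also have "\<dots> = qi q kap * ?x ys" using supp[of ys] by (cases "?x ys = 0") auto
    finally show "oE (oF ?x) ys = (oF (oE ?x) + sc (qi q kap) ?x) ys" by (simp add: fapp algebra_simps)
  qed
  have kk: "kop q (\<lambda>x. - be * k x) (kop q (\<lambda>x. al * k x) v) = sc (q powi ((al - be) * kap)) v"
  proof
    fix ys
    have s: "sm (\<lambda>x. c * k x) ys = c * sm k ys" for c by (simp add: sum_list_const_mult)
    show "kop q (\<lambda>x. - be * k x) (kop q (\<lambda>x. al * k x) v) ys = sc (q powi ((al - be) * kap)) v ys"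
    proof (cases "v ys = 0")
      case False
      have "q powi (- be * kap) * q powi (al * kap) = q powi ((al - be) * kap)"
        by (simp add: power_int_add[symmetric] algebra_simps)
      then show ?thesis unfolding kop_def s n(3)[OF False] fapp by (simp only: mult.assoc[symmetric])
    qed (simp add: kop_def fapp)
  qed
  let ?Z = "tensv ?p (oF (oE ?x)) ?b'" and ?u = "tensv ?p ?x ?b'"
  let ?W = "tensv n v (tensv (N * L) (oE ?b) (oF ?b'))"
  define th where "th = q powi (- 2 * be) * q powi ((al - be) * kap)"
  have uex: "?u = ex n (?p + N * L) v"
  proof -
    have "ex n ?p v = ?x" by (simp add: ex_tensv blk_def good_mm[OF n(1)])
    moreover have "ex ?p (?p + N * L) ?x = ?u"
      using good_mm[of ?p] good_add1 n(1) mm_add1[OF n(1)] by (simp add: ex_tensv blk_def)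
    ultimately show ?thesis using ex_ex[of n ?p "?p + N * L" v] by simp
  qed
  have bb: "tensv (N * L) ?b ?b' = bvec (blk (mm n) @ blk (mm n + 1))" by (simp add: tensv_bvec')
  have "tensv n v (tensv (N * L) (oE ?b) (oF ?b') - sc gam (bvec (blk (mm n) @ blk (mm n + 1)))) \<in> WW (n + (N * L + N * L))"
    by (rule WW_left[OF n(2) mix[folded oE_def oF_def]])
  moreover have "tensv n v (bvec (blk (mm n) @ blk (mm n + 1))) = ?u" unfolding bb[symmetric] tensv_assoc ..
  ultimately have W: "?W - sc gam ?u \<in> WW (?p + N * L)" by (simp add: tensv_diff tensv_sc add.assoc)
  have ut: "?u \<in> tens (?p + N * L)" and Zt: "?Z \<in> tens (?p + N * L)" using tensv_tens[OF xt, of ?b' "N * L"] tensv_tens[OF tF[OF tE[OF xt]], of ?b' "N * L"] by simp_all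
  have Wt: "?W \<in> tens (?p + N * L)"
  proof -
    have "?W \<in> tens (n + (N * L + N * L))" using n(2) by (intro tensv_tens tE tF) simp_all
    then show ?thesis by (simp add: add.assoc)
  qed
  have YX: "Y (X (cl n v)) = cl (?p + N * L) (sc (c * d) (?Z + sc th ?W))"
  proof -
    have "Y (X (cl n v)) = cl (?p + N * L) (sc (c * d) (?Z + sc (q powi (- 2 * be))
       (tensv n (kop q (\<lambda>x. - be * k x) (kop q (\<lambda>x. al * k x) v)) (tensv (N * L) (oE ?b) (oF ?b')))))"
      unfolding oE_def oF_def by (rule r(2))
    then show ?thesis by (simp only: kk th_def tensv_sc sc_sc)
  qed
  also have "\<dots> = cl (?p + N * L) (sc (c * d) (?Z + sc (th * gam) ?u))"
  proof (rule cl_WW)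
    have "sc (c * d * th) (?W - sc gam ?u) \<in> WW (?p + N * L)" by (rule WW_sc[OF W])
    moreover have "sc (c * d) (?Z + sc th ?W) - sc (c * d) (?Z + sc (th * gam) ?u) = sc (c * d * th) (?W - sc gam ?u)"
      by (simp add: fun_eq_iff fapp algebra_simps)
    ultimately show "sc (c * d) (?Z + sc th ?W) - sc (c * d) (?Z + sc (th * gam) ?u) \<in> WW (?p + N * L)" by simp
  qed (use ut Zt Wt in simp_all)
  finally have YX': "Y (X (cl n v)) = cl (?p + N * L) (sc (c * d) (?Z + sc (th * gam) ?u))" .
  have "cl n v = cl (?p + N * L) ?u" unfolding uex using cl_ex[OF n(2), of "?p + N * L"] by simp
  then have "ad (Y (X (cl n v))) (sm' (c * d * (qi q kap - th * gam)) (cl n v))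
      = cl (?p + N * L) (sc (c * d) (?Z + sc (th * gam) ?u) + sc (c * d * (qi q kap - th * gam)) ?u)"
    unfolding YX' using ut Zt by (simp add: fadd_cl fsc_cl)
  also have "sc (c * d) (?Z + sc (th * gam) ?u) + sc (c * d * (qi q kap - th * gam)) ?u = sc (c * d) (tensv ?p (oE (oF ?x)) ?b')"
    unfolding com by (simp add: tensv_add tensv_sc) (simp add: fun_eq_iff fapp algebra_simps)
  also have "cl (?p + N * L) \<dots> = X (Y (cl n v))" unfolding oE_def oF_def by (rule r(1)[symmetric])
  finally have "X (Y (cl n v)) = ad (Y (X (cl n v))) (sm' (c * d * (qi q kap - th * gam)) (cl n v))" by (rule sym)
  moreover have "th * gam = q powi (- 2 * be) * gam * q powi ((al - be) * kap)" by (simp add: th_def mult_ac)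
  ultimately show ?thesis by (simp only:)
qed

end

section \<open>An abstract action of a quantum affine algebra\<close>

lemma cartan_diag: "2 \<le> P \<Longrightarrow> cartan P i i = 2"
proof -
  assume "2 \<le> P"
  then have "(1::int) mod int P = 1" "(- 1 :: int) mod int P = int P - 1" by (simp_all add: zmod_minus1)
  then show ?thesis using \<open>2 \<le> P\<close> by (simp add: cartan_def cgr_def dl_def)
qed

lemma cgr_commute: "cgr P x y = cgr P y x"
  unfolding cgr_def by (metis dvd_eq_mod_eq_0 dvd_minus_iff minus_diff_eq)

lemma cartan_commute: "cartan P i j = cartan P j i"
proof -
  have "cgr P i (j + 1) = cgr P j (i - 1)" "cgr P i (j - 1) = cgr P j (i + 1)"
    using cgr_commute[of P i "j + 1"] cgr_commute[of P i "j - 1"] by (simp_all add: cgr_def algebra_simps)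
  then show ?thesis using cgr_commute[of P i j] by (simp add: cartan_def)
qed

lemma cartan_off_diag:
  assumes "i \<in> {0..<int P}" "j \<in> {0..<int P}" "i \<noteq> j"
  shows "cartan P i j \<in> {0, - 1, - 2}"
proof -
  have "\<not> cgr P i j"
  proof
    assume "cgr P i j"
    then have "i mod int P = j mod int P" by (simp add: cgr_def mod_eq_dvd_iff dvd_eq_mod_eq_0)
    then show False using assms by simp
  qed
  then show ?thesis by (auto simp: cartan_def dl_def)
qed

text \<open>\<open>e i\<close> and \<open>f i\<close> are the partial maps by which \<open>E\<^sub>i\<close> and \<open>F\<^sub>i\<close> act on the basis of one factor, \<open>ck\<close> is the colour
  they change, and \<open>S\<close> is the level.  The coproduct \<open>\<Delta>\<^sup>+\<close> corresponds to \<open>(al, be) = (0, 1)\<close> and \<open>\<Delta>\<^sup>-\<close> to \<open>(1, 0)\<close>.\<close>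

locale uqact = fk +
  fixes P S :: nat and e f :: "int \<Rightarrow> int \<Rightarrow> int option" and k :: "int \<Rightarrow> int \<Rightarrow> int" and al be :: int
    and ck :: "int \<Rightarrow> int" and c1 cN :: "int \<Rightarrow> int"
  assumes P2: "2 \<le> P"
    and ab: "al = 0 \<and> be = 1 \<or> al = 1 \<and> be = 0"
    and inv: "\<And>i x y. i \<in> {0..<int P} \<Longrightarrow> e i x = Some y \<longleftrightarrow> f i y = Some x"
    and kval: "\<And>i x. i \<in> {0..<int P} \<Longrightarrow> k i x = dl (f i x \<noteq> None) - dl (e i x \<noteq> None)"
    and kshift: "\<And>i j x y. i \<in> {0..<int P} \<Longrightarrow> j \<in> {0..<int P} \<Longrightarrow> e i x = Some y \<Longrightarrow> k j y = k j x + cartan P j i"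
    and ee: "\<And>i x y. i \<in> {0..<int P} \<Longrightarrow> e i x = Some y \<Longrightarrow> e i y = None"
    and ef: "\<And>i j x y. i \<in> {0..<int P} \<Longrightarrow> j \<in> {0..<int P} \<Longrightarrow> i \<noteq> j \<Longrightarrow> e i x = Some y \<Longrightarrow> f j y = None"
    and fe: "\<And>i j x y. i \<in> {0..<int P} \<Longrightarrow> j \<in> {0..<int P} \<Longrightarrow> i \<noteq> j \<Longrightarrow> f j x = Some y \<Longrightarrow> e i y = None"
    and s0: "\<And>i j x y. i \<in> {0..<int P} \<Longrightarrow> j \<in> {0..<int P} \<Longrightarrow> cartan P i j = 0 \<Longrightarrow> e i x = Some y \<Longrightarrow> e j y = None"
    and s1: "\<And>i j x y z. i \<in> {0..<int P} \<Longrightarrow> j \<in> {0..<int P} \<Longrightarrow> cartan P i j = - 1 \<Longrightarrow> e i x = Some y \<Longrightarrow> e j y = Some z \<Longrightarrow> e i z = None"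
    and wk: "\<And>i. i \<in> {0..<int P} \<Longrightarrow> wfun (k i)"
    and kb: "\<And>i m. i \<in> {0..<int P} \<Longrightarrow> sm (k i) (blk m) = 0"
    and rng: "\<And>i x y. i \<in> {0..<int P} \<Longrightarrow> e i x = Some y \<Longrightarrow> x - NL \<le> y \<and> y < x"
    and eund: "\<And>i x y. i \<in> {0..<int P} \<Longrightarrow> e i x = Some y \<Longrightarrow> und y = und x + dl (i = 0)"
    and WE: "\<And>i w. i \<in> {0..<int P} \<Longrightarrow> w \<in> W2 \<Longrightarrow> opx q (\<lambda>x. al * k i x) (\<lambda>x. be * k i x) (f i) w \<in> W2"
    and WF: "\<And>i w. i \<in> {0..<int P} \<Longrightarrow> w \<in> W2 \<Longrightarrow> opx q (\<lambda>x. - be * k i x) (\<lambda>x. - al * k i x) (e i) w \<in> W2"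
    and ecol: "\<And>i x. i \<in> {0..<int P} \<Longrightarrow> e i x \<noteq> None \<longleftrightarrow> ck x = c1 i"
    and ecol': "\<And>i x y. i \<in> {0..<int P} \<Longrightarrow> e i x = Some y \<Longrightarrow> ck y = cN i"
    and cc: "\<And>i. i \<in> {0..<int P} \<Longrightarrow> c1 i \<noteq> cN i"
    and wck: "\<And>F. wfun (\<lambda>x. F (ck x))"
    and S: "\<And>i l. i \<in> {0..<int P} \<Longrightarrow> finite {y. und y = l \<and> ck y = c1 i} \<and> card {y. und y = l \<and> ck y = c1 i} = S"
begin

abbreviation "I \<equiv> {0..<int P}"
abbreviation "oE i \<equiv> opx q (\<lambda>x. al * k i x) (\<lambda>x. be * k i x) (f i)"
abbreviation "oF i \<equiv> opx q (\<lambda>x. - be * k i x) (\<lambda>x. - al * k i x) (e i)"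

lemma zero_I: "0 \<in> I" using P2 by simp

lemma wfun_multiple: "i \<in> I \<Longrightarrow> wfun (\<lambda>x. c * k i x)"
  using wfun_mult[OF wk, of i c] by simp

lemma sm_multiple: "i \<in> I \<Longrightarrow> sm (\<lambda>x. c * k i x) (blk m) = 0"
  using kb by (simp add: sum_list_const_mult)

lemma Eop_E: "i \<in> I \<Longrightarrow> Eop (\<lambda>x. al * k i x) (\<lambda>x. be * k i x) (e i) (f i)"
proof -
  assume i: "i \<in> I"
  have w: "wfun (\<lambda>x. al * k i x)" "wfun (\<lambda>x. be * k i x)" using wfun_multiple[OF i] by blast+
  show ?thesis unfolding Eop_def wop_def using w sm_multiple[OF i] rng[OF i] inv[OF i] WE[OF i] by blast
qed

lemma Fop_F: "i \<in> I \<Longrightarrow> Fop (\<lambda>x. - be * k i x) (\<lambda>x. - al * k i x) (f i) (e i)"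
proof -
  assume i: "i \<in> I"
  have w: "wfun (\<lambda>x. - be * k i x)" "wfun (\<lambda>x. - al * k i x)" using wfun_multiple[OF i] by blast+
  have r: "x < y \<and> y \<le> x + NL" if "f i x = Some y" for x y using rng[OF i, of y x] that inv[OF i] by auto
  have v: "f i x = Some y \<longleftrightarrow> e i y = Some x" for x y using inv[OF i] by blast
  show ?thesis unfolding Fop_def wop_def using w sm_multiple[OF i] r v WF[OF i] by blast
qed

lemmas wop_E = Eop_E[unfolded Eop_def, THEN conjunct1]
lemmas wop_F = Fop_F[unfolded Fop_def, THEN conjunct1]

lemma ke: "i \<in> I \<Longrightarrow> e i x = Some y \<Longrightarrow> k i y = k i x + 2"
  using kshift[of i i x y] cartan_diag[OF P2] by simp

subsection \<open>Two consecutive blocks\<close>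

lemma oE_block: "i \<in> I \<Longrightarrow> i \<noteq> 0 \<Longrightarrow> oE i (bvec (blk m)) \<in> WW (N * L)"
proof -
  assume i: "i \<in> I" "i \<noteq> 0"
  show ?thesis
  proof (rule wop_block[OF wop_E[OF i(1)]])
    fix x y assume "e i x = Some y"
    then show "und y = und x" "x \<noteq> y" using eund[OF i(1)] rng[OF i(1)] i(2) by (auto simp: dl_def)
  qed
qed

lemma oF_block: "i \<in> I \<Longrightarrow> i \<noteq> 0 \<Longrightarrow> oF i (bvec (blk m)) \<in> WW (N * L)"
proof -
  assume i: "i \<in> I" "i \<noteq> 0"
  show ?thesis
  proof (rule wop_block[OF wop_F[OF i(1)]])
    fix x y assume "f i x = Some y"
    then have "e i y = Some x" using inv[OF i(1)] by blast
    then show "und y = und x" "x \<noteq> y" using eund[OF i(1), of y x] rng[OF i(1), of y x] i(2) by (auto simp: dl_def)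
  qed
qed

lemma blk_two: "dlist (- (NL * m)) (N * L + N * L) = blk m @ blk (m + 1)"
proof -
  have "- (NL * m) - int (N * L) = - (NL * (m + 1))" by (simp add: NL_def algebra_simps)
  then show ?thesis unfolding blk_def by (simp only: dlist_append)
qed

text \<open>At q = 1 this is a computation in an exterior algebra. E_0 moves an index of block m
  into block m + 1, and F_0 moves an index back. Unless F_0 reverses the very same move, an index is
  repeated; if it does, the result is the vacuum with two entries exchanged, of sign -1. There are S
  possible moves.\<close>

lemma exchange_blocks:
  "\<exists>gam. ev1 gam (- of_nat S) \<and>
     tensv (N * L) (oE 0 (bvec (blk m))) (oF 0 (bvec (blk (m + 1)))) - sc gam (bvec (blk m @ blk (m + 1))) \<in> WW (N * L + N * L)"
proof -
  let ?b = "blk m" and ?b' = "blk (m + 1)" and ?n = "N * L" and ?T = "blk m @ blk (m + 1)"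
  note i = zero_I
  have fe0: "f 0 x = Some y \<longleftrightarrow> e 0 y = Some x" for x y using inv[OF i] by blast
  define A where "A = (\<lambda>j. case e 0 (?b ! j) of None \<Rightarrow> 0
     | Some y \<Rightarrow> sc (q powi sm (\<lambda>x. al * k 0 x) (take j ?b) * q powi sm (\<lambda>x. be * k 0 x) (drop (Suc j) ?b)) (bvec (?b[j := y])))"
  define B where "B = (\<lambda>j. case f 0 (?b' ! j) of None \<Rightarrow> 0
     | Some y \<Rightarrow> sc (q powi sm (\<lambda>x. - be * k 0 x) (take j ?b') * q powi sm (\<lambda>x. - al * k 0 x) (drop (Suc j) ?b')) (bvec (?b'[j := y])))"
  \<comment> \<open>The expected value at q = 1 of the term in which E_0 acts at place
    \<open>j\<close> and F_0 at place \<open>j'\<close>.\<close>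
  define R where "R = (\<lambda>j j'. if e 0 (?b ! j) = Some (?b' ! j') then - 1 else 0 :: rat)"
  have db: "distinct ?b" "distinct ?b'" by (simp_all add: blk_def dlist_distinct)
  have dT: "sorted_wrt (>) ?T" "distinct ?T" unfolding blk_two[symmetric] by (rule dlist_desc dlist_distinct)+
  have pair: "\<exists>c. ev1 c (R j j') \<and> tensv ?n (A j) (B j') - sc c (bvec ?T) \<in> WW (?n + ?n)" if j: "j < ?n" "j' < ?n" for j j'
  proof (cases "e 0 (?b ! j) = None \<or> f 0 (?b' ! j') = None")
    case True
    then have "tensv ?n (A j) (B j') = 0" by (auto simp: A_def B_def)
    moreover have "R j j' = 0"
    proof -
      have "e 0 (?b ! j) \<noteq> Some (?b' ! j')"
      proof
        assume "e 0 (?b ! j) = Some (?b' ! j')"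
        moreover from this have "f 0 (?b' ! j') = Some (?b ! j)" using inv[OF i] by blast
        ultimately show False using True by simp
      qed
      then show ?thesis by (simp add: R_def)
    qed
    ultimately show ?thesis by (intro exI[of _ 0]) (simp add: WW.zero)
  next
    case False
    then obtain y y' where y: "e 0 (?b ! j) = Some y" "f 0 (?b' ! j') = Some y'" by auto
    let ?l = "?b[j := y] @ ?b'[j' := y']"
    have bj: "?b ! j \<in> set ?b" "?b' ! j' \<in> set ?b'" using j by simp_all
    have uy: "und y = m + 1" "und y' = m"
      using eund[OF i y(1)] eund[OF i, of y' "?b' ! j'"] y(2) fe0 bj by (auto simp: blk_set dl_def)
    then have yb: "y \<in> set ?b'" "y' \<in> set ?b" by (simp_all add: blk_set)
    have "set ?l \<subseteq> set ?b \<union> set ?b'" using yb set_update_subset_insert[of ?b j y] set_update_subset_insert[of ?b' j' y'] by auto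
    also have "\<dots> = set ?T" by simp
    also have "\<dots> = {- (NL * m) - int (?n + ?n) + 1..- (NL * m)}" unfolding blk_two[symmetric] by (rule dlist_set)
    finally obtain c where c: "ev1 c (sg ?l)" "bvec ?l - sc c (bvec ?T) \<in> WW (?n + ?n)"
      using interval_single[of ?l "?n + ?n" "- (NL * m)"] unfolding blk_two by auto
    define s where "s = (q powi sm (\<lambda>x. al * k 0 x) (take j ?b) * q powi sm (\<lambda>x. be * k 0 x) (drop (Suc j) ?b)) *
       (q powi sm (\<lambda>x. - be * k 0 x) (take j' ?b') * q powi sm (\<lambda>x. - al * k 0 x) (drop (Suc j') ?b'))"
    have "ev1 s (1 * 1 * (1 * 1))" unfolding s_def by (intro ev1_mult ev1_qq_powi)
    then have es: "ev1 (s * c) (1 * sg ?l)" using c(1) by (intro ev1_mult) simp_all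
    have t: "tensv ?n (A j) (B j') = sc s (bvec ?l)"
      unfolding A_def B_def y option.case s_def by (simp add: tensv_sc tensv_bvec' mult_ac)
    have "sg ?l = R j j'"
    proof (cases "y = ?b' ! j'")
      case True
      then have "f 0 (?b' ! j') = Some (?b ! j)" using y(1) inv[OF i] by blast
      then have y': "y' = ?b ! j" using y(2) by simp
      define us vs us' vs' where uv: "us = take j ?b" "vs = drop (Suc j) ?b" "us' = take j' ?b'" "vs' = drop (Suc j') ?b'"
      have b: "?b = us @ y' # vs" "?b' = us' @ y # vs'" unfolding uv y' True using j by (simp_all add: id_take_nth_drop)
      have l: "?l = us @ y # (vs @ us') @ y' # vs'" using j by (simp add: upd_conv_take_nth_drop uv)
      have T: "?T = us @ y' # (vs @ us') @ y # vs'" using b by simp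
      have "sg ?T = - sg ?l" unfolding l T using dT(2) unfolding T by (rule sg_swap)
      then show ?thesis using sg_decreasing[OF dT(1)] True y(1) by (simp add: R_def)
    next
      case False
      \<comment> \<open>Here \<open>y\<close> also keeps its old place in the second block, so it
        occurs twice.\<close>
      obtain j'' where j'': "j'' < ?n" "?b' ! j'' = y" using yb(1) by (auto simp: in_set_conv_nth)
      then have "j'' \<noteq> j'" using False by auto
      then have "(?b'[j' := y']) ! j'' = y" using j'' by simp
      then have "y \<in> set (?b'[j' := y'])" using j''(1) by (metis blk_length length_list_update nth_mem)
      moreover have "y \<in> set (?b[j := y])" using j by (simp add: set_update_memI)
      ultimately have "\<not> distinct ?l" by auto
      then show ?thesis using sg_repeated False y(1) by (simp add: R_def)
    qed
    then have "ev1 (s * c) (R j j')" using es by simp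
    moreover have "tensv ?n (A j) (B j') - sc (s * c) (bvec ?T) \<in> WW (?n + ?n)"
      using WW_sc[OF c(2), of s] unfolding t by (simp add: sc_diff)
    ultimately show ?thesis by blast
  qed
  then obtain c where c: "\<And>j j'. j < ?n \<Longrightarrow> j' < ?n \<Longrightarrow> ev1 (c j j') (R j j') \<and> tensv ?n (A j) (B j') - sc (c j j') (bvec ?T) \<in> WW (?n + ?n)"
    by metis
  define gam where "gam = (\<Sum>j<?n. \<Sum>j'<?n. c j j')"
  have "ev1 gam (\<Sum>j<?n. \<Sum>j'<?n. R j j')" unfolding gam_def using c by (intro ev1_sum) auto
  moreover have "(\<Sum>j<?n. \<Sum>j'<?n. R j j') = - of_nat S"
  proof -
    have in1: "(\<Sum>j'<?n. R j j') = (if e 0 (?b ! j) = None then 0 else - 1)" if j: "j < ?n" for j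
    proof (cases "e 0 (?b ! j)")
      case None
      then show ?thesis by (simp add: R_def)
    next
      case (Some y)
      have "?b ! j \<in> set ?b" using j by simp
      then have "und y = m + 1" using eund[OF i Some] by (simp add: blk_set dl_def)
      then have "y \<in> set ?b'" by (simp add: blk_set)
      then obtain j0 where j0: "j0 < ?n" "?b' ! j0 = y" by (auto simp: in_set_conv_nth)
      have "R j j' = (if j' = j0 then - 1 else 0)" if "j' < ?n" for j'
        using Some j0 that db(2) nth_eq_iff_index_eq[OF db(2), of j' j0] by (auto simp: R_def)
      then have "(\<Sum>j'<?n. R j j') = (\<Sum>j'<?n. if j' = j0 then - 1 else 0)" by (intro sum.cong) auto
      then show ?thesis using j0 Some by simp
    qed
    have "(\<Sum>j<?n. \<Sum>j'<?n. R j j') = (\<Sum>j<?n. if e 0 (?b ! j) = None then 0 else - 1)" using in1 by (intro sum.cong) auto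
    also have "\<dots> = (\<Sum>x\<in>set ?b. if e 0 x = None then 0 else - 1)"
      using bij_betw_nth[OF db(1), of "{..<?n}" "set ?b"] by (intro sum.reindex_bij_betw) simp
    also have "\<dots> = (\<Sum>x\<in>{y. und y = m \<and> ck y = c1 0}. - 1)"
    proof (rule sum.mono_neutral_cong_right)
      show "{y. und y = m \<and> ck y = c1 0} \<subseteq> set ?b" by (auto simp: blk_set)
    qed (use ecol[OF i] in \<open>auto simp: blk_set\<close>)
    also have "\<dots> = - of_nat S" using S[OF i, of m] by simp
    finally show ?thesis .
  qed
  moreover have "tensv ?n (oE 0 (bvec ?b)) (oF 0 (bvec ?b')) - sc gam (bvec ?T) = (\<Sum>j<?n. \<Sum>j'<?n. tensv ?n (A j) (B j') - sc (c j j') (bvec ?T))"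
  proof -
    have "oE 0 (bvec ?b) = (\<Sum>j<?n. A j)" unfolding A_def using opx_bvec[OF qq_nonzero inv[OF i], of N _ _ ?b] by simp
    moreover have "oF 0 (bvec ?b') = (\<Sum>j<?n. B j)" unfolding B_def using opx_bvec[OF qq_nonzero fe0, of N _ _ ?b'] by (simp only: blk_length)
    ultimately show ?thesis by (simp add: gam_def tensv_sum sum_subtractf) (simp add: fun_eq_iff fapp sum_fun_apply sum_distrib_right, intro allI, rule sum.swap)
  qed
  moreover have "(\<Sum>j<?n. \<Sum>j'<?n. tensv ?n (A j) (B j') - sc (c j j') (bvec ?T)) \<in> WW (?n + ?n)"
    using c by (intro WW_sum) auto
  ultimately show ?thesis by auto
qed

end

section \<open>Weight and degree relations on the Fock space\<close>

context fk begin

lemma FL_pow: "FL X \<Longrightarrow> FL (X ^^ s)"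
proof (induction s)
  case (Suc s)
  then have s: "FL (X ^^ s)" by simp
  show ?case unfolding FL_def using FLD[OF Suc.prems] FLD[OF s] by simp
qed (simp add: FL_def)

lemma kop_ex:
  assumes "\<And>m. sm f (blk m) = 0" "good n" "good p" "n \<le> p"
  shows "kop q f (ex n p v) = ex n p (kop q f v)"
proof -
  obtain R where "p = n + R * (N * L)" using good_diff assms by blast
  then show ?thesis using kop_tail[OF assms(1,2), of R] assms by (simp add: ex_tensv kop_tensv)
qed

lemma dop_ex:
  assumes "good n" "good p" "n \<le> p"
  shows "dop und (ex n p v) + sc (of_int (dvac p)) (ex n p v) = ex n p (dop und v + sc (of_int (dvac n)) v)"
proof -
  obtain R where R: "p = n + R * (N * L)" using good_diff assms by blast
  have d: "dvac p = dvac n - sm und (dlist (M - int n) (p - n))" using dvac_add[OF assms(1), of R] R good_mm[OF assms(1)] by simp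
  show ?thesis
    using assms unfolding d by (simp add: ex_tensv dop_tensv dop_bvec tensv_add tensv_sc) (simp add: fun_eq_iff fapp algebra_simps)
qed

lemma kop_kop: "kop q f (kop q g v) = kop q g (kop q f v)" "kop q f (dop h v) = dop h (kop q f v)"
  by (simp_all add: kop_def dop_def fun_eq_iff)

lemma kop_inverse: "kop q f (kop q (\<lambda>x. - f x) v) = v" "kop q (\<lambda>x. - f x) (kop q f v) = v"
  by (simp_all add: kop_def fun_eq_iff uminus_sum_list_map[symmetric, unfolded o_def] power_int_minus)

lemma EC_pow:
  assumes w: "wop bf af g h" and X: "EC X c bf af h" and n: "good n" "v \<in> tens n"
  shows "(X ^^ s) (cl n v) = cl n (sc (c ^ s) ((opx q bf af h ^^ s) v)) \<and> (opx q bf af h ^^ s) v \<in> tens n"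
proof (induction s)
  case (Suc s)
  then show ?case using X n wop_tens[OF w] by (simp add: EC_def lnrD[OF lnr_opx])
qed (use n in simp)

lemma foldr_ad_cl:
  assumes "\<And>k. k \<in> set ks \<Longrightarrow> T k = cl p (u k) \<and> u k \<in> tens p"
  shows "foldr ad (map (\<lambda>k. sm' (c k) (T k)) ks) (fzero N L M) = cl p (\<Sum>k\<leftarrow>ks. sc (c k) (u k)) \<and> (\<Sum>k\<leftarrow>ks. sc (c k) (u k)) \<in> tens p"
  using assms by (induction ks) (auto simp: fzero_cl[of p] fsc_cl fadd_cl)

lemma KC_KC: "KC X c f \<Longrightarrow> KC Y d g \<Longrightarrow> C \<in> FK \<Longrightarrow> X (Y C) = Y (X C)"
proof -
  assume X: "KC X c f" and Y: "KC Y d g" and C: "C \<in> FK"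
  obtain n v where n: "good n" "v \<in> tens n" "C = cl n v" using FK_cl[OF C, of 0] by blast
  then show ?thesis using X Y kop_tens by (simp add: KC_def lnrD[OF lnr_kop] mult.commute kop_kop(1)[of f g])
qed

lemma DC_KC: "DC X \<Longrightarrow> KC Y d g \<Longrightarrow> C \<in> FK \<Longrightarrow> X (Y C) = Y (X C)"
proof -
  assume X: "DC X" and Y: "KC Y d g" and C: "C \<in> FK"
  obtain n v where n: "good n" "v \<in> tens n" "C = cl n v" using FK_cl[OF C, of 0] by blast
  then show ?thesis using X Y kop_tens dop_tens
    by (simp add: KC_def DC_def lnrD[OF lnr_kop] lnrD[OF lnr_dop] mult.commute kop_kop(2) sc_add)
qed

lemma KC_inverse: "KC X c f \<Longrightarrow> KC Y d (\<lambda>x. - f x) \<Longrightarrow> c * d = 1 \<Longrightarrow> C \<in> FK \<Longrightarrow> X (Y C) = C"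
proof -
  assume X: "KC X c f" and Y: "KC Y d (\<lambda>x. - f x)" and cd: "c * d = 1" and C: "C \<in> FK"
  obtain n v where n: "good n" "v \<in> tens n" "C = cl n v" using FK_cl[OF C, of 0] by blast
  then show ?thesis using X Y kop_tens cd by (simp add: KC_def lnrD[OF lnr_kop] kop_inverse)
qed

lemma KC_EC:
  assumes K: "KC K l k" and X: "EC X c bf af h" and w: "wop bf af g h" and s: "\<And>y x. h y = Some x \<Longrightarrow> k y = k x + a" and C: "C \<in> FK"
  shows "K (X C) = sm' (q powi a) (X (K C))"
proof -
  obtain n v where n: "good n" "v \<in> tens n" "C = cl n v" using FK_cl[OF C, of 0] by blast
  then show ?thesis using K X kop_tens wop_tens[OF w] kop_opx[OF qq_nonzero s, where bf = bf and af = af and v = v]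
    by (simp add: KC_def EC_def fsc_cl lnrD[OF lnr_kop] lnrD[OF lnr_opx] mult_ac)
qed

lemma KC_FC:
  assumes K: "KC K l k" and kb: "\<And>m. sm k (blk m) = 0" and X: "FC X c bf af h" and w: "wop bf af g h"
    and s: "\<And>y x. h y = Some x \<Longrightarrow> k y = k x + a" and C: "C \<in> FK"
  shows "K (X C) = sm' (q powi a) (X (K C))"
proof -
  obtain n v where n: "good n" "v \<in> tens n" "C = cl n v" using FK_cl[OF C, of 0] by blast
  let ?p = "n + N * L"
  have p: "good ?p" using n good_add1 by simp
  have t: "opx q bf af h (ex n ?p w) \<in> tens ?p" if "w \<in> tens n" for w using that wop_tens[OF w] ex_tens by simp
  show ?thesis using n K X p t kop_tens kop_opx[OF qq_nonzero s, where bf = bf and af = af and v = "ex n ?p v"] kop_ex[OF kb n(1) p, of v]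
    by (simp add: KC_def FC_def fsc_cl lnrD[OF lnr_kop] lnrD[OF lnr_opx] ex_lin mult_ac)
qed

lemma DC_EC:
  assumes D: "DC D" and X: "EC X c bf af h" and w: "wop bf af g h" and s: "\<And>y x. h y = Some x \<Longrightarrow> und y = und x + a" and C: "C \<in> FK"
  shows "ad (D (X C)) (sm' (-1) (X (D C))) = sm' (of_int a) (X C)"
proof -
  obtain n v where n: "good n" "v \<in> tens n" "C = cl n v" using FK_cl[OF C, of 0] by blast
  let ?o = "opx q bf af h" and ?d = "\<lambda>v. dop und v + sc (of_int (dvac n)) v"
  have l: "?o (?d v) = ?o (dop und v) + sc (of_int (dvac n)) (?o v)" by (simp add: lnrD[OF lnr_opx])
  have dt: "?d v \<in> tens n" using n dop_tens by simp
  have t: "?o v \<in> tens n" "?o (dop und v) \<in> tens n" using wop_tens[OF w] n dop_tens by simp_all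
  have DX: "D (X C) = cl n (?d (sc c (?o v)))" using D X n t by (simp add: DC_def EC_def)
  have XD: "X (D C) = cl n (sc c (?o (?d v)))" using D X n dt by (simp add: DC_def EC_def)
  have XC: "X C = cl n (sc c (?o v))" using X n by (simp add: EC_def)
  have dd: "dop und (?o v) = ?o (dop und v) + sc (of_int a) (?o v)" by (rule dop_opx[OF s])
  have e: "?d (sc c (?o v)) + sc (- 1) (sc c (?o (?d v))) = sc (of_int a) (sc c (?o v))"
    unfolding l lnrD(2)[OF lnr_dop] dd by (simp add: fun_eq_iff fapp algebra_simps)
  have "ad (D (X C)) (sm' (-1) (X (D C))) = cl n (?d (sc c (?o v)) + sc (- 1) (sc c (?o (?d v))))"
    unfolding DX XD l using t dop_tens by (simp add: fsc_cl fadd_cl)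
  then show ?thesis unfolding e XC using t by (simp add: fsc_cl)
qed

lemma DC_FC:
  assumes D: "DC D" and X: "FC X c bf af h" and w: "wop bf af g h" and s: "\<And>y x. h y = Some x \<Longrightarrow> und y = und x + a" and C: "C \<in> FK"
  shows "ad (D (X C)) (sm' (-1) (X (D C))) = sm' (of_int a) (X C)"
proof -
  obtain n v where n: "good n" "v \<in> tens n" "C = cl n v" using FK_cl[OF C, of 0] by blast
  let ?p = "n + N * L"
  have p: "good ?p" using n good_add1 by simp
  let ?o = "opx q bf af h" and ?d = "\<lambda>n v. dop und v + sc (of_int (dvac n)) v" and ?x = "ex n ?p v"
  have xt: "?x \<in> tens ?p" using n ex_tens by simp
  have l: "?o (?d ?p ?x) = ?o (dop und ?x) + sc (of_int (dvac ?p)) (?o ?x)" by (simp add: lnrD[OF lnr_opx])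
  have dt: "?d n v \<in> tens n" using n dop_tens by simp
  have t: "?o ?x \<in> tens ?p" "?o (dop und ?x) \<in> tens ?p" using wop_tens[OF w] xt dop_tens by simp_all
  have DX: "D (X C) = cl ?p (?d ?p (sc c (?o ?x)))" using D X n t p by (simp add: DC_def FC_def)
  have XD: "X (D C) = cl ?p (sc c (?o (?d ?p ?x)))" using D X n dt by (simp add: DC_def FC_def dop_ex[OF n(1) p])
  have XC: "X C = cl ?p (sc c (?o ?x))" using X n by (simp add: FC_def)
  have dd: "dop und (?o ?x) = ?o (dop und ?x) + sc (of_int a) (?o ?x)" by (rule dop_opx[OF s])
  have e: "?d ?p (sc c (?o ?x)) + sc (- 1) (sc c (?o (?d ?p ?x))) = sc (of_int a) (sc c (?o ?x))"
    unfolding l lnrD(2)[OF lnr_dop] dd by (simp add: fun_eq_iff fapp algebra_simps)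
  have "ad (D (X C)) (sm' (-1) (X (D C))) = cl ?p (?d ?p (sc c (?o ?x)) + sc (- 1) (sc c (?o (?d ?p ?x))))"
    unfolding DX XD l using t dop_tens by (simp add: fsc_cl fadd_cl)
  then show ?thesis unfolding e XC using t by (simp add: fsc_cl)
qed

end

subsection \<open>Serre sums\<close>

lemma qint_qi: "qint q k = qi q (int k)"
  by (simp add: qint_def qi_def power_int_minus power_inverse)

text \<open>Its value at q = 1 is the nonzero integer k.\<close>

lemma qint_nonzero: "0 < N \<Longrightarrow> 0 < k \<Longrightarrow> qint (qq N) k \<noteq> 0"
proof
  assume a: "0 < N" "0 < k" "qint (qq N) k = 0"
  then have "ev1 0 (of_int (int k))" using ev1_qi[of N "int k"] by (simp add: qint_qi)
  then show False using ev1_unique[of 0 0 "of_int (int k)"] a by simp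
qed

lemma qfact_nonzero: "0 < N \<Longrightarrow> qfact (qq N) k \<noteq> 0"
  unfolding qfact_def using qint_nonzero by auto

lemma qbin_ends: "0 < N \<Longrightarrow> qbin (qq N) n 0 = 1" "0 < N \<Longrightarrow> qbin (qq N) n n = 1"
  using qfact_nonzero[of N n] by (simp_all add: qbin_def) (simp_all add: qfact_def)

lemma qfact_Suc: "qfact q (Suc n) = qint q (Suc n) * qfact q n"
  by (simp add: qfact_def)

lemma qint_1: "q - inverse q \<noteq> 0 \<Longrightarrow> qint q (Suc 0) = 1" by (simp add: qint_def)

lemma qint_2: "q - inverse q \<noteq> 0 \<Longrightarrow> qint q (Suc (Suc 0)) = q + inverse q"
  by (simp add: qint_def divide_simps algebra_simps)

lemma qint_3: "q \<noteq> 0 \<Longrightarrow> q - inverse q \<noteq> 0 \<Longrightarrow> qint q (Suc (Suc (Suc 0))) = q ^ 2 + 1 + inverse q ^ 2"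
proof -
  assume a: "q \<noteq> 0" "q - inverse q \<noteq> 0"
  have "(q ^ 2 + 1 + inverse q ^ 2) * (q - inverse q) = q ^ 3 - inverse q ^ 3"
    using a(1) by (simp add: field_simps power2_eq_square power3_eq_cube)
  then show ?thesis using a(2) by (simp add: qint_def divide_simps power3_eq_cube numeral_3_eq_3)
qed

lemma qbin_values:
  assumes "0 < N"
  shows "qbin (qq N) 2 1 = qq N + inverse (qq N)"
    "qbin (qq N) 3 1 = qq N ^ 2 + 1 + inverse (qq N) ^ 2" "qbin (qq N) 3 2 = qq N ^ 2 + 1 + inverse (qq N) ^ 2"
proof -
  have d: "qq N - inverse (qq N) \<noteq> 0" using qq_minus_inverse assms by simp
  note f = qfact_Suc[of "qq N"]
  have f0: "qfact (qq N) 0 = 1" by (simp add: qfact_def)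
  have f1: "qfact (qq N) (Suc 0) = 1" by (simp add: f f0 qint_1[OF d])
  have i2: "qint (qq N) (Suc (Suc 0)) \<noteq> 0" using qint_nonzero assms by simp
  have f2: "qfact (qq N) (Suc (Suc 0)) = qint (qq N) (Suc (Suc 0))" by (simp only: f[of "Suc 0"] f1 mult_1_right)
  have f3: "qfact (qq N) (Suc (Suc (Suc 0))) = qint (qq N) (Suc (Suc (Suc 0))) * qint (qq N) (Suc (Suc 0))" by (simp only: f[of "Suc (Suc 0)"] f2)
  show "qbin (qq N) 2 1 = qq N + inverse (qq N)"
    unfolding qbin_def by (simp add: numeral_2_eq_2 f1 f2 qint_2[OF d])
  show "qbin (qq N) 3 1 = qq N ^ 2 + 1 + inverse (qq N) ^ 2" "qbin (qq N) 3 2 = qq N ^ 2 + 1 + inverse (qq N) ^ 2"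
    unfolding qbin_def using i2 qint_3[OF _ d]
    by (simp_all add: numeral_2_eq_2 numeral_3_eq_3 f1 f2 f3)
qed

lemma upt_123: "[0..<Suc 1] = [0, 1]" "[0..<Suc 2] = [0, 1, 2]" "[0..<Suc 3] = [0, 1, 2, 3]"
  by (simp_all add: upt_rec)

lemma (in serre_pair) serre_sum:
  assumes N: "0 < N" "q = qq N" and a: "a \<in> {0, - 1, - 2}"
    and z0: "\<And>x y. a = 0 \<Longrightarrow> h1 x = Some y \<Longrightarrow> h2 y = None" "\<And>x y. a = 0 \<Longrightarrow> h2 x = Some y \<Longrightarrow> h1 y = None"
    and z1: "\<And>x y z. a = - 1 \<Longrightarrow> h1 x = Some y \<Longrightarrow> h2 y = Some z \<Longrightarrow> h1 z = None"
  shows "(\<Sum>k\<leftarrow>[0..<Suc (nat (1 - a))]. sc ((-1) ^ k * qbin q (nat (1 - a)) k) ((X ^^ (nat (1 - a) - k)) (Y ((X ^^ k) v)))) = 0"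
proof -
  note qb = qbin_ends[OF N(1), folded N(2)] qbin_values[OF N(1), folded N(2)]
  consider "a = 0" | "a = - 1" | "a = - 2" using a by auto
  then show ?thesis
  proof cases
    case 1
    then have n: "nat (1 - a) = 1" by simp
    show ?thesis unfolding n upt_123 using serre1[OF 1 z0(1)[OF 1] z0(2)[OF 1], where v = v] qb(1,2)[of 1]
      by (simp add: sc_minus_one)
  next
    case 2
    then have n: "nat (1 - a) = 2" by simp
    show ?thesis unfolding n upt_123 using serre2[OF 2 z1[OF 2], where v = v]
      by (simp add: qb numeral_2_eq_2[symmetric] del: One_nat_def) (simp add: numeral_2_eq_2 qb(1,2) algebra_simps)
  next
    case 3
    then have n: "nat (1 - a) = 3" by simp
    show ?thesis unfolding n upt_123 using serre3[OF 3 refl, where v = v]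
      by (simp add: qb del: One_nat_def) (simp add: numeral_2_eq_2 numeral_3_eq_3 sc_minus_one algebra_simps)
  qed
qed

text \<open>The powers of q are the eigenvalues of K_i on the vacuum that follows the finite part:
  q^S for i = 0 and 1 otherwise, so S is the level. With K to the right of E (\<open>be = 1\<close>)
  they enter the raising operators; with the inverse of K to the right of F (\<open>al = 1\<close>)
  their inverses enter the lowering ones.\<close>

locale uqmod = uqact +
  fixes XE XF KK KI :: "int \<Rightarrow> fel \<Rightarrow> fel" and DD :: "fel \<Rightarrow> fel"
  assumes XE: "\<And>i. i \<in> {0..<int P} \<Longrightarrow> EC (XE i) (q powi (be * (int S * dl (i = 0)))) (\<lambda>x. al * k i x) (\<lambda>x. be * k i x) (f i)"
    and XF: "\<And>i. i \<in> {0..<int P} \<Longrightarrow> FC (XF i) (q powi (- al * (int S * dl (i = 0)))) (\<lambda>x. - be * k i x) (\<lambda>x. - al * k i x) (e i)"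
    and KK: "\<And>i. i \<in> {0..<int P} \<Longrightarrow> KC (KK i) (q powi (int S * dl (i = 0))) (k i)"
    and KI: "\<And>i. i \<in> {0..<int P} \<Longrightarrow> KC (KI i) (q powi (- (int S * dl (i = 0)))) (\<lambda>x. - k i x)"
    and DD: "DC DD"
begin

lemma FL_XE: "i \<in> I \<Longrightarrow> FL (XE i)" and FL_XF: "i \<in> I \<Longrightarrow> FL (XF i)"
  and FL_KK: "i \<in> I \<Longrightarrow> FL (KK i)" and FL_KI: "i \<in> I \<Longrightarrow> FL (KI i)" and FL_DD: "FL DD"
  using EC_FL[OF XE wop_E] FC_FL[OF XF wop_F] KC_FL[OF KK] KC_FL[OF KI] DC_FL[OF DD] by blast+

lemma k_f: "i \<in> I \<Longrightarrow> j \<in> I \<Longrightarrow> f j y = Some x \<Longrightarrow> k i y = k i x + cartan P i j"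
  using inv kshift by blast

lemma k_e: "i \<in> I \<Longrightarrow> j \<in> I \<Longrightarrow> e j y = Some x \<Longrightarrow> k i y = k i x + - cartan P i j"
  using kshift[of j i y x] by simp

lemma mult_shift: "a = b + d \<Longrightarrow> c * a = c * b + c * (d :: int)" by (simp add: algebra_simps)

lemma XE_XF_distinct:
  assumes i: "i \<in> I" "j \<in> I" "i \<noteq> j" and C: "C \<in> FK"
  shows "XE i (XF j C) = XF j (XE i C)"
proof (rule raising_lowering_commute[OF Eop_E[OF i(1)] Fop_F[OF i(2)] XE[OF i(1)] XF[OF i(2)] _ _ _ C])
  show "- be * k j y = - be * k j x + - be * cartan P j i" if "f i y = Some x" for x y
    using k_f[OF i(2,1) that] by (rule mult_shift)
  show "oE i (oF j v) = oF j (oE i v)" for v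
  proof (rule opx_commute[OF qq_nonzero])
    show "be * k i y = be * k i x + - be * cartan P j i" if "e j y = Some x" for x y
      using mult_shift[OF k_e[OF i(1,2) that], of be] by (simp add: cartan_commute[of P j i])
    show "- be * k j y = - be * k j x + - be * cartan P j i" if "f i y = Some x" for x y
      using k_f[OF i(2,1) that] by (rule mult_shift)
    show "- al * k j y = - al * k j x + - al * cartan P j i" if "f i y = Some x" for x y
      using k_f[OF i(2,1) that] by (rule mult_shift)
    show "al * k i y = al * k i x + - al * cartan P j i" if "e j y = Some x" for x y
      using mult_shift[OF k_e[OF i(1,2) that], of al] by (simp add: cartan_commute[of P j i])
    show "Option.bind (f i y) (e j) = Option.bind (e j y) (f i)" for y
      using fe[of j i y] ef[of j i y] i by (cases "f i y"; cases "e j y") auto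
  qed
  \<comment> \<open>At least one of i and j is nonzero, and that generator already turns a single
    block into a relation.\<close>
  show "tensv (N * L) (oE i (bvec (blk m))) (oF j (bvec (blk (m + 1)))) \<in> WW (N * L + N * L)" for m
  proof (cases "i = 0")
    case True
    then have "oF j (bvec (blk (m + 1))) \<in> WW (N * L)" using oF_block i by blast
    then show ?thesis using wop_tens[OF wop_E[OF i(1)]] by (intro WW_left) simp_all
  next
    case False
    then have "oE i (bvec (blk m)) \<in> WW (N * L)" using oE_block i by blast
    then show ?thesis using wop_tens[OF wop_F[OF i(2)]] by (intro WW_right) simp_all
  qed
qed

subsection \<open>Local nilpotency\<close>

text \<open>Every application turns one entry of colour c1 into colour cN and leaves the others as
  they are, so s applications need s places. A power exceeding the number of factors is thus zero
  already on tensors.\<close>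

lemma oE_pow_count:
  assumes i: "i \<in> I" and "(oE i ^^ s) v ys \<noteq> 0"
  shows "s \<le> length (filter (\<lambda>x. ck x = cN i) ys)"
  using assms(2)
proof (induction s arbitrary: ys)
  case (Suc s)
  then have "oE i ((oE i ^^ s) v) ys \<noteq> 0" by simp
  from opx_nonzero[OF this] obtain us y vs x where u: "ys = us @ y # vs" "f i y = Some x" "(oE i ^^ s) v (us @ x # vs) \<noteq> 0" by blast
  have "e i x = Some y" using u(2) inv[OF i] by blast
  then have "ck y = cN i" "ck x = c1 i" using ecol[OF i, of x] ecol'[OF i] by auto
  then show ?case using Suc.IH[OF u(3)] cc[OF i] by (simp add: u(1))
qed simp

lemma XE_nilpotent: assumes i: "i \<in> I" and C: "C \<in> FK" shows "\<exists>s. (XE i ^^ s) C = fzero N L M"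
proof -
  obtain n v where n: "good n" "v \<in> tens n" "C = cl n v" using FK_cl[OF C, of 0] by blast
  note p = EC_pow[OF wop_E[OF i] XE[OF i] n(1,2), of "Suc n"]
  have "(oE i ^^ Suc n) v ys = 0" for ys
  proof (rule ccontr)
    assume a: "(oE i ^^ Suc n) v ys \<noteq> 0"
    then have "Suc n \<le> length (filter (\<lambda>x. ck x = cN i) ys)" by (rule oE_pow_count[OF i])
    also have "\<dots> \<le> length ys" by simp
    finally show False using a p tens_length[of "(oE i ^^ Suc n) v" n ys] by auto
  qed
  then have "(oE i ^^ Suc n) v = 0" by (simp add: fun_eq_iff fapp)
  then show ?thesis using p n fzero_cl[of n] by (intro exI[of _ "Suc n"]) simp
qed

text \<open>Claimed for all large s, so that the bounds for several basis vectors can be combined in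
  a sum.\<close>

lemma XF_nilpotent_basis:
  assumes i: "i \<in> I" and n: "good n" "length xs = n"
  shows "\<exists>s0. \<forall>s\<ge>s0. (XF i ^^ s) (cl n (bvec xs)) = fzero N L M"
proof -
  have fi: "f i x = Some y \<longleftrightarrow> e i y = Some x" for x y using inv[OF i] by blast
  have "\<exists>s0. \<forall>s\<ge>s0. \<forall>R. (\<forall>x\<in>set xs. und x < mm n + int R) \<longrightarrow>
    (oF i ^^ s) (bvec (xs @ dlist (- (NL * mm n)) (R * (N * L)))) \<in> WW (length xs + R * (N * L))"
  proof (rule energy_vanishing[where ck = ck and ?c1.0 = "c1 i" and cN = "cN i" and dlt = "dl (i = 0)" and g = "f i" and S = S])
    fix x y assume "f i x = Some y"
    then have y: "e i y = Some x" using fi by blast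
    then show "ck x = cN i \<and> ck y = c1 i \<and> und y = und x - dl (i = 0)"
      using ecol[OF i, of y] ecol'[OF i y] eund[OF i y] by auto
  qed (use fi cc[OF i] wck S[OF i] in \<open>auto simp: dl_def\<close>)
  then obtain s0 where s0: "\<And>s R. s \<ge> s0 \<Longrightarrow> (\<forall>x\<in>set xs. und x < mm n + int R) \<Longrightarrow>
    (oF i ^^ s) (bvec (xs @ dlist (- (NL * mm n)) (R * (N * L)))) \<in> WW (length xs + R * (N * L))" by blast
  have "(XF i ^^ s) (cl n (bvec xs)) = fzero N L M" if s: "s \<ge> s0" for s
  proof -
    \<comment> \<open>One block for each of the s applications, and enough further ones to exceed
      every exponent of z in \<open>xs\<close>, as the energy estimate demands.\<close>
    define R where "R = s + nat (Max (insert 0 ((\<lambda>x. und x - mm n + 1) ` set xs)))"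
    have R: "und x < mm n + int R" if "x \<in> set xs" for x
    proof -
      have "und x - mm n + 1 \<le> Max (insert 0 ((\<lambda>x. und x - mm n + 1) ` set xs))" using that by (intro Max_ge) auto
      then show ?thesis by (simp add: R_def)
    qed
    let ?p = "n + R * (N * L)" and ?T = "xs @ dlist (- (NL * mm n)) (R * (N * L))"
    have p: "good ?p" using n good_add by simp
    have x: "ex n ?p (bvec xs) = bvec ?T" using n good_mm by (simp add: ex_tensv tensv_bvec')
    have "rep (cl n (bvec xs)) n ?p (bvec ?T)" using repI[OF n(1) p, of "bvec xs"] n x by simp
    then have "rep ((XF i ^^ s) (cl n (bvec xs))) (n + s * (N * L)) ?p (sc ((q powi (- al * (int S * dl (i = 0)))) ^ s) ((oF i ^^ s) (bvec ?T)))"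
    proof (rule rep_funpow[OF Fop_F[OF i] XF[OF i]])
      show "n + s * (N * L) \<le> ?p" by (simp add: R_def)
    qed
    then have r: "(XF i ^^ s) (cl n (bvec xs)) = cl ?p (sc ((q powi (- al * (int S * dl (i = 0)))) ^ s) ((oF i ^^ s) (bvec ?T)))"
      by (rule rep_cl)
    have W: "sc ((q powi (- al * (int S * dl (i = 0)))) ^ s) ((oF i ^^ s) (bvec ?T)) \<in> WW ?p"
      using s0[OF s, of R] R n by (intro WW_sc) auto
    have "cl ?p (sc ((q powi (- al * (int S * dl (i = 0)))) ^ s) ((oF i ^^ s) (bvec ?T))) = cl ?p 0"
      using W WW_tens[OF W] by (intro cl_WW) simp_all
    then show ?thesis unfolding r using fzero_cl[of ?p] by simp
  qed
  then show ?thesis by blast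
qed

lemma XF_nilpotent: assumes i: "i \<in> I" and C: "C \<in> FK" shows "\<exists>s. (XF i ^^ s) C = fzero N L M"
proof -
  obtain n v where n: "good n" "v \<in> tens n" "C = cl n v" using FK_cl[OF C, of 0] by blast
  have "\<exists>s0. \<forall>s\<ge>s0. (XF i ^^ s) (cl n v) = fzero N L M" using n(2)
  proof (induction rule: tens_induct)
    case zero
    show ?case using FL_fzero[OF FL_pow[OF FL_XF[OF i]]] fzero_cl[of n] by simp
  next
    case (add v c xs)
    obtain s1 s2 where s: "\<And>s. s \<ge> s1 \<Longrightarrow> (XF i ^^ s) (cl n v) = fzero N L M" "\<And>s. s \<ge> s2 \<Longrightarrow> (XF i ^^ s) (cl n (bvec xs)) = fzero N L M"
      using add.IH XF_nilpotent_basis[OF i n(1) add.hyps(2)] by blast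
    have "(XF i ^^ s) (cl n (v + sc c (bvec xs))) = fzero N L M" if "s \<ge> max s1 s2" for s
    proof -
      have x: "cl n (v + sc c (bvec xs)) = ad (cl n v) (sm' c (cl n (bvec xs)))" using add.hyps by (simp add: fsc_cl fadd_cl)
      have K: "cl n v \<in> FK" "cl n (bvec xs) \<in> FK" "sm' c (cl n (bvec xs)) \<in> FK" using add.hyps by (auto intro!: cl_FK FK_sm)
      note l = FLD[OF FL_pow[OF FL_XF[OF i], of s]]
      show ?thesis unfolding x using l(2)[OF K(1,3)] l(3)[OF K(2)] s that ad_fzero[OF FK_zero] sm_fzero by simp
    qed
    then show ?case by blast
  qed
  then show ?thesis using n by blast
qed

end

section \<open>The commutator of E_0 and F_0\<close>

lemma sum_qi_symmetric:
  assumes "0 < N"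
  shows "(\<Sum>j<s. qi (qq N) (int s - 1 - 2 * int j)) = 0"
proof -
  let ?S = "\<Sum>j<s. qi (qq N) (int s - 1 - 2 * int j)"
  have "?S = (\<Sum>j<s. qi (qq N) (int s - 1 - 2 * int (s - Suc j)))" by (rule sum.nat_diff_reindex[symmetric])
  also have "\<dots> = (\<Sum>j<s. - qi (qq N) (int s - 1 - 2 * int j))"
  proof (rule sum.cong[OF refl])
    fix j assume "j \<in> {..<s}"
    then have "int s - 1 - 2 * int (s - Suc j) = - (int s - 1 - 2 * int j)" by (simp add: of_nat_diff)
    then show "qi (qq N) (int s - 1 - 2 * int (s - Suc j)) = - qi (qq N) (int s - 1 - 2 * int j)" by (simp only: qi_uminus)
  qed
  also have "\<dots> = - ?S" by (rule sum_negf)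
  finally have "(1 + 1) * ?S = 0" by (simp add: algebra_simps)
  moreover have "(1 + 1 :: kk) \<noteq> 0"
  proof
    assume "(1 + 1 :: kk) = 0"
    then have "ev1 0 (1 + 1)" using ev1_add[OF ev1_1 ev1_1] by simp
    then show False using ev1_unique[OF ev1_0] by fastforce
  qed
  ultimately show ?thesis by simp
qed

text \<open>At \<open>q = 1\<close> the hypothesis reads \<open>s (lam - s + 1) = 0\<close>.\<close>

lemma string_sum_zero:
  assumes N: "0 < N" and s: "0 < s" and kap: "ev1 kap 0"
    and z: "(\<Sum>j<s. qi (qq N) (lam - 2 * int j) + kap * qq N powi (nu * (lam - 2 * int j))) = 0"
  shows "kap = 0"
proof -
  have "ev1 (\<Sum>j<s. qi (qq N) (lam - 2 * int j) + kap * qq N powi (nu * (lam - 2 * int j))) (\<Sum>j<s. of_int (lam - 2 * int j) + 0 * 1)"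
    by (intro ev1_sum ev1_add ev1_mult ev1_qi ev1_qq_powi kap N)
  then have "(\<Sum>j<s. of_int (lam - 2 * int j) + 0 * 1) = (0 :: rat)" unfolding z using ev1_unique ev1_0 by blast
  then have "(of_int (\<Sum>j<s. lam - 2 * int j) :: rat) = 0" by simp
  then have "(\<Sum>j<s. lam - 2 * int j) = 0" by (simp only: of_int_eq_0_iff)
  moreover have "(\<Sum>j<s. lam - 2 * int j) = int s * (lam - int s + 1)"
    by (induction s) (simp_all add: algebra_simps)
  ultimately have lam: "lam = int s - 1" using s by simp
  \<comment> \<open>With lam = s - 1 the quantum integers cancel in pairs. The factor that
    multiplies \<open>kap\<close> has the value s at q = 1 and is therefore nonzero.\<close>
  have "kap * (\<Sum>j<s. qq N powi (nu * (lam - 2 * int j))) = 0"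
    using z sum_qi_symmetric[OF N, of s] unfolding lam by (simp add: sum.distrib sum_distrib_left)
  moreover have "(\<Sum>j<s. qq N powi (nu * (lam - 2 * int j))) \<noteq> 0"
  proof
    assume a: "(\<Sum>j<s. qq N powi (nu * (lam - 2 * int j))) = 0"
    have "ev1 (\<Sum>j<s. qq N powi (nu * (lam - 2 * int j))) (\<Sum>j<s. 1)" by (intro ev1_sum ev1_qq_powi)
    then have "(\<Sum>j<s. 1) = (0 :: rat)" unfolding a using ev1_unique ev1_0 by blast
    then show False using s by simp
  qed
  ultimately show ?thesis by simp
qed

context uqmod begin

lemma XE_XF_weight:
  assumes i: "i \<in> I" and n: "good n" "v \<in> tens n" and kap: "\<And>ys. v ys \<noteq> 0 \<Longrightarrow> sm (k i) ys = kap"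
    and mix: "tensv (N * L) (oE i (bvec (blk (mm n)))) (oF i (bvec (blk (mm n + 1)))) - sc gam (bvec (blk (mm n) @ blk (mm n + 1))) \<in> WW (N * L + N * L)"
  shows "XE i (XF i (cl n v)) = ad (XF i (XE i (cl n v)))
    (sm' (q powi (be * (int S * dl (i = 0))) * q powi (- al * (int S * dl (i = 0))) * (qi q kap - q powi (- 2 * be) * gam * q powi ((al - be) * kap))) (cl n v))"
proof (rule raising_lowering_matched[OF Eop_E[OF i] Fop_F[OF i] XE[OF i] XF[OF i] ab kval[OF i] ke[OF i] kb[OF i] n kap mix])
qed

lemma XE_XF_weight_nonzero:
  assumes i: "i \<in> I" "i \<noteq> 0" and n: "good n" "v \<in> tens n" and kap: "\<And>ys. v ys \<noteq> 0 \<Longrightarrow> sm (k i) ys = kap"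
  shows "XE i (XF i (cl n v)) = ad (XF i (XE i (cl n v))) (sm' (qi q kap) (cl n v))"
proof -
  have "oE i (bvec (blk (mm n))) \<in> WW (N * L)" using oE_block i by blast
  then have "tensv (N * L) (oE i (bvec (blk (mm n)))) (oF i (bvec (blk (mm n + 1)))) \<in> WW (N * L + N * L)"
    using wop_tens[OF wop_F[OF i(1)]] by (intro WW_right) simp_all
  then have m: "tensv (N * L) (oE i (bvec (blk (mm n)))) (oF i (bvec (blk (mm n + 1)))) - sc 0 (bvec (blk (mm n) @ blk (mm n + 1))) \<in> WW (N * L + N * L)"
    by simp
  show ?thesis using XE_XF_weight[OF i(1) n kap m] i(2) by (simp add: dl_def)
qed

text \<open>\<open>lam\<close> is the full exponent of K_0, of which the vacuum supplies S. The
  presentation index \<open>m\<close> is recorded because the scalar correction is obtained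
  separately for each block at which the tail may begin.\<close>

definition wv :: "int \<Rightarrow> int \<Rightarrow> fel \<Rightarrow> bool" where
  "wv lam m C \<longleftrightarrow> (\<exists>n v. good n \<and> mm n = m \<and> v \<in> tens n \<and> (\<forall>ys. v ys \<noteq> 0 \<longrightarrow> sm (k 0) ys = lam - int S) \<and> C = cl n v)"

lemma wv_FK: "wv lam m C \<Longrightarrow> C \<in> FK" using cl_FK by (auto simp: wv_def)

lemma correction_exists: "\<exists>kap. \<forall>m. ev1 (kap m) 0 \<and> (\<forall>lam C. wv lam m C \<longrightarrow>
     XE 0 (XF 0 C) = ad (XF 0 (XE 0 C)) (sm' (qi q lam + kap m * q powi ((al - be) * lam)) C))"
proof -
  have "\<exists>ka. ev1 ka 0 \<and> (\<forall>lam C. wv lam m C \<longrightarrow>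
     XE 0 (XF 0 C) = ad (XF 0 (XE 0 C)) (sm' (qi q lam + ka * q powi ((al - be) * lam)) C))" for m
  proof -
    obtain gam where g: "ev1 gam (- of_nat S)"
      "tensv (N * L) (oE 0 (bvec (blk m))) (oF 0 (bvec (blk (m + 1)))) - sc gam (bvec (blk m @ blk (m + 1))) \<in> WW (N * L + N * L)"
      using exchange_blocks by blast
    define nu where "nu = al - be"
    have nu: "nu = 1 \<or> nu = - 1" using ab by (auto simp: nu_def)
    \<comment> \<open>Obtained by expressing \<open>qi q lam\<close> through
      \<open>qi q (lam - int S)\<close> with \<open>qi_add\<close>; the rest is a constant times
      q^(nu lam). At q = 1 the constant is - S + S = 0 by the value of \<open>gam\<close>.\<close>
    define ka where "ka = - (q powi (- nu * int S) * qi q (int S)) - q powi (- 2 * nu * int S - 2 * be) * gam"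
    have "ev1 ka (- (1 * of_int (int S)) - 1 * - of_nat S)" unfolding ka_def
      using N2 by (intro ev1_diff ev1_uminus ev1_mult ev1_qq_powi ev1_qi g) simp
    then have "ev1 ka 0" by simp
    moreover have "XE 0 (XF 0 C) = ad (XF 0 (XE 0 C)) (sm' (qi q lam + ka * q powi ((al - be) * lam)) C)"
      if w: "wv lam m C" for lam C
    proof -
      obtain n v where n: "good n" "mm n = m" "v \<in> tens n" "\<And>ys. v ys \<noteq> 0 \<Longrightarrow> sm (k 0) ys = lam - int S" "C = cl n v"
        using w by (auto simp: wv_def)
      have "q powi (be * int S) * q powi (- al * int S) = q powi (- nu * int S)"
        by (simp add: power_int_add[symmetric] nu_def algebra_simps)
      moreover have "q powi (- nu * int S) * (qi q (lam - int S) - q powi (- 2 * be) * gam * q powi (nu * (lam - int S)))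
          = qi q lam + ka * q powi (nu * lam)"
      proof -
        have q1: "qi q lam = q powi (- nu * int S) * qi q (lam - int S) + q powi (nu * (lam - int S)) * qi q (int S)"
          using qi_add[OF qq_nonzero nu, of N "lam - int S" "int S"] by simp
        have q2: "q powi (- nu * int S) * q powi (nu * lam) = q powi (nu * (lam - int S))"
          by (simp add: power_int_add[symmetric] algebra_simps)
        have q3: "q powi (- 2 * nu * int S - 2 * be) * q powi (nu * lam) = q powi (- nu * int S) * q powi (- 2 * be) * q powi (nu * (lam - int S))"
          by (simp add: power_int_add[symmetric] algebra_simps)
        have "ka * q powi (nu * lam) = - (qi q (int S) * (q powi (- nu * int S) * q powi (nu * lam))) - gam * (q powi (- 2 * nu * int S - 2 * be) * q powi (nu * lam))"
          unfolding ka_def by (simp add: algebra_simps)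
        then show ?thesis unfolding q1 q2 q3 by (simp add: algebra_simps)
      qed
      ultimately show ?thesis using XE_XF_weight[OF zero_I n(1,3,4), of gam] g(2) unfolding n(2,5) by (simp add: dl_def nu_def)
    qed
    ultimately show ?thesis by blast
  qed
  then show ?thesis by (rule choice[OF allI])
qed

lemma ex_weight:
  assumes v: "\<And>ys. v ys \<noteq> 0 \<Longrightarrow> sm (k 0) ys = kap" and y: "ex n (n + R * (N * L)) v ys \<noteq> 0" and n: "good n"
  shows "sm (k 0) ys = kap"
proof -
  let ?p = "n + R * (N * L)"
  define us zs where uz: "us = take n ys" "zs = drop n ys"
  have ys: "ys = us @ zs" by (simp add: uz)
  have "v us \<noteq> 0" "zs = dlist (M - int n) (R * (N * L))"
    using y by (auto simp: extv_def tailv_dlist uz split: if_splits)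
  then show ?thesis unfolding ys using v sm_blocks[of "k 0" "mm n" R] kb[OF zero_I] good_mm[OF n] by simp
qed

lemma wv_raise: assumes "wv lam m C" "m \<le> m'" shows "wv lam m' C"
proof -
  obtain n v where n: "good n" "mm n = m" "v \<in> tens n" "\<forall>ys. v ys \<noteq> 0 \<longrightarrow> sm (k 0) ys = lam - int S" "C = cl n v"
    using assms(1) by (auto simp: wv_def)
  let ?p = "n + nat (m' - m) * (N * L)"
  have "good ?p" "mm ?p = m'" using n good_add mm_add[of n "nat (m' - m)"] assms(2) by simp_all
  moreover have "ex n ?p v \<in> tens ?p" "C = cl ?p (ex n ?p v)" using n ex_tens cl_ex by simp_all
  moreover have "sm (k 0) ys = lam - int S" if "ex n ?p v ys \<noteq> 0" for ys by (rule ex_weight[of v _ n]) (use n that in blast)+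
  ultimately show ?thesis unfolding wv_def by blast
qed

lemma opx_weight:
  assumes h: "\<And>y x. h y = Some x \<Longrightarrow> kf y = kf x + d" and v: "\<And>ys. v ys \<noteq> 0 \<Longrightarrow> sm kf ys = kap" and y: "opx q bf af h v ys \<noteq> 0"
  shows "sm kf ys = kap + d"
proof -
  obtain us y vs x where "ys = us @ y # vs" "h y = Some x" "v (us @ x # vs) \<noteq> 0" using opx_nonzero[OF y] by blast
  then show ?thesis using v[of "us @ x # vs"] h[of y x] by simp
qed

lemma wv_E: assumes "wv lam m C" shows "wv (lam + 2) m (XE 0 C)"
proof -
  obtain n v where n: "good n" "mm n = m" "v \<in> tens n" "\<forall>ys. v ys \<noteq> 0 \<longrightarrow> sm (k 0) ys = lam - int S" "C = cl n v"
    using assms by (auto simp: wv_def)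
  let ?w = "sc (q powi (be * (int S * dl ((0::int) = 0)))) (oE 0 v)"
  have "XE 0 C = cl n ?w" using XE[OF zero_I] n by (simp add: EC_def)
  moreover have "?w \<in> tens n" using wop_tens[OF wop_E[OF zero_I]] n by simp
  moreover have "sm (k 0) ys = lam + 2 - int S" if "?w ys \<noteq> 0" for ys
  proof -
    have "oE 0 v ys \<noteq> 0" using that by (auto simp: fapp)
    then have "sm (k 0) ys = (lam - int S) + cartan P 0 0" using n(4)
      by (intro opx_weight[of "f 0" "k 0" _ v]) (use k_f[OF zero_I zero_I] in auto)
    then show ?thesis by (simp add: cartan_diag[OF P2])
  qed
  ultimately show ?thesis unfolding wv_def using n(1,2) by blast
qed

lemma wv_F: assumes "wv lam m C" shows "wv (lam - 2) (m + 1) (XF 0 C)"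
proof -
  obtain n v where n: "good n" "mm n = m" "v \<in> tens n" "\<forall>ys. v ys \<noteq> 0 \<longrightarrow> sm (k 0) ys = lam - int S" "C = cl n v"
    using assms by (auto simp: wv_def)
  let ?p = "n + N * L"
  let ?w = "sc (q powi (- al * (int S * dl ((0::int) = 0)))) (oF 0 (ex n ?p v))"
  have "XF 0 C = cl ?p ?w" using XF[OF zero_I] n by (simp add: FC_def)
  moreover have "?w \<in> tens ?p" using wop_tens[OF wop_F[OF zero_I]] n ex_tens by simp
  moreover have "good ?p" "mm ?p = m + 1" using n good_add1 mm_add1 by simp_all
  moreover have "sm (k 0) ys = lam - 2 - int S" if "?w ys \<noteq> 0" for ys
  proof -
    have o: "oF 0 (ex n ?p v) ys \<noteq> 0" using that by (auto simp: fapp)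
    have x: "sm (k 0) ys = lam - int S" if "ex n ?p v ys \<noteq> 0" for ys
      using ex_weight[of v "lam - int S" n 1 ys] n that by simp
    have "sm (k 0) ys = (lam - int S) + - cartan P 0 0"
      by (rule opx_weight[OF k_e[OF zero_I zero_I] x o])
    then show ?thesis by (simp add: cartan_diag[OF P2])
  qed
  ultimately show ?thesis unfolding wv_def by blast
qed

lemma wv_F_pow: "wv lam m C \<Longrightarrow> wv (lam - 2 * int j) (m + int j) ((XF 0 ^^ j) C)"
proof (induction j)
  case (Suc j)
  from wv_F[OF Suc.IH[OF Suc.prems]] show ?case by (simp add: algebra_simps)
qed simp

lemma wv_E_pow: "wv lam m C \<Longrightarrow> wv (lam + 2 * int j) m ((XE 0 ^^ j) C)"
proof (induction j)
  case (Suc j)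
  from wv_E[OF Suc.IH[OF Suc.prems]] show ?case by (simp add: algebra_simps)
qed simp

lemma last_nonzero:
  assumes "(X ^^ s) C = z" "C \<noteq> z"
  shows "\<exists>a. (X ^^ a) C \<noteq> z \<and> X ((X ^^ a) C) = z"
  using assms
proof (induction s)
  case (Suc s)
  then show ?case by (cases "(X ^^ s) C = z") auto
qed simp

text \<open>The correction vanishes: an \<open>sl\<^sub>2\<close>-string through a nonzero vector is finite, and the
  resulting identity between quantum integers forces its length and then \<open>kap = 0\<close>.\<close>

lemma XE_XF_zero:
  assumes "wv lam m C"
  shows "XE 0 (XF 0 C) = ad (XF 0 (XE 0 C)) (sm' (qi q lam) C)"
proof (cases "C = fzero N L M")
  case True
  show ?thesis unfolding True using FL_fzero[OF FL_XE[OF zero_I]] FL_fzero[OF FL_XF[OF zero_I]] sm_fzero ad_fzero[OF FK_zero] by simp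
next
  case False
  from correction_exists obtain kap where kp: "\<forall>m. ev1 (kap m) 0 \<and> (\<forall>lam C. wv lam m C \<longrightarrow>
     XE 0 (XF 0 C) = ad (XF 0 (XE 0 C)) (sm' (qi q lam + kap m * q powi ((al - be) * lam)) C))" by (rule exE)
  have kap: "ev1 (kap m) 0" for m using kp by (rule allE) (erule conjunct1)
  have kE: "XE 0 (XF 0 C) = ad (XF 0 (XE 0 C)) (sm' (qi q lam + kap m * q powi ((al - be) * lam)) C)" if "wv lam m C" for m lam C
    using kp[rule_format, THEN conjunct2, rule_format, OF that] .
  note CF = wv_FK[OF assms]
  from XE_nilpotent[OF zero_I CF] obtain s where "(XE 0 ^^ s) C = fzero N L M" by (rule exE)
  from last_nonzero[OF this False] obtain a where "(XE 0 ^^ a) C \<noteq> fzero N L M \<and> XE 0 ((XE 0 ^^ a) C) = fzero N L M" by (rule exE)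
  then have a: "(XE 0 ^^ a) C \<noteq> fzero N L M" "XE 0 ((XE 0 ^^ a) C) = fzero N L M" by (rule conjunct1, rule conjunct2)
  define x where "x = (XE 0 ^^ a) C"
  define lx where "lx = lam + 2 * int a"
  have x: "wv lx m x" "x \<noteq> fzero N L M" "XE 0 x = fzero N L M" using wv_E_pow[OF assms, of a] a by (simp_all add: x_def lx_def)
  from XF_nilpotent[OF zero_I wv_FK[OF x(1)]] obtain s' where "(XF 0 ^^ s') x = fzero N L M" by (rule exE)
  from last_nonzero[OF this x(2)] obtain b where "(XF 0 ^^ b) x \<noteq> fzero N L M \<and> XF 0 ((XF 0 ^^ b) x) = fzero N L M" by (rule exE)
  then have b: "(XF 0 ^^ b) x \<noteq> fzero N L M" "XF 0 ((XF 0 ^^ b) x) = fzero N L M" by (rule conjunct1, rule conjunct2)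
  \<comment> \<open>All vectors of the string are presented at this one index, large enough for the
    last of them, so that a single correction \<open>kap m'\<close> occurs in the whole sum.\<close>
  define m' where "m' = m + int b"
  let ?c = "\<lambda>j. qi q (lx - 2 * int j) + kap m' * q powi ((al - be) * (lx - 2 * int j))"
  have w: "wv (lx - 2 * int j) m' ((XF 0 ^^ j) x)" if "j \<le> b" for j
    using wv_raise[OF wv_F_pow[OF x(1), of j], of m'] that by (simp add: m'_def)
  have K: "(XF 0 ^^ j) x \<in> FK" for j using FL_funpow[OF FL_XF[OF zero_I] wv_FK[OF x(1)]] .
  have st: "XE 0 ((XF 0 ^^ Suc j) x) = sm' (\<Sum>l<Suc j. ?c l) ((XF 0 ^^ j) x)" if "j \<le> b" for j
    using that
  proof (induction j)
    case 0
    show ?case using kE[OF w[of 0]] x(3) FL_fzero[OF FL_XF[OF zero_I]] ad_fzero(2)[OF FK_sm[OF wv_FK[OF x(1)]]] by simp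
  next
    case (Suc j)
    let ?y = "(XF 0 ^^ Suc j) x"
    have "XE 0 (XF 0 ?y) = ad (XF 0 (XE 0 ?y)) (sm' (?c (Suc j)) ?y)" using kE[OF w[OF Suc.prems]] .
    also have "XE 0 ?y = sm' (\<Sum>l<Suc j. ?c l) ((XF 0 ^^ j) x)" using Suc by simp
    also have "XF 0 \<dots> = sm' (\<Sum>l<Suc j. ?c l) ?y" using FLD(3)[OF FL_XF[OF zero_I] K] by simp
    also have "ad \<dots> (sm' (?c (Suc j)) ?y) = sm' ((\<Sum>l<Suc j. ?c l) + ?c (Suc j)) ?y" by (rule sm_ad_left[OF K])
    finally show ?case by simp
  qed
  \<comment> \<open>F_0 kills the last vector of the string, so the coefficient in front of that
    nonzero vector must vanish.\<close>
  have "sm' (\<Sum>l<Suc b. ?c l) ((XF 0 ^^ b) x) = fzero N L M" using st[of b] b(2) FL_fzero[OF FL_XE[OF zero_I]] by simp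
  then have "(\<Sum>l<Suc b. ?c l) = 0" using sm_eq_fzero[OF K, of _ b] b(1) by (rule_tac ccontr) simp
  then have k0: "kap m' = 0" using string_sum_zero[of N "Suc b" "kap m'" lx "al - be"] N2 kap by simp
  have "wv lam m' C" using wv_raise[OF assms] by (simp add: m'_def)
  from kE[OF this] show ?thesis by (simp add: k0)
qed

text \<open>Both sides are linear, and a basis vector has a weight, for which the commutator is
  already known.\<close>

lemma XE_XF_same:
  assumes i: "i \<in> I" and C: "C \<in> FK"
  shows "ad (XE i (XF i C)) (sm' (-1) (XF i (XE i C))) = sm' (1 / (q - inverse q)) (ad (KK i C) (sm' (-1) (KI i C)))"
proof -
  obtain n v where n: "good n" "v \<in> tens n" "C = cl n v" using FK_cl[OF C, of 0] by blast
  let ?La = "int S * dl (i = 0)"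
  define Q where "Q = (\<lambda>C. sm' (1 / (q - inverse q)) (ad (KK i C) (sm' (-1) (KI i C))))"
  have Qcl: "Q (cl n v) = cl n (sc (1 / (q - inverse q)) (sc (q powi ?La) (kop q (k i) v) + sc (- (q powi - ?La)) (kop q (\<lambda>x. - k i x) v)))" if "v \<in> tens n" for v
    unfolding Q_def using KK[OF i] KI[OF i] n(1) that kop_tens by (simp add: KC_def fsc_cl fadd_cl)
  have QFK: "Q (cl n v) \<in> FK" if "v \<in> tens n" for v unfolding Qcl[OF that] using that kop_tens by (intro cl_FK) simp
  note lin = FLD[OF FL_XE[OF i]] FLD[OF FL_XF[OF i]]
  have "XE i (XF i (cl n v)) = ad (XF i (XE i (cl n v))) (Q (cl n v))" using n(2)
  proof (induction rule: tens_induct)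
    case zero
    have "Q (cl n 0) = cl n 0" unfolding Qcl[OF tens_0] by (simp add: lnr_zero lnr_kop)
    then show ?case using FL_fzero[OF FL_XE[OF i]] FL_fzero[OF FL_XF[OF i]] ad_fzero[OF FK_zero] fzero_cl[of n] by simp
  next
    case (add v c xs)
    let ?b = "cl n (bvec xs)"
    have bt: "bvec xs \<in> tens n" using add.hyps by simp
    define la where "la = sm (k i) xs + ?La"
    have wb: "sm (k i) ys = sm (k i) xs" if "(bvec xs :: vec) ys \<noteq> 0" for ys using that by (auto simp: bvec_def split: if_splits)
    have QB: "Q ?b = sm' (qi q la) ?b"
    proof -
      have "sm (\<lambda>x. - k i x) xs = - sm (k i) xs" by (simp add: uminus_sum_list_map[symmetric, unfolded o_def])
      then have "sc (1 / (q - inverse q)) (sc (q powi ?La) (kop q (k i) (bvec xs)) + sc (- (q powi - ?La)) (kop q (\<lambda>x. - k i x) (bvec xs))) = sc (qi q la) (bvec xs)"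
        unfolding kop_bvec by (simp add: fun_eq_iff fapp qi_def la_def power_int_add power_int_diff power_int_minus divide_simps) (simp add: algebra_simps)
      then show ?thesis unfolding Qcl[OF bt] using bt by (simp add: fsc_cl)
    qed
    have B: "XE i (XF i ?b) = ad (XF i (XE i ?b)) (Q ?b)"
    proof (cases "i = 0")
      case True
      have "wv la (mm n) ?b" unfolding wv_def using n(1) bt wb True by (intro exI[of _ n] exI[of _ "bvec xs"]) (auto simp: la_def dl_def)
      then show ?thesis using XE_XF_zero QB True by simp
    next
      case False
      then have "la = sm (k i) xs" by (simp add: la_def dl_def)
      then show ?thesis using XE_XF_weight_nonzero[OF i False n(1) bt wb] QB by simp
    qed
    have F: "cl n v \<in> FK" "?b \<in> FK" "sm' c ?b \<in> FK" using add.hyps bt by (auto intro!: cl_FK FK_sm)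
    have x: "cl n (v + sc c (bvec xs)) = ad (cl n v) (sm' c ?b)" using add.hyps by (simp add: fsc_cl fadd_cl)
    have Qx: "Q (ad (cl n v) (sm' c ?b)) = ad (Q (cl n v)) (sm' c (Q ?b))"
      unfolding x[symmetric] using add.hyps bt kop_tens
      by (simp add: Qcl fsc_cl fadd_cl lnrD[OF lnr_kop]) (rule arg_cong[of _ _ "cl n"], simp add: fun_eq_iff fapp algebra_simps)
    have t: "XF i (XE i (cl n v)) \<in> FK" "XF i (XE i ?b) \<in> FK" "Q (cl n v) \<in> FK" "Q ?b \<in> FK" using lin(1,4) F QFK add.hyps bt by auto
    have t': "sm' c (XF i (XE i ?b)) \<in> FK" "sm' c (Q ?b) \<in> FK" using t FK_sm by auto
    have sa: "sm' c (ad A B) = ad (sm' c A) (sm' c B)" if "A \<in> FK" "B \<in> FK" for A B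
      using FK_common[OF that, of 0] by (auto simp: fsc_cl fadd_cl sc_add)
    have "XE i (XF i (ad (cl n v) (sm' c ?b))) = ad (ad (XF i (XE i (cl n v))) (Q (cl n v))) (sm' c (ad (XF i (XE i ?b)) (Q ?b)))"
      using lin F add.IH B FK_sm by simp
    also have "\<dots> = ad (ad (XF i (XE i (cl n v))) (sm' c (XF i (XE i ?b)))) (ad (Q (cl n v)) (sm' c (Q ?b)))"
      unfolding sa[OF t(2,4)] using t t' by (simp add: ad_assoc FK_ad ad_commute[of "Q (cl n v)"])
    also have "ad (XF i (XE i (cl n v))) (sm' c (XF i (XE i ?b))) = XF i (XE i (ad (cl n v) (sm' c ?b)))"
      using lin F FK_sm by simp
    finally show ?case unfolding x Qx .
  qed
  moreover have "XF i (XE i C) \<in> FK" "Q C \<in> FK" using lin(1,4) C QFK n by auto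
  ultimately show ?thesis using ad_sub[of "XF i (XE i C)" "Q C"] n unfolding Q_def by simp
qed

end

section \<open>Serre relations and weight decomposition on the Fock space\<close>

lemma lnr_pow: "lnr A \<Longrightarrow> lnr (A ^^ s)"
  by (induction s) (simp_all add: lnr_def)

lemma sc_sum_list: "(\<Sum>k\<leftarrow>ks. sc (a k) (sc c (w k))) = sc c (\<Sum>k\<leftarrow>ks. sc (a k) (w k))"
  by (induction ks) (simp_all add: sc_add mult.commute)

lemma (in fk) serre_module:
  assumes T: "\<And>k. k \<le> n \<Longrightarrow> T k = cl p (sc c (w k)) \<and> w k \<in> tens p"
    and z: "(\<Sum>k\<leftarrow>[0..<Suc n]. sc (a k) (w k)) = 0"
  shows "foldr ad (map (\<lambda>k. sm' (a k) (T k)) [0..<Suc n]) (fzero N L M) = fzero N L M"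
proof -
  have "foldr ad (map (\<lambda>k. sm' (a k) (T k)) [0..<Suc n]) (fzero N L M) = cl p (\<Sum>k\<leftarrow>[0..<Suc n]. sc (a k) (sc c (w k)))"
    by (rule foldr_ad_cl[THEN conjunct1]) (use T in auto)
  then show ?thesis unfolding sc_sum_list z using fzero_cl[of p] by simp
qed

context uqmod begin

lemma serre_XE:
  assumes i: "i \<in> I" "j \<in> I" "i \<noteq> j" and C: "C \<in> FK" and n: "n = nat (1 - cartan P i j)"
  shows "foldr ad (map (\<lambda>k. sm' ((-1) ^ k * qbin q n k) ((XE i ^^ (n - k)) (XE j ((XE i ^^ k) C)))) [0..<Suc n]) (fzero N L M) = fzero N L M"
proof -
  \<comment> \<open>As E_i is the pull-back along \<open>f i\<close>, the exponents shift by Cartan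
    integers with positive sign. The parameter t is q for \<open>be = 1\<close> and its inverse for
    \<open>al = 1\<close>.\<close>
  interpret serre_pair q "\<lambda>x. al * k i x" "\<lambda>x. be * k i x" "\<lambda>x. al * k j x" "\<lambda>x. be * k j x" "f i" "f j"
    "cartan P i j" "be * 2" "al * 2" "be * cartan P i j" "al * cartan P i j" "be * cartan P i j" "al * cartan P i j" "q powi (be - al)"
  proof
    have fi: "k i y = k i x + 2" if "f i y = Some x" for x y using k_f[OF i(1,1) that] cartan_diag[OF P2] by simp
    show "be * k i y = be * k i x + be * 2" "al * k i y = al * k i x + al * 2" if "f i y = Some x" for x y
      using mult_shift[OF fi[OF that]] by blast+
    show "be * k i y = be * k i x + be * cartan P i j" "al * k i y = al * k i x + al * cartan P i j" if "f j y = Some x" for x y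
      using mult_shift[OF k_f[OF i(1,2) that]] by blast+
    show "be * k j y = be * k j x + be * cartan P i j" "al * k j y = al * k j x + al * cartan P i j" if "f i y = Some x" for x y
      using mult_shift[OF k_f[OF i(2,1) that]] unfolding cartan_commute[of P j i] by blast+
    show "f i y = None" if "f i x = Some y" for x y
    proof (cases "f i y")
      case (Some z)
      then have "e i z = Some y" "e i y = Some x" using that inv[OF i(1)] by blast+
      then show ?thesis using ee[OF i(1)] by force
    qed
  qed (use ab in \<open>auto simp: power_int_minus power_int_mult power_int_power power_int_diff power2_eq_square inverse_eq_divide power_int_divide_distrib\<close>)
  obtain p v where p: "good p" "v \<in> tens p" "C = cl p v" using FK_cl[OF C, of 0] by blast
  let ?ci = "q powi (be * (int S * dl (i = 0)))" and ?cj = "q powi (be * (int S * dl (j = 0)))"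
  have T: "(XE i ^^ (n - k)) (XE j ((XE i ^^ k) C)) = cl p (sc (?ci ^ n * ?cj) ((oE i ^^ (n - k)) (oE j ((oE i ^^ k) v))))
     \<and> (oE i ^^ (n - k)) (oE j ((oE i ^^ k) v)) \<in> tens p" if "k \<le> n" for k
  proof -
    have 1: "(XE i ^^ k) C = cl p (sc (?ci ^ k) ((oE i ^^ k) v))" "(oE i ^^ k) v \<in> tens p"
      using EC_pow[OF wop_E[OF i(1)] XE[OF i(1)] p(1,2), of k] p by simp_all
    then have 2: "XE j ((XE i ^^ k) C) = cl p (sc ?cj (oE j (sc (?ci ^ k) ((oE i ^^ k) v))))" "oE j (sc (?ci ^ k) ((oE i ^^ k) v)) \<in> tens p"
      using XE[OF i(2)] p(1) wop_tens[OF wop_E[OF i(2)]] by (simp_all add: EC_def)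
    let ?w = "sc ?cj (oE j (sc (?ci ^ k) ((oE i ^^ k) v)))"
    have w: "?w \<in> tens p" using 2 by simp
    have e: "?w = sc (?ci ^ k * ?cj) (oE j ((oE i ^^ k) v))" by (simp add: lnrD(2)[OF lnr_opx] mult.commute)
    have 3: "(XE i ^^ (n - k)) (cl p ?w) = cl p (sc (?ci ^ (n - k)) ((oE i ^^ (n - k)) ?w))"
      using EC_pow[OF wop_E[OF i(1)] XE[OF i(1)] p(1) w, of "n - k"] by blast
    have 4: "(oE i ^^ (n - k)) (oE j ((oE i ^^ k) v)) \<in> tens p"
      using EC_pow[OF wop_E[OF i(1)] XE[OF i(1)] p(1), of "oE j ((oE i ^^ k) v)" "n - k"] wop_tens[OF wop_E[OF i(2)] 1(2)] by blast
    have "?ci ^ (n - k) * (?ci ^ k * ?cj) = ?ci ^ n * ?cj" using that by (simp add: power_add[symmetric] mult.assoc[symmetric])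
    then have "sc (?ci ^ (n - k)) ((oE i ^^ (n - k)) (sc (?ci ^ k * ?cj) (oE j ((oE i ^^ k) v)))) = sc (?ci ^ n * ?cj) ((oE i ^^ (n - k)) (oE j ((oE i ^^ k) v)))"
      by (simp only: lnrD(2)[OF lnr_pow[OF lnr_opx]] sc_sc)
    then show ?thesis unfolding 2 3 unfolding e using 4 by simp
  qed
  have z: "(\<Sum>k\<leftarrow>[0..<Suc n]. sc ((-1) ^ k * qbin q n k) ((oE i ^^ (n - k)) (oE j ((oE i ^^ k) v)))) = 0"
    unfolding n
  proof (rule serre_sum[OF _ refl])
    show "0 < N" using N2 by simp
    show "cartan P i j \<in> {0, - 1, - 2}" by (rule cartan_off_diag[OF i])
    show "f j y = None" if "cartan P i j = 0" "f i x = Some y" for x y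
    proof (cases "f j y")
      case (Some z)
      then have "e j z = Some y" "e i y = Some x" using that inv[OF i(1)] inv[OF i(2)] by blast+
      then show ?thesis using s0[of j i z y] i that cartan_commute[of P i j] by simp
    qed
    show "f i y = None" if "cartan P i j = 0" "f j x = Some y" for x y
    proof (cases "f i y")
      case (Some z)
      then have "e i z = Some y" "e j y = Some x" using that inv[OF i(1)] inv[OF i(2)] by blast+
      then show ?thesis using s0[of i j z y] i that by simp
    qed
    show "f i z = None" if "cartan P i j = - 1" "f i x = Some y" "f j y = Some z" for x y z
    proof (cases "f i z")
      case (Some w)
      then have "e i w = Some z" "e j z = Some y" "e i y = Some x" using that inv[OF i(1)] inv[OF i(2)] by blast+
      then show ?thesis using s1[of i j w z y] i that by simp
    qed
  qed
  show ?thesis by (rule serre_module[OF T z])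
qed

lemma serre_XF:
  assumes i: "i \<in> I" "j \<in> I" "i \<noteq> j" and C: "C \<in> FK" and n: "n = nat (1 - cartan P i j)"
  shows "foldr ad (map (\<lambda>k. sm' ((-1) ^ k * qbin q n k) ((XF i ^^ (n - k)) (XF j ((XF i ^^ k) C)))) [0..<Suc n]) (fzero N L M) = fzero N L M"
proof -
  interpret serre_pair q "\<lambda>x. - be * k i x" "\<lambda>x. - al * k i x" "\<lambda>x. - be * k j x" "\<lambda>x. - al * k j x" "e i" "e j"
    "cartan P i j" "- al * - 2" "- be * - 2" "- al * - cartan P i j" "- be * - cartan P i j" "- al * - cartan P i j" "- be * - cartan P i j" "q powi (al - be)"
  proof
    have fi: "k i y = k i x + - 2" if "e i y = Some x" for x y using k_e[OF i(1,1) that] cartan_diag[OF P2] by simp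
    show "- al * k i y = - al * k i x + - al * - 2" "- be * k i y = - be * k i x + - be * - 2" if "e i y = Some x" for x y
      using mult_shift[OF fi[OF that]] by blast+
    show "- al * k i y = - al * k i x + - al * - cartan P i j" "- be * k i y = - be * k i x + - be * - cartan P i j" if "e j y = Some x" for x y
      using mult_shift[OF k_e[OF i(1,2) that]] by blast+
    show "- al * k j y = - al * k j x + - al * - cartan P i j" "- be * k j y = - be * k j x + - be * - cartan P i j" if "e i y = Some x" for x y
      using mult_shift[OF k_e[OF i(2,1) that]] unfolding cartan_commute[of P j i] by blast+
    show "e i y = None" if "e i x = Some y" for x y using ee[OF i(1) that] .
  qed (use ab in \<open>auto simp: power_int_minus power_int_mult power_int_power power_int_diff power2_eq_square inverse_eq_divide power_int_divide_distrib\<close>)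
  obtain p0 v where p0: "good p0" "v \<in> tens p0" "C = cl p0 v" using FK_cl[OF C, of 0] by blast
  \<comment> \<open>Every word of the Serre sum contains n + 1 lowering operators, each of which
    uses up one block. With all blocks supplied beforehand the words act on one and the same vector
    \<open>y\<close>, and the identity for tensor operators applies.\<close>
  define p where "p = p0 + (n + 1) * (N * L)"
  have p: "good p" using p0 good_add by (simp only: p_def)
  define y where "y = ex p0 p v"
  have r0: "rep C p0 p y" unfolding y_def p0(3) using p0 p by (intro repI) (simp_all add: p_def)
  let ?ci = "q powi (- al * (int S * dl (i = 0)))" and ?cj = "q powi (- al * (int S * dl (j = 0)))"
  have yt: "y \<in> tens p" unfolding y_def using p0 ex_tens by (simp add: p_def)
  have powt: "(oF i ^^ s) w \<in> tens p" if "w \<in> tens p" for s w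
  proof (induction s)
    case (Suc s)
    then show ?case using wop_tens[OF wop_F[OF i(1)]] unfolding funpow.simps o_apply by blast
  qed (use that in simp)
  have T: "(XF i ^^ (n - k)) (XF j ((XF i ^^ k) C)) = cl p (sc (?ci ^ n * ?cj) ((oF i ^^ (n - k)) (oF j ((oF i ^^ k) y))))
     \<and> (oF i ^^ (n - k)) (oF j ((oF i ^^ k) y)) \<in> tens p" if k: "k \<le> n" for k
  proof -
    have le: "k * (N * L) \<le> n * (N * L)" using k by simp
    have "rep ((XF i ^^ k) C) (p0 + k * (N * L)) p (sc (?ci ^ k) ((oF i ^^ k) y))"
      by (rule rep_funpow[OF Fop_F[OF i(1)] XF[OF i(1)] r0]) (unfold p_def distrib_right, insert le, linarith)
    then have "rep (XF j ((XF i ^^ k) C)) (p0 + k * (N * L) + N * L) p (sc ?cj (oF j (sc (?ci ^ k) ((oF i ^^ k) y))))"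
      by (rule rep_F[OF Fop_F[OF i(2)] XF[OF i(2)]]) (unfold p_def distrib_right, insert le, linarith)
    then have "rep ((XF i ^^ (n - k)) (XF j ((XF i ^^ k) C))) (p0 + k * (N * L) + N * L + (n - k) * (N * L)) p
        (sc (?ci ^ (n - k)) ((oF i ^^ (n - k)) (sc ?cj (oF j (sc (?ci ^ k) ((oF i ^^ k) y))))))"
    proof (rule rep_funpow[OF Fop_F[OF i(1)] XF[OF i(1)]])
      have "k * (N * L) + (n - k) * (N * L) = n * (N * L)" using k by (simp add: distrib_right[symmetric])
      then show "p0 + k * (N * L) + N * L + (n - k) * (N * L) \<le> p" unfolding p_def by (simp add: algebra_simps)
    qed
    then have 1: "(XF i ^^ (n - k)) (XF j ((XF i ^^ k) C)) = cl p (sc (?ci ^ (n - k)) ((oF i ^^ (n - k)) (sc ?cj (oF j (sc (?ci ^ k) ((oF i ^^ k) y))))))"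
      by (rule rep_cl)
    have 2: "sc ?cj (oF j (sc (?ci ^ k) ((oF i ^^ k) y))) = sc (?ci ^ k * ?cj) (oF j ((oF i ^^ k) y))" by (simp add: lnrD(2)[OF lnr_opx] mult.commute)
    have "?ci ^ (n - k) * (?ci ^ k * ?cj) = ?ci ^ n * ?cj" using that by (simp add: power_add[symmetric] mult.assoc[symmetric])
    then have "sc (?ci ^ (n - k)) ((oF i ^^ (n - k)) (sc (?ci ^ k * ?cj) (oF j ((oF i ^^ k) y)))) = sc (?ci ^ n * ?cj) ((oF i ^^ (n - k)) (oF j ((oF i ^^ k) y)))"
      by (simp only: lnrD(2)[OF lnr_pow[OF lnr_opx]] sc_sc)
    then show ?thesis unfolding 1 2 using powt[OF wop_tens[OF wop_F[OF i(2)] powt[OF yt]]] by simp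
  qed
  have z: "(\<Sum>k\<leftarrow>[0..<Suc n]. sc ((-1) ^ k * qbin q n k) ((oF i ^^ (n - k)) (oF j ((oF i ^^ k) y)))) = 0"
    unfolding n
  proof (rule serre_sum[OF _ refl])
    show "0 < N" using N2 by simp
    show "cartan P i j \<in> {0, - 1, - 2}" by (rule cartan_off_diag[OF i])
    show "e j y = None" if "cartan P i j = 0" "e i x = Some y" for x y using s0[OF i(1,2) that] .
    show "e i y = None" if "cartan P i j = 0" "e j x = Some y" for x y using s0[OF i(2,1) _ that(2)] that(1) cartan_commute[of P i j] by simp
    show "e i z = None" if "cartan P i j = - 1" "e i x = Some y" "e j y = Some z" for x y z using s1[OF i(1,2) that] .
  qed
  show ?thesis by (rule serre_module[OF T z])
qed

lemma weight_decomposition: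
  assumes C: "C \<in> FK"
  shows "\<exists>ws. set ws \<subseteq> FK \<and> (\<forall>x\<in>set ws. weightvec P q sm' KK DD x) \<and> C = foldr ad ws (fzero N L M)"
proof -
  obtain n v where n: "good n" "v \<in> tens n" "C = cl n v" using FK_cl[OF C, of 0] by blast
  have "\<exists>ws. set ws \<subseteq> FK \<and> (\<forall>x\<in>set ws. weightvec P q sm' KK DD x) \<and> cl n v = foldr ad ws (fzero N L M)" using n(2)
  proof (induction rule: tens_induct)
    case zero
    show ?case by (rule exI[of _ "[]"]) (simp add: fzero_cl[of n])
  next
    case (add v c xs)
    then obtain ws where ws: "set ws \<subseteq> FK" "\<forall>x\<in>set ws. weightvec P q sm' KK DD x" "cl n v = foldr ad ws (fzero N L M)" by blast
    let ?b = "cl n (sc c (bvec xs))"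
    have bt: "sc c (bvec xs) \<in> tens n" using add.hyps by simp
    have K: "KK i ?b = sm' (zpow q (int S * dl (i = 0) + sm (k i) xs)) ?b" if "i \<in> I" for i
    proof -
      have "KK i ?b = cl n (sc (q powi (int S * dl (i = 0))) (kop q (k i) (sc c (bvec xs))))" using KK[OF that] n bt by (simp add: KC_def)
      also have "\<dots> = sm' (zpow q (int S * dl (i = 0) + sm (k i) xs)) ?b"
        using bt by (simp add: fsc_cl lnrD[OF lnr_kop] kop_bvec zpow_eq_power_int power_int_add mult_ac)
      finally show ?thesis .
    qed
    have D: "DD ?b = sm' (of_int (sm und xs + dvac n)) ?b"
    proof -
      have "DD ?b = cl n (dop und (sc c (bvec xs)) + sc (of_int (dvac n)) (sc c (bvec xs)))" using DD n bt by (simp add: DC_def)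
      also have "dop und (sc c (bvec xs)) + sc (of_int (dvac n)) (sc c (bvec xs)) = sc (of_int (sm und xs + dvac n)) (sc c (bvec xs))"
        by (simp add: lnrD[OF lnr_dop] dop_bvec) (simp add: fun_eq_iff fapp algebra_simps)
      also have "cl n \<dots> = sm' (of_int (sm und xs + dvac n)) ?b" by (rule fsc_cl[OF bt, symmetric])
      finally show ?thesis .
    qed
    have "weightvec P q sm' KK DD ?b" unfolding weightvec_def
      by (rule exI[of _ "\<lambda>i. int S * dl (i = 0) + sm (k i) xs"], rule exI[of _ "sm und xs + dvac n"]) (use K D in blast)
    moreover have "cl n (v + sc c (bvec xs)) = ad ?b (cl n v)" using add.hyps bt by (simp add: fadd_cl add.commute)
    ultimately show ?case using ws cl_FK[OF bt] by (intro exI[of _ "?b # ws"]) simp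
  qed
  then show ?thesis using n by simp
qed

theorem module: "integrable_uq_module P q FK ad sm' (fzero N L M) XE XF KK KI DD"
proof -
  have KKI: "KK i (KI i C) = C" "KI i (KK i C) = C" if "i \<in> I" "C \<in> FK" for i C
    using KC_inverse[OF KK[OF that(1)] KI[OF that(1)] _ that(2)] KC_inverse[OF KI[OF that(1)], of "KK i" "q powi (int S * dl (i = 0))" C] KK[OF that(1)] that
    by (simp_all add: power_int_add[symmetric])
  have KE: "KK i (XE j C) = sm' (zpow q (cartan P i j)) (XE j (KK i C))" if "i \<in> I" "j \<in> I" "C \<in> FK" for i j C
    unfolding zpow_eq_power_int by (rule KC_EC[OF KK[OF that(1)] XE[OF that(2)] wop_E[OF that(2)] k_f[OF that(1,2)] that(3)])
  have KF: "KK i (XF j C) = sm' (zpow q (- cartan P i j)) (XF j (KK i C))" if "i \<in> I" "j \<in> I" "C \<in> FK" for i j C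
    unfolding zpow_eq_power_int by (rule KC_FC[OF KK[OF that(1)] kb[OF that(1)] XF[OF that(2)] wop_F[OF that(2)] k_e[OF that(1,2)] that(3)])
  have DE: "ad (DD (XE i C)) (sm' (-1) (XE i (DD C))) = sm' (of_int (dl (i = 0))) (XE i C)" if "i \<in> I" "C \<in> FK" for i C
    using inv[OF that(1)] eund[OF that(1)] by (intro DC_EC[OF DD XE[OF that(1)] wop_E[OF that(1)] _ that(2)]) blast
  have DF: "ad (DD (XF i C)) (sm' (-1) (XF i (DD C))) = sm' (- of_int (dl (i = 0))) (XF i C)" if "i \<in> I" "C \<in> FK" for i C
  proof -
    have "und y = und x + - dl (i = 0)" if "e i y = Some x" for x y using eund[OF \<open>i \<in> I\<close> that] by simp
    from DC_FC[OF DD XF[OF that(1)] wop_F[OF that(1)] this that(2)] show ?thesis by simp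
  qed
  have EF: "ad (XE i (XF j C)) (sm' (-1) (XF j (XE i C))) = sm' (of_int (dl (i = j)) / (q - inverse q)) (ad (KK i C) (sm' (-1) (KI i C)))"
    if "i \<in> I" "j \<in> I" "C \<in> FK" for i j C
  proof (cases "i = j")
    case True
    then show ?thesis using XE_XF_same[OF that(1,3)] by (simp add: dl_def)
  next
    case False
    have f: "XF j (XE i C) \<in> FK" "ad (KK i C) (sm' (-1) (KI i C)) \<in> FK"
      using FLD(1)[OF FL_XE[OF that(1)] that(3)] FLD(1)[OF FL_XF[OF that(2)]] FLD(1)[OF FL_KK[OF that(1)] that(3)] FLD(1)[OF FL_KI[OF that(1)] that(3)] FK_sm FK_ad by blast+
    have "ad (XF j (XE i C)) (sm' (-1) (XF j (XE i C))) = fzero N L M"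
      using sm_ad_left[OF f(1), of 1 "-1"] sm_1[OF f(1)] sm_0[OF f(1)] by simp
    then show ?thesis unfolding XE_XF_distinct[OF that(1,2) False that(3)] using False sm_0[OF f(2)] by (simp add: dl_def)
  qed
  have S: "foldr ad (map (\<lambda>k. sm' ((-1) ^ k * qbin q n k) ((X i ^^ (n - k)) (X j ((X i ^^ k) C)))) [0..<Suc n]) (fzero N L M) = fzero N L M"
    if "i \<in> I" "j \<in> I" "i \<noteq> j" "C \<in> FK" "X \<in> {XE, XF}" "n = nat (1 - cartan P i j)" for i j C X n
    using serre_XE[OF that(1-4,6)] serre_XF[OF that(1-4,6)] that(5) by blast
  have "uq_rels P q FK ad sm' (fzero N L M) XE XF KK KI DD"
    unfolding uq_rels_def Let_def
  proof (intro conjI ballI impI, goal_cases)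
    case (1 w i) show ?case using FLD(1)[OF FL_XE[OF 1(2)] 1(1)] .
  next
    case (2 w i) show ?case using FLD(1)[OF FL_XF[OF 2(2)] 2(1)] .
  next
    case (3 w i) show ?case using FLD(1)[OF FL_KK[OF 3(2)] 3(1)] .
  next
    case (4 w i) show ?case using FLD(1)[OF FL_KI[OF 4(2)] 4(1)] .
  next
    case (5 w) show ?case using FLD(1)[OF FL_DD 5] .
  next
    case (6 w i j) show ?case using KC_KC[OF KK[OF 6(2)] KK[OF 6(3)] 6(1)] .
  next
    case (7 w i j) show ?case using KC_KC[OF KK[OF 7(2)] KI[OF 7(3)] 7(1)] .
  next
    case (8 w i j) show ?case using KC_KC[OF KI[OF 8(2)] KI[OF 8(3)] 8(1)] .
  next
    case (9 w i) show ?case using DC_KC[OF DD KK[OF 9(2)] 9(1)] .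
  next
    case (10 w i) show ?case using DC_KC[OF DD KI[OF 10(2)] 10(1)] .
  next
    case (11 w i) show ?case using KKI(1)[OF 11(2,1)] .
  next
    case (12 w i) show ?case using KKI(2)[OF 12(2,1)] .
  next
    case (13 w i j) show ?case using KE[OF 13(2,3,1)] .
  next
    case (14 w i j) show ?case using KF[OF 14(2,3,1)] .
  next
    case (15 w i) show ?case using DE[OF 15(2,1)] .
  next
    case (16 w i) show ?case using DF[OF 16(2,1)] .
  next
    case (17 w i j) show ?case using EF[OF 17(2,3,1)] .
  next
    case (18 w i j X) show ?case using S[OF 18(2,3,4,1,5) refl] .
  qed
  moreover have "integrable P q FK ad sm' (fzero N L M) XE XF KK DD"
    unfolding integrable_def by (intro conjI ballI XE_nilpotent XF_nilpotent weight_decomposition)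
  ultimately show ?thesis by (simp add: integrable_uq_module_def)
qed

end

section \<open>The two actions on the Fock space\<close>

text \<open>The cyclic predecessor: raising with i produces the colour that raising with
  \<open>prd P i\<close> consumes.\<close>

definition prd :: "nat \<Rightarrow> int \<Rightarrow> int" where "prd P i = (i - 1) mod int P"

lemma prd_I: "2 \<le> P \<Longrightarrow> prd P i \<in> {0..<int P}" by (simp add: prd_def)

lemma prd_eq: "i \<in> {0..<int P} \<Longrightarrow> prd P i = (if i = 0 then int P - 1 else i - 1)"
  by (auto simp: prd_def zmod_minus1)

lemma cgr_small: "x \<in> {0..<int P} \<Longrightarrow> y \<in> {0..<int P} \<Longrightarrow> cgr P x y \<longleftrightarrow> x = y"
  by (auto simp: cgr_def dvd_eq_mod_eq_0[symmetric] mod_eq_dvd_iff[symmetric])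

lemma cartan_prd:
  assumes "2 \<le> P" and j: "j \<in> {0..<int P}" and i: "i \<in> {0..<int P}"
  shows "cartan P j i = 2 * dl (i = j) - dl (prd P j = i) - dl (prd P i = j)"
proof -
  have "cgr P j i \<longleftrightarrow> i = j" using cgr_small[OF j i] by auto
  moreover have "cgr P j (i + 1) \<longleftrightarrow> prd P j = i"
  proof -
    have "cgr P j (i + 1) \<longleftrightarrow> (j - 1) mod int P = i mod int P" by (simp add: cgr_def mod_eq_dvd_iff dvd_eq_mod_eq_0 algebra_simps)
    then show ?thesis using i by (simp add: prd_def)
  qed
  moreover have "cgr P j (i - 1) \<longleftrightarrow> prd P i = j"
  proof -
    have "cgr P j (i - 1) \<longleftrightarrow> j mod int P = (i - 1) mod int P" by (simp add: cgr_def mod_eq_dvd_iff dvd_eq_mod_eq_0)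
    then show ?thesis using j by (auto simp: prd_def)
  qed
  ultimately show ?thesis by (simp add: cartan_def)
qed

context fk begin

lemma sm_blk: "sm g (blk m) = (\<Sum>x\<in>{x. und x = m}. g x)"
proof -
  have "distinct (blk m)" by (simp add: blk_def dlist_distinct)
  then have "sm g (blk m) = sum g (set (blk m))" by (rule sum_list_distinct_conv_sum_set)
  also have "set (blk m) = {x. und x = m}" using blk_set by auto
  finally show ?thesis .
qed

lemma finite_slice: "finite {x. und x = m}"
proof -
  have "{x. und x = m} = set (blk m)" using blk_set by auto
  then show ?thesis by simp
qed

lemma sum_dl: "finite A \<Longrightarrow> (\<Sum>x\<in>A. dl (Q x)) = int (card {x \<in> A. Q x})"
  by (simp add: dl_def sum.If_cases Int_def)

text \<open>A cyclic chain of distinct colours, along which \<open>e i\<close> leads from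
  \<open>c i\<close> to \<open>c (prd P i)\<close>, determines the Cartan shifts and the vanishing
  compositions behind the Serre relations. A block has weight zero because each colour occurs S
  times in it.\<close>

lemma uqactI:
  fixes e f :: "int \<Rightarrow> int \<Rightarrow> int option" and k :: "int \<Rightarrow> int \<Rightarrow> int"
  assumes P2: "2 \<le> P"
    and ab: "al = 0 \<and> be = 1 \<or> al = 1 \<and> be = 0"
    and inv: "\<And>i x y. i \<in> {0..<int P} \<Longrightarrow> e i x = Some y \<longleftrightarrow> f i y = Some x"
    and kval: "\<And>i x. i \<in> {0..<int P} \<Longrightarrow> k i x = dl (f i x \<noteq> None) - dl (e i x \<noteq> None)"
    and ecol: "\<And>i x. i \<in> {0..<int P} \<Longrightarrow> e i x \<noteq> None \<longleftrightarrow> ck x = c i"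
    and fcol: "\<And>i x. i \<in> {0..<int P} \<Longrightarrow> f i x \<noteq> None \<longleftrightarrow> ck x = c (prd P i)"
    and inj: "inj_on c {0..<int P}"
    and rng: "\<And>i x y. i \<in> {0..<int P} \<Longrightarrow> e i x = Some y \<Longrightarrow> x - NL \<le> y \<and> y < x"
    and eund: "\<And>i x y. i \<in> {0..<int P} \<Longrightarrow> e i x = Some y \<Longrightarrow> und y = und x + dl (i = 0)"
    and WE: "\<And>i w. i \<in> {0..<int P} \<Longrightarrow> w \<in> W2 \<Longrightarrow> opx q (\<lambda>x. al * k i x) (\<lambda>x. be * k i x) (f i) w \<in> W2"
    and WF: "\<And>i w. i \<in> {0..<int P} \<Longrightarrow> w \<in> W2 \<Longrightarrow> opx q (\<lambda>x. - be * k i x) (\<lambda>x. - al * k i x) (e i) w \<in> W2"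
    and wck: "\<And>F. wfun (\<lambda>x. F (ck x))"
    and S: "\<And>i l. i \<in> {0..<int P} \<Longrightarrow> card {y. und y = l \<and> ck y = c i} = S"
  shows "uqact N L P S e f k al be ck c (\<lambda>i. c (prd P i))"
proof -
  let ?I = "{0..<int P}"
  note pI = prd_I[OF P2]
  have ceq: "c i = c j \<longleftrightarrow> i = j" if "i \<in> ?I" "j \<in> ?I" for i j using inj_on_eq_iff[OF inj that] .
  have pn: "prd P i \<noteq> i" if "i \<in> ?I" for i using prd_eq[OF that] P2 by auto
  have pinj: "prd P i = prd P j \<longleftrightarrow> i = j" if "i \<in> ?I" "j \<in> ?I" for i j using prd_eq[OF that(1)] prd_eq[OF that(2)] that by auto
  have ex': "ck x = c i" "ck y = c (prd P i)" if "i \<in> ?I" "e i x = Some y" for i x y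
  proof -
    have "f i y = Some x" using that inv by blast
    then show "ck x = c i" "ck y = c (prd P i)" using ecol[OF that(1), of x] fcol[OF that(1), of y] that(2) by simp_all
  qed
  have fx': "ck y = c i" "ck x = c (prd P i)" if "i \<in> ?I" "f i x = Some y" for i x y
  proof -
    have "e i y = Some x" using that inv by blast
    then show "ck y = c i" "ck x = c (prd P i)" using ex'[OF that(1)] by blast+
  qed
  have eN: "e j y = None \<longleftrightarrow> ck y \<noteq> c j" "f j y = None \<longleftrightarrow> ck y \<noteq> c (prd P j)" if "j \<in> ?I" for j y using ecol[OF that, of y] fcol[OF that, of y] by auto
  have kv: "k j x = dl (ck x = c (prd P j)) - dl (ck x = c j)" if "j \<in> ?I" for j x
    using kval[OF that] ecol[OF that, of x] fcol[OF that, of x] by simp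
  show ?thesis
  proof (unfold_locales, goal_cases)
    case 1 show ?case by (rule P2)
  next
    case 2 show ?case by (rule ab)
  next
    case (3 i x y) then show ?case by (rule inv)
  next
    case (4 i x) then show ?case by (rule kval)
  next
    case (5 i j x y)
    show ?case unfolding kv[OF 5(2)] ex'[OF 5(1,3)] using cartan_prd[OF P2 5(2,1)] 5(1,2) pI ceq pinj by (simp add: dl_def)
  next
    case (6 i x y)
    show ?case using eN(1)[OF 6(1)] ex'[OF 6] ceq[OF pI 6(1)] pn[OF 6(1)] by simp
  next
    case (7 i j x y)
    show ?case using eN(2)[OF 7(2)] ex'(2)[OF 7(1,4)] ceq[OF pI pI] pinj[OF 7(1,2)] 7(3) by simp
  next
    case (8 i j x y)
    show ?case using eN(1)[OF 8(1)] fx'(1)[OF 8(2,4)] ceq[OF 8(2,1)] 8(3) by simp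
  next
    case (9 i j x y)
    have "prd P i \<noteq> j" using cartan_prd[OF P2 9(1,2)] 9(3) pn[OF 9(1)] by (auto simp: dl_def split: if_splits)
    then show ?case using eN(1)[OF 9(2)] ex'(2)[OF 9(1,4)] ceq[OF pI 9(2)] by simp
  next
    case (10 i j x y z)
    have pj: "prd P i = j" using ex'(2)[OF 10(1,4)] ex'(1)[OF 10(2,5)] ceq[OF pI[of i] 10(2)] by simp
    then have "prd P j \<noteq> i" using cartan_prd[OF P2 10(1,2)] 10(3) pn[OF 10(1)] by (auto simp: dl_def split: if_splits)
    then show ?case using eN(1)[OF 10(1)] ex'(2)[OF 10(2,5)] ceq[OF pI 10(1)] by simp
  next
    case (11 i)
    have "k i = (\<lambda>x. dl (ck x = c (prd P i)) - dl (ck x = c i))" using kv[OF 11] by auto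
    then show ?case using wck[of "\<lambda>x. dl (x = c (prd P i)) - dl (x = c i)"] by simp
  next
    case (12 i m)
    have "sm (k i) (blk m) = (\<Sum>x\<in>{x. und x = m}. dl (ck x = c (prd P i))) - (\<Sum>x\<in>{x. und x = m}. dl (ck x = c i))"
      unfolding sm_blk by (simp add: kv[OF 12] sum_subtractf)
    then show ?case using S[OF pI] S[OF 12] by (simp add: sum_dl[OF finite_slice])
  next
    case (13 i x y) then show ?case by (rule rng)
  next
    case (14 i x y) then show ?case by (rule eund)
  next
    case (15 i w) then show ?case by (rule WE)
  next
    case (16 i w) then show ?case by (rule WF)
  next
    case (17 i x) then show ?case by (rule ecol)
  next
    case (18 i x y) then show ?case by (rule ex')
  next
    case (19 i) show ?case using ceq[OF 19 pI] pn[OF 19] by metis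
  next
    case (20 F) show ?case by (rule wck)
  next
    case (21 i l) then show ?case using S finite_subset[OF _ finite_slice[of l], of "{y. und y = l \<and> ck y = c i}"] by auto
  qed
qed

text \<open>This count is the level: in a block each colour occurs once for every label, which gives
  level L here, and dually level N in \<open>slice_dot\<close>.\<close>

lemma slice_bar: assumes "col c" shows "card {y. und y = l \<and> bar y = c} = L"
proof -
  have c: "1 \<le> c" "c \<le> iN" using assms by (auto simp: col_def)
  have "{y. und y = l \<and> bar y = c} = (\<lambda>a. enc N L l a c) ` {1..iL}"
  proof (intro equalityI subsetI)
    fix y assume "y \<in> {y. und y = l \<and> bar y = c}"
    then have "y = enc N L l (dot y) c" using pos_bar[of y] by (auto simp: enc_def pos_dot)
    then show "y \<in> (\<lambda>a. enc N L l a c) ` {1..iL}" using dot_range by (intro image_eqI[of _ _ "dot y"]) auto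
  next
    fix y assume "y \<in> (\<lambda>a. enc N L l a c) ` {1..iL}"
    then obtain a where a: "1 \<le> a" "a \<le> iL" "y = enc N L l a c" by auto
    then show "y \<in> {y. und y = l \<and> bar y = c}" using dot_und_unique[OF a(1,2), of y l] bar_enc[OF c] pos_enc[OF c] by simp
  qed
  moreover have "inj_on (\<lambda>a. enc N L l a c) {1..iL}" using N2 by (auto simp: inj_on_def enc_def)
  ultimately show ?thesis by (simp add: card_image)
qed

lemma slice_dot: assumes c: "1 \<le> c" "c \<le> iL" shows "card {y. und y = l \<and> dot y = c} = N"
proof -
  have "{y. und y = l \<and> dot y = c} = (\<lambda>e. enc N L l c e) ` {1..iN}"
  proof (intro equalityI subsetI)
    fix y assume "y \<in> {y. und y = l \<and> dot y = c}"
    then have "y = enc N L l c (bar y)" using pos_bar[of y] by (auto simp: enc_def pos_dot)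
    then show "y \<in> (\<lambda>e. enc N L l c e) ` {1..iN}" using bar_range by (intro image_eqI[of _ _ "bar y"]) auto
  next
    fix y assume "y \<in> (\<lambda>e. enc N L l c e) ` {1..iN}"
    then obtain a where a: "1 \<le> a" "a \<le> iN" "y = enc N L l c a" by auto
    then show "y \<in> {y. und y = l \<and> dot y = c}" using dot_und_unique[OF c, of y l] pos_enc[OF a(1,2)] by simp
  qed
  moreover have "inj_on (\<lambda>e. enc N L l c e) {1..iN}" by (auto simp: inj_on_def enc_def)
  ultimately show ?thesis by (simp add: card_image)
qed

lemma uqact_undotted: "uqact N L N L (e1 N L) (f1 N L) (kexp N) 0 1 bar (\<lambda>i. i + 1) (\<lambda>i. prd N i + 1)"
proof (rule uqactI[where c = "\<lambda>i. i + 1"], goal_cases)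
  case (3 i x y) then show ?case using e1_f1 by simp
next
  case (4 i x) show ?case by (simp add: kexp_def f1_def e1_def)
next
  case (5 i x) then show ?case by (simp add: e1_eq)
next
  case (6 i x) then show ?case using prd_eq[OF 6] by (auto simp: f1_eq ci_def)
next
  case (8 i x y)
  then have i: "0 \<le> i" "i < iN" by simp_all
  have y: "bar x = i + 1" "y = ci i - iN * (pos x + iL * dl (i = 0))" using 8(2) by (auto simp: e1_eq[OF i] split: if_splits)
  have x: "x = bar x - iN * pos x" by (rule pos_bar)
  have "2 * iN \<le> iN * iL" using L2 N2 by simp
  then have "2 * iN \<le> NL" by (simp add: NL_def)
  moreover have "y = ci i - iN * pos x - NL * dl (i = 0)" using y(2) by (simp add: NL_def algebra_simps)
  moreover have "x = i + 1 - iN * pos x" using x y(1) by simp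
  ultimately show ?case using i N2 by (cases "i = 0") (simp_all add: ci_def dl_def)
next
  case (9 i x y)
  then have i: "0 \<le> i" "i < iN" by simp_all
  have y: "bar x = i + 1" "y = ci i - iN * (pos x + iL * dl (i = 0))" using 9(2) by (auto simp: e1_eq[OF i] split: if_splits)
  have "1 \<le> ci i" "ci i \<le> iN" using i N2 by (auto simp: ci_def)
  then have "pos y = pos x + iL * dl (i = 0)" unfolding y(2) by (rule pos_of)
  then have "pos y = dot x + iL * (und x + dl (i = 0))" by (simp add: pos_dot algebra_simps)
  then show ?case using dot_und_unique[OF dot_range] by blast
next
  case (10 i w)
  then show ?case using W2_E[of i] by (auto simp: W2_def)
next
  case (11 i w)
  then show ?case using W2_F[of i] by (auto simp: W2_def)
next
  case (12 F) show ?case by (rule wfun_bar)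
next
  case (13 i l) then show ?case by (intro slice_bar) (simp add: col_def)
qed (use N2 in \<open>auto simp: inj_on_def\<close>)

lemma dot_cgr: assumes a: "a \<in> {0..<iL}"
  shows "cgr L (dot x) (iL - a) \<longleftrightarrow> dot x = iL - a" "cgr L (dot x) (iL - a + 1) \<longleftrightarrow> dot x = iL - prd L a"
proof -
  have r: "cgr L (dot x) y \<longleftrightarrow> dot x = y" if "1 \<le> y" "y \<le> iL" for y
  proof
    assume "cgr L (dot x) y"
    then have "(dot x - y) mod iL = 0" by (simp add: cgr_def)
    moreover have "- iL < dot x - y" "dot x - y < iL" using dot_range[of x] that by linarith+
    ultimately have "dot x - y = 0" by (rule mod_range_0)
    then show "dot x = y" by simp
  qed (simp add: cgr_def)
  show "cgr L (dot x) (iL - a) \<longleftrightarrow> dot x = iL - a" using a by (intro r) auto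
  show "cgr L (dot x) (iL - a + 1) \<longleftrightarrow> dot x = iL - prd L a"
  proof (cases "a = 0")
    case True
    have "dot x - 1 = dot x - (iL + 1) + iL" by simp
    then have "(dot x - 1) mod iL = (dot x - (iL + 1)) mod iL" by (simp only: mod_add_self2)
    then have "cgr L (dot x) (iL + 1) \<longleftrightarrow> cgr L (dot x) 1" by (simp add: cgr_def)
    then show ?thesis using r[of 1] L2 prd_eq[OF a] True by simp
  next
    case False
    then have e: "iL - prd L a = iL - a + 1" using prd_eq[OF a] by simp
    show ?thesis unfolding e using a False by (intro r) auto
  qed
qed

lemma uqact_dotted: "uqact N L L N (ed1 N L) (fd1 N L) (kdexp N L) 1 0 dot (\<lambda>a. iL - a) (\<lambda>a. iL - prd L a)"
proof (rule uqactI[where c = "\<lambda>a. iL - a"], goal_cases)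
  case (3 i x y) then show ?case using ed1_fd1 by simp
next
  case (4 i x) show ?case by (simp add: kdexp_def fd1_def ed1_def)
next
  case (5 i x) then show ?case using dot_cgr(1)[OF 5] by (simp add: ed1_def)
next
  case (6 i x) then show ?case using dot_cgr(2)[OF 6] by (simp add: fd1_def)
next
  case (8 i x y)
  then have i: "0 \<le> i" "i < iL" by simp_all
  have "y = x - iN" using 8(2) by (auto simp: ed1_eq[OF i] split: if_splits)
  moreover have "1 * iN \<le> iL * iN" using L2 by (intro mult_right_mono) auto
  ultimately show ?case using N2 by (simp add: NL_def mult.commute)
next
  case (9 i x y)
  then have i: "0 \<le> i" "i < iL" by simp_all
  have y: "y = x - iN" using 9(2) by (auto simp: ed1_eq[OF i] split: if_splits)
  have "cgr L (dot x) (iL - i)" using 9(2) by (auto simp: ed1_def split: if_splits)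
  then have d: "dot x = iL - i" using dot_cgr(1)[OF 9(1)] by simp
  have p: "pos y = dot x + iL * und x + 1" unfolding y using pos_shift(1)[of x] pos_dot[of x] by simp
  show ?case
  proof (cases "i = 0")
    case True
    have "pos y = 1 + iL * (und x + 1)" using p d True by (simp add: algebra_simps)
    then show ?thesis using dot_und_unique[of 1 y "und x + 1"] L2 True by (simp add: dl_def)
  next
    case False
    have "pos y = (iL - i + 1) + iL * und x" using p d by simp
    then show ?thesis using dot_und_unique[of "iL - i + 1" y "und x"] i False by (simp add: dl_def)
  qed
next
  case (10 i w)
  then show ?case using W2_XE_XF(1)[of i] by (auto simp: W2_def XE_def)
next
  case (11 i w)
  then show ?case using W2_XE_XF(2)[of i] by (auto simp: W2_def XF_def)
next
  case (12 F) show ?case by (rule wfun_dot)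
next
  case (13 i l) then show ?case by (intro slice_dot) auto
qed (use L2 in \<open>auto simp: inj_on_def\<close>)

end

subsection \<open>The tensor operators of the statement\<close>

lemma prod_powi: "(\<Prod>l\<in>{a..<b}. zpow (qq N) (g (xs ! l))) = qq N powi sm g (map ((!) xs) [a..<b])"
proof -
  have s: "prod_list (map (\<lambda>l. qq N powi h l) ls) = qq N powi sum_list (map h ls)" for h :: "nat \<Rightarrow> int" and ls
    by (induction ls) (simp_all add: power_int_add)
  have "(\<Prod>l\<in>{a..<b}. zpow (qq N) (g (xs ! l))) = prod_list (map (\<lambda>l. qq N powi g (xs ! l)) [a..<b])"
    using prod.distinct_set_conv_list[of "[a..<b]" "\<lambda>l. qq N powi g (xs ! l)"] by (simp add: zpow_eq_power_int)
  then show ?thesis unfolding s by (simp add: o_def)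
qed

lemma map_nth_upt: "b \<le> length xs \<Longrightarrow> map ((!) xs) [a..<b] = take (b - a) (drop a xs)"
  by (rule nth_equalityI) auto

lemma cafter_powi: "cafter (qq N) g j xs = qq N powi sm g (drop (Suc j) xs)"
  unfolding cafter_def prod_powi by (simp add: map_nth_upt)

lemma cbefore_powi: "j \<le> length xs \<Longrightarrow> cbefore (qq N) g j xs = qq N powi sm g (take j xs)"
  unfolding cbefore_def lessThan_atLeast0 prod_powi by (simp add: map_nth_upt)

lemma tens_linear_eqI:
  assumes "v \<in> tens n" and A: "lnr A" and B: "\<And>xs. length xs = n \<Longrightarrow> F xs = A (bvec xs)"
  shows "lin F v = A v"
  using assms(1)
proof (induction rule: tens_induct)
  case (add v c xs)
  have "lin F (v + sc c (bvec xs)) = lin F v + sc c (F xs)" using tens_fs[OF add.hyps(1)] by (simp add: lin_add lin_sc)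
  then show ?case using add B by (simp add: lnrD[OF A])
qed (simp add: lnr_zero[OF A])

text \<open>The bridge from the generators of the statement, given by push-forward on basis vectors,
  to the pull-back operators. The two are compared on tensors, where supports are finite.\<close>

lemma lin_copr:
  assumes inv: "\<And>x y. g x = Some y \<longleftrightarrow> h y = Some x" and v: "v \<in> tens n"
    and c: "\<And>xs j. j < length xs \<Longrightarrow> c j xs = qq N powi sm bf (take j xs) * qq N powi sm af (drop (Suc j) xs)"
  shows "lin (copr g c) v = opx (qq N) bf af h v"
proof (rule tens_linear_eqI[OF v lnr_opx])
  fix xs :: "int list"
  show "copr g c xs = opx (qq N) bf af h (bvec xs)"
    unfolding opx_bvec[OF qq_nonzero inv] copr_def
    by (rule ext, unfold sum_fun_apply, rule sum.cong[OF refl]) (auto simp: c fapp split: option.split)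
qed

lemma diagop_kop: "v \<in> tens n \<Longrightarrow> diagop (qq N) g v = kop (qq N) g v"
  unfolding diagop_def
proof (rule tens_linear_eqI[OF _ lnr_kop])
  fix xs :: "int list"
  show "sc (\<Prod>l<length xs. zpow (qq N) (g (xs ! l))) (bvec xs) = kop (qq N) g (bvec xs)"
    unfolding lessThan_atLeast0 prod_powi kop_bvec by (simp add: map_nth_upt)
qed

lemma tD_dop: "v \<in> tens n \<Longrightarrow> tD N L v = dop (undr N L) v"
  unfolding tD_def
proof (rule tens_linear_eqI[OF _ lnr_dop])
  fix xs :: "int list"
  show "sc (of_int (\<Sum>l<length xs. undr N L (xs ! l))) (bvec xs) = dop (undr N L) (bvec xs)"
    unfolding dop_bvec by (simp add: sum_list_sum_nth lessThan_atLeast0)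
qed

context uqact begin

text \<open>In the statement F_i acts on the first block of the tail only for i = 0, whereas
  \<open>FC\<close> lets it act there for every i. For the other i the additional term is a relation
  by \<open>oF_block\<close>.\<close>

lemma FC_liftI:
  assumes i: "i \<in> I" and g: "\<And>n v. good n \<Longrightarrow> v \<in> tens n \<Longrightarrow> g (n, v) = (n + N * L, ex n (n + N * L) (sc c (oF i v))
       + (if i = 0 then sc c (tensv n (kop q (\<lambda>x. - be * k i x) v) (oF i (bvec (blk (mm n))))) else 0))"
  shows "FC (liftF N L M g) c (\<lambda>x. - be * k i x) (\<lambda>x. - al * k i x) (e i)"
proof (rule FC_lift[OF Fop_F[OF i]], intro conjI)
  fix n v assume n: "good n" "v \<in> tens n"
  let ?p = "n + N * L" and ?b = "bvec (blk (mm n))"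
  let ?T = "tensv n (kop q (\<lambda>x. - be * k i x) v) (oF i ?b)"
  let ?B = "ex n ?p (sc c (oF i v)) + (if i = 0 then sc c ?T else 0)"
  show "g (n, v) = (?p, ?B)" using g[OF n] .
  have t: "oF i v \<in> tens n" "oF i ?b \<in> tens (N * L)" using wop_tens[OF wop_F[OF i]] n(2) by simp_all
  have Tt: "?T \<in> tens ?p" using t n kop_tens by (intro tensv_tens)
  show "?B \<in> tens ?p"
  proof (rule tens_add)
    show "ex n ?p (sc c (oF i v)) \<in> tens ?p" by (rule ex_tens[OF le_add1 tens_sc[OF t(1)]])
    show "(if i = 0 then sc c ?T else 0) \<in> tens ?p" using tens_sc[OF Tt, of c] tens_0[of ?p] by presburger
  qed
  have eb: "ex n ?p w = tensv n w ?b" for w by (simp add: ex_tensv blk_def good_mm[OF n(1)])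
  have kb': "kop q (\<lambda>x. - al * k i x) ?b = ?b" using sm_multiple[OF i, of "- al"] by (simp add: kop_bvec)
  have o: "oF i (ex n ?p v) = ex n ?p (oF i v) + ?T"
    unfolding eb opx_tensv[OF qq_nonzero n(2)] kb' ..
  show "?B - sc c (oF i (ex n ?p v)) \<in> WW ?p"
  proof (cases "i = 0")
    case True
    then show ?thesis unfolding o by (simp add: ex_lin sc_add WW.zero)
  next
    case False
    have "?T \<in> WW ?p" by (intro WW_left kop_tens[OF n(2)] oF_block[OF i False])
    then have "sc c ?T \<in> WW ?p" by (rule WW_sc)
    then have "- sc c ?T \<in> WW ?p" by (rule WW_uminus)
    moreover have "?B - sc c (oF i (ex n ?p v)) = - sc c ?T" unfolding o using False by (simp add: ex_lin sc_add)
    ultimately show ?thesis by simp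
  qed
qed

end

context fk begin

lemma kop_zero: "kop q (\<lambda>_. 0) v = v" by (simp add: kop_def fun_eq_iff)

lemma uqmod_undotted: "uqmod N L M N L (e1 N L) (f1 N L) (kexp N) 0 1 bar (\<lambda>i. i + 1) (\<lambda>i. prd N i + 1)
   (\<lambda>i. liftF N L M (rE N L M i)) (\<lambda>i. liftF N L M (rF N L M i)) (\<lambda>i. liftF N L M (rK N L M i)) (\<lambda>i. liftF N L M (rKi N L M i)) (liftF N L M (rD N L M))"
proof -
  interpret A: uqact N L M N L "e1 N L" "f1 N L" "kexp N" 0 1 bar "\<lambda>i. i + 1" "\<lambda>i. prd N i + 1" by (rule uqact_undotted)
  have tE: "tE N L i v = opx q (\<lambda>x. 0 * kexp N i x) (\<lambda>x. 1 * kexp N i x) (f1 N L i) v" if "i \<in> A.I" "v \<in> tens n" for i v n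
    unfolding tE_def by (rule lin_copr[OF A.inv[OF that(1)] that(2)]) (simp add: cafter_powi)
  have tF: "tF N L i v = opx q (\<lambda>x. - 1 * kexp N i x) (\<lambda>x. - 0 * kexp N i x) (e1 N L i) v" if "i \<in> A.I" "v \<in> tens n" for i v n
    unfolding tF_def by (rule lin_copr[OF A.inv[OF that(1), symmetric] that(2)]) (simp add: cbefore_powi)
  show ?thesis
  proof (unfold_locales, goal_cases)
    case (1 i)
    show ?case by (rule EC_lift[OF A.Eop_E[OF 1]]) (simp add: rE_def tE[OF 1] zpow_eq_power_int)
  next
    case (2 i)
    show ?case
      by (rule A.FC_liftI[OF 2]) (use 2 in \<open>simp add: rF_def Let_def tF tF[OF A.zero_I tens_bvec[OF blk_length]] vbar_blk tKi_def diagop_kop\<close>)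
  next
    case (3 i)
    show ?case by (rule KC_lift[OF A.wk[OF 3] A.kb[OF 3]]) (simp add: rK_def tK_def diagop_kop zpow_eq_power_int)
  next
    case (4 i)
    show ?case using A.wfun_multiple[OF 4, of "- 1"] A.sm_multiple[OF 4, of "- 1"]
      by (intro KC_lift) (simp_all add: rKi_def tKi_def diagop_kop zpow_eq_power_int)
  next
    case 5
    show ?case by (rule DC_lift) (simp add: rD_def Let_def tD_dop dvac_def)
  qed
qed

lemma uqmod_dotted: "uqmod N L M L N (ed1 N L) (fd1 N L) (kdexp N L) 1 0 dot (\<lambda>a. iL - a) (\<lambda>a. iL - prd L a)
   (\<lambda>i. liftF N L M (rEd N L M i)) (\<lambda>i. liftF N L M (rFd N L M i)) (\<lambda>i. liftF N L M (rKd N L M i)) (\<lambda>i. liftF N L M (rKdi N L M i)) (liftF N L M (rDd N L M))"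
proof -
  interpret A: uqact N L M L N "ed1 N L" "fd1 N L" "kdexp N L" 1 0 dot "\<lambda>a. iL - a" "\<lambda>a. iL - prd L a" by (rule uqact_dotted)
  have tE: "tEd N L i v = opx q (\<lambda>x. 1 * kdexp N L i x) (\<lambda>x. 0 * kdexp N L i x) (fd1 N L i) v" if "i \<in> A.I" "v \<in> tens n" for i v n
    unfolding tEd_def by (rule lin_copr[OF A.inv[OF that(1)] that(2)]) (simp add: cbefore_powi)
  have tF: "tFd N L i v = opx q (\<lambda>x. - 0 * kdexp N L i x) (\<lambda>x. - 1 * kdexp N L i x) (ed1 N L i) v" if "i \<in> A.I" "v \<in> tens n" for i v n
    unfolding tFd_def by (rule lin_copr[OF A.inv[OF that(1), symmetric] that(2)]) (simp add: cafter_powi)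
  show ?thesis
  proof (unfold_locales, goal_cases)
    case (1 i)
    show ?case by (rule EC_lift[OF A.Eop_E[OF 1]]) (simp add: rEd_def tE[OF 1])
  next
    case (2 i)
    show ?case
      by (rule A.FC_liftI[OF 2]) (use 2 in \<open>simp add: rFd_def Let_def tF tF[OF A.zero_I tens_bvec[OF blk_length]] vbar_blk kop_zero zpow_eq_power_int dl_def\<close>)
  next
    case (3 i)
    show ?case by (rule KC_lift[OF A.wk[OF 3] A.kb[OF 3]]) (simp add: rKd_def tKd_def diagop_kop zpow_eq_power_int)
  next
    case (4 i)
    show ?case using A.wfun_multiple[OF 4, of "- 1"] A.sm_multiple[OF 4, of "- 1"]
      by (intro KC_lift) (simp_all add: rKdi_def tKdi_def diagop_kop zpow_eq_power_int)
  next
    case 5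
    show ?case by (rule DC_lift) (simp add: rDd_def Let_def tD_dop dvac_def)
  qed
qed

subsection \<open>Mutual commutativity\<close>

lemma EC_EC_commute:
  assumes X: "EC X c b1 a1 h1" "wop b1 a1 g1 h1" and Y: "EC Y d b2 a2 h2" "wop b2 a2 g2 h2"
    and com: "\<And>v. opx q b1 a1 h1 (opx q b2 a2 h2 v) = opx q b2 a2 h2 (opx q b1 a1 h1 v)" and C: "C \<in> FK"
  shows "X (Y C) = Y (X C)"
proof -
  obtain n v where n: "good n" "v \<in> tens n" "C = cl n v" using FK_cl[OF C, of 0] by blast
  then show ?thesis using X(1) Y(1) wop_tens[OF X(2)] wop_tens[OF Y(2)]
    by (simp add: EC_def lnrD[OF lnr_opx] com mult.commute)
qed

text \<open>Two blocks are supplied beforehand, one for each lowering operator; after that both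
  products are tensor operators applied to the same vector.\<close>

lemma FC_FC_commute:
  assumes X: "FC X c b1 a1 h1" "Fop b1 a1 g1 h1" and Y: "FC Y d b2 a2 h2" "Fop b2 a2 g2 h2"
    and com: "\<And>v. opx q b1 a1 h1 (opx q b2 a2 h2 v) = opx q b2 a2 h2 (opx q b1 a1 h1 v)" and C: "C \<in> FK"
  shows "X (Y C) = Y (X C)"
proof -
  obtain n v where n: "good n" "v \<in> tens n" "C = cl n v" using FK_cl[OF C, of 0] by blast
  let ?p = "n + N * L + N * L"
  have p: "good ?p" using n good_add1 by simp
  have r: "rep C n ?p (ex n ?p v)" unfolding n(3) using n p by (intro repI) simp_all
  have r1: "rep (X (Y C)) ?p ?p (sc c (opx q b1 a1 h1 (sc d (opx q b2 a2 h2 (ex n ?p v)))))"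
    by (rule rep_F[OF X(2,1) rep_F[OF Y(2,1) r]]) simp_all
  have r2: "rep (Y (X C)) ?p ?p (sc d (opx q b2 a2 h2 (sc c (opx q b1 a1 h1 (ex n ?p v)))))"
    by (rule rep_F[OF Y(2,1) rep_F[OF X(2,1) r]]) simp_all
  show ?thesis unfolding rep_cl[OF r1] rep_cl[OF r2] by (simp add: lnrD[OF lnr_opx] com mult.commute)
qed

text \<open>The cross term stays within the indices of the two blocks, but by \<open>s\<close> their
  sum differs from that of the vacuum, so it is zero. For generators from different algebras there
  is thus no scalar to determine.\<close>

lemma exchange_vanishes:
  assumes E: "Eop b1 a1 g1 h1" and F: "Fop b2 a2 g2 h2"
    and s: "\<And>x y x' y'. g1 x = Some y \<Longrightarrow> g2 x' = Some y' \<Longrightarrow> y + y' \<noteq> x + x'"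
  shows "tensv (N * L) (opx q b1 a1 h1 (bvec (blk m))) (opx q b2 a2 h2 (bvec (blk (m + 1)))) \<in> WW (N * L + N * L)"
proof (rule WW_of_basis)
  have w: "wop b1 a1 g1 h1" "wop b2 a2 g2 h2" using E F by (simp_all add: Eop_def Fop_def)
  let ?n = "N * L" and ?b = "- (NL * m)"
  let ?A = "opx q b1 a1 h1 (bvec (blk m))" and ?B = "opx q b2 a2 h2 (bvec (blk (m + 1)))"
  have t: "tensv ?n ?A ?B \<in> tens (?n + ?n)" using wop_tens[OF w(1)] wop_tens[OF w(2)] by (intro tensv_tens) simp_all
  then show "fs (tensv ?n ?A ?B)" by (rule tens_fs)
  fix zs assume z: "tensv ?n ?A ?B zs \<noteq> 0"
  then have len: "length zs = ?n + ?n" using tens_length[OF t] by blast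
  define ys ys' where "ys = take ?n zs" and "ys' = drop ?n zs"
  have zs: "zs = ys @ ys'" by (simp add: ys_def ys'_def)
  have o: "?A ys \<noteq> 0" "?B ys' \<noteq> 0" using z by (auto simp: tensv_def ys_def ys'_def split: if_splits)
  from opx_bvec_supp[OF wop_inv[OF w(1)] o(1)] obtain us x y vs where u: "blk m = us @ x # vs" "ys = us @ y # vs" "g1 x = Some y" by blast
  from opx_bvec_supp[OF wop_inv[OF w(2)] o(2)] obtain us' x' y' vs' where u': "blk (m + 1) = us' @ x' # vs'" "ys' = us' @ y' # vs'" "g2 x' = Some y'" by blast
  have b2: "dlist ?b (?n + ?n) = blk m @ blk (m + 1)"
  proof -
    have "- (NL * m) - int (N * L) = - (NL * (m + 1))" by (simp add: NL_def algebra_simps)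
    then show ?thesis unfolding blk_def by (simp only: dlist_append)
  qed
  have st: "set (blk m) = {?b - NL + 1..?b}" "set (blk (m + 1)) = {?b - NL - NL + 1..?b - NL}"
    unfolding blk_def dlist_set by (auto simp: NL_def algebra_simps)
  have "x \<in> set (blk m)" "x' \<in> set (blk (m + 1))" unfolding u(1) u'(1) by simp_all
  moreover have "x - NL \<le> y" "y < x" "x' < y'" "y' \<le> x' + NL" using E F u(3) u'(3) by (auto simp: Eop_def Fop_def)
  ultimately have "y \<in> {?b - NL - NL + 1..?b}" "y' \<in> {?b - NL - NL + 1..?b}" unfolding st using NL_pos by auto
  moreover have "set (blk m) \<subseteq> {?b - NL - NL + 1..?b}" "set (blk (m + 1)) \<subseteq> {?b - NL - NL + 1..?b}"
    unfolding st using NL_pos by auto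
  then have "set us \<union> set vs \<subseteq> {?b - NL - NL + 1..?b}" "set us' \<union> set vs' \<subseteq> {?b - NL - NL + 1..?b}"
    unfolding u(1) u'(1) by simp_all
  ultimately have "set zs \<subseteq> {?b - NL - NL + 1..?b}" unfolding zs u(2) u'(2) by auto
  then have "set zs \<subseteq> {?b - int (?n + ?n) + 1..?b}" by (simp add: NL_def algebra_simps)
  moreover have "\<not> samew (dlist ?b (?n + ?n)) zs"
    unfolding b2 zs u(1,2) u'(1,2) samew_def using s[OF u(3) u'(3)] by simp
  ultimately show "bvec zs \<in> WW (?n + ?n)" using len by (intro interval_zero)
qed

lemma bind_commute:
  fixes s t :: int
  assumes "\<And>x. g x = (if Q x then Some (x + s) else None)" "\<And>x. g' x = (if R x then Some (x + t) else None)"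
    and "\<And>x. Q (x + t) = Q x" "\<And>x. Q x \<Longrightarrow> R (x + s) = R x"
  shows "Option.bind (g x) g' = Option.bind (g' x) g"
  using assms(3)[of x] assms(4)[of x] by (simp add: assms(1,2))

end

section \<open>Index steps of the generators of both algebras\<close>

context fk begin

lemma KC_EC_commute:
  assumes K: "KC K l k" and X: "EC X c bf af h" and w: "wop bf af g h" and s: "\<And>y x. h y = Some x \<Longrightarrow> k y = k x" and C: "C \<in> FK"
  shows "K (X C) = X (K C)"
proof -
  have "K (X C) = sm' (q powi 0) (X (K C))" by (rule KC_EC[OF K X w _ C]) (simp add: s)
  then show ?thesis using sm_1[OF FLD(1)[OF EC_FL[OF X w] FLD(1)[OF KC_FL[OF K] C]]] by simp
qed

lemma KC_FC_commute:
  assumes K: "KC K l k" and kb: "\<And>m. sm k (blk m) = 0" and X: "FC X c bf af h" and w: "wop bf af g h"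
    and s: "\<And>y x. h y = Some x \<Longrightarrow> k y = k x" and C: "C \<in> FK"
  shows "K (X C) = X (K C)"
proof -
  have "K (X C) = sm' (q powi 0) (X (K C))" by (rule KC_FC[OF K kb X w _ C]) (simp add: s)
  then show ?thesis using sm_1[OF FLD(1)[OF FC_FL[OF X w] FLD(1)[OF KC_FL[OF K] C]]] by simp
qed

text \<open>The change of the index under E_i: -1 for i > 0, and N - 1 - N L for i = 0, where the
  colour wraps around and a factor z enters.\<close>

definition stp :: "int \<Rightarrow> int" where "stp i = ci i - (i + 1) - NL * dl (i = 0)"

lemma e1_step: "0 \<le> i \<Longrightarrow> i < iN \<Longrightarrow> e1 N L i x = (if bar x = i + 1 then Some (x + stp i) else None)"
  using pos_bar[of x] by (simp add: e1_eq stp_def NL_def algebra_simps)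

lemma f1_step: "0 \<le> i \<Longrightarrow> i < iN \<Longrightarrow> f1 N L i x = (if bar x = ci i then Some (x + - stp i) else None)"
  using pos_bar[of x] by (simp add: f1_eq stp_def NL_def algebra_simps)

text \<open>Modulo N the step of E_i is -1, while dotted generators move indices by N; the two can
  never compensate each other.\<close>

lemma stp_neq: assumes "0 \<le> i" "i < iN" shows "stp i + iN \<noteq> 0"
proof
  assume "stp i + iN = 0"
  then have "iN dvd stp i + 1 - 1" by (metis add_diff_cancel_right' add_eq_0_iff dvd_minus_iff dvd_refl)
  moreover have "stp i + 1 = iN * (dl (i = 0) * (1 - iL))" by (auto simp: stp_def ci_def dl_def NL_def algebra_simps)
  then have "iN dvd stp i + 1" by simp
  ultimately have "iN dvd 1" by (metis dvd_diff_right_iff)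
  then show False using N2 by simp
qed

text \<open>An undotted generator changes the position by a multiple of L, so it does not affect
  which dotted generators apply.\<close>

lemma zl_pos_step:
  assumes i: "0 \<le> i" "i < iN"
  shows "bar x = i + 1 \<Longrightarrow> zl (pos (x + stp i) + c) = zl (pos x + c)" "bar x = ci i \<Longrightarrow> zl (pos (x + - stp i) + c) = zl (pos x + c)"
proof -
  have z: "zl (p + iL * d + c) = zl (p + c)" for p d
  proof -
    have "p + iL * d + c = (p + c) + iL * d" by simp
    then show ?thesis unfolding zl_def by (simp only: mod_mult_self2)
  qed
  have r: "1 \<le> ci i" "ci i \<le> iN" "1 \<le> i + 1" "i + 1 \<le> iN" using i N2 by (auto simp: ci_def)
  have x: "x = bar x - iN * pos x" by (rule pos_bar)
  show "zl (pos (x + stp i) + c) = zl (pos x + c)" if "bar x = i + 1"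
  proof -
    have "x + stp i = ci i - iN * (pos x + iL * dl (i = 0))" using x that by (simp add: stp_def NL_def algebra_simps)
    then have "pos (x + stp i) = pos x + iL * dl (i = 0)" using pos_of[OF r(1,2)] by simp
    then show ?thesis using z by simp
  qed
  show "zl (pos (x + - stp i) + c) = zl (pos x + c)" if "bar x = ci i"
  proof -
    have "x + - stp i = i + 1 - iN * (pos x + iL * - dl (i = 0))" using x that by (simp add: stp_def NL_def algebra_simps)
    then have "pos (x + - stp i) = pos x + iL * - dl (i = 0)" using pos_of[OF r(3,4)] by simp
    then show ?thesis by (simp only: z)
  qed
qed

lemma kdexp_step: assumes i: "0 \<le> i" "i < iN" and h: "h \<in> {e1 N L i, f1 N L i}" and y: "h y = Some x" shows "kdexp N L a y = kdexp N L a x"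
proof -
  have "zl (pos x + c) = zl (pos y + c)" for c
    using h y zl_pos_step[OF i, of y c] by (auto simp: e1_step[OF i] f1_step[OF i] split: if_splits)
  from this[of "a - 1"] this[of a] show ?thesis by (simp add: kdexp_eq algebra_simps)
qed

lemma kexp_step: assumes a: "0 \<le> a" "a < iL" and h: "h \<in> {ed1 N L a, fd1 N L a}" and y: "h y = Some x" shows "kexp N i y = kexp N i x"
proof -
  have "bar x = bar y" using h y pos_shift(3,4)[of y] by (auto simp: ed1_eq[OF a] fd1_eq[OF a] split: if_splits)
  then show ?thesis by (simp add: kexp_def)
qed

lemma bind_step:
  assumes i: "0 \<le> i" "i < iN" and a: "0 \<le> a" "a < iL" and h: "h1 \<in> {e1 N L i, f1 N L i}" "h2 \<in> {ed1 N L a, fd1 N L a}"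
  shows "Option.bind (h1 y) h2 = Option.bind (h2 y) h1"
proof -
  obtain c s where h1: "\<And>x. h1 x = (if bar x = c then Some (x + s) else None)" and z: "\<And>x d. bar x = c \<Longrightarrow> zl (pos (x + s) + d) = zl (pos x + d)"
    using h(1)
  proof (elim insertE emptyE)
    assume "h1 = e1 N L i"
    then show thesis using that[of "i + 1" "stp i"] e1_step[OF i] zl_pos_step(1)[OF i] by simp
  next
    assume "h1 = f1 N L i"
    then show thesis using that[of "ci i" "- stp i"] f1_step[OF i] zl_pos_step(2)[OF i] by simp
  qed
  obtain d t where h2: "\<And>x. h2 x = (if zl (pos x + d) then Some (x + t) else None)" and b: "\<And>x. bar (x + t) = bar x"
    using h(2)
  proof (elim insertE emptyE)
    assume "h2 = ed1 N L a"
    then show thesis using that[of a "- iN"] ed1_eq[OF a] pos_shift(3) by simp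
  next
    assume "h2 = fd1 N L a"
    then show thesis using that[of "a - 1" "iN"] fd1_eq[OF a] pos_shift(4) by (simp add: add_diff_eq)
  qed
  show ?thesis by (rule bind_commute[OF h1 h2]) (simp_all add: b z)
qed

lemma opx_step_commute:
  assumes i: "0 \<le> i" "i < iN" and a: "0 \<le> a" "a < iL" and h: "h1 \<in> {e1 N L i, f1 N L i}" "h2 \<in> {ed1 N L a, fd1 N L a}"
  shows "opx q (\<lambda>x. r * kexp N i x) (\<lambda>x. s * kexp N i x) h1 (opx q (\<lambda>x. r' * kdexp N L a x) (\<lambda>x. s' * kdexp N L a x) h2 v)
    = opx q (\<lambda>x. r' * kdexp N L a x) (\<lambda>x. s' * kdexp N L a x) h2 (opx q (\<lambda>x. r * kexp N i x) (\<lambda>x. s * kexp N i x) h1 v)"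
proof (rule opx_commute[where d = 0 and d' = 0, OF qq_nonzero])
  show "Option.bind (h1 y) h2 = Option.bind (h2 y) h1" for y by (rule bind_step[OF i a h])
qed (simp_all add: kexp_step[OF a h(2)] kdexp_step[OF i h(1)])

theorem actions_commute:
  assumes C: "C \<in> FK" and i: "i \<in> {0..<iN}" and a: "a \<in> {0..<iL}"
    and X: "X \<in> {rE N L M i, rF N L M i, rK N L M i, rKi N L M i}"
    and Y: "Y \<in> {rEd N L M a, rFd N L M a, rKd N L M a, rKdi N L M a}"
  shows "liftF N L M X (liftF N L M Y C) = liftF N L M Y (liftF N L M X C)"
proof -
  interpret A: uqmod N L M N L "e1 N L" "f1 N L" "kexp N" 0 1 bar "\<lambda>i. i + 1" "\<lambda>i. prd N i + 1"
    "\<lambda>i. liftF N L M (rE N L M i)" "\<lambda>i. liftF N L M (rF N L M i)" "\<lambda>i. liftF N L M (rK N L M i)" "\<lambda>i. liftF N L M (rKi N L M i)" "liftF N L M (rD N L M)"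
    by (rule uqmod_undotted)
  interpret B: uqmod N L M L N "ed1 N L" "fd1 N L" "kdexp N L" 1 0 dot "\<lambda>a. iL - a" "\<lambda>a. iL - prd L a"
    "\<lambda>i. liftF N L M (rEd N L M i)" "\<lambda>i. liftF N L M (rFd N L M i)" "\<lambda>i. liftF N L M (rKd N L M i)" "\<lambda>i. liftF N L M (rKdi N L M i)" "liftF N L M (rDd N L M)"
    by (rule uqmod_dotted)
  have i': "0 \<le> i" "i < iN" and a': "0 \<le> a" "a < iL" using i a by simp_all
  note cm = opx_step_commute[OF i' a'] and ke = kexp_step[OF a'] and kd = kdexp_step[OF i']
  note AE = A.XE[OF i] and AF = A.XF[OF i] and AK = A.KK[OF i] and AKi = A.KI[OF i]
  note BE = B.XE[OF a] and BF = B.XF[OF a] and BK = B.KK[OF a] and BKi = B.KI[OF a]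
  note wA = A.wop_E[OF i] A.wop_F[OF i] and wB = B.wop_E[OF a] B.wop_F[OF a]
  have kbA: "sm (kexp N i) (blk m) = 0" "sm (\<lambda>x. - kexp N i x) (blk m) = 0" for m using A.sm_multiple[OF i, of 1] A.sm_multiple[OF i, of "-1"] by simp_all
  have kbB: "sm (kdexp N L a) (blk m) = 0" "sm (\<lambda>x. - kdexp N L a x) (blk m) = 0" for m using B.sm_multiple[OF a, of 1] B.sm_multiple[OF a, of "-1"] by simp_all
  let ?E = "liftF N L M (rE N L M i)" and ?F = "liftF N L M (rF N L M i)" and ?K = "liftF N L M (rK N L M i)" and ?Ki = "liftF N L M (rKi N L M i)"
  let ?Ed = "liftF N L M (rEd N L M a)" and ?Fd = "liftF N L M (rFd N L M a)" and ?Kd = "liftF N L M (rKd N L M a)" and ?Kdi = "liftF N L M (rKdi N L M a)"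
  \<comment> \<open>The sum of the indices changes by \<open>stp i + iN\<close> when E_i meets a
    dotted lowering operator, and by the negative of this when a dotted raising operator meets
    F_i.\<close>
  have s1: "y + y' \<noteq> x + x'" if "e1 N L i x = Some y" "fd1 N L a x' = Some y'" for x y x' y'
    using that stp_neq[OF i'] by (auto simp: e1_step[OF i'] fd1_eq[OF a'] split: if_splits)
  have s2: "y + y' \<noteq> x + x'" if "ed1 N L a x = Some y" "f1 N L i x' = Some y'" for x y x' y'
    using that stp_neq[OF i'] by (auto simp: f1_step[OF i'] ed1_eq[OF a'] split: if_splits)
  have 1: "?E (?Ed C) = ?Ed (?E C)" by (rule EC_EC_commute[OF AE wA(1) BE wB(1) cm C]) simp_all
  have 2: "?F (?Fd C) = ?Fd (?F C)" by (rule FC_FC_commute[OF AF A.Fop_F[OF i] BF B.Fop_F[OF a] cm C]) simp_all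
  have 3: "?E (?Fd C) = ?Fd (?E C)"
  proof (rule raising_lowering_commute[where t = 0, OF A.Eop_E[OF i] B.Fop_F[OF a] AE BF _ cm exchange_vanishes[OF A.Eop_E[OF i] B.Fop_F[OF a] s1] C])
    show "- 0 * kdexp N L a y = - 0 * kdexp N L a x + 0" for x y by simp
  qed simp_all
  have 4: "?Ed (?F C) = ?F (?Ed C)"
  proof (rule raising_lowering_commute[where t = 0, OF B.Eop_E[OF a] A.Fop_F[OF i] BE AF _ cm[symmetric] exchange_vanishes[OF B.Eop_E[OF a] A.Fop_F[OF i] s2] C])
    show "- 1 * kexp N i y = - 1 * kexp N i x + 0" if "fd1 N L a y = Some x" for x y using ke[of "fd1 N L a"] that by simp
  qed simp_all
  have 5: "?K (?Ed C) = ?Ed (?K C)" "?Ki (?Ed C) = ?Ed (?Ki C)"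
    by (rule KC_EC_commute[OF AK BE wB(1) _ C] KC_EC_commute[OF AKi BE wB(1) _ C]; use ke[of "fd1 N L a"] in simp)+
  have 6: "?K (?Fd C) = ?Fd (?K C)" "?Ki (?Fd C) = ?Fd (?Ki C)"
    by (rule KC_FC_commute[OF AK kbA(1) BF wB(2) _ C] KC_FC_commute[OF AKi kbA(2) BF wB(2) _ C]; use ke[of "ed1 N L a"] in simp)+
  have 7: "?Kd (?E C) = ?E (?Kd C)" "?Kdi (?E C) = ?E (?Kdi C)"
    by (rule KC_EC_commute[OF BK AE wA(1) _ C] KC_EC_commute[OF BKi AE wA(1) _ C]; use kd[of "f1 N L i"] in simp)+
  have 8: "?Kd (?F C) = ?F (?Kd C)" "?Kdi (?F C) = ?F (?Kdi C)"
    by (rule KC_FC_commute[OF BK kbB(1) AF wA(2) _ C] KC_FC_commute[OF BKi kbB(2) AF wA(2) _ C]; use kd[of "e1 N L i"] in simp)+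
  note 9 = KC_KC[OF AK BK C] KC_KC[OF AK BKi C] KC_KC[OF AKi BK C] KC_KC[OF AKi BKi C]
  show ?thesis using X Y
    by (elim insertE emptyE; simp only:) (rule 1 2 3 4[symmetric] 5 6 7[symmetric] 8[symmetric] 9)+
qed

end

theorem mainTheorem4:
  fixes N L :: nat and M :: int
  assumes "N \<ge> 2" and "L \<ge> 2"
  shows "integrable_uq_module N (qq N) (fock N L M) (fadd N L M) (fsc N L M) (fzero N L M)
           (\<lambda>i. liftF N L M (rE N L M i)) (\<lambda>i. liftF N L M (rF N L M i))
           (\<lambda>i. liftF N L M (rK N L M i)) (\<lambda>i. liftF N L M (rKi N L M i)) (liftF N L M (rD N L M))
       \<and> integrable_uq_module L (qq N) (fock N L M) (fadd N L M) (fsc N L M) (fzero N L M)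
           (\<lambda>a. liftF N L M (rEd N L M a)) (\<lambda>a. liftF N L M (rFd N L M a))
           (\<lambda>a. liftF N L M (rKd N L M a)) (\<lambda>a. liftF N L M (rKdi N L M a)) (liftF N L M (rDd N L M))
       \<and> (\<forall>C\<in>fock N L M. \<forall>i\<in>{0..<int N}. \<forall>a\<in>{0..<int L}.
            \<forall>X\<in>{rE N L M i, rF N L M i, rK N L M i, rKi N L M i}.
            \<forall>Y\<in>{rEd N L M a, rFd N L M a, rKd N L M a, rKdi N L M a}.
              liftF N L M X (liftF N L M Y C) = liftF N L M Y (liftF N L M X C))"
proof -
  interpret fk N L M using assms by unfold_locales
  show ?thesis
    by (intro conjI ballI uqmod.module[OF uqmod_undotted] uqmod.module[OF uqmod_dotted] actions_commute)
qed

end
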